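(* For any nilradical $\mathfrak n$ in $\mathfrak{sp}_{2n}$, $\mathcal S(\mathfrak n)$ is a free module over $\mathcal S(\mathfrak n)^U$.
   Context: Everything is over $\mathbb C$. $\mathfrak g=\mathfrak{sp}_{2n}$ with a fixed Borel subalgebra $\mathfrak b$, $\mathfrak u=[\mathfrak b,\mathfrak b]$, and $U=\exp(\mathfrak u)\subset Sp_{2n}$ the corresponding maximal unipotent subgroup. A nilradical $\mathfrak n$ means the nilradical of a standard parabolic subalgebra $\mathfrak p\supset\mathfrak b$. Since $\mathfrak n$ is $\mathfrak b$-stable, $U$ acts on the symmetric algebra $\mathcal S(\mathfrak n)$, and $\mathcal S(\mathfrak n)^U$ is the subalgebra of invariants. *)

theory Defs
  imports
    Complex_Main
    "HOL-Library.Poly_Mapping"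
    "HOL-Algebra.QuotRing"
    "Jordan_Normal_Form.VS_Connect"
begin

section \<open>Lie algebras of complex matrices\<close>

abbreviation gl_space :: "nat \<Rightarrow> (complex, complex mat) module" where
  "gl_space N \<equiv> module_mat TYPE(complex) N N"

definition lin_span :: "nat \<Rightarrow> complex mat set \<Rightarrow> complex mat set" where
  "lin_span N X = LinearCombinations.module.span class_ring (gl_space N) X"

definition lie_bracket :: "nat \<Rightarrow> complex mat set \<Rightarrow> complex mat set \<Rightarrow> complex mat set" where
  "lie_bracket N A B = lin_span N {x * y - y * x | x y. x \<in> A \<and> y \<in> B}"

definition lie_subalgebra :: "nat \<Rightarrow> complex mat set \<Rightarrow> bool" where
  "lie_subalgebra N L \<longleftrightarrow>
     VectorSpace.subspace class_ring L (gl_space N) \<and> (\<forall>x\<in>L. \<forall>y\<in>L. x * y - y * x \<in> L)"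

definition lie_ideal :: "nat \<Rightarrow> complex mat set \<Rightarrow> complex mat set \<Rightarrow> bool" where
  "lie_ideal N L I \<longleftrightarrow>
     VectorSpace.subspace class_ring I (gl_space N) \<and> I \<subseteq> L \<and> (\<forall>x\<in>L. \<forall>y\<in>I. x * y - y * x \<in> I)"

primrec derived_series :: "nat \<Rightarrow> complex mat set \<Rightarrow> nat \<Rightarrow> complex mat set" where
  "derived_series N L 0 = L"
| "derived_series N L (Suc k) = lie_bracket N (derived_series N L k) (derived_series N L k)"

primrec lower_central_series :: "nat \<Rightarrow> complex mat set \<Rightarrow> nat \<Rightarrow> complex mat set" where
  "lower_central_series N L 0 = L"
| "lower_central_series N L (Suc k) = lie_bracket N L (lower_central_series N L k)"

definition solvable_lie :: "nat \<Rightarrow> complex mat set \<Rightarrow> bool" where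
  "solvable_lie N L \<longleftrightarrow> (\<exists>k. derived_series N L k = {0\<^sub>m N N})"

definition nilpotent_lie :: "nat \<Rightarrow> complex mat set \<Rightarrow> bool" where
  "nilpotent_lie N L \<longleftrightarrow> (\<exists>k. lower_central_series N L k = {0\<^sub>m N N})"

definition borel_subalgebra :: "nat \<Rightarrow> complex mat set \<Rightarrow> complex mat set \<Rightarrow> bool" where
  "borel_subalgebra N \<gg> \<bb> \<longleftrightarrow>
     lie_subalgebra N \<bb> \<and> solvable_lie N \<bb> \<and> \<bb> \<subseteq> \<gg> \<and>
     (\<forall>\<cc>. lie_subalgebra N \<cc> \<and> solvable_lie N \<cc> \<and> \<bb> \<subseteq> \<cc> \<and> \<cc> \<subseteq> \<gg> \<longrightarrow> \<cc> = \<bb>)"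

definition standard_parabolic ::
  "nat \<Rightarrow> complex mat set \<Rightarrow> complex mat set \<Rightarrow> complex mat set \<Rightarrow> bool" where
  "standard_parabolic N \<gg> \<bb> \<pp> \<longleftrightarrow> lie_subalgebra N \<pp> \<and> \<bb> \<subseteq> \<pp> \<and> \<pp> \<subseteq> \<gg>"

text \<open>The sum of all nilpotent ideals, that is, the largest nilpotent ideal. For a parabolic
  subalgebra of a semisimple Lie algebra this is the nilpotent part of its Levi decomposition.\<close>

definition nilradical :: "nat \<Rightarrow> complex mat set \<Rightarrow> complex mat set" where
  "nilradical N \<pp> = lin_span N (\<Union>{I. lie_ideal N \<pp> I \<and> nilpotent_lie N I})"

abbreviation nilradical_space :: "nat \<Rightarrow> complex mat set \<Rightarrow> (complex, complex mat) module" where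
  "nilradical_space N \<pp> \<equiv> (gl_space N)\<lparr>carrier := nilradical N \<pp>\<rparr>"


section \<open>The symplectic Lie algebra, exponentials and the adjoint action\<close>

definition symp_form :: "nat \<Rightarrow> complex mat" where
  "symp_form n = four_block_mat (0\<^sub>m n n) (1\<^sub>m n) (- 1\<^sub>m n) (0\<^sub>m n n)"

definition sp :: "nat \<Rightarrow> complex mat set" where
  "sp n = {A \<in> carrier_mat (2 * n) (2 * n).
     transpose_mat A * symp_form n + symp_form n * A = 0\<^sub>m (2 * n) (2 * n)}"

definition mat_exp :: "complex mat \<Rightarrow> complex mat" where
  "mat_exp A = mat (dim_row A) (dim_row A) (\<lambda>(i, j). suminf (\<lambda>k. (A ^\<^sub>m k) $$ (i, j) / fact k))"

text \<open>The subgroup \<open>U = exp [\<bb>, \<bb>]\<close>.\<close>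

definition max_unipotent :: "nat \<Rightarrow> complex mat set \<Rightarrow> complex mat set" where
  "max_unipotent N \<bb> = mat_exp ` lie_bracket N \<bb> \<bb>"

definition Ad :: "nat \<Rightarrow> complex mat \<Rightarrow> complex mat \<Rightarrow> complex mat" where
  "Ad N g x = g * x * inv\<^bsub>ring_mat TYPE(complex) N ()\<^esub> g"


section \<open>Symmetric algebras\<close>

text \<open>\<open>S(V)\<close> is the free commutative algebra on the set \<open>V\<close>, i.e. the polynomial ring with one
  indeterminate \<open>X\<^sub>v\<close> for each \<open>v \<in> V\<close>, modulo the ideal generated by all
  \<open>X\<^bsub>v + w\<^esub> - (X\<^sub>v + X\<^sub>w)\<close> and \<open>X\<^bsub>c v\<^esub> - c X\<^sub>v\<close>; these are exactly the relations that make
  \<open>v \<mapsto> X\<^sub>v\<close> linear. A polynomial is a finitely supported map from monomials to coefficients, a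
  monomial a finitely supported map from indeterminates to exponents.\<close>

type_synonym 'v cpoly = "('v \<Rightarrow>\<^sub>0 nat) \<Rightarrow>\<^sub>0 complex"

definition pvar :: "'v \<Rightarrow> 'v cpoly" where
  "pvar v = Poly_Mapping.single (Poly_Mapping.single v 1) 1"

definition pconst :: "complex \<Rightarrow> 'v cpoly" where
  "pconst c = Poly_Mapping.single 0 c"

definition cpoly_ring :: "'v set \<Rightarrow> 'v cpoly ring" where
  "cpoly_ring V =
     \<lparr>carrier = {p. \<forall>m \<in> Poly_Mapping.keys p. Poly_Mapping.keys m \<subseteq> V},
      mult = (*), one = 1, zero = 0, add = (+)\<rparr>"

definition sym_relations :: "(complex, 'v) module \<Rightarrow> 'v cpoly set" where
  "sym_relations V =
     {pvar (v \<oplus>\<^bsub>V\<^esub> w) - (pvar v + pvar w) | v w. v \<in> carrier V \<and> w \<in> carrier V} \<union>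
     {pvar (c \<odot>\<^bsub>V\<^esub> v) - pconst c * pvar v | c v. v \<in> carrier V}"

definition sym_ideal :: "(complex, 'v) module \<Rightarrow> 'v cpoly set" where
  "sym_ideal V = genideal (cpoly_ring (carrier V)) (sym_relations V)"

definition sym_alg :: "(complex, 'v) module \<Rightarrow> 'v cpoly set ring" where
  "sym_alg V = cpoly_ring (carrier V) Quot sym_ideal V"

text \<open>The substitution \<open>X\<^sub>v \<mapsto> X\<^bsub>f v\<^esub>\<close>, and the endomorphism of \<open>S(V)\<close> that it induces on cosets
  when \<open>f\<close> is a linear map from \<open>V\<close> to itself.\<close>

definition pvar_subst :: "('v \<Rightarrow> 'v) \<Rightarrow> 'v cpoly \<Rightarrow> 'v cpoly" where
  "pvar_subst f p = (\<Sum>m \<in> Poly_Mapping.keys p.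
     pconst (Poly_Mapping.lookup p m) *
       (\<Prod>v \<in> Poly_Mapping.keys m. pvar (f v) ^ Poly_Mapping.lookup m v))"

definition sym_map :: "(complex, 'v) module \<Rightarrow> ('v \<Rightarrow> 'v) \<Rightarrow> 'v cpoly set \<Rightarrow> 'v cpoly set" where
  "sym_map V f s = (\<Union>p\<in>s. sym_ideal V +>\<^bsub>cpoly_ring (carrier V)\<^esub> pvar_subst f p)"

definition sym_invariants ::
  "(complex, 'v) module \<Rightarrow> ('g \<Rightarrow> 'v \<Rightarrow> 'v) \<Rightarrow> 'g set \<Rightarrow> 'v cpoly set set" where
  "sym_invariants V act G = {s \<in> carrier (sym_alg V). \<forall>g\<in>G. sym_map V (act g) s = s}"


section \<open>Freeness over a subring\<close>

definition module_of_ring :: "'a ring \<Rightarrow> ('a, 'a) module" where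
  "module_of_ring S =
     \<lparr>carrier = carrier S, mult = mult S, one = one S, zero = zero S, add = add S,
      smult = mult S\<rparr>"

definition free_module :: "'r ring \<Rightarrow> ('r, 'm) module \<Rightarrow> bool" where
  "free_module R M \<longleftrightarrow> Module.module R M \<and>
     (\<exists>B \<subseteq> carrier M.
        \<not> LinearCombinations.module.lin_dep R M B \<and>
        LinearCombinations.module.span R M B = carrier M)"

definition free_over_subring :: "'a ring \<Rightarrow> 'a set \<Rightarrow> bool" where
  "free_over_subring S T \<longleftrightarrow> free_module (S\<lparr>carrier := T\<rparr>) (module_of_ring S)"

end

theory Submission
  imports "HOL-Library.Function_Algebras" "HOL-Computational_Algebra.Fundamental_Theorem_Algebra"
    "HOL-Algebra.Subrings" Defs
begin

text \<open>In coordinates adapted to a flag that is stable under \<open>\<bb>\<close> (Lie's theorem for isotropic subspaces),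
  the nilradical becomes a subspace of \<open>[\<bb>, \<bb>]\<close> spanned by root vectors of two kinds: \<open>e\<^sub>i - e\<^sub>j\<close>
  and \<open>e\<^sub>i + e\<^sub>j\<close>. If \<open>2e\<^sub>0, \<dots>, 2e\<^bsub>m - 1\<^esub>\<close> are the long roots that occur, all roots \<open>e\<^sub>i + e\<^sub>j\<close> with \<open>i, j < m\<close>
  occur, and the leading principal minors \<open>D\<^sub>0, \<dots>, D\<^bsub>m - 1\<^esub>\<close> of the generic symmetric \<open>m \<times> m\<close> matrix in these
  root vectors are invariant under \<open>U\<close>. Where no minor vanishes, \<open>U\<close> moves every linear form on the nilradical to
  one that is zero except on the long root vectors, so an invariant is determined by its values on
  this diagonal slice, and it follows that the invariants are exactly the polynomials in the minors.
  For a suitable weight the leading monomial of \<open>D\<^sub>k\<close> is the antidiagonal product; these monomials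
  are pairwise coprime, and therefore the monomials divisible by none of them represent a basis
  of the symmetric algebra over the subalgebra of invariants.\<close>

text \<open>An element of the symmetric algebra is treated as a polynomial function on the linear
  forms of the nilradical, so that equality modulo the relations and invariance both become
  statements about values. As \<open>max_unipotent\<close> is given as a set of exponentials, forms
  are moved by finite lists of its elements and no group law is proved. The nilradical is used
  through two facts: brackets with the Borel subalgebra preserve it, and in adapted coordinates it
  is strictly triangular; parabolics are never classified. The minors are invariant because an
  exponential changes the symmetric matrix M of values by a congruence H^T M H with H upper
  unitriangular. The obstacle is division: the slice has the entries D_k / D_(k-1), so restricting
  to it describes an invariant only up to a power of the product of the minors. Freeness over the
  algebra generated by the minors, proved beforehand, removes that power by comparing coordinates.
  The weight of the variable at (i, j) is (i - j)^2 because the sum of squared displacements of a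
  permutation is maximal at the reversal alone.\<close>

declare plus_fun_apply [simp del] zero_fun_apply [simp del] minus_apply [simp del]

section \<open>Substitution in polynomials\<close>

definition monom_subst :: "('v \<Rightarrow> 'a::comm_ring_1) \<Rightarrow> ('v \<Rightarrow>\<^sub>0 nat) \<Rightarrow> 'a" where
  "monom_subst \<sigma> m = (\<Prod>v\<in>Poly_Mapping.keys m. \<sigma> v ^ Poly_Mapping.lookup m v)"

definition poly_subst :: "(complex \<Rightarrow> 'a::comm_ring_1) \<Rightarrow> ('v \<Rightarrow> 'a) \<Rightarrow> 'v cpoly \<Rightarrow> 'a" where
  "poly_subst \<kappa> \<sigma> p =
     (\<Sum>m\<in>Poly_Mapping.keys p. \<kappa> (Poly_Mapping.lookup p m) * monom_subst \<sigma> m)"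

definition poly_on :: "'v set \<Rightarrow> 'v cpoly set" where
  "poly_on E = {p. \<forall>m\<in>Poly_Mapping.keys p. Poly_Mapping.keys m \<subseteq> E}"

lemma monom_subst_superset:
  assumes "finite A" "Poly_Mapping.keys m \<subseteq> A"
  shows "monom_subst \<sigma> m = (\<Prod>v\<in>A. \<sigma> v ^ Poly_Mapping.lookup m v)"
  unfolding monom_subst_def using assms
  by (intro prod.mono_neutral_left) (auto simp: in_keys_iff)

lemma monom_subst_0 [simp]: "monom_subst \<sigma> 0 = 1"
  by (simp add: monom_subst_def)

lemma monom_subst_add: "monom_subst \<sigma> (m + m') = monom_subst \<sigma> m * monom_subst \<sigma> m'"
proof -
  let ?A = "Poly_Mapping.keys m \<union> Poly_Mapping.keys m'"
  have "Poly_Mapping.keys (m + m') \<subseteq> ?A" by (rule keys_add)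
  then show ?thesis
    by (simp add: monom_subst_superset[of ?A] lookup_add power_add prod.distrib)
qed

lemma monom_subst_single [simp]: "monom_subst \<sigma> (Poly_Mapping.single v k) = \<sigma> v ^ k"
  by (cases "k = 0") (auto simp: monom_subst_def)

lemma monom_subst_sum:
  "finite A \<Longrightarrow> monom_subst \<sigma> (\<Sum>i\<in>A. f i) = (\<Prod>i\<in>A. monom_subst \<sigma> (f i))"
  by (induction A rule: finite_induct) (auto simp: monom_subst_add)

lemma monom_subst_cong:
  "(\<And>v. v \<in> Poly_Mapping.keys m \<Longrightarrow> \<sigma> v = \<tau> v) \<Longrightarrow> monom_subst \<sigma> m = monom_subst \<tau> m"
  unfolding monom_subst_def by (intro prod.cong) auto

lemma poly_mapping_eq_sum_single:
  "p = (\<Sum>m\<in>Poly_Mapping.keys p. Poly_Mapping.single m (Poly_Mapping.lookup p m))"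
proof (rule poly_mapping_eqI)
  fix k
  have "Poly_Mapping.lookup (\<Sum>m\<in>Poly_Mapping.keys p. Poly_Mapping.single m (Poly_Mapping.lookup p m)) k
      = (\<Sum>m\<in>Poly_Mapping.keys p. if m = k then Poly_Mapping.lookup p k else 0)"
    unfolding lookup_sum by (intro sum.cong refl) (auto simp: lookup_single)
  then show "Poly_Mapping.lookup p k = Poly_Mapping.lookup
      (\<Sum>m\<in>Poly_Mapping.keys p. Poly_Mapping.single m (Poly_Mapping.lookup p m)) k"
    by (simp add: in_keys_iff)
qed

lemma pconst_0 [simp]: "pconst 0 = 0"
  and pconst_1 [simp]: "pconst 1 = 1"
  and pconst_add: "pconst (a + b) = pconst a + pconst b"
  and pconst_mult: "pconst (a * b) = pconst a * pconst b"
  by (simp_all add: pconst_def single_add mult_single single_uminus)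

lemma single_mult_pconst: "Poly_Mapping.single m c = pconst c * Poly_Mapping.single m 1"
  by (simp add: pconst_def mult_single)

lemma monom_subst_pvar: "monom_subst pvar m = Poly_Mapping.single m 1"
proof -
  have pow: "pvar v ^ k = Poly_Mapping.single (Poly_Mapping.single v k) (1::complex)"
    for v :: 'a and k
    by (induction k) (auto simp: pvar_def mult_single single_add[symmetric])
  have "(\<Prod>v\<in>A. Poly_Mapping.single (f v) (1::complex)) = Poly_Mapping.single (\<Sum>v\<in>A. f v) 1"
    if "finite A" for A and f :: "'a \<Rightarrow> 'a \<Rightarrow>\<^sub>0 nat"
    using that by (induction A rule: finite_induct) (auto simp: mult_single)
  then show ?thesis
    by (simp add: monom_subst_def pow poly_mapping_eq_sum_single[symmetric])
qed

text \<open>The coefficient map stays abstract so that one set of rules serves both numerical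
  evaluation (the identity) and substitution of polynomials for variables
  (\<open>pconst\<close>).\<close>

locale coeff_hom =
  fixes \<kappa> :: "complex \<Rightarrow> 'a::comm_ring_1"
  assumes kappa_0: "\<kappa> 0 = 0" and kappa_1: "\<kappa> 1 = 1"
    and kappa_add: "\<kappa> (a + b) = \<kappa> a + \<kappa> b" and kappa_mult: "\<kappa> (a * b) = \<kappa> a * \<kappa> b"
begin

abbreviation (input) "S \<equiv> poly_subst \<kappa>"

lemma subst_superset:
  assumes "finite A" "Poly_Mapping.keys p \<subseteq> A"
  shows "S \<sigma> p = (\<Sum>m\<in>A. \<kappa> (Poly_Mapping.lookup p m) * monom_subst \<sigma> m)"
  unfolding poly_subst_def using assms
  by (intro sum.mono_neutral_left) (auto simp: in_keys_iff kappa_0)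

lemma subst_0 [simp]: "S \<sigma> 0 = 0"
  by (simp add: poly_subst_def)

lemma subst_add: "S \<sigma> (p + q) = S \<sigma> p + S \<sigma> q"
proof -
  let ?A = "Poly_Mapping.keys p \<union> Poly_Mapping.keys q"
  have "Poly_Mapping.keys (p + q) \<subseteq> ?A" by (rule keys_add)
  then show ?thesis
    by (simp add: subst_superset[of ?A] lookup_add kappa_add distrib_right sum.distrib)
qed

lemma subst_sum: "S \<sigma> (\<Sum>i\<in>A. f i) = (\<Sum>i\<in>A. S \<sigma> (f i))"
  by (induction A rule: infinite_finite_induct) (auto simp: subst_add)

lemma subst_single: "S \<sigma> (Poly_Mapping.single m c) = \<kappa> c * monom_subst \<sigma> m"
  by (cases "c = 0") (auto simp: poly_subst_def kappa_0)

lemma subst_pvar [simp]: "S \<sigma> (pvar v) = \<sigma> v"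
  by (simp add: pvar_def subst_single kappa_1)

lemma subst_pconst [simp]: "S \<sigma> (pconst c) = \<kappa> c"
  by (simp add: pconst_def subst_single)

lemma subst_1 [simp]: "S \<sigma> 1 = 1"
  using subst_pconst[of \<sigma> 1] by (simp add: kappa_1)

lemma subst_mult: "S \<sigma> (p * q) = S \<sigma> p * S \<sigma> q"
proof -
  let ?c = "Poly_Mapping.lookup"
  have "p * q = (\<Sum>a\<in>Poly_Mapping.keys p. \<Sum>b\<in>Poly_Mapping.keys q.
      Poly_Mapping.single (a + b) (?c p a * ?c q b))"
    by (subst (1) poly_mapping_eq_sum_single[of p], subst (1) poly_mapping_eq_sum_single[of q])
       (simp add: sum_product mult_single)
  then have "S \<sigma> (p * q) = (\<Sum>a\<in>Poly_Mapping.keys p. \<Sum>b\<in>Poly_Mapping.keys q.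
      (\<kappa> (?c p a) * monom_subst \<sigma> a) * (\<kappa> (?c q b) * monom_subst \<sigma> b))"
    by (simp add: subst_sum subst_single kappa_mult monom_subst_add mult_ac)
  then show ?thesis
    by (simp add: poly_subst_def sum_product)
qed

lemma subst_power: "S \<sigma> (p ^ k) = S \<sigma> p ^ k"
  by (induction k) (auto simp: subst_mult)

lemma subst_prod: "S \<sigma> (\<Prod>i\<in>A. f i) = (\<Prod>i\<in>A. S \<sigma> (f i))"
  by (induction A rule: infinite_finite_induct) (auto simp: subst_mult)

lemma subst_minus: "S \<sigma> (- p) = - S \<sigma> p"
  using subst_add[of \<sigma> p "- p"] by (simp add: add_eq_0_iff)

lemma subst_diff: "S \<sigma> (p - q) = S \<sigma> p - S \<sigma> q"
  using subst_add[of \<sigma> p "- q"] by (simp add: subst_minus)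

lemma subst_monom_subst: "S \<sigma> (monom_subst \<tau> m) = monom_subst (\<lambda>v. S \<sigma> (\<tau> v)) m"
  by (simp add: monom_subst_def subst_prod subst_power)

lemma subst_cong:
  assumes "p \<in> poly_on E" "\<And>v. v \<in> E \<Longrightarrow> \<sigma> v = \<tau> v"
  shows "S \<sigma> p = S \<tau> p"
  using assms unfolding poly_subst_def poly_on_def
  by (intro sum.cong refl arg_cong2[where f = times] monom_subst_cong) auto

end

interpretation ev: coeff_hom "\<lambda>c. c"
  by (rule coeff_hom.intro) simp_all

interpretation ps: coeff_hom pconst
  by (rule coeff_hom.intro) (simp_all only: pconst_0 pconst_1 pconst_add pconst_mult)

abbreviation poly_eval :: "('v \<Rightarrow> complex) \<Rightarrow> 'v cpoly \<Rightarrow> complex" where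
  "poly_eval \<equiv> poly_subst (\<lambda>c. c)"

lemma (in coeff_hom) subst_subst:
  "S \<sigma> (poly_subst pconst \<tau> p) = S (\<lambda>v. S \<sigma> (\<tau> v)) p"
proof -
  have "S \<sigma> (poly_subst pconst \<tau> p) = (\<Sum>m\<in>Poly_Mapping.keys p.
      S \<sigma> (pconst (Poly_Mapping.lookup p m) * monom_subst \<tau> m))"
    unfolding poly_subst_def[of pconst] by (rule subst_sum)
  also have "\<dots> = S (\<lambda>v. S \<sigma> (\<tau> v)) p"
    unfolding poly_subst_def[of _ _ p] by (intro sum.cong refl) (simp add: subst_mult subst_monom_subst)
  finally show ?thesis .
qed

lemma poly_subst_pvar [simp]: "poly_subst pconst pvar p = p"
proof -
  have "poly_subst pconst pvar p
      = (\<Sum>m\<in>Poly_Mapping.keys p. Poly_Mapping.single m (Poly_Mapping.lookup p m))"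
    unfolding poly_subst_def
    by (intro sum.cong refl) (simp only: monom_subst_pvar single_mult_pconst[symmetric])
  then show ?thesis by (simp only: poly_mapping_eq_sum_single[symmetric])
qed

lemma pvar_subst_eq: "pvar_subst f = poly_subst pconst (\<lambda>v. pvar (f v))"
  by (rule ext) (simp add: pvar_subst_def poly_subst_def monom_subst_def)

section \<open>Polynomials in a prescribed set of variables\<close>

lemma poly_onD:
  "p \<in> poly_on V \<Longrightarrow> m \<in> Poly_Mapping.keys p \<Longrightarrow> v \<in> Poly_Mapping.keys m \<Longrightarrow> v \<in> V"
  by (auto simp: poly_on_def)

lemma poly_on_0 [simp]: "0 \<in> poly_on E"
  and poly_on_1 [simp]: "1 \<in> poly_on E"
  and poly_on_pconst [simp]: "pconst c \<in> poly_on E"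
  and poly_on_pvar [simp]: "v \<in> E \<Longrightarrow> pvar v \<in> poly_on E"
  by (auto simp: poly_on_def pconst_def pvar_def)

lemma poly_on_single: "Poly_Mapping.keys m \<subseteq> E \<Longrightarrow> Poly_Mapping.single m c \<in> poly_on E"
  by (auto simp: poly_on_def)

lemma poly_on_add: "p \<in> poly_on E \<Longrightarrow> q \<in> poly_on E \<Longrightarrow> p + q \<in> poly_on E"
  using keys_add[of p q] by (auto simp: poly_on_def)

lemma poly_on_minus: "p \<in> poly_on E \<Longrightarrow> - p \<in> poly_on E"
  by (auto simp: poly_on_def in_keys_iff)

lemma poly_on_diff: "p \<in> poly_on E \<Longrightarrow> q \<in> poly_on E \<Longrightarrow> p - q \<in> poly_on E"
  using poly_on_add[of p E "- q"] by (simp add: poly_on_minus)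

lemma poly_on_mult:
  assumes "p \<in> poly_on E" "q \<in> poly_on E" shows "p * q \<in> poly_on E"
  unfolding poly_on_def
proof (clarsimp)
  fix m v assume "m \<in> Poly_Mapping.keys (p * q)" and v: "v \<in> Poly_Mapping.keys m"
  then obtain a b where "a \<in> Poly_Mapping.keys p" "b \<in> Poly_Mapping.keys q" "m = a + b"
    using keys_mult[of p q] by auto
  then show "v \<in> E"
    using assms v keys_add[of a b] unfolding poly_on_def by blast
qed

lemma poly_on_sum: "(\<And>i. i \<in> A \<Longrightarrow> f i \<in> poly_on E) \<Longrightarrow> (\<Sum>i\<in>A. f i) \<in> poly_on E"
  by (induction A rule: infinite_finite_induct) (auto intro: poly_on_add)

lemma poly_on_prod: "(\<And>i. i \<in> A \<Longrightarrow> f i \<in> poly_on E) \<Longrightarrow> (\<Prod>i\<in>A. f i) \<in> poly_on E"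
  by (induction A rule: infinite_finite_induct) (auto intro: poly_on_mult)

lemma poly_on_power: "p \<in> poly_on E \<Longrightarrow> p ^ k \<in> poly_on E"
  by (induction k) (auto intro: poly_on_mult)

lemma poly_on_subst:
  assumes "p \<in> poly_on V" "\<And>v. v \<in> V \<Longrightarrow> \<sigma> v \<in> poly_on E"
  shows "poly_subst pconst \<sigma> p \<in> poly_on E"
  unfolding poly_subst_def monom_subst_def using poly_onD[OF assms(1)]
  by (intro poly_on_sum poly_on_mult poly_on_prod poly_on_power poly_on_pconst assms(2)) auto

lemma poly_on_mono: "V \<subseteq> W \<Longrightarrow> poly_on V \<subseteq> poly_on W"
  by (auto simp: poly_on_def)

lemma poly_on_induct [consumes 1, case_names const var add mult]:
  assumes "p \<in> poly_on V"
    and const: "\<And>c. P (pconst c)" and var: "\<And>v. v \<in> V \<Longrightarrow> P (pvar v)"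
    and add: "\<And>p q. p \<in> poly_on V \<Longrightarrow> q \<in> poly_on V \<Longrightarrow> P p \<Longrightarrow> P q \<Longrightarrow> P (p + q)"
    and mult: "\<And>p q. p \<in> poly_on V \<Longrightarrow> q \<in> poly_on V \<Longrightarrow> P p \<Longrightarrow> P q \<Longrightarrow> P (p * q)"
  shows "P p"
proof -
  have 0: "P 0" and 1: "P 1" using const[of 0] const[of 1] by simp_all
  have sum: "P (\<Sum>i\<in>A. f i)" if "\<And>i. i \<in> A \<Longrightarrow> f i \<in> poly_on V \<and> P (f i)" for A and f :: "'b \<Rightarrow> _"
    using that by (induction A rule: infinite_finite_induct) (auto intro!: add 0 poly_on_sum)
  have prod: "P (\<Prod>i\<in>A. f i)" if "\<And>i. i \<in> A \<Longrightarrow> f i \<in> poly_on V \<and> P (f i)" for A and f :: "'c \<Rightarrow> _"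
    using that by (induction A rule: infinite_finite_induct) (auto intro!: mult 1 poly_on_prod)
  have pow: "P (f ^ k)" if "f \<in> poly_on V" "P f" for f k
    using that by (induction k) (auto intro!: mult 1 poly_on_power)
  \<comment> \<open>The identity substitution displays \<open>p\<close> as a sum of products of
    constants and variables, to which the closure rules apply.\<close>
  have "P (poly_subst pconst pvar p)"
    unfolding poly_subst_def monom_subst_def using poly_onD[OF assms(1)]
    by (intro sum conjI poly_on_mult poly_on_prod poly_on_power poly_on_pconst poly_on_pvar
        mult const prod pow var) auto
  then show ?thesis by simp
qed

section \<open>Polynomials are determined by their values\<close>

lemma independent_characters:
  fixes X :: "('m \<Rightarrow> complex) set" and f :: "'m \<Rightarrow> 'm \<Rightarrow> 'm"
  assumes "finite X"
    and "\<And>\<chi> x y. \<chi> \<in> X \<Longrightarrow> \<chi> (f x y) = \<chi> x * \<chi> y" and "\<And>\<chi>. \<chi> \<in> X \<Longrightarrow> \<chi> e = 1"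
    and "\<And>x. (\<Sum>\<chi>\<in>X. c \<chi> * \<chi> x) = 0"
  shows "\<forall>\<chi>\<in>X. c \<chi> = 0"
  using assms
proof (induction X arbitrary: c rule: finite_induct)
  case (insert \<rho> X)
  have "c \<chi> = 0" if \<chi>: "\<chi> \<in> X" for \<chi>
  proof -
    have "\<chi> \<noteq> \<rho>" using \<chi> insert.hyps by auto
    then obtain x where x: "\<chi> x \<noteq> \<rho> x" by auto
    \<comment> \<open>Artin's elimination: the relation at \<open>f x y\<close> minus
      \<open>\<rho> x\<close> times the relation at \<open>y\<close> no longer contains
      \<open>\<rho>\<close>.\<close>
    have "(\<Sum>\<psi>\<in>X. (c \<psi> * (\<psi> x - \<rho> x)) * \<psi> y) = 0" for y
    proof -
      have "0 = (\<Sum>\<psi>\<in>insert \<rho> X. c \<psi> * \<psi> (f x y)) - \<rho> x * (\<Sum>\<psi>\<in>insert \<rho> X. c \<psi> * \<psi> y)"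
        using insert.prems(3) by simp
      also have "\<dots> = (\<Sum>\<psi>\<in>insert \<rho> X. c \<psi> * (\<psi> x - \<rho> x) * \<psi> y)"
        by (simp add: sum_distrib_left sum_subtractf[symmetric] insert.prems(1) algebra_simps
            del: sum.insert)
      finally show ?thesis using insert.hyps by simp
    qed
    then have "\<forall>\<psi>\<in>X. c \<psi> * (\<psi> x - \<rho> x) = 0"
      using insert.prems by (intro insert.IH) auto
    then show ?thesis using \<chi> x by auto
  qed
  moreover from this have "c \<rho> = 0"
    using insert.prems(3)[of e] insert.hyps insert.prems(2)[of \<rho>] by simp
  ultimately show ?case by auto
qed auto

text \<open>As functions of the assignment, monomials are characters for pointwise multiplication,
  and distinct monomials are distinct characters. Independence of characters then treats all
  variables at once.\<close>

lemma poly_eq_0_if_eval_eq_0: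
  fixes p :: "'v cpoly"
  assumes "\<And>\<xi>. poly_eval \<xi> p = 0"
  shows "p = 0"
proof -
  let ?K = "Poly_Mapping.keys p"
  define h where "h = (\<lambda>m (\<xi> :: 'v \<Rightarrow> complex). monom_subst \<xi> m)"
  have h: "h m \<xi> = monom_subst \<xi> m" for m \<xi> by (simp add: h_def)
  have inj: "inj_on h ?K"
  proof (rule inj_onI, rule poly_mapping_eqI)
    fix m m' :: "'v \<Rightarrow>\<^sub>0 nat" and v :: 'v assume eq: "h m = h m'"
    \<comment> \<open>The assignment with 2 at \<open>v\<close> and 1 elsewhere reads off the
      exponent of \<open>v\<close>.\<close>
    have "monom_subst (\<lambda>w. if w = v then 2 else 1) k = (2::complex) ^ Poly_Mapping.lookup k v" for k
      by (cases "v \<in> Poly_Mapping.keys k")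
         (auto simp: monom_subst_def if_distrib[of "\<lambda>x. x ^ _"] prod.If_cases in_keys_iff
           Int_absorb1 cong: if_cong)
    then have "(2::complex) ^ Poly_Mapping.lookup m v = 2 ^ Poly_Mapping.lookup m' v"
      using fun_cong[OF eq, of "\<lambda>w. if w = v then 2 else 1"] by (simp add: h_def)
    then have "of_nat (2 ^ Poly_Mapping.lookup m v) = (of_nat (2 ^ Poly_Mapping.lookup m' v) :: complex)"
      by simp
    then show "Poly_Mapping.lookup m v = Poly_Mapping.lookup m' v"
      unfolding of_nat_eq_iff by simp
  qed
  have "\<forall>\<chi>\<in>h ` ?K. Poly_Mapping.lookup p (inv_into ?K h \<chi>) = 0"
  proof (rule independent_characters[where f = "\<lambda>\<xi> \<zeta> v. \<xi> v * \<zeta> v" and e = "\<lambda>_. 1"])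
    show "(\<Sum>\<chi>\<in>h ` ?K. Poly_Mapping.lookup p (inv_into ?K h \<chi>) * \<chi> \<xi>) = 0" for \<xi>
      using assms[of \<xi>] by (simp add: sum.reindex[OF inj] inj poly_subst_def h)
  qed (auto simp: h_def monom_subst_def power_mult_distrib prod.distrib)
  then have "Poly_Mapping.lookup p m = 0" if "m \<in> ?K" for m
    using that inj by auto
  then show ?thesis by (intro poly_mapping_eqI) (metis in_keys_iff lookup_zero)
qed

lemma poly_eqI_eval: "(\<And>\<xi>. poly_eval \<xi> p = poly_eval \<xi> q) \<Longrightarrow> p = q"
  using poly_eq_0_if_eval_eq_0[of "p - q"] by (simp add: ev.subst_diff)

section \<open>Leading monomials\<close>

definition wt :: "('v \<Rightarrow> nat) \<Rightarrow> ('v \<Rightarrow>\<^sub>0 nat) \<Rightarrow> nat" where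
  "wt w a = (\<Sum>v\<in>Poly_Mapping.keys a. w v * Poly_Mapping.lookup a v)"

definition low :: "('v \<Rightarrow> nat) \<Rightarrow> 'v set \<Rightarrow> nat \<Rightarrow> 'v cpoly set" where
  "low w E k = {p \<in> poly_on E. \<forall>a\<in>Poly_Mapping.keys p. wt w a < k}"

text \<open>The weight is not a monomial order, since different monomials may share a weight. Hence
  the requirement that \<open>a\<close> be the only monomial of \<open>p\<close> whose weight
  reaches \<open>wt w a\<close>.\<close>

definition lead :: "('v \<Rightarrow> nat) \<Rightarrow> 'v set \<Rightarrow> complex \<Rightarrow> ('v \<Rightarrow>\<^sub>0 nat) \<Rightarrow> 'v cpoly \<Rightarrow> bool" where
  "lead w E c a p \<longleftrightarrow> Poly_Mapping.keys a \<subseteq> E \<and> p - Poly_Mapping.single a c \<in> low w E (wt w a)"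

lemma wt_superset:
  "finite A \<Longrightarrow> Poly_Mapping.keys a \<subseteq> A \<Longrightarrow> wt w a = (\<Sum>v\<in>A. w v * Poly_Mapping.lookup a v)"
  unfolding wt_def by (intro sum.mono_neutral_left) (auto simp: in_keys_iff)

lemma wt_add: "wt w (a + b) = wt w a + wt w b"
proof -
  let ?A = "Poly_Mapping.keys a \<union> Poly_Mapping.keys b"
  have "Poly_Mapping.keys (a + b) \<subseteq> ?A" by (rule keys_add)
  then show ?thesis
    by (simp add: wt_superset[of ?A] lookup_add distrib_left sum.distrib)
qed

lemma wt_0 [simp]: "wt w 0 = 0"
  by (simp add: wt_def)

lemma wt_single [simp]: "wt w (Poly_Mapping.single v k) = w v * k"
  by (simp add: wt_def)

lemma wt_sum: "wt w (\<Sum>i\<in>A. f i) = (\<Sum>i\<in>A. wt w (f i))"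
  by (induction A rule: infinite_finite_induct) (auto simp: wt_add)

lemma low_0 [simp]: "0 \<in> low w E k"
  by (simp add: low_def)

lemma low_add: "p \<in> low w E k \<Longrightarrow> q \<in> low w E k \<Longrightarrow> p + q \<in> low w E k"
  using keys_add[of p q] by (auto simp: low_def poly_on_add)

lemma low_sum: "(\<And>i. i \<in> A \<Longrightarrow> f i \<in> low w E k) \<Longrightarrow> (\<Sum>i\<in>A. f i) \<in> low w E k"
  by (induction A rule: infinite_finite_induct) (auto intro: low_add)

text \<open>The bound \<open>Suc l\<close> makes the second estimate a weak one. This is what a
  product of lower terms with a leading term of weight \<open>l\<close> needs.\<close>

lemma low_mult:
  assumes "p \<in> low w E k" "q \<in> low w E (Suc l)"
  shows "p * q \<in> low w E (k + l)"
  unfolding low_def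
proof (safe)
  show "p * q \<in> poly_on E" using assms by (auto simp: low_def intro: poly_on_mult)
  fix a assume "a \<in> Poly_Mapping.keys (p * q)"
  then obtain b c where "b \<in> Poly_Mapping.keys p" "c \<in> Poly_Mapping.keys q" "a = b + c"
    using keys_mult[of p q] by auto
  then show "wt w a < k + l"
    using assms by (fastforce simp: low_def wt_add less_Suc_eq_le intro: add_less_le_mono)
qed

lemma low_mono: "p \<in> low w E k \<Longrightarrow> k \<le> l \<Longrightarrow> p \<in> low w E l"
  by (auto simp: low_def)

lemma low_single: "Poly_Mapping.keys a \<subseteq> E \<Longrightarrow> wt w a < k \<Longrightarrow> Poly_Mapping.single a c \<in> low w E k"
  by (auto simp: low_def poly_on_single)

lemma lead_single: "Poly_Mapping.keys a \<subseteq> E \<Longrightarrow> lead w E c a (Poly_Mapping.single a c)"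
  by (simp add: lead_def)

lemma lead_mult:
  assumes "lead w E c a p" "lead w E d b q"
  shows "lead w E (c * d) (a + b) (p * q)"
proof -
  define r s where "r = p - Poly_Mapping.single a c" and "s = q - Poly_Mapping.single b d"
  have r: "r \<in> low w E (wt w a)" and s: "s \<in> low w E (wt w b)"
    and E: "Poly_Mapping.keys a \<subseteq> E" "Poly_Mapping.keys b \<subseteq> E"
    using assms by (auto simp: lead_def r_def s_def)
  have pq: "p = Poly_Mapping.single a c + r" "q = Poly_Mapping.single b d + s"
    by (simp_all add: r_def s_def)
  have "p * q - Poly_Mapping.single (a + b) (c * d)
      = s * Poly_Mapping.single a c + r * Poly_Mapping.single b d + r * s"
    by (simp add: pq algebra_simps mult_single)
  also have "\<dots> \<in> low w E (wt w (a + b))"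
    using low_mult[OF s low_single[OF E(1) lessI]] low_mult[OF r low_single[OF E(2) lessI]]
      low_mult[OF r low_mono[OF s le_SucI[OF order_refl]]]
    by (auto intro!: low_add simp: wt_add add.commute)
  finally show ?thesis using E keys_add[of a b] by (auto simp: lead_def)
qed

lemma lead_1: "lead w E 1 0 1"
  using lead_single[of 0 E w 1] by simp

lemma lead_prod:
  assumes "\<And>i. i \<in> A \<Longrightarrow> lead w E (c i) (a i) (p i)"
  shows "lead w E (\<Prod>i\<in>A. c i) (\<Sum>i\<in>A. a i) (\<Prod>i\<in>A. p i)"
  using assms by (induction A rule: infinite_finite_induct) (auto intro: lead_mult lead_1)

definition nmul :: "nat \<Rightarrow> ('v \<Rightarrow>\<^sub>0 nat) \<Rightarrow> ('v \<Rightarrow>\<^sub>0 nat)" where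
  "nmul t a = (\<Sum>_<t. a)"

lemma lookup_nmul [simp]: "Poly_Mapping.lookup (nmul t a) v = t * Poly_Mapping.lookup a v"
  by (simp add: nmul_def lookup_sum)

lemma lead_power: "lead w E c a p \<Longrightarrow> lead w E (c ^ t) (nmul t a) (p ^ t)"
  using lead_prod[of "{..<t}" w E "\<lambda>_. c" "\<lambda>_. a" "\<lambda>_. p"] by (simp add: nmul_def)

lemma lead_poly_on: "lead w E c a p \<Longrightarrow> p \<in> poly_on E"
  using poly_on_add[of "p - Poly_Mapping.single a c" E "Poly_Mapping.single a c"]
  by (auto simp: lead_def low_def poly_on_single)

lemma lead_lookup:
  assumes "lead w E c a p" "wt w a \<le> wt w b"
  shows "Poly_Mapping.lookup p b = (if b = a then c else 0)"
proof -
  have "b \<notin> Poly_Mapping.keys (p - Poly_Mapping.single a c)"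
    using assms by (auto simp: lead_def low_def)
  then show ?thesis by (simp add: in_keys_iff lookup_minus lookup_single when_def)
qed

text \<open>A family of polynomials, one with leading monomial \<open>a\<close> for every monomial \<open>a\<close>, is a basis;
  \<open>lcomb\<close> is the linear map sending the monomial \<open>a\<close> to the member \<open>f a\<close> of the family.\<close>

definition lcomb :: "(('v \<Rightarrow>\<^sub>0 nat) \<Rightarrow> 'w cpoly) \<Rightarrow> 'v cpoly \<Rightarrow> 'w cpoly" where
  "lcomb f Q = (\<Sum>a\<in>Poly_Mapping.keys Q. pconst (Poly_Mapping.lookup Q a) * f a)"

lemma lcomb_superset:
  "finite A \<Longrightarrow> Poly_Mapping.keys Q \<subseteq> A \<Longrightarrow>
    lcomb f Q = (\<Sum>a\<in>A. pconst (Poly_Mapping.lookup Q a) * f a)"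
  unfolding lcomb_def by (intro sum.mono_neutral_left) (auto simp: in_keys_iff)

lemma lcomb_add: "lcomb f (p + q) = lcomb f p + lcomb f q"
proof -
  let ?A = "Poly_Mapping.keys p \<union> Poly_Mapping.keys q"
  have "Poly_Mapping.keys (p + q) \<subseteq> ?A" by (rule keys_add)
  then show ?thesis
    by (simp add: lcomb_superset[of ?A] lookup_add pconst_add distrib_right sum.distrib)
qed

lemma lcomb_0 [simp]: "lcomb f 0 = 0"
  by (simp add: lcomb_def)

lemma lcomb_sum: "lcomb f (\<Sum>i\<in>A. g i) = (\<Sum>i\<in>A. lcomb f (g i))"
  by (induction A rule: infinite_finite_induct) (auto simp: lcomb_add)

lemma lcomb_diff: "lcomb f (p - q) = lcomb f p - lcomb f q"
  using lcomb_add[of f "p - q" q] by simp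

lemma lcomb_single: "lcomb f (Poly_Mapping.single a c) = pconst c * f a"
  by (cases "c = 0") (auto simp: lcomb_def)

lemma lookup_pconst_mult:
  "Poly_Mapping.lookup (pconst c * p) a = c * Poly_Mapping.lookup p a"
proof -
  have "pconst c * p = (\<Sum>b\<in>Poly_Mapping.keys p. Poly_Mapping.single b (c * Poly_Mapping.lookup p b))"
    by (subst (1) poly_mapping_eq_sum_single[of p]) (simp add: sum_distrib_left pconst_def mult_single)
  also have "Poly_Mapping.lookup \<dots> a = c * Poly_Mapping.lookup p a"
    by (auto simp: lookup_sum lookup_single when_def sum.If_cases in_keys_iff
           intro!: trans[OF sum.delta])
  finally show ?thesis .
qed

lemma lookup_lcomb:
  "Poly_Mapping.lookup (lcomb f Q) b
    = (\<Sum>a\<in>Poly_Mapping.keys Q. Poly_Mapping.lookup Q a * Poly_Mapping.lookup (f a) b)"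
  by (simp add: lcomb_def lookup_sum lookup_pconst_mult)

locale leading_family =
  fixes w :: "'v \<Rightarrow> nat" and E :: "'v set"
    and f :: "('v \<Rightarrow>\<^sub>0 nat) \<Rightarrow> 'v cpoly" and u :: "('v \<Rightarrow>\<^sub>0 nat) \<Rightarrow> complex"
  assumes lead: "Poly_Mapping.keys a \<subseteq> E \<Longrightarrow> lead w E (u a) a (f a)" and u: "u a \<noteq> 0"
begin

text \<open>At a monomial \<open>b\<close> of \<open>Q\<close> of maximal weight, no
  \<open>f a\<close> with \<open>a \<noteq> b\<close> contributes, so the coefficient of
  \<open>b\<close> in the combination is that of \<open>Q\<close> times \<open>u b\<close>.\<close>

lemma lcomb_inj:
  assumes "Q \<in> poly_on E" "lcomb f Q = 0"
  shows "Q = 0"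
proof (rule ccontr)
  assume "Q \<noteq> 0"
  then have "Poly_Mapping.keys Q \<noteq> {}" by simp
  then have "Max (wt w ` Poly_Mapping.keys Q) \<in> wt w ` Poly_Mapping.keys Q" by simp
  then obtain b where b: "b \<in> Poly_Mapping.keys Q" "wt w b = Max (wt w ` Poly_Mapping.keys Q)" by auto
  have b: "b \<in> Poly_Mapping.keys Q" "\<And>a. a \<in> Poly_Mapping.keys Q \<Longrightarrow> wt w a \<le> wt w b"
    using b by auto
  have "0 = Poly_Mapping.lookup (lcomb f Q) b" using assms by simp
  also have "\<dots> = (\<Sum>a\<in>Poly_Mapping.keys Q. if a = b then Poly_Mapping.lookup Q b * u b else 0)"
    unfolding lookup_lcomb using assms(1) b(2)
    by (intro sum.cong refl) (auto simp: lead_lookup[OF lead] poly_on_def)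
  also have "\<dots> = Poly_Mapping.lookup Q b * u b" using b(1) by simp
  finally show False using u b(1) by (simp add: in_keys_iff)
qed

text \<open>Up to the factor \<open>u a\<close>, \<open>f a\<close> differs from the monomial only
  by monomials of smaller weight, which are in the image by induction on the weight.\<close>

lemma lcomb_single_surj:
  "Poly_Mapping.keys a \<subseteq> E \<Longrightarrow> \<exists>Q\<in>poly_on E. lcomb f Q = Poly_Mapping.single a c"
proof (induction "wt w a" arbitrary: a c rule: less_induct)
  case less
  define l where "l = f a - Poly_Mapping.single a (u a)"
  have l: "l \<in> low w E (wt w a)" using lead[OF less.prems] by (simp add: lead_def l_def)
  have "\<exists>Q. \<forall>b\<in>Poly_Mapping.keys l. Q b \<in> poly_on E \<and>
      lcomb f (Q b) = Poly_Mapping.single b (c / u a * Poly_Mapping.lookup l b)"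
    using l less.hyps by (intro bchoice) (auto simp: low_def poly_on_def)
  then obtain Q where Q: "\<And>b. b \<in> Poly_Mapping.keys l \<Longrightarrow> Q b \<in> poly_on E \<and>
      lcomb f (Q b) = Poly_Mapping.single b (c / u a * Poly_Mapping.lookup l b)"
    by blast
  let ?R = "Poly_Mapping.single a (c / u a) - (\<Sum>b\<in>Poly_Mapping.keys l. Q b)"
  have "pconst (c / u a) * l
      = (\<Sum>b\<in>Poly_Mapping.keys l. Poly_Mapping.single b (c / u a * Poly_Mapping.lookup l b))"
    by (subst (1) poly_mapping_eq_sum_single[of l]) (simp add: sum_distrib_left pconst_def mult_single)
  then have "lcomb f ?R = pconst (c / u a) * f a - pconst (c / u a) * l"
    by (simp add: lcomb_diff lcomb_sum lcomb_single Q)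
  also have "\<dots> = pconst (c / u a) * Poly_Mapping.single a (u a)"
    by (simp add: l_def algebra_simps)
  also have "\<dots> = Poly_Mapping.single a c" using u by (simp add: pconst_def mult_single)
  finally show ?case using Q less.prems
    by (intro bexI[of _ ?R]) (auto intro!: poly_on_diff poly_on_sum poly_on_single)
qed

lemma lcomb_surj:
  assumes "p \<in> poly_on E" shows "\<exists>Q\<in>poly_on E. lcomb f Q = p"
proof -
  have "\<exists>Q. \<forall>b\<in>Poly_Mapping.keys p. Q b \<in> poly_on E \<and>
      lcomb f (Q b) = Poly_Mapping.single b (Poly_Mapping.lookup p b)"
    using lcomb_single_surj assms by (intro bchoice) (auto simp: poly_on_def)
  then obtain Q where Q: "\<And>b. b \<in> Poly_Mapping.keys p \<Longrightarrow> Q b \<in> poly_on E \<and>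
      lcomb f (Q b) = Poly_Mapping.single b (Poly_Mapping.lookup p b)" by blast
  then have "lcomb f (\<Sum>b\<in>Poly_Mapping.keys p. Q b) = p"
    by (simp add: lcomb_sum poly_mapping_eq_sum_single[symmetric])
  then show ?thesis using Q by (intro bexI[of _ "\<Sum>b\<in>Poly_Mapping.keys p. Q b"]) (auto intro: poly_on_sum)
qed

end

section \<open>Freeness over an algebra with coprime leading monomials\<close>

locale coprime_leads =
  fixes w :: "'v \<Rightarrow> nat" and E :: "'v set" and m :: nat
    and D :: "nat \<Rightarrow> 'v cpoly" and M :: "nat \<Rightarrow> 'v \<Rightarrow>\<^sub>0 nat" and c :: "nat \<Rightarrow> complex"
  assumes lead_D: "k < m \<Longrightarrow> lead w E (c k) (M k) (D k)" and c: "c k \<noteq> 0"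
    and M_ne: "k < m \<Longrightarrow> Poly_Mapping.keys (M k) \<noteq> {}"
    and M_disj: "k < m \<Longrightarrow> l < m \<Longrightarrow> k \<noteq> l \<Longrightarrow> Poly_Mapping.keys (M k) \<inter> Poly_Mapping.keys (M l) = {}"
begin

text \<open>The largest power of \<open>M k\<close> that divides the monomial \<open>a\<close>.
  Since the \<open>M k\<close> are pairwise coprime, these powers can be split off independently;
  \<open>\<gamma> a\<close> is the cofactor that remains.\<close>

definition \<beta> :: "('v \<Rightarrow>\<^sub>0 nat) \<Rightarrow> nat \<Rightarrow> nat" where
  "\<beta> a k = Min ((\<lambda>v. Poly_Mapping.lookup a v div Poly_Mapping.lookup (M k) v) ` Poly_Mapping.keys (M k))"

definition Mb :: "(nat \<Rightarrow> nat) \<Rightarrow> 'v \<Rightarrow>\<^sub>0 nat" where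
  "Mb b = (\<Sum>k<m. nmul (b k) (M k))"

definition \<gamma> :: "('v \<Rightarrow>\<^sub>0 nat) \<Rightarrow> 'v \<Rightarrow>\<^sub>0 nat" where
  "\<gamma> a = a - Mb (\<beta> a)"

definition Dm :: "(nat \<Rightarrow> nat) \<Rightarrow> 'v cpoly" where
  "Dm b = (\<Prod>k<m. D k ^ b k)"

definition std :: "('v \<Rightarrow>\<^sub>0 nat) set" where
  "std = {s. Poly_Mapping.keys s \<subseteq> E \<and> (\<forall>k<m. \<beta> s k = 0)}"

definition invs :: "'v cpoly set" where
  "invs = poly_subst pconst D ` poly_on {..<m}"

lemma keys_M: "k < m \<Longrightarrow> Poly_Mapping.keys (M k) \<subseteq> E"
  using lead_D by (auto simp: lead_def)

lemma lookup_Mb: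
  assumes "k < m" "v \<in> Poly_Mapping.keys (M k)"
  shows "Poly_Mapping.lookup (Mb b) v = b k * Poly_Mapping.lookup (M k) v"
proof -
  have "Poly_Mapping.lookup (Mb b) v = (\<Sum>l<m. if l = k then b k * Poly_Mapping.lookup (M k) v else 0)"
    unfolding Mb_def lookup_sum lookup_nmul using M_disj[OF assms(1)] assms(2)
    by (intro sum.cong refl) (auto simp: disjoint_iff not_in_keys_iff_lookup_eq_zero)
  then show ?thesis using assms(1) by simp
qed

lemma lookup_Mb_0: "(\<And>k. k < m \<Longrightarrow> v \<notin> Poly_Mapping.keys (M k)) \<Longrightarrow> Poly_Mapping.lookup (Mb b) v = 0"
  by (simp add: Mb_def lookup_sum in_keys_iff)

lemma Mb_cong: "(\<And>k. k < m \<Longrightarrow> b k = b' k) \<Longrightarrow> Mb b = Mb b'"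
  by (simp add: Mb_def)

lemma Dm_cong: "(\<And>k. k < m \<Longrightarrow> b k = b' k) \<Longrightarrow> Dm b = Dm b'"
  by (simp add: Dm_def)

lemma keys_Mb: "Poly_Mapping.keys (Mb b) \<subseteq> E"
proof
  fix v assume "v \<in> Poly_Mapping.keys (Mb b)"
  then have "\<exists>k<m. v \<in> Poly_Mapping.keys (M k)"
    using lookup_Mb_0[of v b] not_in_keys_iff_lookup_eq_zero by metis
  then show "v \<in> E" using keys_M by auto
qed

lemma \<beta>_Mb_add: "k < m \<Longrightarrow> \<beta> (Mb b + s) k = b k + \<beta> s k"
proof -
  assume k: "k < m"
  let ?f = "\<lambda>v. Poly_Mapping.lookup s v div Poly_Mapping.lookup (M k) v"
  have "\<beta> (Mb b + s) k = Min ((\<lambda>x. b k + x) ` (?f ` Poly_Mapping.keys (M k)))"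
    unfolding \<beta>_def image_image using k
    by (intro arg_cong[where f = Min] image_cong refl) (simp add: lookup_add lookup_Mb in_keys_iff)
  also have "\<dots> = b k + \<beta> s k"
    unfolding \<beta>_def using M_ne[OF k] by (intro mono_Min_commute[symmetric] monoI) auto
  finally show ?thesis .
qed

lemma \<beta>_0 [simp]: "k < m \<Longrightarrow> \<beta> 0 k = 0"
  using M_ne[of k] by (auto simp: \<beta>_def image_constant_conv)

lemma Mb_add_\<gamma>: "Mb (\<beta> a) + \<gamma> a = a"
proof (rule poly_mapping_eqI)
  fix v
  \<comment> \<open>Subtraction of exponents is truncated; this bound makes it exact.\<close>
  have "Poly_Mapping.lookup (Mb (\<beta> a)) v \<le> Poly_Mapping.lookup a v"
  proof (cases "\<exists>k<m. v \<in> Poly_Mapping.keys (M k)")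
    case True
    then obtain k where k: "k < m" "v \<in> Poly_Mapping.keys (M k)" by auto
    have "\<beta> a k \<le> Poly_Mapping.lookup a v div Poly_Mapping.lookup (M k) v"
      unfolding \<beta>_def using k by (intro Min_le) auto
    then show ?thesis
      by (simp add: lookup_Mb[OF k]) (meson le_trans mult_le_mono1 div_times_less_eq_dividend)
  qed (auto simp: lookup_Mb_0)
  then show "Poly_Mapping.lookup (Mb (\<beta> a) + \<gamma> a) v = Poly_Mapping.lookup a v"
    by (simp add: \<gamma>_def lookup_add lookup_minus)
qed

lemma keys_\<gamma>: "Poly_Mapping.keys a \<subseteq> E \<Longrightarrow> Poly_Mapping.keys (\<gamma> a) \<subseteq> E"
  by (auto simp: \<gamma>_def in_keys_iff lookup_minus subset_iff)

lemma \<gamma>_std: "Poly_Mapping.keys a \<subseteq> E \<Longrightarrow> \<gamma> a \<in> std"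
  using \<beta>_Mb_add[of _ "\<beta> a" "\<gamma> a"] by (auto simp: std_def Mb_add_\<gamma> dest: keys_\<gamma>)

lemma \<beta>_std: "s \<in> std \<Longrightarrow> k < m \<Longrightarrow> \<beta> (Mb b + s) k = b k"
  by (simp add: \<beta>_Mb_add std_def)

lemma \<gamma>_Mb_add: "s \<in> std \<Longrightarrow> \<gamma> (Mb b + s) = s"
  using Mb_cong[of "\<beta> (Mb b + s)" b] by (simp add: \<gamma>_def \<beta>_std)

text \<open>The monomial \<open>a\<close> with each extracted power of \<open>M k\<close> replaced
  by the same power of \<open>D k\<close>. Its leading monomial is still \<open>a\<close>, so these
  polynomials form a basis.\<close>

definition vb :: "('v \<Rightarrow>\<^sub>0 nat) \<Rightarrow> 'v cpoly" where
  "vb a = Dm (\<beta> a) * Poly_Mapping.single (\<gamma> a) 1"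

lemma vb_Mb_add: "s \<in> std \<Longrightarrow> vb (Mb b + s) = Dm b * Poly_Mapping.single s 1"
  using Dm_cong[of "\<beta> (Mb b + s)" b] by (simp add: vb_def \<gamma>_Mb_add \<beta>_std)

sublocale leading_family w E vb "\<lambda>a. \<Prod>k<m. c k ^ \<beta> a k"
proof
  fix a :: "'v \<Rightarrow>\<^sub>0 nat" assume "Poly_Mapping.keys a \<subseteq> E"
  then have "lead w E ((\<Prod>k<m. c k ^ \<beta> a k) * 1) (Mb (\<beta> a) + \<gamma> a) (vb a)"
    unfolding vb_def Mb_def Dm_def
    by (intro lead_mult lead_prod lead_power lead_D lead_single keys_\<gamma>) auto
  then show "lead w E (\<Prod>k<m. c k ^ \<beta> a k) a (vb a)" by (simp add: Mb_add_\<gamma>)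
qed (simp add: c)

lemma D_poly_on: "k < m \<Longrightarrow> D k \<in> poly_on E"
  using lead_D lead_poly_on by blast

lemma monom_subst_D:
  assumes "Poly_Mapping.keys b \<subseteq> {..<m}"
  shows "monom_subst D b = Dm (Poly_Mapping.lookup b)"
  using assms by (simp add: monom_subst_superset[of "{..<m}"] Dm_def)

lemma Dm_invs: "Dm b \<in> invs"
proof -
  have "Dm b = poly_subst pconst D (\<Prod>k<m. pvar k ^ b k)"
    by (simp add: Dm_def ps.subst_prod ps.subst_power)
  then show ?thesis unfolding invs_def
    by (rule image_eqI) (auto intro!: poly_on_prod poly_on_power)
qed

lemma invs_add: "p \<in> invs \<Longrightarrow> q \<in> invs \<Longrightarrow> p + q \<in> invs"
  unfolding invs_def by (auto simp: ps.subst_add[symmetric] intro!: imageI poly_on_add)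

lemma invs_mult: "p \<in> invs \<Longrightarrow> q \<in> invs \<Longrightarrow> p * q \<in> invs"
  unfolding invs_def by (auto simp: ps.subst_mult[symmetric] intro!: imageI poly_on_mult)

lemma invs_minus: "p \<in> invs \<Longrightarrow> - p \<in> invs"
  unfolding invs_def by (auto simp: ps.subst_minus[symmetric] intro!: imageI poly_on_minus)

lemma invs_pconst: "pconst r \<in> invs"
  unfolding invs_def by (rule image_eqI[of _ _ "pconst r"]) auto

lemma invs_sum: "(\<And>i. i \<in> A \<Longrightarrow> f i \<in> invs) \<Longrightarrow> (\<Sum>i\<in>A. f i) \<in> invs"
  using invs_pconst[of 0] by (induction A rule: infinite_finite_induct) (auto intro: invs_add)

lemma invs_poly_on: "invs \<subseteq> poly_on E"
  unfolding invs_def by (auto intro!: poly_on_subst D_poly_on)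

text \<open>Expand \<open>p\<close> in the basis \<open>vb\<close> and collect the terms with the
  same standard cofactor \<open>\<gamma> a\<close>.\<close>

lemma std_spanning:
  assumes "p \<in> poly_on E"
  shows "\<exists>F q. finite F \<and> F \<subseteq> std \<and> (\<forall>s\<in>F. q s \<in> invs) \<and>
    p = (\<Sum>s\<in>F. q s * Poly_Mapping.single s 1)"
proof -
  obtain Q where Q: "Q \<in> poly_on E" "lcomb vb Q = p" using lcomb_surj[OF assms] by blast
  define q where "q s = (\<Sum>a\<in>{a\<in>Poly_Mapping.keys Q. \<gamma> a = s}.
    pconst (Poly_Mapping.lookup Q a) * Dm (\<beta> a))" for s
  have "p = (\<Sum>a\<in>Poly_Mapping.keys Q. pconst (Poly_Mapping.lookup Q a) * Dm (\<beta> a) * Poly_Mapping.single (\<gamma> a) 1)"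
    using Q(2) by (simp add: lcomb_def vb_def mult.assoc)
  also have "\<dots> = (\<Sum>s\<in>\<gamma> ` Poly_Mapping.keys Q. q s * Poly_Mapping.single s 1)"
    unfolding q_def sum_distrib_right by (subst sum.image_gen[of _ _ \<gamma>]) (auto intro!: sum.cong)
  finally show ?thesis using Q(1)
    by (intro exI[of _ "\<gamma> ` Poly_Mapping.keys Q"] exI[of _ q])
       (auto simp: q_def poly_on_def intro!: \<gamma>_std invs_sum invs_mult invs_pconst Dm_invs)
qed

text \<open>Expanding the coefficients turns the relation into \<open>lcomb vb R = 0\<close>, hence
  \<open>R = 0\<close>. The pair of an exponent vector and a standard monomial is recovered from
  their product by \<open>\<beta>\<close> and \<open>\<gamma>\<close>, so no two coefficients of the
  \<open>Q s\<close> are merged in \<open>R\<close>. For a single standard monomial 1 this is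
  algebraic independence of the \<open>D k\<close>.\<close>

lemma std_independent:
  assumes F: "finite F" "F \<subseteq> std" and Q: "\<And>s. s \<in> F \<Longrightarrow> Q s \<in> poly_on {..<m}"
    and 0: "(\<Sum>s\<in>F. poly_subst pconst D (Q s) * Poly_Mapping.single s 1) = 0"
    and s: "s \<in> F"
  shows "Q s = 0"
proof -
  let ?l = Poly_Mapping.lookup and ?K = "\<lambda>s. Poly_Mapping.keys (Q s)"
  define R where "R = (\<Sum>s\<in>F. \<Sum>b\<in>?K s. Poly_Mapping.single (Mb (?l b) + s) (?l (Q s) b))"
  have E: "Poly_Mapping.keys (Mb b + s) \<subseteq> E" if "s \<in> F" for b s
    using keys_add[of "Mb b" s] keys_Mb[of b] F(2) that by (auto simp: std_def)
  have "lcomb vb R = (\<Sum>s\<in>F. \<Sum>b\<in>?K s. pconst (?l (Q s) b) * (Dm (?l b) * Poly_Mapping.single s 1))"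
    unfolding R_def lcomb_sum lcomb_single using F(2) by (intro sum.cong refl) (auto simp: vb_Mb_add)
  also have "\<dots> = (\<Sum>s\<in>F. poly_subst pconst D (Q s) * Poly_Mapping.single s 1)"
    unfolding poly_subst_def sum_distrib_right using Q
    by (intro sum.cong refl) (auto simp: monom_subst_D poly_on_def mult.assoc)
  finally have "lcomb vb R = 0" using 0 by simp
  moreover have "R \<in> poly_on E" unfolding R_def by (intro poly_on_sum poly_on_single E)
  ultimately have "R = 0" by (rule lcomb_inj[rotated])
  show ?thesis
  proof (rule poly_mapping_eqI)
    fix b
    show "?l (Q s) b = ?l 0 b"
    proof (rule ccontr)
      assume "?l (Q s) b \<noteq> ?l 0 b"
      then have b: "b \<in> ?K s" by (simp add: in_keys_iff)
      have uniq: "s' = s \<and> b' = b" if "s' \<in> F" "b' \<in> ?K s'" "Mb (?l b') + s' = Mb (?l b) + s" for s' b'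
      proof
        show "s' = s" using that(1,3) s F(2) \<gamma>_Mb_add by (metis subsetD)
        show "b' = b"
        proof (rule poly_mapping_eqI)
          fix k
          show "?l b' k = ?l b k"
          proof (cases "k < m")
            case True
            then show ?thesis
              using that(1,3) s F(2) \<beta>_std by (metis subsetD)
          next
            case False
            then have "k \<notin> Poly_Mapping.keys b'" "k \<notin> Poly_Mapping.keys b"
              using poly_onD[OF Q[OF s] b] poly_onD[OF Q[OF that(1)] that(2)] by auto
            then show ?thesis by (simp add: in_keys_iff)
          qed
        qed
      qed
      have "0 = ?l R (Mb (?l b) + s)" using \<open>R = 0\<close> by simp
      also have "\<dots> = (\<Sum>s'\<in>F. \<Sum>b'\<in>?K s'. if s' = s \<and> b' = b then ?l (Q s) b else 0)"
        unfolding R_def lookup_sum lookup_single using uniq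
        by (intro sum.cong refl) (auto simp: when_def)
      also have "\<dots> = (\<Sum>s'\<in>F. if s' = s then ?l (Q s) b else 0)"
        using b by (intro sum.cong refl) auto
      also have "\<dots> = ?l (Q s) b" using s F(1) by simp
      finally show False using b by (simp add: in_keys_iff)
    qed
  qed
qed

lemma zero_std: "0 \<in> std"
  by (simp add: std_def)

text \<open>In the basis of standard monomials the product has a coordinate only at 1.
  Multiplication by the power of the minors acts on each coordinate separately and injectively, so
  \<open>P\<close> too has a coordinate only at 1.\<close>

lemma invs_if_mult_invs:
  assumes P: "P \<in> poly_on E" and PI: "(\<Prod>k<m. D k) ^ K * P \<in> invs"
  shows "P \<in> invs"
proof -
  let ?\<Delta> = "(\<Prod>k<m. pvar k) ^ K :: nat cpoly"
  have \<Delta>: "poly_subst pconst D ?\<Delta> = (\<Prod>k<m. D k) ^ K"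
    by (simp add: ps.subst_prod ps.subst_power)
  have \<Delta>_on: "?\<Delta> \<in> poly_on {..<m}" by (intro poly_on_power poly_on_prod) auto
  have "pvar k \<noteq> 0" for k :: nat
    by (metis lookup_single_eq lookup_zero one_neq_zero pvar_def)
  then have \<Delta>_ne: "?\<Delta> \<noteq> 0" by simp
  obtain R where R: "R \<in> poly_on {..<m}" "(\<Prod>k<m. D k) ^ K * P = poly_subst pconst D R"
    using PI by (auto simp: invs_def)
  obtain F q where F: "finite F" "F \<subseteq> std" "\<And>s. s \<in> F \<Longrightarrow> q s \<in> invs"
    "P = (\<Sum>s\<in>F. q s * Poly_Mapping.single s 1)"
    using std_spanning[OF P] by auto
  have "\<exists>Q. \<forall>s\<in>F. Q s \<in> poly_on {..<m} \<and> q s = poly_subst pconst D (Q s)"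
    using F(3) by (intro bchoice) (auto simp: invs_def)
  then obtain Q where Q: "\<And>s. s \<in> F \<Longrightarrow> Q s \<in> poly_on {..<m}"
    "\<And>s. s \<in> F \<Longrightarrow> q s = poly_subst pconst D (Q s)" by auto
  \<comment> \<open>The coordinates of the difference of the two expressions for the product.
    \<open>R\<close> belongs to the monomial 1, whose exponent is 0 and which need not lie in
    \<open>F\<close>.\<close>
  define Q' where "Q' s = (if s \<in> F then ?\<Delta> * Q s else 0) - (if s = 0 then R else 0)" for s
  have Q'_on: "Q' s \<in> poly_on {..<m}" for s
    using Q(1) R(1) \<Delta>_on by (auto simp: Q'_def intro!: poly_on_diff poly_on_mult poly_on_minus)
  have "(\<Sum>s\<in>insert 0 F. poly_subst pconst D (Q' s) * Poly_Mapping.single s 1)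
      = (\<Sum>s\<in>insert 0 F. poly_subst pconst D (if s \<in> F then ?\<Delta> * Q s else 0) * Poly_Mapping.single s 1)
        - (\<Sum>s\<in>insert 0 F. poly_subst pconst D (if s = 0 then R else 0) * Poly_Mapping.single s 1)"
    by (simp add: Q'_def ps.subst_diff left_diff_distrib sum_subtractf del: sum.insert)
  also have "(\<Sum>s\<in>insert 0 F. poly_subst pconst D (if s = 0 then R else 0) * Poly_Mapping.single s 1)
      = (\<Sum>s\<in>insert 0 F. if s = 0 then poly_subst pconst D R else 0)"
    by (intro sum.cong) auto
  also have "\<dots> = poly_subst pconst D R" using F(1) by simp
  also have "(\<Sum>s\<in>insert 0 F. poly_subst pconst D (if s \<in> F then ?\<Delta> * Q s else 0) * Poly_Mapping.single s 1)
      = (\<Sum>s\<in>F. (\<Prod>k<m. D k) ^ K * (q s * Poly_Mapping.single s 1))"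
    by (rule sum.mono_neutral_cong_right)
       (use F(1) in \<open>auto simp: ps.subst_mult \<Delta> Q(2) mult.assoc\<close>)
  also have "\<dots> = (\<Prod>k<m. D k) ^ K * P" unfolding F(4) by (simp add: sum_distrib_left)
  finally have "(\<Sum>s\<in>insert 0 F. poly_subst pconst D (Q' s) * Poly_Mapping.single s 1) = 0"
    using R(2) by simp
  then have "Q' s = 0" if "s \<in> insert 0 F" for s
    using std_independent[of "insert 0 F" Q' s] F(1,2) zero_std Q'_on that by auto
  then have "?\<Delta> * Q s = 0" if "s \<in> F" "s \<noteq> 0" for s
    using that by (force simp: Q'_def)
  then have "q s = 0" if "s \<in> F" "s \<noteq> 0" for s
    using that \<Delta>_ne Q(2)[of s] by (metis mult_eq_0_iff ps.subst_0)
  then have "P = (\<Sum>s\<in>F \<inter> {0}. q s)"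
    unfolding F(4) by (intro sum.mono_neutral_cong_right) (use F(1) in auto)
  then show ?thesis using F(3) by (auto intro!: invs_sum)
qed

end

section \<open>Leading principal minors of a generic symmetric matrix\<close>

declare sum.lessThan_Suc [simp del] prod.lessThan_Suc [simp del]

lemma reversal_permutes: "(\<lambda>i. if i < Suc k then k - i else i) permutes {0..<Suc k}"
  by (rule bij_imp_permutes, rule bij_betwI[where g = "\<lambda>i. k - i"]) auto

text \<open>Adding (i + p i - k)^2 to (i - p i)^2 leaves no mixed term i * p i, so the total of both
  sums is the same for every permutation. The displacement is therefore maximal exactly where the
  second sum vanishes, that is, for p i = k - i.\<close>

lemma displacement_less_reversal:
  fixes k :: nat
  assumes p: "p permutes {0..<Suc k}" and ne: "p \<noteq> (\<lambda>i. if i < Suc k then k - i else i)"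
  shows "(\<Sum>i<Suc k. (int i - int (p i))\<^sup>2) 
    < (\<Sum>i<Suc k. (int i - int (if i < Suc k then k - i else i))\<^sup>2)"
proof -
  have A: "{0..<Suc k} = {..<Suc k}" by auto
  have sq: "(\<Sum>i<Suc k. g (q i)) = (\<Sum>i<Suc k. g i)" if "q permutes {0..<Suc k}" for q and g :: "nat \<Rightarrow> int"
    using sum.permute[OF that, of g] unfolding A by (simp add: o_def)
  have id: "(\<Sum>i<Suc k. (int i - int (q i))\<^sup>2) = (\<Sum>i<Suc k. 2 * (int i)\<^sup>2 - 2 * int k * int i + (int k)\<^sup>2)
      + (\<Sum>i<Suc k. 2 * (int i)\<^sup>2 - 2 * int k * int i)
      - (\<Sum>i<Suc k. (int i + int (q i) - int k)\<^sup>2)" if q: "q permutes {0..<Suc k}" for q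
  proof -
    have "(\<Sum>i<Suc k. (int i - int (q i))\<^sup>2 + (int i + int (q i) - int k)\<^sup>2)
        = (\<Sum>i<Suc k. 2 * (int i)\<^sup>2 - 2 * int k * int i + (int k)\<^sup>2)
          + (\<Sum>i<Suc k. 2 * (int (q i))\<^sup>2 - 2 * int k * int (q i))"
      unfolding sum.distrib[symmetric]
      by (intro sum.cong refl) (simp add: power2_eq_square algebra_simps)
    also have "(\<Sum>i<Suc k. 2 * (int (q i))\<^sup>2 - 2 * int k * int (q i))
        = (\<Sum>i<Suc k. 2 * (int i)\<^sup>2 - 2 * int k * int i)"
      by (rule sq[OF q, of "\<lambda>i. 2 * (int i)\<^sup>2 - 2 * int k * int i"])
    finally show ?thesis
      unfolding sum.distrib[of "\<lambda>i. (int i - int (q i))\<^sup>2"] by simp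
  qed
  have r: "(\<Sum>i<Suc k. (int i + int (if i < Suc k then k - i else i) - int k)\<^sup>2) = 0"
    by (intro sum.neutral) auto
  have "\<exists>i<Suc k. int i + int (p i) - int k \<noteq> 0"
  proof (rule ccontr)
    assume "\<not> ?thesis"
    then have "p i = (if i < Suc k then k - i else i)" for i
      using permutes_not_in[OF p, of i] by (cases "i < Suc k") auto
    then show False using ne by auto
  qed
  then have "(\<Sum>i<Suc k. (int i + int (p i) - int k)\<^sup>2) > 0"
    by (meson finite_lessThan lessThan_iff sum_pos2 zero_le_power2 zero_less_power2)
  then show ?thesis
    unfolding id[OF p] id[OF reversal_permutes[of k]] r by simp
qed

definition lmat :: "nat \<Rightarrow> (nat \<Rightarrow> nat \<Rightarrow> 'a) \<Rightarrow> 'a mat" where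
  "lmat k r = mat k k (\<lambda>(i, j). r i j)"

lemma lmat_carrier [simp]: "lmat k r \<in> carrier_mat k k"
  by (simp add: lmat_def)

lemma det_lmat:
  "det (lmat k r) = (\<Sum>p | p permutes {0..<k}. signof p * (\<Prod>i<k. r i (p i)))"
  unfolding det_def'[OF lmat_carrier] lessThan_atLeast0
proof (intro sum.cong refl arg_cong2[where f = times] prod.cong)
  fix p i assume "p \<in> {p. p permutes {0..<k}}" "i \<in> {0..<k}"
  then show "lmat k r $$ (i, p i) = r i (p i)"
    using permutes_in_image[of p "{0..<k}" i] by (simp add: lmat_def)
qed

locale minors =
  fixes E :: "'v set" and m :: nat and X :: "nat \<Rightarrow> nat \<Rightarrow> 'v"
  assumes X_E: "i < m \<Longrightarrow> j < m \<Longrightarrow> X i j \<in> E"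
    and X_sym: "X i j = X j i"
    and X_inj: "i \<le> j \<Longrightarrow> k \<le> l \<Longrightarrow> j < m \<Longrightarrow> l < m \<Longrightarrow> X i j = X k l \<Longrightarrow> i = k \<and> j = l"
begin

definition D :: "nat \<Rightarrow> 'v cpoly" where
  "D k = det (lmat (Suc k) (\<lambda>i j. pvar (X i j)))"

text \<open>The sum has at most one term, as \<open>X\<close> is injective on sorted index pairs; it
  serves to define the weight of a variable from its indices, with 0 for all other
  variables.\<close>

definition w :: "'v \<Rightarrow> nat" where
  "w v = (\<Sum>(i, j)\<in>{(i, j). i \<le> j \<and> j < m \<and> X i j = v}. (j - i)\<^sup>2)"

definition M :: "nat \<Rightarrow> 'v \<Rightarrow>\<^sub>0 nat" where
  "M k = (\<Sum>i<Suc k. Poly_Mapping.single (X i (k - i)) 1)"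

lemma w_X_le: "i \<le> j \<Longrightarrow> j < m \<Longrightarrow> int (w (X i j)) = (int i - int j)\<^sup>2"
proof -
  assume ij: "i \<le> j" "j < m"
  then have "{(k, l). k \<le> l \<and> l < m \<and> X k l = X i j} = {(i, j)}" using X_inj[of _ _ i j] by blast
  then show ?thesis using ij by (simp add: w_def of_nat_diff power2_commute)
qed

lemma w_X: "i < m \<Longrightarrow> j < m \<Longrightarrow> int (w (X i j)) = (int i - int j)\<^sup>2"
  using w_X_le[of i j] w_X_le[of j i] by (cases "i \<le> j") (auto simp: X_sym[of i j] power2_commute)

lemma lookup_M_pos:
  assumes "i < Suc k" shows "Poly_Mapping.lookup (M k) (X i (k - i)) > 0"
proof -
  have "0 < Poly_Mapping.lookup (Poly_Mapping.single (X i (k - i)) (1::nat)) (X i (k - i))" by simp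
  also have "\<dots> \<le> (\<Sum>j<Suc k. Poly_Mapping.lookup (Poly_Mapping.single (X j (k - j)) (1::nat)) (X i (k - i)))"
    using assms by (intro member_le_sum[of i _ "\<lambda>j. Poly_Mapping.lookup (Poly_Mapping.single (X j (k - j)) (1::nat)) (X i (k - i))"]) auto
  finally show ?thesis unfolding M_def lookup_sum .
qed

lemma keys_M_subset: "Poly_Mapping.keys (M k) \<subseteq> (\<lambda>i. X i (k - i)) ` {..<Suc k}"
  unfolding M_def by (rule order_trans[OF keys_sum]) auto

text \<open>In the Leibniz expansion the term of \<open>p\<close> has as weight the sum of (i - p
  i)^2. The matrix is symmetric, so different permutations may give the same monomial, but the
  strict inequality keeps the reversal from being cancelled. Coprimality holds because the indices
  of every variable in \<open>M k\<close> add up to \<open>k\<close>.\<close>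

sublocale coprime_leads w E m D M
  "\<lambda>k. signof (\<lambda>i. if i < Suc k then k - i else i)"
proof
  fix k assume k: "k < m"
  let ?P = "{p. p permutes {0..<Suc k}}" and ?r = "\<lambda>i. if i < Suc k then k - i else i"
  let ?e = "\<lambda>p. \<Sum>i<Suc k. Poly_Mapping.single (X i (p i)) (1::nat)"
  let ?s = "\<lambda>p. Poly_Mapping.single (?e p) (signof p :: complex)"
  have lt: "p i < m" if "p permutes {0..<Suc k}" "i < Suc k" for p i
    using permutes_in_image[OF that(1), of i] that(2) k by auto
  have E: "Poly_Mapping.keys (?e p) \<subseteq> E" if "p permutes {0..<Suc k}" for p
    using lt[OF that] k by (intro order_trans[OF keys_sum]) (auto intro!: X_E)
  have summand: "signof p * (\<Prod>i<Suc k. pvar (X i (p i))) = ?s p" for p :: "nat \<Rightarrow> nat"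
  proof -
    have "(\<Prod>i<Suc k. pvar (X i (p i))) = monom_subst pvar (?e p)"
      by (simp only: monom_subst_sum[OF finite_lessThan] monom_subst_single power_one_right)
    then show ?thesis by (simp add: monom_subst_pvar sign_def single_uminus)
  qed
  have "D k = (\<Sum>p\<in>?P. ?s p)" by (simp only: D_def det_lmat summand)
  also have "\<dots> = ?s ?r + (\<Sum>p\<in>?P - {?r}. ?s p)"
    using reversal_permutes[of k] finite_permutations[of "{0..<Suc k}"]
    by (intro sum.remove) auto
  finally have D: "D k - ?s ?r = (\<Sum>p\<in>?P - {?r}. ?s p)" by simp
  have e_r: "?e ?r = M k" unfolding M_def by (intro sum.cong) auto
  have wt_e: "int (wt w (?e p)) = (\<Sum>i<Suc k. (int i - int (p i))\<^sup>2)" if "p permutes {0..<Suc k}" for p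
    unfolding wt_sum of_nat_sum using lt[OF that] k by (intro sum.cong refl) (simp add: w_X)
  have "wt w (?e p) < wt w (M k)" if p: "p \<in> ?P - {?r}" for p
  proof -
    have "int (wt w (?e p)) < int (wt w (?e ?r))"
      using displacement_less_reversal[of p k] p wt_e[of p] wt_e[OF reversal_permutes[of k]]
      by simp
    then show ?thesis unfolding e_r by simp
  qed
  then have "(\<Sum>p\<in>?P - {?r}. ?s p) \<in> low w E (wt w (M k))"
    using E by (intro low_sum low_single) blast+
  moreover have "Poly_Mapping.keys (M k) \<subseteq> E"
    using E[OF reversal_permutes[of k]] unfolding e_r .
  ultimately show "lead w E (signof ?r) (M k) (D k)"
    unfolding lead_def D[symmetric] e_r by blast
  show "Poly_Mapping.keys (M k) \<noteq> {}"
    using lookup_M_pos[of 0 k] by (metis empty_iff in_keys_iff less_numeral_extra(3) zero_less_Suc)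
next
  fix k l assume kl: "k < m" "l < m" "k \<noteq> l"
  show "Poly_Mapping.keys (M k) \<inter> Poly_Mapping.keys (M l) = {}"
  proof (rule ccontr)
    assume "\<not> ?thesis"
    then obtain i j where ij: "i \<le> k" "j \<le> l" "X i (k - i) = X j (l - j)"
      using keys_M_subset[of k] keys_M_subset[of l] by fastforce
    \<comment> \<open>\<open>X_inj\<close> speaks of sorted pairs only, so both index pairs are
      sorted; their sums do not change.\<close>
    define a b c d where "a = min i (k - i)" and "b = max i (k - i)"
      and "c = min j (l - j)" and "d = max j (l - j)"
    have "X a b = X c d" using ij(3) X_sym[of i "k - i"] X_sym[of j "l - j"]
      by (auto simp: a_def b_def c_def d_def min_def max_def)
    then have "a = c \<and> b = d" using ij kl by (intro X_inj) (auto simp: a_def b_def c_def d_def)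
    moreover have "a + b = k" "c + d = l" using ij by (auto simp: a_def b_def c_def d_def)
    ultimately show False using kl by simp
  qed
qed (auto simp: sign_def)

lemma eval_D: "poly_eval \<xi> (D k) = det (lmat (Suc k) (\<lambda>i j. \<xi> (X i j)))"
proof -
  have "poly_eval \<xi> (signof p * q) = signof p * poly_eval \<xi> q" for p :: "nat \<Rightarrow> nat" and q
    by (simp add: sign_def ev.subst_minus)
  then show ?thesis
    unfolding D_def det_lmat by (simp add: ev.subst_sum ev.subst_prod)
qed

text \<open>On the diagonal slice with entries \<open>D\<^sub>k / D\<^sub>k\<^sub>-\<^sub>1\<close> every monomial becomes a Laurent monomial
  in the minors; clearing denominators and using freeness leads back to a polynomial in them.\<close>

lemma invs_if_diagonal:
  assumes P: "P \<in> poly_on E"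
    and diag: "\<And>\<xi>. (\<forall>k<m. poly_eval \<xi> (D k) \<noteq> 0) \<Longrightarrow>
      \<exists>\<zeta>. poly_eval \<xi> P = poly_eval \<zeta> P \<and> (\<forall>k<m. poly_eval \<zeta> (D k) = poly_eval \<xi> (D k)) \<and>
        (\<forall>v\<in>E - {X i i | i. i < m}. \<zeta> v = 0)"
  shows "P \<in> invs"
proof -
  let ?l = Poly_Mapping.lookup
  define dg where "dg = {X i i | i. i < m}"
  \<comment> \<open>The exponents of the diagonal variables, continued by 0 from \<open>m\<close> on
    so that the telescoping product has no remainder at the end.\<close>
  define e :: "('v \<Rightarrow>\<^sub>0 nat) \<Rightarrow> nat \<Rightarrow> nat"
    where "e a i = (if i < m then ?l a (X i i) else 0)" for a i
  define K where "K = (\<Sum>a\<in>Poly_Mapping.keys P. \<Sum>i<m. e a i)"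
  \<comment> \<open>On the slice a diagonal monomial telescopes to the product of the minors
    \<open>D i\<close> with exponents \<open>e a i - e a (Suc i)\<close>, and every other monomial
    vanishes. The summand \<open>K\<close> exceeds or equals all exponents, so the subtraction is
    exact.\<close>
  define R where "R = (\<Sum>a\<in>{a\<in>Poly_Mapping.keys P. Poly_Mapping.keys a \<subseteq> dg}.
     pconst (?l P a) * Dm (\<lambda>i. K + e a i - e a (Suc i)))"
  have R: "R \<in> invs" unfolding R_def by (intro invs_sum invs_mult invs_pconst Dm_invs)
  have e_K: "e a i \<le> K" if "a \<in> Poly_Mapping.keys P" for a i
  proof (cases "i < m")
    case True
    have "e a i \<le> (\<Sum>i<m. e a i)" using True by (intro member_le_sum) auto
    also have "\<dots> \<le> K" unfolding K_def using that by (intro member_le_sum) auto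
    finally show ?thesis .
  qed (simp add: e_def)
  have eval: "poly_eval \<xi> ((\<Prod>k<m. D k) ^ K * P) = poly_eval \<xi> R"
    if nz: "\<forall>k<m. poly_eval \<xi> (D k) \<noteq> 0" for \<xi>
  proof -
    obtain \<zeta> where \<zeta>: "poly_eval \<xi> P = poly_eval \<zeta> P"
      "\<And>k. k < m \<Longrightarrow> poly_eval \<zeta> (D k) = poly_eval \<xi> (D k)"
      "\<And>v. v \<in> E - dg \<Longrightarrow> \<zeta> v = 0"
      using diag[OF nz] unfolding dg_def by blast
    define d where "d k = poly_eval \<xi> (D k)" for k
    have off: "\<zeta> (X i j) = 0" if "i < m" "j < m" "i \<noteq> j" for i j
    proof -
      have "X i j \<notin> dg"
      proof
        assume "X i j \<in> dg"
        then obtain l where l: "l < m" "X i j = X l l" by (auto simp: dg_def)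
        then show False
          using X_inj[of i j l l] X_inj[of j i l l] that X_sym[of i j] by (cases "i \<le> j") auto
      qed
      then show ?thesis using \<zeta>(3) X_E that by blast
    qed
    have d: "d k = (\<Prod>i<Suc k. \<zeta> (X i i))" if "k < m" for k
    proof -
      have "d k = det (lmat (Suc k) (\<lambda>i j. \<zeta> (X i j)))"
        using \<zeta>(2)[OF that] by (simp add: d_def eval_D)
      also have "\<dots> = prod_list (diag_mat (lmat (Suc k) (\<lambda>i j. \<zeta> (X i j))))"
        using off that by (intro det_upper_triangular) (auto simp: lmat_def upper_triangular_def)
      also have "\<dots> = (\<Prod>i<Suc k. \<zeta> (X i i))"
        by (simp add: diag_mat_def lmat_def prod.list_conv_set_nth lessThan_atLeast0 del: upt_Suc)
      finally show ?thesis .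
    qed
    \<comment> \<open>Telescoping without division: the last factor is what the first
      \<open>n\<close> diagonal entries leave open, with an empty minor of value 1 for
      \<open>n = 0\<close>.\<close>
    have z: "(\<Prod>i<n. \<zeta> (X i i) ^ f i) * (\<Prod>i<n. d i ^ f (Suc i)) = (\<Prod>i<n. d i ^ f i) * (if n = 0 then 1 else d (n-1) ^ f n)"
      if "n \<le> m" for n and f :: "nat \<Rightarrow> nat"
      using that
    proof (induction n)
      case (Suc n)
      have "d n = (if n = 0 then 1 else d (n - 1)) * \<zeta> (X n n)"
        using d[of n] d[of "n - 1"] Suc.prems by (cases n) (auto simp: prod.lessThan_Suc)
      then have e: "d n ^ f n = (if n = 0 then 1 else d (n-1) ^ f n) * \<zeta> (X n n) ^ f n"
        by (auto simp: power_mult_distrib)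
      have "(\<Prod>i<Suc n. \<zeta> (X i i) ^ f i) * (\<Prod>i<Suc n. d i ^ f (Suc i))
          = ((\<Prod>i<n. \<zeta> (X i i) ^ f i) * (\<Prod>i<n. d i ^ f (Suc i))) * \<zeta> (X n n) ^ f n * d n ^ f (Suc n)"
        by (simp add: prod.lessThan_Suc mult_ac)
      also have "(\<Prod>i<n. \<zeta> (X i i) ^ f i) * (\<Prod>i<n. d i ^ f (Suc i))
          = (\<Prod>i<n. d i ^ f i) * (if n = 0 then 1 else d (n-1) ^ f n)"
        using Suc.prems by (intro Suc.IH) simp
      also have "\<dots> * \<zeta> (X n n) ^ f n * d n ^ f (Suc n) = (\<Prod>i<n. d i ^ f i) * d n ^ f n * d n ^ f (Suc n)"
        unfolding e by (simp only: mult.assoc)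
      finally show ?case by (simp add: prod.lessThan_Suc)
    qed simp
    have mon: "(\<Prod>k<m. d k) ^ K * monom_subst \<zeta> a = (\<Prod>k<m. d k ^ (K + e a k - e a (Suc k)))"
      if a: "a \<in> Poly_Mapping.keys P" "Poly_Mapping.keys a \<subseteq> dg" for a
    proof -
      have e_m: "e a m = 0" by (simp add: e_def)
      have inj: "inj_on (\<lambda>i. X i i) {..<m}"
        by (rule inj_onI) (use X_inj in blast)
      have "monom_subst \<zeta> a = (\<Prod>v\<in>(\<lambda>i. X i i) ` {..<m}. \<zeta> v ^ ?l a v)"
        using a(2) by (intro monom_subst_superset) (auto simp: dg_def)
      also have "\<dots> = (\<Prod>i<m. \<zeta> (X i i) ^ e a i)"
        by (simp add: prod.reindex[OF inj] e_def)
      finally have "monom_subst \<zeta> a * (\<Prod>i<m. d i ^ e a (Suc i)) = (\<Prod>i<m. d i ^ e a i)"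
        using z[of m "e a"] e_m by simp
      then have "(\<Prod>k<m. d k) ^ K * monom_subst \<zeta> a * (\<Prod>i<m. d i ^ e a (Suc i))
          = (\<Prod>k<m. d k) ^ K * (\<Prod>i<m. d i ^ e a i)" by (simp only: mult.assoc)
      also have "(\<Prod>k<m. d k) ^ K * (\<Prod>i<m. d i ^ e a i)
          = (\<Prod>k<m. d k ^ (K + e a k - e a (Suc k))) * (\<Prod>i<m. d i ^ e a (Suc i))"
        unfolding prod_power_distrib prod.distrib[symmetric] power_add[symmetric]
        using e_K[OF a(1)] by (intro prod.cong refl arg_cong2[where f = "(^)"]) (simp add: trans_le_add1)
      finally show ?thesis using nz by (simp add: d_def)
    qed
    have 1: "poly_eval \<xi> ((\<Prod>k<m. D k) ^ K * P) = (\<Prod>k<m. d k) ^ K * poly_eval \<zeta> P"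
      by (simp add: ev.subst_mult ev.subst_power ev.subst_prod d_def \<zeta>(1))
    have 2: "\<dots> = (\<Sum>a\<in>Poly_Mapping.keys P. ?l P a * ((\<Prod>k<m. d k) ^ K * monom_subst \<zeta> a))"
      by (simp add: poly_subst_def sum_distrib_left mult_ac)
    have 3: "\<dots> = (\<Sum>a\<in>{a\<in>Poly_Mapping.keys P. Poly_Mapping.keys a \<subseteq> dg}.
        ?l P a * (\<Prod>k<m. d k ^ (K + e a k - e a (Suc k))))"
    proof (rule sum.mono_neutral_cong_right)
      show "\<forall>a\<in>Poly_Mapping.keys P - {a \<in> Poly_Mapping.keys P. Poly_Mapping.keys a \<subseteq> dg}.
          ?l P a * ((\<Prod>k<m. d k) ^ K * monom_subst \<zeta> a) = 0"
      proof
        fix a assume "a \<in> Poly_Mapping.keys P - {a \<in> Poly_Mapping.keys P. Poly_Mapping.keys a \<subseteq> dg}"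
        then obtain v where v: "a \<in> Poly_Mapping.keys P" "v \<in> Poly_Mapping.keys a" "v \<notin> dg" by auto
        then have "\<zeta> v = 0" using \<zeta>(3) poly_onD[OF P] by auto
        then have "monom_subst \<zeta> a = 0"
          using v(2) by (auto simp: monom_subst_def in_keys_iff intro!: prod_zero bexI[of _ v])
        then show "?l P a * ((\<Prod>k<m. d k) ^ K * monom_subst \<zeta> a) = 0" by simp
      qed
    qed (use mon in auto)
    have 4: "\<dots> = poly_eval \<xi> R"
      unfolding R_def Dm_def ev.subst_sum ev.subst_mult ev.subst_prod ev.subst_power ev.subst_pconst d_def ..
    show ?thesis by (rule trans[OF 1 trans[OF 2 trans[OF 3 4]]])
  qed
  \<comment> \<open>The equality of values is known only where no minor vanishes. One more factor of
    the product of the minors makes it hold everywhere, hence as an identity of polynomials.\<close>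
  have "(\<Prod>k<m. D k) * ((\<Prod>k<m. D k) ^ K * P - R) = 0"
  proof (rule poly_eq_0_if_eval_eq_0)
    fix \<xi>
    show "poly_eval \<xi> ((\<Prod>k<m. D k) * ((\<Prod>k<m. D k) ^ K * P - R)) = 0"
    proof (cases "\<forall>k<m. poly_eval \<xi> (D k) \<noteq> 0")
      case True
      then show ?thesis using eval[OF True] unfolding ev.subst_mult[of _ "\<Prod>k<m. D k"] ev.subst_diff by simp
    next
      case False
      then show ?thesis by (auto simp: ev.subst_mult ev.subst_prod)
    qed
  qed
  then have "(\<Prod>k<m. D k) ^ Suc K * P = (\<Prod>k<m. D k) * R"
    by (simp add: algebra_simps)
  also have "\<dots> \<in> invs" using Dm_invs[of "\<lambda>_. 1"] R by (simp add: Dm_def invs_mult)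
  finally show ?thesis by (rule invs_if_mult_invs[OF P])
qed

end

declare sum.lessThan_Suc [simp] prod.lessThan_Suc [simp]

section \<open>Freeness of the symmetric algebra over invariants\<close>

text \<open>Transport along an injective map \<open>h\<close> that respects both operations, so that
  spanning and independence can be checked with ordinary finite sums in a commutative ring.\<close>

lemma free_over_subringI:
  fixes S :: "'s ring" and h :: "'s \<Rightarrow> 'c::comm_ring_1"
  assumes S: "cring S" and T: "subring T S"
    and hm: "\<And>x y. x \<in> carrier S \<Longrightarrow> y \<in> carrier S \<Longrightarrow> h (x \<otimes>\<^bsub>S\<^esub> y) = h x * h y"
    and ha: "\<And>x y. x \<in> carrier S \<Longrightarrow> y \<in> carrier S \<Longrightarrow> h (x \<oplus>\<^bsub>S\<^esub> y) = h x + h y"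
    and inj: "inj_on h (carrier S)" and B: "B \<subseteq> h ` carrier S"
    and span: "\<And>p. p \<in> h ` carrier S \<Longrightarrow>
      \<exists>F q. finite F \<and> F \<subseteq> B \<and> (\<forall>b\<in>F. q b \<in> h ` T) \<and> p = (\<Sum>b\<in>F. q b * b)"
    and indep: "\<And>F q b. finite F \<Longrightarrow> F \<subseteq> B \<Longrightarrow> \<forall>b\<in>F. q b \<in> h ` T \<Longrightarrow>
      (\<Sum>b\<in>F. q b * b) = 0 \<Longrightarrow> b \<in> F \<Longrightarrow> q b = 0"
  shows "free_over_subring S T"
proof -
  interpret S: cring S by (rule S)
  let ?R = "S\<lparr>carrier := T\<rparr>" and ?M = "module_of_ring S"
  have T_S: "T \<subseteq> carrier S" by (rule subringE(1)[OF T])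
  have R: "cring ?R"
    using S.subcringI'[OF T] S.subcring_iff[OF T_S] by simp
  have Ms: "carrier ?M = carrier S" "add ?M = add S" "zero ?M = \<zero>\<^bsub>S\<^esub>" "smult ?M = mult S"
    by (simp_all add: module_of_ring_def)
  have TD: "t \<in> T \<Longrightarrow> t \<in> carrier S" for t using T_S by auto
  have M: "Module.module ?R ?M"
    by (rule module_criteria[OF R])
       (auto simp: Ms S.a_assoc S.a_comm S.a_lcomm S.m_assoc S.l_distr S.r_distr TD intro: S.r_neg)
  interpret M: Module.module ?R ?M by (rule M)
  have h0: "h \<zero>\<^bsub>S\<^esub> = 0" using ha[of "\<zero>\<^bsub>S\<^esub>" "\<zero>\<^bsub>S\<^esub>"] by simp
  have lc: "h (M.lincomb a A) = (\<Sum>v\<in>A. h (a v) * h v)" and lc_in: "M.lincomb a A \<in> carrier S"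
    if "finite A" "A \<subseteq> carrier S" "a \<in> A \<rightarrow> T" for a A
    using that
  proof (induction A rule: finite_induct)
    case empty
    case 1 show ?case by (simp add: M.lincomb_def Ms h0)
    case 2 show ?case by (simp add: M.lincomb_def Ms)
  next
    case (insert v A)
    have eq: "M.lincomb a (insert v A) = a v \<otimes>\<^bsub>S\<^esub> v \<oplus>\<^bsub>S\<^esub> M.lincomb a A"
      if "insert v A \<subseteq> carrier S" "a \<in> insert v A \<rightarrow> T"
      unfolding M.lincomb_def using insert.hyps that T_S
      by (subst M.finsum_insert) (auto simp: Ms Pi_def subset_iff)
    case 1
    then have "a v \<in> carrier S" "v \<in> carrier S" using T_S by auto
    then show ?case using 1 insert by (subst eq) (auto simp: ha hm)
    case 2
    then have "a v \<in> carrier S" "v \<in> carrier S" using T_S by auto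
    then show ?case using 2 insert by (subst eq) auto
  qed
  define B' where "B' = {x \<in> carrier S. h x \<in> B}"
  have B'_S: "B' \<subseteq> carrier S" by (auto simp: B'_def)
  have hB': "h ` B' = B" using B by (auto simp: B'_def)
  have injA: "inj_on h A" if "A \<subseteq> B'" for A
    using inj_on_subset[OF inj] that B'_S by blast
  have "M.lin_indpt B'"
  proof
    assume "M.lin_dep B'"
    then obtain A a v where A: "finite A" "A \<subseteq> B'" "a \<in> A \<rightarrow> T" "v \<in> A"
      and 0: "M.lincomb a A = \<zero>\<^bsub>S\<^esub>" and ne: "a v \<noteq> \<zero>\<^bsub>S\<^esub>"
      unfolding M.lin_dep_def by (auto simp: Ms)
    have A_S: "A \<subseteq> carrier S" using A B'_S by blast
    let ?q = "\<lambda>b. h (a (inv_into A h b))"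
    have "(\<Sum>b\<in>h ` A. ?q b * b) = (\<Sum>v\<in>A. h (a v) * h v)"
      by (simp add: sum.reindex[OF injA[OF A(2)]] injA[OF A(2)])
    also have "\<dots> = 0" using lc[OF A(1) A_S A(3)] 0 h0 by simp
    finally have "?q (h v) = 0"
    proof (rule indep[rotated 3])
      show "finite (h ` A)" "h ` A \<subseteq> B" "h v \<in> h ` A" using A hB' by auto
      show "\<forall>b\<in>h ` A. ?q b \<in> h ` T" using A(3) injA[OF A(2)] by auto
    qed
    then have "h (a v) = h \<zero>\<^bsub>S\<^esub>"
      by (simp only: inv_into_f_f[OF injA[OF A(2)] A(4)] h0)
    moreover have "a v \<in> carrier S" using A T_S by auto
    ultimately show False using ne inj_onD[OF inj _ _ S.zero_closed] by blast
  qed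
  moreover have "M.span B' = carrier ?M"
  proof
    show "M.span B' \<subseteq> carrier ?M"
      using B'_S by (intro M.span_is_subset2) (simp add: Ms)
    show "carrier ?M \<subseteq> M.span B'"
    proof
      fix x assume "x \<in> carrier ?M"
      then have x: "x \<in> carrier S" by (simp add: Ms)
      obtain F q where F: "finite F" "F \<subseteq> B" "\<And>b. b \<in> F \<Longrightarrow> q b \<in> h ` T" "h x = (\<Sum>b\<in>F. q b * b)"
        using span[of "h x"] x by blast
      define A where "A = {x \<in> B'. h x \<in> F}"
      have A: "A \<subseteq> B'" "h ` A = F" using hB' F(2) by (auto simp: A_def)
      have fA: "finite A" using finite_imageD[OF _ injA[OF A(1)]] A(2) F(1) by simp
      have "\<forall>b\<in>F. \<exists>t\<in>T. q b = h t" using F(3) by auto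
      then obtain t where t: "\<And>b. b \<in> F \<Longrightarrow> t b \<in> T \<and> q b = h (t b)" by metis
      define a where "a v = t (h v)" for v
      have a: "a \<in> A \<rightarrow> T" using t A by (auto simp: a_def)
      have A_S: "A \<subseteq> carrier S" using A B'_S by blast
      have "h (M.lincomb a A) = (\<Sum>v\<in>A. q (h v) * h v)"
        unfolding lc[OF fA A_S a] using t A by (intro sum.cong) (auto simp: a_def)
      also have "\<dots> = h x" unfolding F(4) A(2)[symmetric] by (simp add: sum.reindex[OF injA[OF A(1)]])
      finally have "M.lincomb a A = x" by (rule inj_onD[OF inj _ lc_in[OF fA A_S a] x])
      then show "x \<in> M.span B'" unfolding M.span_def using fA A(1) a by auto
    qed
  qed
  moreover have "B' \<subseteq> carrier ?M" using B'_S by (simp add: Ms)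
  ultimately show ?thesis
    unfolding free_over_subring_def free_module_def using M by blast
qed

section \<open>The symmetric algebra as a polynomial ring in coordinates\<close>

lemma carrier_cpoly_ring [simp]: "carrier (cpoly_ring V) = poly_on V"
  and mult_cpoly_ring [simp]: "mult (cpoly_ring V) = (*)"
  and add_cpoly_ring [simp]: "add (cpoly_ring V) = (+)"
  and one_cpoly_ring [simp]: "one (cpoly_ring V) = 1"
  and zero_cpoly_ring [simp]: "zero (cpoly_ring V) = 0"
  by (simp_all add: cpoly_ring_def poly_on_def)

lemma cring_cpoly_ring: "cring (cpoly_ring V)"
proof (intro cringI abelian_groupI comm_monoidI)
  fix p :: "'a cpoly" assume "p \<in> carrier (cpoly_ring V)"
  then show "\<exists>q\<in>carrier (cpoly_ring V). q \<oplus>\<^bsub>cpoly_ring V\<^esub> p = \<zero>\<^bsub>cpoly_ring V\<^esub>"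
    by (intro bexI[of _ "- p"]) (auto intro: poly_on_minus)
qed (auto simp: algebra_simps intro: poly_on_add poly_on_mult)

definition linear_form :: "(complex, 'v) module \<Rightarrow> ('v \<Rightarrow> complex) \<Rightarrow> bool" where
  "linear_form V \<xi> \<longleftrightarrow> (\<forall>v\<in>carrier V. \<forall>w\<in>carrier V. \<xi> (v \<oplus>\<^bsub>V\<^esub> w) = \<xi> v + \<xi> w) \<and>
     (\<forall>c. \<forall>v\<in>carrier V. \<xi> (c \<odot>\<^bsub>V\<^esub> v) = c * \<xi> v)"

text \<open>A finite basis \<open>E\<close> with coordinate functionals \<open>co\<close>. That
  \<open>E\<close> spans is expressed by the induction rule \<open>V_induct\<close>, the form in
  which it is applied.\<close>

locale based_module =
  fixes V :: "(complex, 'v) module" and E :: "'v set" and co :: "'v \<Rightarrow> 'v \<Rightarrow> complex"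
  assumes finite_E: "finite E" and E_V: "E \<subseteq> carrier V"
    and zero_V: "\<zero>\<^bsub>V\<^esub> \<in> carrier V"
    and add_V: "v \<in> carrier V \<Longrightarrow> v' \<in> carrier V \<Longrightarrow> v \<oplus>\<^bsub>V\<^esub> v' \<in> carrier V"
    and smult_V: "v \<in> carrier V \<Longrightarrow> c \<odot>\<^bsub>V\<^esub> v \<in> carrier V"
    and smult_0: "v \<in> carrier V \<Longrightarrow> 0 \<odot>\<^bsub>V\<^esub> v = \<zero>\<^bsub>V\<^esub>"
    and co_add: "v \<in> carrier V \<Longrightarrow> v' \<in> carrier V \<Longrightarrow> co (v \<oplus>\<^bsub>V\<^esub> v') e = co v e + co v' e"
    and co_smult: "v \<in> carrier V \<Longrightarrow> co (c \<odot>\<^bsub>V\<^esub> v) e = c * co v e"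
    and co_E: "e \<in> E \<Longrightarrow> e' \<in> E \<Longrightarrow> co e e' = (if e = e' then 1 else 0)"
    and V_induct: "v \<in> carrier V \<Longrightarrow> Q \<zero>\<^bsub>V\<^esub> \<Longrightarrow>
      (\<And>v e c. v \<in> carrier V \<Longrightarrow> e \<in> E \<Longrightarrow> Q v \<Longrightarrow> Q (v \<oplus>\<^bsub>V\<^esub> c \<odot>\<^bsub>V\<^esub> e)) \<Longrightarrow> Q v"
begin

abbreviation "R0 \<equiv> cpoly_ring (carrier V)"
abbreviation "I \<equiv> sym_ideal V"
abbreviation "PV \<equiv> poly_on (carrier V)"

lemmas V_ind = V_induct [consumes 1, case_names zero add]

lemma co_0: "co \<zero>\<^bsub>V\<^esub> e = 0"
  using co_smult[OF zero_V, of 0 e] smult_0[OF zero_V] by simp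

lemma linear_form_0: "linear_form V \<xi> \<Longrightarrow> \<xi> \<zero>\<^bsub>V\<^esub> = 0"
  using smult_0[OF zero_V] zero_V unfolding linear_form_def by (metis mult_zero_left)

lemma linear_form_expand:
  assumes \<xi>: "linear_form V \<xi>" and v: "v \<in> carrier V"
  shows "\<xi> v = (\<Sum>e\<in>E. co v e * \<xi> e)"
  using v
proof (induction v rule: V_ind)
  case zero then show ?case by (simp add: co_0 linear_form_0[OF \<xi>])
next
  case (add v e c)
  have "e \<in> carrier V" using add E_V by auto
  then have "\<xi> (v \<oplus>\<^bsub>V\<^esub> c \<odot>\<^bsub>V\<^esub> e) = \<xi> v + c * \<xi> e"
    using \<xi> add smult_V by (auto simp: linear_form_def)
  also have "\<dots> = (\<Sum>e'\<in>E. co v e' * \<xi> e') + (\<Sum>e'\<in>E. c * co e e' * \<xi> e')"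
  proof -
    have "(\<Sum>e'\<in>E. c * co e e' * \<xi> e') = (\<Sum>e'\<in>E. if e' = e then c * \<xi> e else 0)"
      using add by (intro sum.cong refl) (auto simp: co_E)
    then show ?thesis using add finite_E by simp
  qed
  also have "\<dots> = (\<Sum>e'\<in>E. co (v \<oplus>\<^bsub>V\<^esub> c \<odot>\<^bsub>V\<^esub> e) e' * \<xi> e')"
    unfolding sum.distrib[symmetric] using add \<open>e \<in> carrier V\<close>
    by (intro sum.cong refl) (simp add: co_add co_smult smult_V algebra_simps)
  finally show ?case .
qed

lemma linear_form_co: "linear_form V (\<lambda>v. \<Sum>e\<in>E. co v e * \<zeta> e)"
  by (auto simp: linear_form_def co_add co_smult algebra_simps sum.distrib sum_distrib_left)

lemma co_sum_E: "e \<in> E \<Longrightarrow> (\<Sum>e'\<in>E. co e e' * \<zeta> e') = \<zeta> e"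
proof -
  assume e: "e \<in> E"
  have "(\<Sum>e'\<in>E. co e e' * \<zeta> e') = (\<Sum>e'\<in>E. if e' = e then \<zeta> e else 0)"
    using e by (intro sum.cong refl) (auto simp: co_E)
  then show ?thesis using e finite_E by simp
qed

text \<open>Normal form modulo the relations: each variable is expanded in the basis. It fixes the
  polynomials in \<open>E\<close>, and its kernel on \<open>PV\<close> is the ideal
  \<open>I\<close>.\<close>

definition red :: "'v cpoly \<Rightarrow> 'v cpoly" where
  "red p = poly_subst pconst (\<lambda>v. \<Sum>e\<in>E. pconst (co v e) * pvar e) p"

lemma red_on: "p \<in> PV \<Longrightarrow> red p \<in> poly_on E"
  unfolding red_def by (erule poly_on_subst) (auto intro!: poly_on_sum poly_on_mult)

lemma red_pvar: "red (pvar v) = (\<Sum>e\<in>E. pconst (co v e) * pvar e)"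
  by (simp add: red_def)

lemma red_id: assumes "p \<in> poly_on E" shows "red p = p"
proof -
  have "red p = poly_subst pconst pvar p"
    unfolding red_def
  proof (rule ps.subst_cong[OF assms])
    fix e assume e: "e \<in> E"
    have "(\<Sum>e'\<in>E. pconst (co e e') * pvar e') = (\<Sum>e'\<in>E. if e' = e then pvar e else 0)"
      using e by (intro sum.cong refl) (auto simp: co_E)
    then show "(\<Sum>e'\<in>E. pconst (co e e') * pvar e') = pvar e" using e finite_E by simp
  qed
  then show ?thesis by simp
qed

lemma eval_red:
  assumes "linear_form V \<xi>" "p \<in> PV"
  shows "poly_eval \<xi> (red p) = poly_eval \<xi> p"
proof -
  have "poly_eval \<xi> (red p) = poly_eval (\<lambda>v. \<Sum>e\<in>E. co v e * \<xi> e) p"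
    by (simp add: red_def ev.subst_subst ev.subst_sum ev.subst_mult)
  also have "\<dots> = poly_eval \<xi> p"
    by (rule ev.subst_cong[OF assms(2)]) (simp add: linear_form_expand[OF assms(1), symmetric])
  finally show ?thesis .
qed

text \<open>Any assignment of values to \<open>E\<close> extends to a linear form, and the normal
  form involves only \<open>E\<close>; so linear forms separate normal forms.\<close>

lemma red_eqI:
  assumes "p \<in> PV" "q \<in> PV" "\<And>\<xi>. linear_form V \<xi> \<Longrightarrow> poly_eval \<xi> p = poly_eval \<xi> q"
  shows "red p = red q"
proof (rule poly_eqI_eval)
  fix \<zeta>
  define \<xi> where "\<xi> v = (\<Sum>e\<in>E. co v e * \<zeta> e)" for v
  have \<xi>: "linear_form V \<xi>" unfolding \<xi>_def by (rule linear_form_co)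
  have "poly_eval \<zeta> (red r) = poly_eval \<xi> r" if "r \<in> PV" for r
    using ev.subst_cong[OF red_on[OF that], of \<zeta> \<xi>] eval_red[OF \<xi> that]
    by (simp add: \<xi>_def co_sum_E)
  then show "poly_eval \<zeta> (red p) = poly_eval \<zeta> (red q)" using assms \<xi> by simp
qed

lemma rel_subset: "sym_relations V \<subseteq> PV"
  unfolding sym_relations_def
  by (auto intro!: poly_on_diff poly_on_add poly_on_mult poly_on_pvar poly_on_pconst add_V smult_V)

lemma ideal_I: "ideal I R0"
  unfolding sym_ideal_def using cring.axioms(1)[OF cring_cpoly_ring] rel_subset
  by (intro ring.genideal_ideal) auto

lemma rel_I: "sym_relations V \<subseteq> I"
  unfolding sym_ideal_def using cring.axioms(1)[OF cring_cpoly_ring] rel_subset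
  by (intro ring.genideal_self) auto

lemma I_PV: "I \<subseteq> PV"
  using ideal.Icarr[OF ideal_I] by auto

lemma I_add: "p \<in> I \<Longrightarrow> q \<in> I \<Longrightarrow> p + q \<in> I"
  using additive_subgroup.a_closed[OF ideal.axioms(1)[OF ideal_I]] by simp

lemma I_0: "0 \<in> I"
  using additive_subgroup.zero_closed[OF ideal.axioms(1)[OF ideal_I]] by simp

lemma I_mult: "p \<in> I \<Longrightarrow> q \<in> PV \<Longrightarrow> p * q \<in> I"
  using ideal.I_r_closed[OF ideal_I] by simp

lemma pvar_zero_I: "pvar \<zero>\<^bsub>V\<^esub> \<in> I"
proof -
  have "pvar (0 \<odot>\<^bsub>V\<^esub> \<zero>\<^bsub>V\<^esub>) - pconst 0 * pvar \<zero>\<^bsub>V\<^esub> \<in> sym_relations V"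
    using zero_V unfolding sym_relations_def by blast
  then show ?thesis using rel_I smult_0[OF zero_V] by auto
qed

lemma pvar_red_I: "v \<in> carrier V \<Longrightarrow> pvar v - red (pvar v) \<in> I"
proof (induction v rule: V_ind)
  case zero
  show ?case by (simp add: red_pvar co_0 pvar_zero_I)
next
  case (add v e c)
  have e: "e \<in> carrier V" using add E_V by auto
  have ce: "c \<odot>\<^bsub>V\<^esub> e \<in> carrier V" using e smult_V by blast
  have 1: "pvar (v \<oplus>\<^bsub>V\<^esub> c \<odot>\<^bsub>V\<^esub> e) - (pvar v + pvar (c \<odot>\<^bsub>V\<^esub> e)) \<in> I"
    using add ce rel_I unfolding sym_relations_def by blast
  have 2: "pvar (c \<odot>\<^bsub>V\<^esub> e) - pconst c * pvar e \<in> I"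
    using e rel_I unfolding sym_relations_def by blast
  have "(\<Sum>e'\<in>E. pconst (co e e') * pvar e') = pvar e"
    using red_id[of "pvar e"] add by (simp add: red_pvar)
  then have "red (pvar (v \<oplus>\<^bsub>V\<^esub> c \<odot>\<^bsub>V\<^esub> e)) = red (pvar v) + pconst c * pvar e"
    unfolding red_pvar using add e ce
    by (simp add: co_add co_smult pconst_add pconst_mult distrib_right sum.distrib
        sum_distrib_left[symmetric] mult.assoc)
  then have eq: "pvar (v \<oplus>\<^bsub>V\<^esub> c \<odot>\<^bsub>V\<^esub> e) - red (pvar (v \<oplus>\<^bsub>V\<^esub> c \<odot>\<^bsub>V\<^esub> e))
    = (pvar (v \<oplus>\<^bsub>V\<^esub> c \<odot>\<^bsub>V\<^esub> e) - (pvar v + pvar (c \<odot>\<^bsub>V\<^esub> e)))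
      + (pvar (c \<odot>\<^bsub>V\<^esub> e) - pconst c * pvar e) + (pvar v - red (pvar v))"
    by simp
  show ?case unfolding eq by (intro I_add 1 2 add)
qed

lemma diff_red_I: "p \<in> PV \<Longrightarrow> p - red p \<in> I"
proof (induction p rule: poly_on_induct)
  case (const c)
  then show ?case by (simp add: red_def I_0)
next
  case (var v)
  then show ?case by (rule pvar_red_I)
next
  case (add p q)
  have eq: "p + q - red (p + q) = (p - red p) + (q - red q)"
    by (simp add: red_def ps.subst_add)
  show ?case unfolding eq using add by (intro I_add)
next
  case (mult p q)
  have eq: "p * q - red (p * q) = (p - red p) * q + (q - red q) * red p"
    by (simp add: red_def ps.subst_mult algebra_simps)
  have "red p \<in> PV" using red_on[OF mult(1)] poly_on_mono[OF E_V] by blast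
  then show ?case unfolding eq using mult by (intro I_add I_mult)
qed

text \<open>The kernel of \<open>red\<close> is an ideal, and it contains the generating relations
  because these vanish at every linear form.\<close>

lemma red_I: assumes "p \<in> I" shows "red p = 0"
proof -
  have "red p = red 0" if "p \<in> sym_relations V" for p
    using that unfolding sym_relations_def
    by (intro red_eqI) (auto intro!: poly_on_diff poly_on_add poly_on_mult poly_on_pvar poly_on_pconst add_V smult_V
        simp: ev.subst_diff ev.subst_add ev.subst_mult linear_form_def)
  then have rel: "sym_relations V \<subseteq> {p \<in> PV. red p = 0}" using rel_subset by (auto simp: red_def)
  interpret R0: cring R0 by (rule cring_cpoly_ring)
  have "ideal {p \<in> PV. red p = 0} R0"
  proof (rule idealI)
    show "subgroup {p \<in> PV. red p = 0} (add_monoid R0)"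
    proof (rule R0.add.subgroupI)
      show "{p \<in> PV. red p = 0} \<subseteq> carrier R0" by auto
      have "0 \<in> {p \<in> PV. red p = 0}" by (simp add: red_def)
      then show "{p \<in> PV. red p = 0} \<noteq> {}" by blast
      fix a assume a: "a \<in> {p \<in> PV. red p = 0}"
      have "\<ominus>\<^bsub>R0\<^esub> a = - a" using a
        by (intro R0.minus_equality) (auto intro: poly_on_minus)
      then show "\<ominus>\<^bsub>R0\<^esub> a \<in> {p \<in> PV. red p = 0}"
        using a by (auto simp: red_def ps.subst_minus intro: poly_on_minus)
      fix b assume b: "b \<in> {p \<in> PV. red p = 0}"
      have "a + b \<in> {p \<in> PV. red p = 0}"
        using a b by (auto simp: red_def ps.subst_add intro: poly_on_add)
      then show "a \<oplus>\<^bsub>R0\<^esub> b \<in> {p \<in> PV. red p = 0}" by simp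
    qed
  qed (auto simp: red_def ps.subst_mult R0.ring_axioms intro: poly_on_mult)
  then have "I \<subseteq> {p \<in> PV. red p = 0}"
    unfolding sym_ideal_def by (rule R0.genideal_minimal) (rule rel)
  then show ?thesis using assms by auto
qed

lemma coset: "I +>\<^bsub>R0\<^esub> p = {i + p | i. i \<in> I}"
  by (auto simp: a_r_coset_def')

lemma coset_eq_iff:
  assumes "p \<in> PV" "q \<in> PV"
  shows "I +>\<^bsub>R0\<^esub> p = I +>\<^bsub>R0\<^esub> q \<longleftrightarrow> red p = red q"
proof
  assume "I +>\<^bsub>R0\<^esub> p = I +>\<^bsub>R0\<^esub> q"
  moreover have "p \<in> I +>\<^bsub>R0\<^esub> p" using I_0 by (force simp: coset)
  ultimately obtain i where "i \<in> I" "p = i + q" by (auto simp: coset)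
  then show "red p = red q" by (simp add: red_def ps.subst_add red_I[unfolded red_def])
next
  assume eq: "red p = red q"
  have neg: "- i \<in> I" if "i \<in> I" for i
    using I_mult[OF that, of "- 1"] by (simp add: poly_on_minus)
  have d: "p - q \<in> I"
    using I_add[OF diff_red_I[OF assms(1)] neg[OF diff_red_I[OF assms(2)]]] eq by simp
  show "I +>\<^bsub>R0\<^esub> p = I +>\<^bsub>R0\<^esub> q"
  proof (intro equalityI subsetI)
    fix x assume "x \<in> I +>\<^bsub>R0\<^esub> p"
    then obtain i where "i \<in> I" "x = i + p" by (auto simp: coset)
    then show "x \<in> I +>\<^bsub>R0\<^esub> q"
      unfolding coset using I_add[OF _ d, of i] by (auto intro!: exI[of _ "i + (p - q)"])
  next
    fix x assume "x \<in> I +>\<^bsub>R0\<^esub> q"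
    then obtain i where "i \<in> I" "x = i + q" by (auto simp: coset)
    then show "x \<in> I +>\<^bsub>R0\<^esub> p"
      unfolding coset using I_add[OF _ neg[OF d], of i] by (auto intro!: exI[of _ "i + (q - p)"])
  qed
qed

text \<open>The identification of the symmetric algebra with the polynomials in \<open>E\<close>.
  The choice of a representative is harmless, as \<open>red\<close> is constant on cosets.\<close>

definition h :: "'v cpoly set \<Rightarrow> 'v cpoly" where
  "h s = red (SOME p. p \<in> s)"

lemma red_coset: "p \<in> PV \<Longrightarrow> q \<in> I +>\<^bsub>R0\<^esub> p \<Longrightarrow> red q = red p \<and> q \<in> PV"
  using red_I I_PV by (auto simp: coset red_def ps.subst_add intro: poly_on_add)

lemma h_coset: "p \<in> PV \<Longrightarrow> h (I +>\<^bsub>R0\<^esub> p) = red p"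
proof -
  assume p: "p \<in> PV"
  have "p \<in> I +>\<^bsub>R0\<^esub> p" using I_0 by (force simp: coset)
  then have "(SOME q. q \<in> I +>\<^bsub>R0\<^esub> p) \<in> I +>\<^bsub>R0\<^esub> p" by (rule someI)
  then show ?thesis unfolding h_def using red_coset[OF p] by blast
qed

lemma carrier_sym_alg: "carrier (sym_alg V) = (\<lambda>p. I +>\<^bsub>R0\<^esub> p) ` PV"
  by (auto simp: sym_alg_def FactRing_def A_RCOSETS_def' )

lemma mult_sym_alg: "p \<in> PV \<Longrightarrow> q \<in> PV \<Longrightarrow>
    (I +>\<^bsub>R0\<^esub> p) \<otimes>\<^bsub>sym_alg V\<^esub> (I +>\<^bsub>R0\<^esub> q) = I +>\<^bsub>R0\<^esub> (p * q)"
  using ideal.rcoset_mult_add[OF ideal_I] by (simp add: sym_alg_def FactRing_def)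

lemma add_sym_alg: "p \<in> PV \<Longrightarrow> q \<in> PV \<Longrightarrow>
    (I +>\<^bsub>R0\<^esub> p) \<oplus>\<^bsub>sym_alg V\<^esub> (I +>\<^bsub>R0\<^esub> q) = I +>\<^bsub>R0\<^esub> (p + q)"
  using abelian_subgroup.a_rcos_sum[OF abelian_subgroupI3[OF ideal.axioms(1)[OF ideal_I]
      ring.is_abelian_group[OF cring.axioms(1)[OF cring_cpoly_ring]]]]
  by (simp add: sym_alg_def FactRing_def)

lemma cring_sym_alg: "cring (sym_alg V)"
  unfolding sym_alg_def by (rule ideal.quotient_is_cring[OF ideal_I cring_cpoly_ring])

lemma h_mult: "x \<in> carrier (sym_alg V) \<Longrightarrow> y \<in> carrier (sym_alg V) \<Longrightarrow>
    h (x \<otimes>\<^bsub>sym_alg V\<^esub> y) = h x * h y"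
  by (auto simp: carrier_sym_alg mult_sym_alg h_coset poly_on_mult)
     (simp add: red_def ps.subst_mult)

lemma h_add: "x \<in> carrier (sym_alg V) \<Longrightarrow> y \<in> carrier (sym_alg V) \<Longrightarrow>
    h (x \<oplus>\<^bsub>sym_alg V\<^esub> y) = h x + h y"
  by (auto simp: carrier_sym_alg add_sym_alg h_coset poly_on_add)
     (simp add: red_def ps.subst_add)

lemma h_inj: "inj_on h (carrier (sym_alg V))"
  by (auto simp: inj_on_def carrier_sym_alg h_coset coset_eq_iff)

lemma PE_PV: "p \<in> poly_on E \<Longrightarrow> p \<in> PV"
  using poly_on_mono[OF E_V] by blast

lemma h_image: "h ` carrier (sym_alg V) = poly_on E"
proof
  show "h ` carrier (sym_alg V) \<subseteq> poly_on E" by (auto simp: carrier_sym_alg h_coset red_on)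
  show "poly_on E \<subseteq> h ` carrier (sym_alg V)"
  proof
    fix p assume "p \<in> poly_on E"
    then have "p = h (I +>\<^bsub>R0\<^esub> p)" "p \<in> PV" using PE_PV[of p] by (simp_all add: h_coset red_id)
    then show "p \<in> h ` carrier (sym_alg V)" by (auto simp: carrier_sym_alg)
  qed
qed

lemma linear_form_comp:
  assumes "linear_form V \<xi>" "\<And>v. v \<in> carrier V \<Longrightarrow> f v \<in> carrier V"
    and "\<And>v w. v \<in> carrier V \<Longrightarrow> w \<in> carrier V \<Longrightarrow> f (v \<oplus>\<^bsub>V\<^esub> w) = f v \<oplus>\<^bsub>V\<^esub> f w"
    and "\<And>c v. v \<in> carrier V \<Longrightarrow> f (c \<odot>\<^bsub>V\<^esub> v) = c \<odot>\<^bsub>V\<^esub> f v"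
  shows "linear_form V (\<lambda>v. \<xi> (f v))"
  using assms by (simp add: linear_form_def)

text \<open>Substituting \<open>f\<close> and then evaluating at \<open>\<xi>\<close> is evaluation
  at \<open>\<xi>\<close> composed with \<open>f\<close>. Hence all representatives of a coset have
  images in one coset, the union in \<open>sym_map\<close> is that coset, and being fixed is a
  condition on values at linear forms.\<close>

lemma sym_map_fixed_iff:
  assumes f: "\<And>v. v \<in> carrier V \<Longrightarrow> f v \<in> carrier V"
    and fl: "\<And>\<xi>. linear_form V \<xi> \<Longrightarrow> linear_form V (\<lambda>v. \<xi> (f v))"
    and p: "p \<in> PV"
  shows "sym_map V f (I +>\<^bsub>R0\<^esub> p) = I +>\<^bsub>R0\<^esub> p \<longleftrightarrow>
    (\<forall>\<xi>. linear_form V \<xi> \<longrightarrow> poly_eval (\<lambda>v. \<xi> (f v)) (red p) = poly_eval \<xi> (red p))"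
proof -
  have on: "pvar_subst f q \<in> PV" if "q \<in> PV" for q
    unfolding pvar_subst_eq using that by (rule poly_on_subst) (intro poly_on_pvar f)
  have ev: "poly_eval \<xi> (pvar_subst f q) = poly_eval (\<lambda>v. \<xi> (f v)) q" for \<xi> q
    unfolding pvar_subst_eq ev.subst_subst by simp
  have "red (pvar_subst f q) = red (pvar_subst f p)" if "q \<in> I +>\<^bsub>R0\<^esub> p" for q
  proof (rule red_eqI)
    fix \<xi> assume \<xi>: "linear_form V \<xi>"
    have "poly_eval (\<lambda>v. \<xi> (f v)) (red r) = poly_eval (\<lambda>v. \<xi> (f v)) r" if "r \<in> PV" for r
      by (rule eval_red[OF fl[OF \<xi>] that])
    from this[of p] this[of q] show "poly_eval \<xi> (pvar_subst f q) = poly_eval \<xi> (pvar_subst f p)"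
      using red_coset[OF p that] p by (simp add: ev)
  qed (rule on, rule conjunct2[OF red_coset[OF p that]], rule on, rule p)
  then have "I +>\<^bsub>R0\<^esub> pvar_subst f q = I +>\<^bsub>R0\<^esub> pvar_subst f p" if "q \<in> I +>\<^bsub>R0\<^esub> p" for q
    using that red_coset[OF p that] p on by (simp add: coset_eq_iff)
  moreover have "p \<in> I +>\<^bsub>R0\<^esub> p" using I_0 by (force simp: coset)
  ultimately have "sym_map V f (I +>\<^bsub>R0\<^esub> p) = I +>\<^bsub>R0\<^esub> pvar_subst f p"
    unfolding sym_map_def by blast
  then have "sym_map V f (I +>\<^bsub>R0\<^esub> p) = I +>\<^bsub>R0\<^esub> p \<longleftrightarrow> red (pvar_subst f p) = red p"
    using p on by (simp add: coset_eq_iff)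
  also have "\<dots> \<longleftrightarrow> (\<forall>\<xi>. linear_form V \<xi> \<longrightarrow> poly_eval \<xi> (pvar_subst f p) = poly_eval \<xi> p)"
  proof (intro iffI allI impI)
    fix \<xi> assume "red (pvar_subst f p) = red p" "linear_form V \<xi>"
    then show "poly_eval \<xi> (pvar_subst f p) = poly_eval \<xi> p"
      using eval_red[of \<xi> "pvar_subst f p"] eval_red[of \<xi> p] on[OF p] p by simp
  next
    assume "\<forall>\<xi>. linear_form V \<xi> \<longrightarrow> poly_eval \<xi> (pvar_subst f p) = poly_eval \<xi> p"
    then show "red (pvar_subst f p) = red p" using red_eqI[OF on[OF p] p] by blast
  qed
  also have "\<dots> \<longleftrightarrow> (\<forall>\<xi>. linear_form V \<xi> \<longrightarrow>
      poly_eval (\<lambda>v. \<xi> (f v)) (red p) = poly_eval \<xi> (red p))"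
  proof -
    have "poly_eval (\<lambda>v. \<xi> (f v)) (red p) = poly_eval \<xi> (pvar_subst f p)"
      "poly_eval \<xi> (red p) = poly_eval \<xi> p" if "linear_form V \<xi>" for \<xi>
      using eval_red[OF fl[OF that] p] eval_red[OF that p] by (simp_all only: ev)
    then show ?thesis by metis
  qed
  finally show ?thesis .
qed

end

text \<open>The interface to the Lie theory. The last two assumptions say that the minors are
  constant along the action and that a form with nonzero minors can be moved to the diagonal slice.
  A list of elements does the moving, so that \<open>G\<close> need not be known to be closed under
  products.\<close>

locale minors_action = based_module V E co + minors E m X
  for V :: "(complex, 'v) module" and E co m X +
  fixes act :: "'g \<Rightarrow> 'v \<Rightarrow> 'v" and G :: "'g set"
  assumes act_V: "g \<in> G \<Longrightarrow> v \<in> carrier V \<Longrightarrow> act g v \<in> carrier V"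
    and act_add: "g \<in> G \<Longrightarrow> v \<in> carrier V \<Longrightarrow> v' \<in> carrier V \<Longrightarrow>
      act g (v \<oplus>\<^bsub>V\<^esub> v') = act g v \<oplus>\<^bsub>V\<^esub> act g v'"
    and act_smult: "g \<in> G \<Longrightarrow> v \<in> carrier V \<Longrightarrow> act g (c \<odot>\<^bsub>V\<^esub> v) = c \<odot>\<^bsub>V\<^esub> act g v"
    and minors_invariant: "g \<in> G \<Longrightarrow> linear_form V \<xi> \<Longrightarrow> k < m \<Longrightarrow>
      det (lmat (Suc k) (\<lambda>i j. \<xi> (act g (X i j)))) = det (lmat (Suc k) (\<lambda>i j. \<xi> (X i j)))"
    and diagonalizable: "linear_form V \<xi> \<Longrightarrow>
      (\<And>k. k < m \<Longrightarrow> det (lmat (Suc k) (\<lambda>i j. \<xi> (X i j))) \<noteq> 0) \<Longrightarrow>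
      \<exists>gs. set gs \<subseteq> G \<and> (\<forall>e\<in>E - {X i i | i. i < m}. \<xi> (foldr act gs e) = 0)"
begin

lemma linear_form_act: "g \<in> G \<Longrightarrow> linear_form V \<xi> \<Longrightarrow> linear_form V (\<lambda>v. \<xi> (act g v))"
  by (rule linear_form_comp) (auto simp: act_V act_add act_smult)

lemma invariant_foldr:
  assumes inv: "\<And>g \<xi>. g \<in> G \<Longrightarrow> linear_form V \<xi> \<Longrightarrow> poly_eval (\<lambda>v. \<xi> (act g v)) p = poly_eval \<xi> p"
    and "set gs \<subseteq> G" "linear_form V \<xi>"
  shows "poly_eval (\<lambda>v. \<xi> (foldr act gs v)) p = poly_eval \<xi> p"
  using assms(2,3)
proof (induction gs arbitrary: \<xi>)
  case (Cons g gs)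
  then have "poly_eval (\<lambda>v. (\<lambda>v. \<xi> (act g v)) (foldr act gs v)) p = poly_eval (\<lambda>v. \<xi> (act g v)) p"
    using linear_form_act[of g \<xi>] by (intro Cons.IH) auto
  then show ?case using Cons.prems inv[of g \<xi>] by simp
qed simp

lemma D_invariant:
  "g \<in> G \<Longrightarrow> linear_form V \<xi> \<Longrightarrow> k < m \<Longrightarrow> poly_eval (\<lambda>v. \<xi> (act g v)) (D k) = poly_eval \<xi> (D k)"
  by (simp add: eval_D minors_invariant)

lemma coset_invariant_iff:
  assumes "p \<in> PV"
  shows "I +>\<^bsub>R0\<^esub> p \<in> sym_invariants V act G \<longleftrightarrow> red p \<in> invs"
proof -
  have iff: "I +>\<^bsub>R0\<^esub> p \<in> sym_invariants V act G \<longleftrightarrow> (\<forall>g\<in>G. \<forall>\<xi>. linear_form V \<xi> \<longrightarrow>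
      poly_eval (\<lambda>v. \<xi> (act g v)) (red p) = poly_eval \<xi> (red p))"
  proof -
    have "sym_map V (act g) (I +>\<^bsub>R0\<^esub> p) = I +>\<^bsub>R0\<^esub> p \<longleftrightarrow> (\<forall>\<xi>. linear_form V \<xi> \<longrightarrow>
        poly_eval (\<lambda>v. \<xi> (act g v)) (red p) = poly_eval \<xi> (red p))" if "g \<in> G" for g
      by (rule sym_map_fixed_iff[of "act g", OF act_V[OF that] linear_form_act[OF that] assms])
    then show ?thesis using assms by (auto simp: sym_invariants_def carrier_sym_alg)
  qed
  show ?thesis
  proof
    assume inv: "I +>\<^bsub>R0\<^esub> p \<in> sym_invariants V act G"
    show "red p \<in> invs"
    proof (rule invs_if_diagonal[OF red_on[OF assms]])
      fix \<zeta> assume nz: "\<forall>k<m. poly_eval \<zeta> (D k) \<noteq> 0"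
      \<comment> \<open>The assignment \<open>\<zeta>\<close> is arbitrary, while the action is
        controlled on linear forms only; \<open>\<xi>\<close> is the linear form that agrees with it
        on \<open>E\<close>.\<close>
      define \<xi> where "\<xi> v = (\<Sum>e\<in>E. co v e * \<zeta> e)" for v
      have \<xi>: "linear_form V \<xi>" unfolding \<xi>_def by (rule linear_form_co)
      have eq: "poly_eval \<xi> q = poly_eval \<zeta> q" if "q \<in> poly_on E" for q
        by (rule ev.subst_cong[OF that]) (simp add: \<xi>_def co_sum_E)
      have nz': "k < m \<Longrightarrow> det (lmat (Suc k) (\<lambda>i j. \<xi> (X i j))) \<noteq> 0" for k
        using nz eq[OF D_poly_on] by (simp add: eval_D)
      obtain gs where gs: "set gs \<subseteq> G" "\<forall>e\<in>E - {X i i | i. i < m}. \<xi> (foldr act gs e) = 0"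
        using diagonalizable[OF \<xi> nz'] by blast
      have "poly_eval (\<lambda>v. \<xi> (foldr act gs v)) (red p) = poly_eval \<xi> (red p)"
        using invariant_foldr[OF _ gs(1) \<xi>] inv iff by blast
      moreover have "poly_eval (\<lambda>v. \<xi> (foldr act gs v)) (D k) = poly_eval \<xi> (D k)" if "k < m" for k
        using invariant_foldr[OF _ gs(1) \<xi>] D_invariant that by blast
      ultimately show "\<exists>\<zeta>'. poly_eval \<zeta> (red p) = poly_eval \<zeta>' (red p) \<and>
          (\<forall>k<m. poly_eval \<zeta>' (D k) = poly_eval \<zeta> (D k)) \<and> (\<forall>v\<in>E - {X i i |i. i < m}. \<zeta>' v = 0)"
        using gs(2) eq[OF red_on[OF assms]] eq[OF D_poly_on]
        by (intro exI[of _ "\<lambda>v. \<xi> (foldr act gs v)"]) simp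
    qed
  next
    assume "red p \<in> invs"
    then obtain Q where Q: "Q \<in> poly_on {..<m}" "red p = poly_subst pconst D Q"
      by (auto simp: invs_def)
    show "I +>\<^bsub>R0\<^esub> p \<in> sym_invariants V act G"
      unfolding iff Q(2) ev.subst_subst
      using D_invariant by (intro ballI allI impI ev.subst_cong[OF Q(1)]) simp
  qed
qed

lemma invs_1: "1 \<in> invs"
  using invs_pconst[of 1] by simp

text \<open>The standard monomials are the basis: \<open>h\<close> carries the invariants onto
  \<open>invs\<close>, where spanning and independence are already known.\<close>

theorem free_over_invariants: "free_over_subring (sym_alg V) (sym_invariants V act G)"
proof -
  let ?T = "sym_invariants V act G"
  have T_S: "?T \<subseteq> carrier (sym_alg V)" by (auto simp: sym_invariants_def)
  have T_iff: "s \<in> ?T \<longleftrightarrow> h s \<in> invs" if s: "s \<in> carrier (sym_alg V)" for s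
    using s coset_invariant_iff by (auto simp: carrier_sym_alg h_coset)
  have hT: "h ` ?T = invs"
  proof
    show "h ` ?T \<subseteq> invs" using T_iff T_S by blast
    show "invs \<subseteq> h ` ?T"
    proof
      fix q assume "q \<in> invs"
      then obtain s where "s \<in> carrier (sym_alg V)" "q = h s"
        using invs_poly_on unfolding h_image[symmetric] by blast
      then show "q \<in> h ` ?T" using T_iff[of s] \<open>q \<in> invs\<close> by auto
    qed
  qed
  interpret S: cring "sym_alg V" by (rule cring_sym_alg)
  have h0: "h \<zero>\<^bsub>sym_alg V\<^esub> = 0"
    using h_add[of "\<zero>\<^bsub>sym_alg V\<^esub>" "\<zero>\<^bsub>sym_alg V\<^esub>"] by simp
  have h1: "h \<one>\<^bsub>sym_alg V\<^esub> = 1"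
  proof -
    have "\<one>\<^bsub>sym_alg V\<^esub> = I +>\<^bsub>R0\<^esub> 1" by (simp add: sym_alg_def FactRing_def)
    then show ?thesis by (simp add: h_coset red_def)
  qed
  have T: "subring ?T (sym_alg V)"
  proof (rule S.subringI[OF T_S])
    show "\<one>\<^bsub>sym_alg V\<^esub> \<in> ?T" by (simp add: T_iff h1 invs_1)
    fix x assume x: "x \<in> ?T"
    then have "x \<in> carrier (sym_alg V)" using T_S by auto
    then have "h (\<ominus>\<^bsub>sym_alg V\<^esub> x) = - h x"
      using h_add[of x "\<ominus>\<^bsub>sym_alg V\<^esub> x"] by (simp add: h0 S.r_neg add_eq_0_iff)
    then show "\<ominus>\<^bsub>sym_alg V\<^esub> x \<in> ?T"
      using x T_S T_iff by (auto simp: subset_iff invs_minus)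
    fix y assume y: "y \<in> ?T"
    have xy: "x \<in> carrier (sym_alg V)" "y \<in> carrier (sym_alg V)" using x y T_S by auto
    have "h x \<in> invs" "h y \<in> invs" using x y xy T_iff by auto
    then show "x \<otimes>\<^bsub>sym_alg V\<^esub> y \<in> ?T" "x \<oplus>\<^bsub>sym_alg V\<^esub> y \<in> ?T"
      using xy T_iff by (simp_all add: h_mult h_add invs_mult invs_add)
  qed
  let ?b = "\<lambda>s. Poly_Mapping.single s (1::complex)"
  have inj_b: "inj_on ?b F" for F :: "('v \<Rightarrow>\<^sub>0 nat) set"
    by (rule inj_onI) (metis lookup_single_eq lookup_single_not_eq zero_neq_one)
  show ?thesis
  proof (rule free_over_subringI[OF cring_sym_alg T h_mult h_add h_inj, of "?b ` std"])
    show "?b ` std \<subseteq> h ` carrier (sym_alg V)"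
      unfolding h_image by (auto simp: std_def intro!: poly_on_single)
  next
    fix p assume "p \<in> h ` carrier (sym_alg V)"
    then obtain F q where F: "finite F" "F \<subseteq> std" "\<forall>s\<in>F. q s \<in> invs" "p = (\<Sum>s\<in>F. q s * ?b s)"
      unfolding h_image using std_spanning by blast
    show "\<exists>F q. finite F \<and> F \<subseteq> ?b ` std \<and> (\<forall>b\<in>F. q b \<in> h ` ?T) \<and> p = (\<Sum>b\<in>F. q b * b)"
      unfolding hT using F inv_into_f_f[OF inj_b[of F]]
      by (intro exI[of _ "?b ` F"] exI[of _ "\<lambda>b. q (inv_into F ?b b)"])
         (auto simp: sum.reindex[OF inj_b] simp del: inv_into_f_f intro!: sum.cong)
  next
    fix F q b
    assume F: "finite F" "F \<subseteq> ?b ` std" "\<forall>b\<in>F. q b \<in> h ` ?T" "(\<Sum>b\<in>F. q b * b) = 0" "b \<in> F"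
    define F' where "F' = {s \<in> std. ?b s \<in> F}"
    have F': "F = ?b ` F'" "F' \<subseteq> std" using F(2) by (auto simp: F'_def)
    have fin: "finite F'" using finite_imageD[OF _ inj_b] F(1) F'(1) by blast
    have "\<forall>s\<in>F'. \<exists>Q. Q \<in> poly_on {..<m} \<and> q (?b s) = poly_subst pconst D Q"
      using F(3) unfolding hT F'(1) invs_def by blast
    then obtain Q where Q: "\<And>s. s \<in> F' \<Longrightarrow> Q s \<in> poly_on {..<m}"
      "\<And>s. s \<in> F' \<Longrightarrow> q (?b s) = poly_subst pconst D (Q s)" by metis
    obtain s where s: "s \<in> F'" "b = ?b s" using F(5) F'(1) by auto
    have "(\<Sum>s\<in>F'. poly_subst pconst D (Q s) * ?b s) = (\<Sum>b\<in>F. q b * b)"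
      unfolding F'(1) by (subst sum.reindex[OF inj_b]) (simp add: Q(2))
    then have "Q s = 0" using std_independent[OF fin F'(2) Q(1) _ s(1)] F(4) by simp
    then show "q b = 0" using Q(2)[OF s(1)] s(2) by simp
  qed
qed

end

section \<open>Lie's theorem\<close>

definition mat_subspace :: "nat \<Rightarrow> complex mat set \<Rightarrow> bool" where
  "mat_subspace N W \<longleftrightarrow> W \<subseteq> carrier_mat N N \<and> 0\<^sub>m N N \<in> W \<and>
     (\<forall>x\<in>W. \<forall>y\<in>W. x + y \<in> W) \<and> (\<forall>c. \<forall>x\<in>W. c \<cdot>\<^sub>m x \<in> W)"

lemma gl_space_simps:
  "carrier (gl_space N) = carrier_mat N N" "zero (gl_space N) = 0\<^sub>m N N"
  "add (gl_space N) = (+)" "module.smult (gl_space N) = (\<cdot>\<^sub>m)"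
  by (simp_all add: module_mat_def)

lemma gl_module: "Module.module class_ring (gl_space N)"
  using matrix_vs vectorspace.axioms(1) by blast

lemma submodule_iff: "submodule class_ring W (gl_space N) \<longleftrightarrow> mat_subspace N W"
  using gl_module[of N] unfolding submodule_def mat_subspace_def gl_space_simps by auto

lemma subspace_iff: "VectorSpace.subspace class_ring W (gl_space N) \<longleftrightarrow> mat_subspace N W"
  unfolding VectorSpace.subspace_def submodule_iff using matrix_vs by blast

lemma mat_subspace_lin_span: "X \<subseteq> carrier_mat N N \<Longrightarrow> mat_subspace N (lin_span N X)"
  unfolding lin_span_def submodule_iff[symmetric]
  by (rule module.span_is_submodule[OF gl_module]) (simp add: gl_space_simps)

lemma lin_span_superset: "X \<subseteq> carrier_mat N N \<Longrightarrow> X \<subseteq> lin_span N X"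
  unfolding lin_span_def by (rule module.in_own_span[OF gl_module]) (simp add: gl_space_simps)

lemma lin_span_least: "X \<subseteq> W \<Longrightarrow> mat_subspace N W \<Longrightarrow> lin_span N X \<subseteq> W"
  unfolding lin_span_def submodule_iff[symmetric] by (rule module.span_is_subset[OF gl_module])

lemma mat_subspaceD:
  assumes "mat_subspace N W"
  shows "x \<in> W \<Longrightarrow> x \<in> carrier_mat N N" "0\<^sub>m N N \<in> W"
    "x \<in> W \<Longrightarrow> y \<in> W \<Longrightarrow> x + y \<in> W" "x \<in> W \<Longrightarrow> c \<cdot>\<^sub>m x \<in> W"
  using assms by (auto simp: mat_subspace_def)

lemma mat_subspace_minus:
  assumes "mat_subspace N W" "x \<in> W" "y \<in> W" shows "x - y \<in> W"
proof -
  have "x - y = x + (-1) \<cdot>\<^sub>m y" using mat_subspaceD(1)[OF assms(1)] assms(2,3)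
    by (intro eq_matI) (auto dest!: carrier_matD)
  then show ?thesis using assms mat_subspaceD by metis
qed

lemma lie_subalgebra_iff:
  "lie_subalgebra N L \<longleftrightarrow> mat_subspace N L \<and> (\<forall>x\<in>L. \<forall>y\<in>L. x * y - y * x \<in> L)"
  by (simp add: lie_subalgebra_def subspace_iff)

lemma lie_ideal_iff:
  "lie_ideal N L I \<longleftrightarrow> mat_subspace N I \<and> I \<subseteq> L \<and> (\<forall>x\<in>L. \<forall>y\<in>I. x * y - y * x \<in> I)"
  by (simp add: lie_ideal_def subspace_iff)

lemma brackets_carrier:
  fixes A B :: "complex mat set"
  assumes "A \<subseteq> carrier_mat N N" "B \<subseteq> carrier_mat N N"
  shows "{x * y - y * x | x y. x \<in> A \<and> y \<in> B} \<subseteq> carrier_mat N N"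
proof clarify
  fix x y assume "x \<in> A" "y \<in> B"
  then have "x \<in> carrier_mat N N" "y \<in> carrier_mat N N" using assms by auto
  then show "x * y - y * x \<in> carrier_mat N N" by (intro minus_carrier_mat mult_carrier_mat)
qed

lemma mat_subspace_lie_bracket:
  "A \<subseteq> carrier_mat N N \<Longrightarrow> B \<subseteq> carrier_mat N N \<Longrightarrow> mat_subspace N (lie_bracket N A B)"
  unfolding lie_bracket_def by (intro mat_subspace_lin_span brackets_carrier)

lemma bracket_in_lie_bracket:
  assumes "A \<subseteq> carrier_mat N N" "B \<subseteq> carrier_mat N N" "x \<in> A" "y \<in> B"
  shows "x * y - y * x \<in> lie_bracket N A B"
  using lin_span_superset[OF brackets_carrier[OF assms(1,2)]] assms(3,4)
  unfolding lie_bracket_def by blast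

lemma lie_bracket_least:
  assumes "mat_subspace N W" "\<And>x y. x \<in> A \<Longrightarrow> y \<in> B \<Longrightarrow> x * y - y * x \<in> W"
  shows "lie_bracket N A B \<subseteq> W"
  unfolding lie_bracket_def using assms by (intro lin_span_least) auto

lemma lie_subalgebra_derived:
  assumes "lie_subalgebra N L"
  shows "lie_bracket N L L \<subseteq> L" "lie_subalgebra N (lie_bracket N L L)"
proof -
  have L: "mat_subspace N L" "L \<subseteq> carrier_mat N N" "\<And>x y. x \<in> L \<Longrightarrow> y \<in> L \<Longrightarrow> x * y - y * x \<in> L"
    using assms by (auto simp: lie_subalgebra_iff mat_subspace_def)
  show sub: "lie_bracket N L L \<subseteq> L" by (rule lie_bracket_least[OF L(1) L(3)])
  show "lie_subalgebra N (lie_bracket N L L)"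
    unfolding lie_subalgebra_iff using mat_subspace_lie_bracket[OF L(2) L(2)]
      bracket_in_lie_bracket[OF L(2) L(2)] sub by blast
qed

lemma derived_series_shift:
  "derived_series N (lie_bracket N L L) k = derived_series N L (Suc k)"
  by (induction k) auto

subsection \<open>Dimension via pivots\<close>

definition sc :: "complex \<Rightarrow> (nat \<Rightarrow> complex) \<Rightarrow> nat \<Rightarrow> complex" where
  "sc c f = (\<lambda>i. c * f i)"

lemma sc_apply: "sc c f i = c * f i"
  by (simp add: sc_def)

lemmas vec_ext = fun_eq_iff plus_fun_apply zero_fun_apply minus_apply sc_apply

lemma sc_simps [simp]: "sc 0 f = 0" "sc 1 f = f" "sc c 0 = 0" "sc a (sc b f) = sc (a * b) f"
  by (simp_all add: vec_ext)

lemma sc_distrib: "sc c (f + g) = sc c f + sc c g" "sc c (f - g) = sc c f - sc c g"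
    "sc (a + b) f = sc a f + sc b f" "sc (a - b) f = sc a f - sc b f"
  by (simp_all add: vec_ext algebra_simps)

definition vecs :: "nat \<Rightarrow> (nat \<Rightarrow> complex) set" where
  "vecs N = {f. \<forall>i\<ge>N. f i = 0}"

definition vsub :: "(nat \<Rightarrow> complex) set \<Rightarrow> bool" where
  "vsub W \<longleftrightarrow> 0 \<in> W \<and> (\<forall>f\<in>W. \<forall>g\<in>W. f + g \<in> W) \<and> (\<forall>c. \<forall>f\<in>W. sc c f \<in> W)"

text \<open>The positions of the leading entries in an echelon basis; their number plays the role of
  the dimension.\<close>

definition pivots :: "(nat \<Rightarrow> complex) set \<Rightarrow> nat set" where
  "pivots W = {i. \<exists>f\<in>W. f i \<noteq> 0 \<and> (\<forall>j<i. f j = 0)}"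

lemma vsubD:
  assumes "vsub W"
  shows "0 \<in> W" "f \<in> W \<Longrightarrow> g \<in> W \<Longrightarrow> f + g \<in> W" "f \<in> W \<Longrightarrow> sc c f \<in> W"
  using assms by (auto simp: vsub_def)

lemma vsub_diff: assumes "vsub W" "f \<in> W" "g \<in> W" shows "f - g \<in> W"
proof -
  have "f - g = f + sc (-1) g" by (auto simp: vec_ext)
  then show ?thesis using vsubD[OF assms(1)] assms(2,3) by metis
qed

lemma pivots_mono: "A \<subseteq> B \<Longrightarrow> pivots A \<subseteq> pivots B"
  by (auto simp: pivots_def)

lemma pivots_bound: "W \<subseteq> vecs N \<Longrightarrow> pivots W \<subseteq> {..<N}"
  by (auto simp: pivots_def vecs_def subset_iff) (meson leI)

text \<open>Gaussian elimination: the first possible nonzero entry of \<open>f\<close> is cleared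
  with a vector of \<open>A\<close> that has its pivot there. The induction is on the number
  \<open>d\<close> of trailing positions where \<open>f\<close> may still be nonzero.\<close>

lemma vsub_eq_if_pivots:
  assumes A: "vsub A" and B: "vsub B" and AB: "A \<subseteq> B" and BN: "B \<subseteq> vecs N"
    and piv: "pivots B \<subseteq> pivots A"
  shows "A = B"
proof -
  have "f \<in> A" if "f \<in> B" "\<forall>j<N - d. f j = 0" for d f
    using that
  proof (induction d arbitrary: f)
    case 0
    have "f i = 0" for i using 0 BN by (cases "i < N") (auto simp: vecs_def)
    then have "f = 0" by (simp add: vec_ext)
    then show ?case using vsubD(1)[OF A] by simp
  next
    case (Suc d)
    let ?i = "N - Suc d"
    show ?case
    proof (cases "f ?i = 0 \<or> N \<le> d")
      case True
      have "f j = 0" if "j < N - d" for j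
      proof (cases "j < ?i")
        case False then have "j = ?i" using that by auto
        then show ?thesis using True that by auto
      qed (use Suc.prems in auto)
      then show ?thesis using Suc by blast
    next
      case False
      then have "?i \<in> pivots A" using Suc.prems piv by (auto simp: pivots_def)
      then obtain g where g: "g \<in> A" "g ?i \<noteq> 0" "\<And>j. j < ?i \<Longrightarrow> g j = 0" by (auto simp: pivots_def)
      define f' where "f' = f - sc (f ?i / g ?i) g"
      have "f' \<in> A"
      proof (rule Suc.IH)
        show "f' \<in> B" unfolding f'_def using g(1) AB Suc.prems(1) by (intro vsub_diff B vsubD(3)) auto
        show "\<forall>j<N - d. f' j = 0"
        proof (intro allI impI)
          fix j assume "j < N - d"
          then have "j < ?i \<or> j = ?i" by linarith
          then show "f' j = 0" using g Suc.prems(2) by (auto simp: f'_def vec_ext)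
        qed
      qed
      then have "f' + sc (f ?i / g ?i) g \<in> A" using g(1) by (intro vsubD[OF A])
      then show ?thesis by (simp add: f'_def)
    qed
  qed
  from this[of _ N] show ?thesis using AB by auto
qed

lemma card_pivots_less:
  assumes "vsub A" "vsub B" "A \<subset> B" "B \<subseteq> vecs N"
  shows "card (pivots A) < card (pivots B)"
proof (rule psubset_card_mono)
  show "finite (pivots B)" using pivots_bound[OF assms(4)] finite_subset by blast
  show "pivots A \<subset> pivots B"
    using vsub_eq_if_pivots[OF assms(1,2) _ assms(4)] pivots_mono[of A B] assms(3) by blast
qed

lemma chain_stabilizes:
  assumes "\<And>i. vsub (U i)" "\<And>i. U i \<subseteq> U (Suc i)" "\<And>i. U i \<subseteq> vecs N"
  shows "\<exists>d. U d = U (Suc d)"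
proof (rule ccontr)
  assume ne: "\<nexists>d. U d = U (Suc d)"
  have "i \<le> card (pivots (U i))" for i
  proof (induction i)
    case (Suc i)
    have "card (pivots (U i)) < card (pivots (U (Suc i)))"
      using ne assms by (intro card_pivots_less[of _ _ N] psubsetI) auto
    then show ?case using Suc by linarith
  qed simp
  moreover have "card (pivots (U (Suc N))) \<le> N"
    using card_mono[OF _ pivots_bound[OF assms(3)[of "Suc N"]]] by simp
  ultimately show False using Suc_n_not_le_n le_trans by blast
qed

lemma minimal_subspace:
  assumes "P B" "\<And>B. P B \<Longrightarrow> vsub B \<and> B \<subseteq> vecs N"
  shows "\<exists>B. P B \<and> (\<forall>B'. P B' \<longrightarrow> B' \<subseteq> B \<longrightarrow> B' = B)"
proof -
  obtain C where C: "P C" "\<And>B'. P B' \<Longrightarrow> card (pivots C) \<le> card (pivots B')"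
    using ex_has_least_nat[of P B "\<lambda>B. card (pivots B)"] assms(1) by blast
  have "B' = C" if "P B'" "B' \<subseteq> C" for B'
    using card_pivots_less[of B' C N] C assms(2) that by (meson leD psubsetI)
  then show ?thesis using C(1) by blast
qed

subsection \<open>Eigenvectors modulo a stable subspace\<close>

definition lin_op :: "((nat \<Rightarrow> complex) \<Rightarrow> (nat \<Rightarrow> complex)) \<Rightarrow> bool" where
  "lin_op T \<longleftrightarrow> (\<forall>f g. T (f + g) = T f + T g) \<and> (\<forall>c f. T (sc c f) = sc c (T f))"

lemma lin_opD: assumes "lin_op T"
  shows "T (f + g) = T f + T g" "T (sc c f) = sc c (T f)" "T 0 = 0" "T (f - g) = T f - T g"
proof -
  show add: "T (f + g) = T f + T g" for f g using assms by (simp add: lin_op_def)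
  show "T (sc c f) = sc c (T f)" for c f using assms by (simp add: lin_op_def)
  show "T 0 = 0" using add[of 0 0] by simp
  show "T (f - g) = T f - T g" using add[of "f - g" g] by (simp add: algebra_simps)
qed

text \<open>The sum of \<open>A\<close> and the span of the first \<open>d\<close> vectors of the
  chain v, T v, T (T v), ...\<close>

primrec cyc :: "(nat \<Rightarrow> complex) set \<Rightarrow> ((nat \<Rightarrow> complex) \<Rightarrow> (nat \<Rightarrow> complex)) \<Rightarrow>
    (nat \<Rightarrow> complex) \<Rightarrow> nat \<Rightarrow> (nat \<Rightarrow> complex) set" where
  "cyc A T v 0 = A"
| "cyc A T v (Suc d) = {u + sc c ((T ^^ d) v) | u c. u \<in> cyc A T v d}"

lemma cyc_mono1: "cyc A T v d \<subseteq> cyc A T v (Suc d)"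
proof
  fix u assume "u \<in> cyc A T v d"
  moreover have "u = u + sc 0 ((T ^^ d) v)" by simp
  ultimately show "u \<in> cyc A T v (Suc d)" unfolding cyc.simps(2) by blast
qed

lemma cyc_mono: "d \<le> e \<Longrightarrow> cyc A T v d \<subseteq> cyc A T v e"
  by (rule lift_Suc_mono_le[of "cyc A T v"]) (rule cyc_mono1)

lemma vsub_cyc: "vsub A \<Longrightarrow> vsub (cyc A T v d)"
proof (induction d)
  case (Suc d)
  then have W: "vsub (cyc A T v d)" by simp
  show ?case
    unfolding vsub_def
  proof (intro conjI ballI allI)
    show "0 \<in> cyc A T v (Suc d)" using vsubD(1)[OF W] cyc_mono1 by blast
  next
    fix f g assume "f \<in> cyc A T v (Suc d)" "g \<in> cyc A T v (Suc d)"
    then obtain u c u' c' where u: "u \<in> cyc A T v d" "u' \<in> cyc A T v d"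
      "f = u + sc c ((T ^^ d) v)" "g = u' + sc c' ((T ^^ d) v)" by auto
    then have "f + g = (u + u') + sc (c + c') ((T ^^ d) v)" by (simp add: vec_ext algebra_simps)
    then show "f + g \<in> cyc A T v (Suc d)" using vsubD(2)[OF W u(1,2)] by auto
  next
    fix a f assume "f \<in> cyc A T v (Suc d)"
    then obtain u c where u: "u \<in> cyc A T v d" "f = u + sc c ((T ^^ d) v)" by auto
    then have "sc a f = sc a u + sc (a * c) ((T ^^ d) v)" by (simp add: vec_ext algebra_simps)
    then show "sc a f \<in> cyc A T v (Suc d)" using vsubD(3)[OF W u(1)] by auto
  qed
qed simp

lemma cyc_pow: assumes "vsub A" shows "(T ^^ d) v \<in> cyc A T v (Suc d)"
proof -
  have "(T ^^ d) v = 0 + sc 1 ((T ^^ d) v)" by simp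
  then show ?thesis using vsubD(1)[OF vsub_cyc[OF assms]] unfolding cyc.simps(2) by blast
qed

lemma cyc_subset:
  assumes "vsub B" "A \<subseteq> B" "v \<in> B" "\<And>f. f \<in> B \<Longrightarrow> T f \<in> B"
  shows "cyc A T v d \<subseteq> B"
proof (induction d)
  case (Suc d)
  have "(T ^^ d) v \<in> B" by (induction d) (use assms in auto)
  then show ?case using Suc vsubD[OF assms(1)] by auto
qed (use assms in auto)

lemma cyc_step:
  assumes T: "lin_op T" and TA: "\<And>f. f \<in> A \<Longrightarrow> T f \<in> A" and A: "vsub A"
  shows "u \<in> cyc A T v d \<Longrightarrow> T u \<in> cyc A T v (Suc d)"
proof (induction d arbitrary: u)
  case 0 then show ?case using TA cyc_mono1[of A T v 0] by auto
next
  case (Suc d)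
  then obtain u' c where u: "u' \<in> cyc A T v d" "u = u' + sc c ((T ^^ d) v)" by auto
  then have "T u = T u' + sc c ((T ^^ Suc d) v)" by (simp add: lin_opD[OF T])
  then show ?case using Suc.IH[OF u(1)] unfolding cyc.simps(2)[of A T v "Suc d"] by blast
qed

text \<open>Inside the finite-dimensional \<open>B\<close> the chain becomes stationary. The first
  power of \<open>T\<close> that brings \<open>v\<close> into the span of the earlier ones is not
  the zeroth, because \<open>v\<close> is outside \<open>A\<close>.\<close>

lemma cyc_stop:
  assumes "vsub A" "vsub B" "A \<subseteq> B" "B \<subseteq> vecs N" "v \<in> B" "v \<notin> A" "\<And>f. f \<in> B \<Longrightarrow> T f \<in> B"
  obtains d where "(T ^^ Suc d) v \<in> cyc A T v (Suc d)" "(T ^^ d) v \<notin> cyc A T v d"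
proof -
  let ?P = "\<lambda>d. (T ^^ d) v \<in> cyc A T v d"
  have "\<exists>d. cyc A T v d = cyc A T v (Suc d)"
  proof (rule chain_stabilizes[of _ N])
    show "cyc A T v i \<subseteq> vecs N" for i using cyc_subset[of B A v T i] assms by blast
  qed (use vsub_cyc[OF assms(1)] cyc_mono1 in auto)
  then have ex: "\<exists>d. ?P d" using cyc_pow[OF assms(1)] by metis
  define e where "e = (LEAST d. ?P d)"
  have e: "?P e" "\<And>d. ?P d \<Longrightarrow> e \<le> d"
    unfolding e_def using ex by (auto intro: LeastI_ex Least_le)
  have "e \<noteq> 0" using e(1) assms(6) by (cases e) auto
  then obtain d where "e = Suc d" by (cases e) auto
  then show ?thesis using that[of d] e by fastforce
qed

text \<open>The vector p(T) v, computed by Horner's scheme.\<close>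

definition op_poly :: "((nat \<Rightarrow> complex) \<Rightarrow> (nat \<Rightarrow> complex)) \<Rightarrow> complex poly \<Rightarrow> (nat \<Rightarrow> complex) \<Rightarrow> nat \<Rightarrow> complex" where
  "op_poly T p v = fold_coeffs (\<lambda>a w. sc a v + T w) p 0"

lemma op_poly_0 [simp]: "op_poly T 0 v = 0"
  by (simp add: op_poly_def)

lemma op_poly_pCons: "lin_op T \<Longrightarrow> op_poly T (pCons a p) v = sc a v + T (op_poly T p v)"
  by (cases "pCons a p = 0") (auto simp: op_poly_def lin_opD vec_ext)

lemma op_poly_add: assumes T: "lin_op T" shows "op_poly T (p + q) v = op_poly T p v + op_poly T q v"
  by (induction p q rule: poly_induct2)
     (simp_all add: op_poly_pCons[OF T] lin_opD[OF T] sc_distrib algebra_simps)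

lemma op_poly_smult: assumes T: "lin_op T" shows "op_poly T (Polynomial.smult c p) v = sc c (op_poly T p v)"
proof (induction p)
  case (pCons a p)
  then show ?case by (simp add: op_poly_pCons[OF T] lin_opD[OF T] sc_distrib)
qed simp

lemma op_poly_linear_factor:
  assumes T: "lin_op T"
  shows "op_poly T ([:-\<mu>, 1:] * q) v = T (op_poly T q v) - sc \<mu> (op_poly T q v)"
proof -
  have "[:-\<mu>, 1:] * q = Polynomial.smult (-\<mu>) q + pCons 0 q" by simp
  then show ?thesis
    by (simp only: op_poly_add[OF T] op_poly_smult[OF T] op_poly_pCons[OF T]) (simp add: vec_ext)
qed

lemma op_poly_closed:
  assumes "lin_op T" "vsub B" "v \<in> B" "\<And>f. f \<in> B \<Longrightarrow> T f \<in> B"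
  shows "op_poly T p v \<in> B"
  by (induction p) (auto simp: op_poly_pCons[OF assms(1)] intro!: vsubD[OF assms(2)] assms)

lemma cyc_op_poly:
  assumes T: "lin_op T" and A: "vsub A"
  shows "u \<in> cyc A T v d \<Longrightarrow> \<exists>q. (q = 0 \<or> degree q < d) \<and> u - op_poly T q v \<in> A"
proof (induction d arbitrary: u)
  case 0 then show ?case by (intro exI[of _ 0]) simp
next
  case (Suc d)
  then obtain u' c where u: "u' \<in> cyc A T v d" "u = u' + sc c ((T ^^ d) v)" by auto
  obtain q where q: "q = 0 \<or> degree q < d" "u' - op_poly T q v \<in> A" using Suc.IH[OF u(1)] by blast
  have m: "op_poly T (Polynomial.monom c d) v = sc c ((T ^^ d) v)" for c d
    by (induction d) (simp_all add: monom_0 monom_Suc op_poly_pCons[OF T] lin_opD[OF T])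
  have "u - op_poly T (q + Polynomial.monom c d) v = u' - op_poly T q v"
    by (simp add: op_poly_add[OF T] m u(2))
  moreover have "degree (q + Polynomial.monom c d) < Suc d"
    using q(1) by (auto intro!: degree_add_less simp: degree_monom_le le_imp_less_Suc)
  ultimately show ?case using q(2) by metis
qed

text \<open>Some nonzero polynomial p satisfies p(T) v \<in> A. Splitting off a root \<mu> gives p =
  (x - \<mu>) q: either q(T) v is outside \<open>A\<close>, and then it is an eigenvector modulo
  \<open>A\<close>, or q is an annihilating polynomial of smaller degree.\<close>

lemma eigenvector_mod:
  assumes T: "lin_op T" and A: "vsub A" and B: "vsub B" and AB: "A \<subset> B" and BN: "B \<subseteq> vecs N"
    and TB: "\<And>f. f \<in> B \<Longrightarrow> T f \<in> B"
  shows "\<exists>v\<in>B - A. \<exists>\<mu>. T v - sc \<mu> v \<in> A"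
proof -
  have main: "\<exists>v\<in>B - A. \<exists>\<mu>. T v - sc \<mu> v \<in> A"
    if "p \<noteq> 0" "v \<in> B - A" "op_poly T p v \<in> A" for p v
    using that
  proof (induction "degree p" arbitrary: p)
    case 0
    then obtain c where c: "p = [:c:]" "c \<noteq> 0" by (metis degree_eq_zeroE pCons_0_0)
    then have "sc c v \<in> A" using 0 by (simp add: op_poly_pCons[OF T] lin_opD[OF T])
    then have "sc (1 / c) (sc c v) \<in> A" by (rule vsubD(3)[OF A])
    then show ?case using 0 c(2) by simp
  next
    case (Suc d)
    then have "\<not> constant (poly p)" by (simp add: constant_degree)
    then obtain \<mu> where "poly p \<mu> = 0" using fundamental_theorem_of_algebra by blast
    then obtain q where q: "p = [:-\<mu>, 1:] * q" by (auto simp: poly_eq_0_iff_dvd elim: dvdE)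
    have q0: "q \<noteq> 0" using q Suc.prems by auto
    then have "degree p = Suc (degree q)" unfolding q by (subst degree_mult_eq) auto
    then have dq: "d = degree q" using Suc.hyps(2) by simp
    show ?case
    proof (cases "op_poly T q v \<in> A")
      case True then show ?thesis using Suc.hyps(1)[OF dq q0 Suc.prems(2)] by blast
    next
      case False
      moreover have "op_poly T q v \<in> B" using Suc.prems(2) TB by (intro op_poly_closed T B) auto
      ultimately show ?thesis using Suc.prems(3) unfolding q op_poly_linear_factor[OF T]
        by (intro bexI[of _ "op_poly T q v"] exI[of _ \<mu>]) auto
    qed
  qed
  obtain v where v: "v \<in> B" "v \<notin> A" using AB by auto
  obtain d where d: "(T ^^ Suc d) v \<in> cyc A T v (Suc d)"
    by (rule cyc_stop[OF A B _ BN v, of T]) (use AB TB in auto)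
  obtain q where q: "q = 0 \<or> degree q < Suc d" "(T ^^ Suc d) v - op_poly T q v \<in> A"
    using cyc_op_poly[OF T A d] by blast
  have m: "op_poly T (Polynomial.monom 1 d) v = (T ^^ d) v" for d
    by (induction d) (simp_all add: monom_0 monom_Suc op_poly_pCons[OF T] lin_opD[OF T])
  have neg: "op_poly T (Polynomial.monom 1 (Suc d) - q) v = (T ^^ Suc d) v - op_poly T q v"
    using op_poly_add[OF T, of "Polynomial.monom 1 (Suc d) - q" q v] m[of "Suc d"] by (simp add: algebra_simps)
  have "Polynomial.monom 1 (Suc d) - q \<noteq> 0"
  proof
    assume "Polynomial.monom 1 (Suc d) - q = 0"
    then have "q = Polynomial.monom 1 (Suc d)" by simp
    then show False using q(1) by (simp add: degree_monom_eq)
  qed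
  then show ?thesis using main[of "Polynomial.monom 1 (Suc d) - q" v] q(2) neg v by simp
qed

text \<open>The replacement for the trace argument in Lie's theorem: \<open>Y\<close> acts on the cyclic space of
  \<open>v\<close> under \<open>Z\<close> triangularly, with off-diagonal entries \<open>i * c\<close>.\<close>

lemma lie_scalar_zero:
  assumes Y: "lin_op Y" and A: "vsub A" and B: "vsub B" and AB: "A \<subseteq> B" and BN: "B \<subseteq> vecs N"
    and ZB: "\<And>f. f \<in> B \<Longrightarrow> Z f \<in> B" and YA: "\<And>f. f \<in> A \<Longrightarrow> Y f \<in> A"
    and v: "v \<in> B" "v \<notin> A"
    and tri: "\<And>i. Y ((Z ^^ i) v) - sc \<nu> ((Z ^^ i) v) - sc (of_nat i * c) ((Z ^^ (i - 1)) v) \<in> cyc A Z v (i - 1)"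
  shows "c = 0"
proof -
  let ?U = "cyc A Z v"
  have U: "vsub (?U i)" for i by (rule vsub_cyc[OF A])
  have pow: "Y ((Z ^^ i) v) - sc \<nu> ((Z ^^ i) v) \<in> ?U i" for i
  proof (cases i)
    case 0 then show ?thesis using tri[of 0] by simp
  next
    case (Suc j)
    have p: "(Z ^^ j) v \<in> ?U i" unfolding Suc by (rule cyc_pow[OF A])
    have "Y ((Z ^^ i) v) - sc \<nu> ((Z ^^ i) v) - sc (of_nat i * c) ((Z ^^ j) v) \<in> ?U i"
      using tri[of i] cyc_mono1[of A Z v j] unfolding Suc by auto
    from vsubD(2)[OF U this vsubD(3)[OF U p, where c = "of_nat i * c"]] show ?thesis by simp
  qed
  have lower: "Y u - sc \<nu> u \<in> ?U (k - 1)" if "u \<in> ?U k" for u k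
    using that
  proof (induction k arbitrary: u)
    case 0
    then show ?case using YA by (auto intro!: vsub_diff A vsubD[OF A])
  next
    case (Suc k)
    then obtain u' a where u: "u' \<in> ?U k" "u = u' + sc a ((Z ^^ k) v)" by auto
    have "Y u - sc \<nu> u = (Y u' - sc \<nu> u') + sc a (Y ((Z ^^ k) v) - sc \<nu> ((Z ^^ k) v))"
      unfolding u(2) lin_opD[OF Y] by (simp add: vec_ext algebra_simps)
    moreover have "Y u' - sc \<nu> u' \<in> ?U k"
      using Suc.IH[OF u(1)] cyc_mono[of "k - 1" k A Z v] by auto
    ultimately show ?case using vsubD(2,3)[OF U] pow[of k] by simp
  qed
  obtain d where d: "(Z ^^ Suc d) v \<in> ?U (Suc d)" "(Z ^^ d) v \<notin> ?U d"
    by (rule cyc_stop[OF A B AB BN v, of Z]) (use ZB in auto)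
  \<comment> \<open>The power \<open>Suc d\<close> of \<open>Z\<close> applied to \<open>v\<close>
    already lies in the cyclic space of length \<open>Suc d\<close>, and \<open>Y\<close> minus its
    eigenvalue shortens the length by one. So the off-diagonal term, a multiple of a vector outside
    \<open>?U d\<close>, would lie in \<open>?U d\<close>.\<close>
  let ?w = "Y ((Z ^^ Suc d) v) - sc \<nu> ((Z ^^ Suc d) v)"
  have "?w - (?w - sc (of_nat (Suc d) * c) ((Z ^^ d) v)) \<in> ?U d"
    by (rule vsub_diff[OF U]) (use lower[OF d(1)] tri[of "Suc d"] in simp_all)
  then have w: "sc (of_nat (Suc d) * c) ((Z ^^ d) v) \<in> ?U d" by simp
  show "c = 0"
  proof (rule ccontr)
    assume c: "c \<noteq> 0"
    have "sc (1 / (of_nat (Suc d) * c)) (sc (of_nat (Suc d) * c) ((Z ^^ d) v)) \<in> ?U d"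
      by (rule vsubD(3)[OF U w])
    moreover have "sc (1 / (of_nat (Suc d) * c)) (sc (of_nat (Suc d) * c) ((Z ^^ d) v)) = (Z ^^ d) v"
      using c by (simp add: vec_ext del: of_nat_Suc)
    ultimately show False using d(2) by simp
  qed
qed

section \<open>Matrices as operators on finitely supported functions\<close>

definition op :: "nat \<Rightarrow> complex mat \<Rightarrow> (nat \<Rightarrow> complex) \<Rightarrow> nat \<Rightarrow> complex" where
  "op N x f = (\<lambda>i. if i < N then \<Sum>j<N. x $$ (i, j) * f j else 0)"

lemma op_vecs [simp]: "op N x f \<in> vecs N"
  by (simp add: op_def vecs_def)

lemma lin_op_op: "lin_op (op N x)"
  by (auto simp: lin_op_def op_def vec_ext algebra_simps sum.distrib sum_distrib_left)

lemma op_mult: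
  assumes "x \<in> carrier_mat N N" "y \<in> carrier_mat N N"
  shows "op N (x * y) f = op N x (op N y f)"
proof
  fix i
  show "op N (x * y) f i = op N x (op N y f) i"
  proof (cases "i < N")
    case True
    have "(\<Sum>j<N. (x * y) $$ (i, j) * f j) = (\<Sum>j<N. \<Sum>k<N. x $$ (i, k) * y $$ (k, j) * f j)"
      using assms True
      by (intro sum.cong refl) (auto simp: scalar_prod_def sum_distrib_right lessThan_atLeast0)
    also have "\<dots> = (\<Sum>k<N. x $$ (i, k) * (\<Sum>j<N. y $$ (k, j) * f j))"
      by (subst sum.swap) (simp add: sum_distrib_left mult.assoc)
    finally show ?thesis using True by (simp add: op_def)
  qed (simp add: op_def)
qed

lemma op_minus:
  assumes "x \<in> carrier_mat N N" "y \<in> carrier_mat N N"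
  shows "op N (x - y) f = op N x f - op N y f"
  using assms by (auto simp: op_def vec_ext left_diff_distrib sum_subtractf)

lemma op_bracket:
  assumes "x \<in> carrier_mat N N" "y \<in> carrier_mat N N"
  shows "op N (x * y - y * x) f = op N x (op N y f) - op N y (op N x f)"
  using assms by (subst op_minus) (auto simp: op_mult intro!: mult_carrier_mat)

lemma op_zero_mat: "op N (0\<^sub>m N N) f = 0"
  by (auto simp: op_def vec_ext)

definition stable :: "nat \<Rightarrow> complex mat set \<Rightarrow> (nat \<Rightarrow> complex) set \<Rightarrow> bool" where
  "stable N L W \<longleftrightarrow> vsub W \<and> W \<subseteq> vecs N \<and> (\<forall>x\<in>L. \<forall>f\<in>W. op N x f \<in> W)"

lemma cyc_shift:
  assumes "lin_op Z" "\<And>f. f \<in> A \<Longrightarrow> Z f \<in> A" "vsub A" "u \<in> cyc A Z v (i - 1)"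
  shows "Z u \<in> cyc A Z v i"
  using cyc_step[OF assms] by (cases i) (use assms(2,4) in auto)

text \<open>The induction passes to the derived algebra \<open>K\<close>, not to an ideal of
  codimension one. \<open>W\<close> is a weight space of \<open>K\<close> modulo \<open>A\<close>.
  The weight vanishes on brackets of \<open>K\<close> with \<open>L\<close>, which makes
  \<open>W\<close> stable, and on all brackets of \<open>L\<close>, so the operators of
  \<open>L\<close> commute on \<open>W\<close> modulo \<open>A\<close>. A minimal stable space above
  \<open>A\<close> inside \<open>W\<close> is then acted on by scalars.\<close>

theorem lie_theorem:
  assumes "lie_subalgebra N L" "derived_series N L k = {0\<^sub>m N N}"
    and "stable N L A" "stable N L B" "A \<subset> B"
  shows "\<exists>v\<in>B - A. \<forall>x\<in>L. \<exists>\<mu>. op N x v - sc \<mu> v \<in> A"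
  using assms
proof (induction k arbitrary: L A B)
  case 0
  then obtain v where "v \<in> B - A" by auto
  moreover have "op N x v - sc 0 v \<in> A" if "x \<in> L" for x
    using 0 that by (simp add: op_zero_mat stable_def vsub_def)
  ultimately show ?case by blast
next
  case (Suc k)
  define K where "K = lie_bracket N L L"
  have LN: "L \<subseteq> carrier_mat N N" using Suc.prems(1) by (auto simp: lie_subalgebra_iff mat_subspace_def)
  have KL: "K \<subseteq> L" and K: "lie_subalgebra N K" using lie_subalgebra_derived[OF Suc.prems(1)] by (auto simp: K_def)
  have br: "x * y - y * x \<in> K" if "x \<in> L" "y \<in> L" for x y
    unfolding K_def using bracket_in_lie_bracket[OF LN LN that] .
  have A: "vsub A" "A \<subseteq> vecs N" "\<And>x f. x \<in> L \<Longrightarrow> f \<in> A \<Longrightarrow> op N x f \<in> A"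
    and B: "vsub B" "B \<subseteq> vecs N" "\<And>x f. x \<in> L \<Longrightarrow> f \<in> B \<Longrightarrow> op N x f \<in> B"
    using Suc.prems by (auto simp: stable_def)
  have AB: "A \<subseteq> B" using Suc.prems(5) by auto
  note lin = lin_opD[OF lin_op_op]
  have opb: "op N x (op N y f) = op N y (op N x f) + op N (x * y - y * x) f"
    if "x \<in> L" "y \<in> L" for x y f
  proof -
    have "x \<in> carrier_mat N N" "y \<in> carrier_mat N N" using that LN by auto
    then show ?thesis by (simp add: op_bracket)
  qed
  have "\<exists>v\<in>B - A. \<forall>x\<in>K. \<exists>\<mu>. op N x v - sc \<mu> v \<in> A"
  proof (rule Suc.IH[OF K])
    show "derived_series N K k = {0\<^sub>m N N}"
      unfolding K_def derived_series_shift by (rule Suc.prems(2))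
  qed (use Suc.prems KL in \<open>auto simp: stable_def\<close>)
  then obtain v0 where v0: "v0 \<in> B" "v0 \<notin> A" "\<forall>x\<in>K. \<exists>\<mu>. op N x v0 - sc \<mu> v0 \<in> A" by auto
  then obtain \<nu> where \<nu>: "\<And>x. x \<in> K \<Longrightarrow> op N x v0 - sc (\<nu> x) v0 \<in> A" by metis
  define W where "W = {v \<in> B. \<forall>y\<in>K. op N y v - sc (\<nu> y) v \<in> A}"
  have W_vsub: "vsub W"
    unfolding vsub_def
  proof (intro conjI ballI allI)
    show "0 \<in> W" using vsubD(1)[OF A(1)] vsubD(1)[OF B(1)] by (simp add: W_def lin)
  next
    fix f g assume fg: "f \<in> W" "g \<in> W"
    have "op N y (f + g) - sc (\<nu> y) (f + g) \<in> A" if y: "y \<in> K" for y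
    proof -
      have "op N y (f + g) - sc (\<nu> y) (f + g) = (op N y f - sc (\<nu> y) f) + (op N y g - sc (\<nu> y) g)"
        by (simp add: lin sc_distrib)
      then show ?thesis using fg y vsubD(2)[OF A(1)] by (simp add: W_def)
    qed
    then show "f + g \<in> W" using fg vsubD(2)[OF B(1)] by (simp add: W_def)
  next
    fix c f assume f: "f \<in> W"
    have "op N y (sc c f) - sc (\<nu> y) (sc c f) \<in> A" if y: "y \<in> K" for y
    proof -
      have "op N y (sc c f) - sc (\<nu> y) (sc c f) = sc c (op N y f - sc (\<nu> y) f)"
        by (simp add: lin sc_distrib mult.commute)
      then show ?thesis using f y vsubD(3)[OF A(1)] by (simp add: W_def)
    qed
    then show "sc c f \<in> W" using f vsubD(3)[OF B(1)] by (simp add: W_def)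
  qed
  have AW: "A \<subseteq> W"
    using AB A KL by (auto simp: W_def intro!: vsub_diff vsubD(3))
  have AW': "A \<subset> W" using AW v0 \<nu> by (auto simp: W_def)
  have WN: "W \<subseteq> vecs N" using B by (auto simp: W_def)
  \<comment> \<open>Along the chain of \<open>v0\<close> under \<open>z\<close>, the element
    \<open>y\<close> has \<open>\<nu> y\<close> on the diagonal and multiples of the weight of the
    bracket next to it.\<close>
  have weight_0: "\<nu> (y * z - z * y) = 0" if y: "y \<in> K" and z: "z \<in> L" for y z
  proof (rule lie_scalar_zero[OF lin_op_op A(1) B(1) AB B(2)])
    show "op N z f \<in> B" if "f \<in> B" for f using B(3) z that by blast
    show "op N y f \<in> A" if "f \<in> A" for f using A(3) y KL that by blast
    show "v0 \<in> B" "v0 \<notin> A" using v0 by auto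
    let ?z = "op N z"
    let ?U = "cyc A ?z v0"
    have U: "vsub (?U i)" for i by (rule vsub_cyc[OF A(1)])
    have yz: "y' * z - z * y' \<in> K" if "y' \<in> K" for y' using br KL that z by blast
    show "op N y ((?z ^^ i) v0) - sc (\<nu> y) ((?z ^^ i) v0)
        - sc (of_nat i * \<nu> (y * z - z * y)) ((?z ^^ (i - 1)) v0) \<in> ?U (i - 1)" for i
      using y
    \<comment> \<open>Moving \<open>y\<close> past one \<open>z\<close> produces the bracket of
      \<open>y\<close> with \<open>z\<close>, again in \<open>K\<close>, for which the claim at the
      previous index is also needed.\<close>
    proof (induction i arbitrary: y)
      case 0
      then show ?case using \<nu> by simp
    next
      case (Suc i)
      let ?c = "y * z - z * y"
      let ?w = "(?z ^^ i) v0" and ?w' = "(?z ^^ (i - 1)) v0"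
      define u where "u = op N y ?w - sc (\<nu> y) ?w - sc (of_nat i * \<nu> ?c) ?w'"
      define u' where "u' = op N ?c ?w - sc (\<nu> ?c) ?w - sc (of_nat i * \<nu> (?c * z - z * ?c)) ?w'"
      have u: "u \<in> ?U (i - 1)" unfolding u_def by (rule Suc.IH[OF Suc.prems])
      have u': "u' \<in> ?U (i - 1)" unfolding u'_def by (rule Suc.IH[OF yz[OF Suc.prems]])
      have zu: "?z u \<in> ?U i"
        using u A z by (intro cyc_shift lin_op_op) auto
      have w': "sc (of_nat i * a) ?w' \<in> ?U i" for a
      proof (cases i)
        case 0 then show ?thesis using vsubD(1)[OF A(1)] by simp
      next
        case (Suc j)
        show ?thesis unfolding Suc diff_Suc_1 by (rule vsubD(3)[OF U cyc_pow[OF A(1)]])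
      qed
      have zw': "sc (of_nat i * a) (?z ?w') = sc (of_nat i * a) ?w" for a
        by (cases i) (simp_all add: lin)
      have yw: "op N y ?w = u + sc (\<nu> y) ?w + sc (of_nat i * \<nu> ?c) ?w'" by (simp add: u_def)
      have cw: "op N ?c ?w = u' + sc (\<nu> ?c) ?w + sc (of_nat i * \<nu> (?c * z - z * ?c)) ?w'" by (simp add: u'_def)
      have "op N y (?z ?w) = ?z (op N y ?w) + op N ?c ?w"
        using opb[of y z ?w] Suc.prems KL z by auto
      also have "?z (op N y ?w) = ?z u + sc (\<nu> y) (?z ?w) + sc (of_nat i * \<nu> ?c) ?w"
        unfolding yw by (simp only: lin zw')
      finally have "op N y (?z ?w) - sc (\<nu> y) (?z ?w) - sc (of_nat (Suc i) * \<nu> ?c) ?w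
          = ?z u + u' + sc (of_nat i * \<nu> (?c * z - z * ?c)) ?w'"
        unfolding cw by (simp add: sc_distrib distrib_right)
      moreover have "?z u + u' + sc (of_nat i * \<nu> (?c * z - z * ?c)) ?w' \<in> ?U i"
        using zu u' w' cyc_mono[of "i - 1" i A ?z v0] by (intro vsubD(2)[OF U]) auto
      ultimately show ?case by simp
    qed
  qed
  have W_L: "op N z v \<in> W" if z: "z \<in> L" and v: "v \<in> W" for z v
  proof -
    have "op N y (op N z v) - sc (\<nu> y) (op N z v) \<in> A" if y: "y \<in> K" for y
    proof -
      have c: "y * z - z * y \<in> K" using br KL y z by blast
      have "op N y (op N z v) - sc (\<nu> y) (op N z v)
          = op N z (op N y v - sc (\<nu> y) v) + (op N (y * z - z * y) v - sc (\<nu> (y * z - z * y)) v)"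
        using opb[of y z v] y KL z by (auto simp: lin weight_0[OF y z])
      then show ?thesis using v y c A z by (auto simp: W_def intro!: vsubD(2)[OF A(1)])
    qed
    then show ?thesis using v B z by (auto simp: W_def)
  qed
  \<comment> \<open>Here \<open>x\<close> need not be in \<open>K\<close>, so the chain starts at an
    eigenvector of \<open>x\<close> in \<open>W\<close>. The bracket lies in \<open>K\<close> and
    acts on \<open>W\<close> by its weight modulo \<open>A\<close>, hence all error terms stay in
    \<open>A\<close>.\<close>
  have comm_0: "\<nu> (x * z - z * x) = 0" if x: "x \<in> L" and z: "z \<in> L" for x z
  proof -
    obtain w \<mu> where w: "w \<in> W" "w \<notin> A" "op N x w - sc \<mu> w \<in> A"
      using eigenvector_mod[OF lin_op_op A(1) W_vsub AW' WN] W_L[OF x] by blast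
    let ?z = "op N z" and ?c = "x * z - z * x"
    show ?thesis
    proof (rule lie_scalar_zero[OF lin_op_op A(1) W_vsub AW WN])
      show "?z f \<in> W" if "f \<in> W" for f using W_L z that by blast
      show "op N x f \<in> A" if "f \<in> A" for f using A(3) x that by blast
      show "w \<in> W" "w \<notin> A" using w by auto
      have zW: "(?z ^^ i) w \<in> W" for i by (induction i) (use w W_L z in auto)
      have "op N x ((?z ^^ i) w) - sc \<mu> ((?z ^^ i) w)
          - sc (of_nat i * \<nu> ?c) ((?z ^^ (i - 1)) w) \<in> A" for i
      proof (induction i)
        case 0 then show ?case using w by simp
      next
        case (Suc i)
        let ?w = "(?z ^^ i) w" and ?w' = "(?z ^^ (i - 1)) w"
        define u where "u = op N x ?w - sc \<mu> ?w - sc (of_nat i * \<nu> ?c) ?w'"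
        define u' where "u' = op N ?c ?w - sc (\<nu> ?c) ?w"
        have u': "u' \<in> A" using zW[of i] br[OF x z] by (simp add: u'_def W_def)
        have zw': "sc (of_nat i * a) (?z ?w') = sc (of_nat i * a) ?w" for a
          by (cases i) (simp_all add: lin)
        have xw: "op N x ?w = u + sc \<mu> ?w + sc (of_nat i * \<nu> ?c) ?w'" by (simp add: u_def)
        have cw: "op N ?c ?w = u' + sc (\<nu> ?c) ?w" by (simp add: u'_def)
        have "op N x (?z ?w) = ?z (op N x ?w) + op N ?c ?w" by (rule opb[OF x z])
        also have "?z (op N x ?w) = ?z u + sc \<mu> (?z ?w) + sc (of_nat i * \<nu> ?c) ?w"
          unfolding xw by (simp only: lin zw')
        finally have "op N x (?z ?w) - sc \<mu> (?z ?w) - sc (of_nat (Suc i) * \<nu> ?c) ?w = ?z u + u'"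
          unfolding cw by (simp add: sc_distrib distrib_right)
        moreover have "?z u + u' \<in> A"
          using Suc u' A z unfolding u_def[symmetric] by (intro vsubD(2)[OF A(1)]) auto
        ultimately show ?case by simp
      qed
      then show "op N x ((?z ^^ i) w) - sc \<mu> ((?z ^^ i) w)
          - sc (of_nat i * \<nu> ?c) ((?z ^^ (i - 1)) w) \<in> cyc A ?z w (i - 1)" for i
        using cyc_mono[of 0 "i - 1" A ?z w] by auto
    qed
  qed
  have "stable N L W" using W_vsub WN W_L by (simp add: stable_def)
  then have "\<exists>C. (stable N L C \<and> A \<subset> C \<and> C \<subseteq> W) \<and>
      (\<forall>C'. stable N L C' \<and> A \<subset> C' \<and> C' \<subseteq> W \<longrightarrow> C' \<subseteq> C \<longrightarrow> C' = C)"
    using AW' by (intro minimal_subspace[of _ W N]) (simp_all add: stable_def)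
  then obtain C where C0: "(stable N L C \<and> A \<subset> C \<and> C \<subseteq> W) \<and>
      (\<forall>C'. stable N L C' \<and> A \<subset> C' \<and> C' \<subseteq> W \<longrightarrow> C' \<subseteq> C \<longrightarrow> C' = C)" ..
  have C: "stable N L C" "A \<subset> C" "C \<subseteq> W" using C0 by simp_all
  have C_min: "C' = C" if "stable N L C'" "A \<subset> C'" "C' \<subseteq> W" "C' \<subseteq> C" for C'
    using C0 that by simp
  have scalar: "\<exists>\<mu>. \<forall>v\<in>C. op N z v - sc \<mu> v \<in> A" if z: "z \<in> L" for z
  proof -
    have C': "vsub C" "C \<subseteq> vecs N" "\<And>x f. x \<in> L \<Longrightarrow> f \<in> C \<Longrightarrow> op N x f \<in> C"
      using C(1) by (auto simp: stable_def)
    obtain w \<mu> where w: "w \<in> C" "w \<notin> A" "op N z w - sc \<mu> w \<in> A"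
      using eigenvector_mod[OF lin_op_op A(1) C'(1) C(2) C'(2)] C'(3)[OF z] by blast
    \<comment> \<open>This eigenspace of \<open>z\<close> is stable because commutators send
      \<open>W\<close> into \<open>A\<close>; the minimality of \<open>C\<close> makes it all of
      \<open>C\<close>.\<close>
    define W' where "W' = {v \<in> C. op N z v - sc \<mu> v \<in> A}"
    have "W' = C"
    proof (rule C_min)
      show "W' \<subseteq> C" "W' \<subseteq> W" using C by (auto simp: W'_def)
      have "A \<subseteq> W'" using C A z by (auto simp: W'_def intro!: vsub_diff vsubD(3))
      then show "A \<subset> W'" using w by (auto simp: W'_def)
      show "stable N L W'"
        unfolding stable_def vsub_def
      proof (intro conjI ballI allI)
        show "0 \<in> W'" using vsubD(1)[OF A(1)] vsubD(1)[OF C'(1)] by (simp add: W'_def lin)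
        show "W' \<subseteq> vecs N" using C' by (auto simp: W'_def)
      next
        fix f g assume fg: "f \<in> W'" "g \<in> W'"
        have "op N z (f + g) - sc \<mu> (f + g) = (op N z f - sc \<mu> f) + (op N z g - sc \<mu> g)"
          by (simp add: lin sc_distrib)
        then show "f + g \<in> W'" using fg vsubD(2)[OF A(1)] vsubD(2)[OF C'(1)] by (simp add: W'_def)
      next
        fix c f assume f: "f \<in> W'"
        have "op N z (sc c f) - sc \<mu> (sc c f) = sc c (op N z f - sc \<mu> f)"
          by (simp add: lin sc_distrib mult.commute)
        then show "sc c f \<in> W'" using f vsubD(3)[OF A(1)] vsubD(3)[OF C'(1)] by (simp add: W'_def)
      next
        fix x f assume x: "x \<in> L" and f: "f \<in> W'"
        have "op N (z * x - x * z) f - sc (\<nu> (z * x - x * z)) f \<in> A"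
          using br[OF z x] f C(3) by (auto simp: W'_def W_def)
        then have c: "op N (z * x - x * z) f \<in> A" by (simp add: comm_0[OF z x])
        have "op N z (op N x f) - sc \<mu> (op N x f) = op N x (op N z f - sc \<mu> f) + op N (z * x - x * z) f"
          using opb[OF z x, of f] by (simp add: lin)
        then show "op N x f \<in> W'"
          using f c x A C' by (auto simp: W'_def intro!: vsubD(2)[OF A(1)])
      qed
    qed
    then show ?thesis by (auto simp: W'_def)
  qed
  obtain v where v: "v \<in> C" "v \<notin> A" using C(2) by auto
  then have "v \<in> B - A" using C(3) by (auto simp: W_def)
  then show ?case using scalar v(1) by blast
qed

section \<open>Borel subalgebras of the symplectic Lie algebra\<close>

lemma sum_split2: "(\<Sum>k<2 * n. F k) = (\<Sum>k<n. F k) + (\<Sum>k<n. F (n + k))" for F :: "nat \<Rightarrow> 'a::comm_monoid_add"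
proof -
  have "(\<Sum>k<n + m. F k) = (\<Sum>k<n. F k) + (\<Sum>k<m. F (n + k))" for m
    by (induction m) (auto simp: add.assoc)
  from this[of n] show ?thesis by (simp add: mult_2)
qed

definition \<omega> :: "nat \<Rightarrow> (nat \<Rightarrow> complex) \<Rightarrow> (nat \<Rightarrow> complex) \<Rightarrow> complex" where
  "\<omega> n f h = (\<Sum>i<n. f i * h (n + i) - f (n + i) * h i)"

lemma \<omega>_linear:
  "\<omega> n (f + f') h = \<omega> n f h + \<omega> n f' h" "\<omega> n h (f + f') = \<omega> n h f + \<omega> n h f'"
  "\<omega> n (f - f') h = \<omega> n f h - \<omega> n f' h" "\<omega> n h (f - f') = \<omega> n h f - \<omega> n h f'"
  "\<omega> n (sc c f) h = c * \<omega> n f h" "\<omega> n h (sc c f) = c * \<omega> n h f" "\<omega> n 0 h = 0" "\<omega> n h 0 = 0"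
  by (simp_all add: \<omega>_def vec_ext sum_distrib_left sum.distrib[symmetric] sum_subtractf[symmetric] algebra_simps)

lemma \<omega>_sum:
  "\<omega> n (\<Sum>l\<in>A. F l) h = (\<Sum>l\<in>A. \<omega> n (F l) h)" "\<omega> n h (\<Sum>l\<in>A. F l) = (\<Sum>l\<in>A. \<omega> n h (F l))"
  by (induction A rule: infinite_finite_induct) (simp_all add: \<omega>_linear)

lemma \<omega>_antisym: "\<omega> n f h = - \<omega> n h f"
  by (simp add: \<omega>_def sum_negf[symmetric] algebra_simps)

lemma \<omega>_self: "\<omega> n f f = 0"
  by (simp add: \<omega>_def mult.commute)

lemma index_sp_form:
  assumes x: "x \<in> carrier_mat (2 * n) (2 * n)" and a: "a < 2 * n" and b: "b < 2 * n"
  shows "(transpose_mat x * symp_form n + symp_form n * x) $$ (a, b)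
    = (if b < n then - x $$ (n + b, a) else x $$ (b - n, a))
      + (if a < n then x $$ (n + a, b) else - x $$ (a - n, b))"
proof -
  have J: "symp_form n \<in> carrier_mat (2 * n) (2 * n)" by (simp add: symp_form_def mult_2)
  have Jab: "symp_form n $$ (k, b) = (if b < n \<and> k = n + b then -1 else if n \<le> b \<and> k = b - n then 1 else 0)"
    if "k < 2 * n" "b < 2 * n" for k b
    using that by (auto simp: symp_form_def)
  have "(transpose_mat x * symp_form n) $$ (a, b) = (\<Sum>k<2 * n. x $$ (k, a) * symp_form n $$ (k, b))"
    using x J a b by (auto simp: scalar_prod_def lessThan_atLeast0)
  also have "\<dots> = (\<Sum>k<2 * n. if k = (if b < n then n + b else b - n)
      then (if b < n then - x $$ (n + b, a) else x $$ (b - n, a)) else 0)"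
    using b by (intro sum.cong refl) (auto simp: Jab)
  also have "\<dots> = (if b < n then - x $$ (n + b, a) else x $$ (b - n, a))"
    using b by (subst sum.delta) auto
  finally have 1: "(transpose_mat x * symp_form n) $$ (a, b) = \<dots>" .
  have "(symp_form n * x) $$ (a, b) = (\<Sum>k<2 * n. symp_form n $$ (a, k) * x $$ (k, b))"
    using x J a b by (auto simp: scalar_prod_def lessThan_atLeast0)
  also have "\<dots> = (\<Sum>k<2 * n. if k = (if a < n then n + a else a - n)
      then (if a < n then x $$ (n + a, b) else - x $$ (a - n, b)) else 0)"
    using a by (intro sum.cong refl) (auto simp: Jab)
  also have "\<dots> = (if a < n then x $$ (n + a, b) else - x $$ (a - n, b))"
    using a by (subst sum.delta) auto
  finally have 2: "(symp_form n * x) $$ (a, b) = \<dots>" .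
  show ?thesis using 1 2 x J a b by simp
qed

lemma sp_iff:
  "x \<in> sp n \<longleftrightarrow> x \<in> carrier_mat (2 * n) (2 * n) \<and>
    (\<forall>i<n. \<forall>j<n. x $$ (n + i, n + j) = - x $$ (j, i) \<and> x $$ (i, n + j) = x $$ (j, n + i) \<and>
      x $$ (n + i, j) = x $$ (n + j, i))" (is "_ \<longleftrightarrow> ?c \<and> ?R")
proof -
  have "transpose_mat x * symp_form n + symp_form n * x = 0\<^sub>m (2 * n) (2 * n) \<longleftrightarrow> ?R" if x: ?c
  proof
    assume eq: "transpose_mat x * symp_form n + symp_form n * x = 0\<^sub>m (2 * n) (2 * n)"
    have e: "(if b < n then - x $$ (n + b, a) else x $$ (b - n, a))
      + (if a < n then x $$ (n + a, b) else - x $$ (a - n, b)) = 0" if "a < 2 * n" "b < 2 * n" for a b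
      using index_sp_form[OF x that] that unfolding eq by simp
    show ?R
    proof (intro allI impI conjI)
      fix i j assume ij: "i < n" "j < n"
      show "x $$ (n + i, n + j) = - x $$ (j, i)" using e[of i "n + j"] ij by (simp add: add_eq_0_iff)
      show "x $$ (i, n + j) = x $$ (j, n + i)" using e[of "n + i" "n + j"] ij by simp
      show "x $$ (n + i, j) = x $$ (n + j, i)" using e[of i j] ij by simp
    qed
  next
    assume R: ?R
    have J: "symp_form n \<in> carrier_mat (2 * n) (2 * n)" by (simp add: symp_form_def mult_2)
    show "transpose_mat x * symp_form n + symp_form n * x = 0\<^sub>m (2 * n) (2 * n)"
    proof (rule eq_matI)
      fix a b assume "a < dim_row (0\<^sub>m (2 * n) (2 * n) :: complex mat)"
        "b < dim_col (0\<^sub>m (2 * n) (2 * n) :: complex mat)"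
      then have ab: "a < 2 * n" "b < 2 * n" by auto
      have "a < n \<or> (\<exists>i<n. a = n + i)" "b < n \<or> (\<exists>i<n. b = n + i)"
        using ab by (auto intro: exI[of _ "a - n"] exI[of _ "b - n"])
      then show "(transpose_mat x * symp_form n + symp_form n * x) $$ (a, b) = 0\<^sub>m (2 * n) (2 * n) $$ (a, b)"
        unfolding index_sp_form[OF x ab] using R ab by auto
    qed (use x J in auto)
  qed
  then show ?thesis by (auto simp: sp_def)
qed

lemma \<omega>_op:
  assumes "x \<in> sp n"
  shows "\<omega> n (op (2 * n) x f) h + \<omega> n f (op (2 * n) x h) = 0"
proof -
  have x: "x $$ (n + i, n + j) = - x $$ (j, i)" "x $$ (i, n + j) = x $$ (j, n + i)"
      "x $$ (n + i, j) = x $$ (n + j, i)" if "i < n" "j < n" for i j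
    using assms that by (auto simp: sp_iff)
  have "\<omega> n (op (2 * n) x f) h = (\<Sum>i<n. \<Sum>j<n. (x $$ (i, j) * f j + x $$ (i, n + j) * f (n + j)) * h (n + i)
      - (x $$ (n + i, j) * f j + x $$ (n + i, n + j) * f (n + j)) * h i)"
    by (simp add: \<omega>_def op_def sum_split2 sum_distrib_right sum_subtractf sum.distrib distrib_right)
  moreover have "\<omega> n f (op (2 * n) x h) = (\<Sum>j<n. \<Sum>i<n. f j * (x $$ (n + j, i) * h i + x $$ (n + j, n + i) * h (n + i))
      - f (n + j) * (x $$ (j, i) * h i + x $$ (j, n + i) * h (n + i)))"
    by (simp add: \<omega>_def op_def sum_split2 sum_distrib_left sum_subtractf sum.distrib distrib_left)
  moreover have "\<dots> = (\<Sum>i<n. \<Sum>j<n. f j * (x $$ (n + j, i) * h i + x $$ (n + j, n + i) * h (n + i))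
      - f (n + j) * (x $$ (j, i) * h i + x $$ (j, n + i) * h (n + i)))"
    by (rule sum.swap)
  \<comment> \<open>With the summation order exchanged in the second sum, the terms cancel for each
    index pair separately.\<close>
  moreover have "(\<Sum>i<n. \<Sum>j<n. (x $$ (i, j) * f j + x $$ (i, n + j) * f (n + j)) * h (n + i)
        - (x $$ (n + i, j) * f j + x $$ (n + i, n + j) * f (n + j)) * h i)
      + (\<Sum>i<n. \<Sum>j<n. f j * (x $$ (n + j, i) * h i + x $$ (n + j, n + i) * h (n + i))
        - f (n + j) * (x $$ (j, i) * h i + x $$ (j, n + i) * h (n + i))) = 0"
    unfolding sum.distrib[symmetric]
  proof (intro sum.neutral ballI)
    fix i j assume "i \<in> {..<n}" "j \<in> {..<n}"
    then have ij: "i < n" "j < n" by auto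
    have "x $$ (n + j, n + i) = - x $$ (i, j)" "x $$ (n + i, n + j) = - x $$ (j, i)"
      "x $$ (j, n + i) = x $$ (i, n + j)" "x $$ (n + j, i) = x $$ (n + i, j)"
      using x[OF ij] x[OF ij(2,1)] by auto
    then show "(x $$ (i, j) * f j + x $$ (i, n + j) * f (n + j)) * h (n + i)
        - (x $$ (n + i, j) * f j + x $$ (n + i, n + j) * f (n + j)) * h i
        + (f j * (x $$ (n + j, i) * h i + x $$ (n + j, n + i) * h (n + i))
        - f (n + j) * (x $$ (j, i) * h i + x $$ (j, n + i) * h (n + i))) = 0"
      by (simp only:) (simp add: algebra_simps)
  qed
  ultimately show ?thesis by simp
qed

definition unit :: "nat \<Rightarrow> nat \<Rightarrow> complex" where
  "unit k = (\<lambda>i. if i = k then 1 else 0)"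

lemma unit_vecs: "k < N \<Longrightarrow> unit k \<in> vecs N"
  by (auto simp: unit_def vecs_def)

lemma op_unit: "k < N \<Longrightarrow> op N x (unit k) i = (if i < N then x $$ (i, k) else 0)"
  by (simp add: op_def unit_def if_distrib[of "\<lambda>c. _ * c"] cong: if_cong)

lemma \<omega>_unit: "k < n \<Longrightarrow> \<omega> n (unit k) h = h (n + k)" "k < n \<Longrightarrow> \<omega> n (unit (n + k)) h = - h k"
  by (simp_all add: \<omega>_def unit_def if_distrib[of "\<lambda>c. c * _"] if_distrib[of "\<lambda>c. _ - c"] cong: if_cong)

lemma sp_if_\<omega>:
  assumes x: "x \<in> carrier_mat (2 * n) (2 * n)"
    and inv: "\<And>f h. f \<in> vecs (2 * n) \<Longrightarrow> h \<in> vecs (2 * n) \<Longrightarrow>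
      \<omega> n (op (2 * n) x f) h + \<omega> n f (op (2 * n) x h) = 0"
  shows "x \<in> sp n"
  unfolding sp_iff
proof (intro conjI allI impI x)
  fix i j assume ij: "i < n" "j < n"
  have u: "\<omega> n (op (2 * n) x (unit a)) (unit b) + \<omega> n (unit a) (op (2 * n) x (unit b)) = 0"
    if "a < 2 * n" "b < 2 * n" for a b
    using that by (intro inv unit_vecs)
  have sw: "\<omega> n f (unit i) = - f (n + i)" "\<omega> n f (unit (n + i)) = f i" if "i < n" for f i
    using that \<omega>_antisym[of n f] by (simp_all add: \<omega>_unit)
  show "x $$ (n + i, n + j) = - x $$ (j, i)"
    using u[of i "n + j"] ij by (simp add: sw \<omega>_unit op_unit add_eq_0_iff)
  show "x $$ (i, n + j) = x $$ (j, n + i)"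
    using u[of "n + i" "n + j"] ij by (simp add: sw \<omega>_unit op_unit)
  show "x $$ (n + i, j) = x $$ (n + j, i)"
    using u[of i j] ij by (simp add: sw \<omega>_unit op_unit)
qed

lemma nonzero_solution:
  fixes a :: "nat \<Rightarrow> nat \<Rightarrow> complex"
  assumes "m < N"
  obtains w where "w \<in> vecs N" "w \<noteq> 0" "\<And>l. l < m \<Longrightarrow> (\<Sum>i<N. a l i * w i) = 0"
proof -
  \<comment> \<open>The system is padded with zero rows to a square one. The last row is zero, so
    every Leibniz term of the determinant vanishes.\<close>
  define A where "A = mat N N (\<lambda>(l, i). if l < m then a l i else 0)"
  have A: "A \<in> carrier_mat N N" by (simp add: A_def)
  have "(\<Prod>i = 0..<N. A $$ (i, p i)) = 0" if p: "p permutes {0..<N}" for p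
  proof -
    have "p (N - 1) < N" using permutes_in_image[OF p, of "N - 1"] assms by auto
    then have "A $$ (N - 1, p (N - 1)) = 0" using assms by (simp add: A_def)
    then show ?thesis using assms by (intro prod_zero bexI[of _ "N - 1"]) auto
  qed
  then have "det A = 0" unfolding det_def'[OF A] by (intro sum.neutral) simp
  then obtain v where v: "v \<in> carrier_vec N" "v \<noteq> 0\<^sub>v N" "A *\<^sub>v v = 0\<^sub>v N"
    using det_0_iff_vec_prod_zero[OF A] by blast
  define w where "w i = (if i < N then v $ i else 0)" for i
  have "w \<in> vecs N" by (simp add: w_def vecs_def)
  moreover have "w \<noteq> 0"
  proof
    assume "w = 0"
    then have "v $ i = 0" if "i < N" for i using that by (simp add: w_def vec_ext) meson
    then show False using v(1,2) by (auto intro: eq_vecI)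
  qed
  moreover have "(\<Sum>i<N. a l i * w i) = 0" if "l < m" for l
  proof -
    have "0 = (A *\<^sub>v v) $ l" using v(3) that assms by simp
    also have "\<dots> = (\<Sum>i<N. A $$ (l, i) * v $ i)"
      using A v(1) that assms by (auto simp: scalar_prod_def lessThan_atLeast0)
    also have "\<dots> = (\<Sum>i<N. a l i * w i)"
      using that assms by (intro sum.cong) (auto simp: A_def w_def)
    finally show ?thesis by simp
  qed
  ultimately show ?thesis using that by blast
qed

subsection \<open>A symplectic basis adapted to a solvable subalgebra\<close>

definition lspan :: "(nat \<Rightarrow> nat \<Rightarrow> complex) \<Rightarrow> nat \<Rightarrow> (nat \<Rightarrow> complex) set" where
  "lspan f k = {\<Sum>l<k. sc (c l) (f l) | c. True}"

lemma lspanI: "(\<Sum>l<k. sc (c l) (f l)) \<in> lspan f k"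
  by (auto simp: lspan_def)

lemma lspanE: assumes "u \<in> lspan f k" obtains c where "u = (\<Sum>l<k. sc (c l) (f l))"
  using assms by (auto simp: lspan_def)

lemma vsub_lspan: "vsub (lspan f k)"
  unfolding vsub_def
proof (intro conjI ballI allI)
  show "0 \<in> lspan f k" using lspanI[where c = "\<lambda>_. 0" and f = f and k = k] by simp
next
  fix u v assume "u \<in> lspan f k" "v \<in> lspan f k"
  then obtain c d where "u = (\<Sum>l<k. sc (c l) (f l))" "v = (\<Sum>l<k. sc (d l) (f l))" by (elim lspanE)
  then have "u + v = (\<Sum>l<k. sc (c l + d l) (f l))" by (simp add: sc_distrib sum.distrib)
  then show "u + v \<in> lspan f k" using lspanI[where c = "\<lambda>l. c l + d l"] by simp
next
  fix a u assume "u \<in> lspan f k"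
  then obtain c where u: "u = (\<Sum>l<k. sc (c l) (f l))" by (elim lspanE)
  have "sc a (\<Sum>l\<in>A. F l) = (\<Sum>l\<in>A. sc a (F l))" for A :: "nat set" and F
    by (induction A rule: infinite_finite_induct) (simp_all add: sc_distrib)
  then have "sc a u = (\<Sum>l<k. sc (a * c l) (f l))" by (simp add: u)
  then show "sc a u \<in> lspan f k" using lspanI[where c = "\<lambda>l. a * c l"] by simp
qed

lemma lspan_base: "l < k \<Longrightarrow> f l \<in> lspan f k"
proof -
  assume "l < k"
  then have "f l = (\<Sum>i<k. if i = l then f l else 0)" by simp
  also have "\<dots> = (\<Sum>i<k. sc (if i = l then 1 else 0) (f i))" by (intro sum.cong) auto
  finally show ?thesis using lspanI[where c = "\<lambda>i. if i = l then 1 else 0"] by simp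
qed

lemma lspan_subset:
  assumes "vsub W" "\<And>l. l < k \<Longrightarrow> f l \<in> W" shows "lspan f k \<subseteq> W"
proof -
  have "(\<Sum>l<k. sc (c l) (f l)) \<in> W" for c
    using assms(2)
  proof (induction k)
    case (Suc k)
    then show ?case using vsubD(2,3)[OF assms(1)] by simp
  qed (use vsubD(1)[OF assms(1)] in simp)
  then show ?thesis by (auto simp: lspan_def)
qed

lemma lspan_cong: "(\<And>l. l < k \<Longrightarrow> f l = f' l) \<Longrightarrow> lspan f k = lspan f' k"
  by (simp add: lspan_def)

lemma vsub_vecs: "vsub (vecs N)"
  by (auto simp: vsub_def vecs_def vec_ext)

lemma lin_op_sum: "lin_op T \<Longrightarrow> T (\<Sum>l\<in>A. F l) = (\<Sum>l\<in>A. T (F l))"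
  by (induction A rule: infinite_finite_induct) (simp_all add: lin_opD)

text \<open>Half of a symplectic basis spans a flag stable under \<open>L\<close>; the dual half
  \<open>f'\<close> carries no stability condition and only completes the basis.\<close>

definition symp_flag ::
  "nat \<Rightarrow> complex mat set \<Rightarrow> nat \<Rightarrow> (nat \<Rightarrow> nat \<Rightarrow> complex) \<Rightarrow> (nat \<Rightarrow> nat \<Rightarrow> complex) \<Rightarrow> bool" where
  "symp_flag n L k f f' \<longleftrightarrow> (\<forall>i<k. f i \<in> vecs (2 * n) \<and> f' i \<in> vecs (2 * n) \<and>
     (\<forall>x\<in>L. op (2 * n) x (f i) \<in> lspan f (Suc i)) \<and>
     (\<forall>j<k. \<omega> n (f i) (f j) = 0 \<and> \<omega> n (f' i) (f' j) = 0 \<and> \<omega> n (f i) (f' j) = (if i = j then 1 else 0)))"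

lemma \<omega>_nondegenerate:
  assumes "f \<in> vecs (2 * n)" "f \<noteq> 0"
  obtains u where "u \<in> vecs (2 * n)" "\<omega> n f u = 1"
proof -
  obtain k where k: "f k \<noteq> 0" using assms(2) by (auto simp: vec_ext)
  then have "k < 2 * n" using assms(1) by (auto simp: vecs_def not_less[symmetric])
  have "\<exists>u\<in>vecs (2 * n). \<omega> n f u \<noteq> 0"
  proof (cases "k < n")
    case True
    then have "\<omega> n f (unit (n + k)) = f k" using \<omega>_antisym[of n f] by (simp add: \<omega>_unit)
    then show ?thesis using k True by (intro bexI[of _ "unit (n + k)"]) (auto intro: unit_vecs)
  next
    case False
    then obtain l where l: "k = n + l" "l < n" using \<open>k < 2 * n\<close>
      by (metis add_less_cancel_left le_add_diff_inverse mult_2 not_less)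
    then have "\<omega> n f (unit l) = - f k" using \<omega>_antisym[of n f] by (simp add: \<omega>_unit)
    then show ?thesis using k l by (intro bexI[of _ "unit l"]) (auto intro: unit_vecs)
  qed
  then obtain u where u: "u \<in> vecs (2 * n)" "\<omega> n f u \<noteq> 0" by auto
  then have "\<omega> n f (sc (1 / \<omega> n f u) u) = 1" by (simp add: \<omega>_linear)
  then show ?thesis using that u(1) vsubD(3)[OF vsub_vecs] by blast
qed

text \<open>Lie's theorem is applied between the isotropic span \<open>A\<close> of the vectors
  found so far and its orthogonal space \<open>B\<close>, which is stable because \<open>L\<close>
  preserves the form infinitesimally. Taking the new vector from \<open>B\<close> keeps the flag
  isotropic.\<close>

lemma symp_flag_step:
  assumes fl: "symp_flag n L k f f'" and k: "k < n" and L: "lie_subalgebra (2 * n) L" "L \<subseteq> sp n"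
    and solv: "derived_series (2 * n) L d = {0\<^sub>m (2 * n) (2 * n)}"
  obtains v v' where "symp_flag n L (Suc k) (f(k := v)) (f'(k := v'))"
proof -
  let ?N = "2 * n"
  have f: "\<And>i. i < k \<Longrightarrow> f i \<in> vecs ?N" "\<And>i. i < k \<Longrightarrow> f' i \<in> vecs ?N"
    and flag: "\<And>i x. i < k \<Longrightarrow> x \<in> L \<Longrightarrow> op ?N x (f i) \<in> lspan f (Suc i)"
    and \<omega>: "\<And>i j. i < k \<Longrightarrow> j < k \<Longrightarrow> \<omega> n (f i) (f j) = 0"
      "\<And>i j. i < k \<Longrightarrow> j < k \<Longrightarrow> \<omega> n (f' i) (f' j) = 0"
      "\<And>i j. i < k \<Longrightarrow> j < k \<Longrightarrow> \<omega> n (f i) (f' j) = (if i = j then 1 else 0)"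
    using fl by (auto simp: symp_flag_def)
  have \<omega>': "\<omega> n (f' i) (f j) = (if i = j then -1 else 0)" if "i < k" "j < k" for i j
    using \<omega>_antisym[of n "f' i" "f j"] \<omega>(3)[OF that(2,1)] by auto
  have del: "(\<Sum>j<k. a j * (if j = i then c else 0)) = a i * c" "(\<Sum>j<k. a j * (if i = j then c else 0)) = a i * c"
    if "i < k" for a and i and c :: complex
    using that by (simp_all add: if_distrib[of "\<lambda>c. _ * c"] cong: if_cong)
  define A where "A = lspan f k"
  define B where "B = {w \<in> vecs ?N. \<forall>l<k. \<omega> n (f l) w = 0}"
  have A: "vsub A" "A \<subseteq> vecs ?N" unfolding A_def by (auto intro: vsub_lspan lspan_subset[OF vsub_vecs, THEN subsetD] f)
  have B: "vsub B" using vsub_vecs[of ?N] by (auto simp: B_def vsub_def \<omega>_linear)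
  have fA: "f i \<in> A" if "i < k" for i unfolding A_def by (rule lspan_base[OF that])
  have LA: "op ?N x u \<in> A" if x: "x \<in> L" and u: "u \<in> A" for x u
  proof -
    obtain c where c: "u = (\<Sum>l<k. sc (c l) (f l))" using u unfolding A_def by (elim lspanE)
    have "op ?N x (f l) \<in> A" if l: "l < k" for l
    proof -
      have "lspan f (Suc l) \<subseteq> A" using l by (intro lspan_subset A fA) auto
      then show ?thesis using flag[OF l x] by blast
    qed
    then have "lspan (\<lambda>l. op ?N x (f l)) k \<subseteq> A" by (intro lspan_subset A)
    moreover have "op ?N x u = (\<Sum>l<k. sc (c l) (op ?N x (f l)))"
      unfolding c lin_op_sum[OF lin_op_op] by (simp add: lin_opD[OF lin_op_op])
    ultimately show ?thesis using lspanI[where f = "\<lambda>l. op ?N x (f l)" and c = c and k = k] by auto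
  qed
  have A\<omega>: "\<omega> n u w = 0" if "u \<in> A" "w \<in> B" for u w
    using that by (auto simp: A_def B_def \<omega>_sum \<omega>_linear elim!: lspanE)
  have "stable ?N L A" using A LA by (auto simp: stable_def)
  moreover have "stable ?N L B"
    unfolding stable_def
  proof (intro conjI ballI B)
    show "B \<subseteq> vecs ?N" by (auto simp: B_def)
    fix x w assume x: "x \<in> L" and w: "w \<in> B"
    have "\<omega> n (f l) (op ?N x w) = 0" if l: "l < k" for l
      using \<omega>_op[of x n "f l" w] x L(2) A\<omega>[OF LA[OF x fA[OF l]] w] by auto
    then show "op ?N x w \<in> B" by (simp add: B_def)
  qed
  moreover have "A \<subset> B"
  proof
    show "A \<subseteq> B" unfolding A_def using f \<omega> by (intro lspan_subset B) (auto simp: B_def)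
    \<comment> \<open>The coefficients of the 2k equations saying that \<open>w\<close> is
      orthogonal to all \<open>f l\<close> and \<open>f' l\<close>. As 2k < 2n there is a nonzero
      solution; it is in \<open>B\<close>, and pairing with the \<open>f' l\<close> shows that it is
      not in \<open>A\<close>.\<close>
    define a where "a l i = (if l < k then if i < n then - f l (n + i) else f l (i - n)
      else if i < n then - f' (l - k) (n + i) else f' (l - k) (i - n))" for l i
    obtain w where w: "w \<in> vecs ?N" "w \<noteq> 0" "\<And>l. l < 2 * k \<Longrightarrow> (\<Sum>i<?N. a l i * w i) = 0"
      using nonzero_solution[of "2 * k" ?N a] k by auto
    have "\<omega> n (f l) w = 0" "\<omega> n (f' l) w = 0" if "l < k" for l
      using w(3)[of l] w(3)[of "k + l"] that
      by (simp_all add: sum_split2 a_def \<omega>_def sum_subtractf sum_negf)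
    note \<omega>w = this
    have "w \<notin> A"
    proof
      assume "w \<in> A"
      then obtain c where c: "w = (\<Sum>l<k. sc (c l) (f l))" unfolding A_def by (elim lspanE)
      have "c l = 0" if "l < k" for l
        using \<omega>w(2)[OF that] that unfolding c \<omega>_sum by (simp add: \<omega>_linear \<omega>' del)
      then have "w = 0" unfolding c by simp
      then show False using w(2) by simp
    qed
    moreover have "w \<in> B" using w \<omega>w by (simp add: B_def)
    ultimately show "A \<noteq> B" by blast
  qed
  ultimately obtain v0 where v0: "v0 \<in> B" "v0 \<notin> A" "\<forall>x\<in>L. \<exists>\<mu>. op ?N x v0 - sc \<mu> v0 \<in> A"
    using lie_theorem[OF L(1) solv] by blast
  \<comment> \<open>The correction makes \<open>v\<close> orthogonal to the \<open>f' j\<close>. It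
    lies in \<open>A\<close>, so \<open>v\<close> is still an eigenvector modulo \<open>A\<close>
    and outside \<open>A\<close>.\<close>
  define s where "s = (\<Sum>j<k. sc (\<omega> n v0 (f' j)) (f j))"
  have s: "s \<in> A" unfolding s_def A_def by (rule lspanI)
  define v where "v = v0 - s"
  have AB: "A \<subseteq> B" unfolding A_def using f \<omega> by (intro lspan_subset B) (auto simp: B_def)
  have vB: "v \<in> B" using v0 s AB by (auto simp: v_def intro!: vsub_diff B)
  have vN: "v \<in> vecs ?N" using vB by (simp add: B_def)
  have v_f: "\<omega> n (f l) v = 0" "\<omega> n v (f l) = 0" if "l < k" for l
    using vB that \<omega>_antisym[of n v "f l"] by (auto simp: B_def)
  have v_f': "\<omega> n v (f' l) = 0" "\<omega> n (f' l) v = 0" if "l < k" for l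
  proof -
    show "\<omega> n v (f' l) = 0"
      using that by (simp add: v_def s_def \<omega>_linear \<omega>_sum \<omega> del)
    then show "\<omega> n (f' l) v = 0" using \<omega>_antisym[of n "f' l" v] by simp
  qed
  have "v \<noteq> 0" using v0(2) s by (auto simp: v_def)
  then obtain u where u: "u \<in> vecs ?N" "\<omega> n v u = 1" using \<omega>_nondegenerate[OF vN] by blast
  \<comment> \<open>Symplectic Gram-Schmidt. The signs of the two corrections differ because the
    form takes the value 1 on \<open>f j\<close>, \<open>f' j\<close> and -1 in the opposite
    order.\<close>
  define v' where "v' = u - (\<Sum>j<k. sc (\<omega> n u (f' j)) (f j)) + (\<Sum>j<k. sc (\<omega> n u (f j)) (f' j))"
  have vv': "\<omega> n v v' = 1" by (simp add: v'_def \<omega>_linear \<omega>_sum v_f v_f' u)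
  have v'_f: "\<omega> n v' (f l) = 0" "\<omega> n (f l) v' = 0" if "l < k" for l
  proof -
    show "\<omega> n v' (f l) = 0"
      using that by (simp add: v'_def \<omega>_linear \<omega>_sum \<omega> \<omega>' del)
    then show "\<omega> n (f l) v' = 0" using \<omega>_antisym[of n "f l" v'] by simp
  qed
  have v'_f': "\<omega> n v' (f' l) = 0" "\<omega> n (f' l) v' = 0" if "l < k" for l
  proof -
    show "\<omega> n v' (f' l) = 0"
      using that by (simp add: v'_def \<omega>_linear \<omega>_sum \<omega> \<omega>' del)
    then show "\<omega> n (f' l) v' = 0" using \<omega>_antisym[of n "f' l" v'] by simp
  qed
  have sumN: "(\<Sum>j<k. sc (c j) (F j)) \<in> vecs ?N" if "\<And>j. j < k \<Longrightarrow> F j \<in> vecs ?N" for c F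
    using lspan_subset[of "vecs ?N" k F, OF vsub_vecs that] lspanI[of c F k] by auto
  have v'N: "v' \<in> vecs ?N"
    unfolding v'_def using f u by (intro vsubD(2)[OF vsub_vecs] vsub_diff[OF vsub_vecs] sumN) auto
  have "op ?N x v \<in> lspan (f(k := v)) (Suc k)" if x: "x \<in> L" for x
  proof -
    let ?S = "lspan (f(k := v)) (Suc k)"
    obtain \<mu> where \<mu>: "op ?N x v0 - sc \<mu> v0 \<in> A" using v0(3) x by blast
    have AS: "A \<subseteq> ?S"
      unfolding A_def
    proof (rule lspan_subset[OF vsub_lspan])
      fix l assume "l < k"
      then show "f l \<in> ?S" using lspan_base[of l "Suc k" "f(k := v)"] by simp
    qed
    have vS: "v \<in> ?S" using lspan_base[of k "Suc k" "f(k := v)"] by simp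
    define a where "a = (op ?N x v0 - sc \<mu> v0) - op ?N x s + sc \<mu> s"
    have "a \<in> ?S"
      using vsubD(2)[OF A(1) vsub_diff[OF A(1) \<mu> LA[OF x s]] vsubD(3)[OF A(1) s]] AS by (auto simp: a_def)
    then have "a + sc \<mu> v \<in> ?S" by (rule vsubD(2)[OF vsub_lspan _ vsubD(3)[OF vsub_lspan vS]])
    moreover have "op ?N x v = a + sc \<mu> v"
      by (simp add: v_def a_def lin_opD[OF lin_op_op] sc_distrib)
    ultimately show ?thesis by simp
  qed
  moreover have "op ?N x (f i) \<in> lspan (f(k := v)) (Suc i)" if "i < k" "x \<in> L" for i x
    using flag[OF that] that lspan_cong[of "Suc i" f "f(k := v)"] by auto
  ultimately have "symp_flag n L (Suc k) (f(k := v)) (f'(k := v'))"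
    using f \<omega> vN v'N vv' v_f v_f' v'_f v'_f'
    unfolding symp_flag_def by (auto simp: less_Suc_eq \<omega>_self)
  then show ?thesis by (rule that)
qed

lemma symp_flag_exists:
  assumes "lie_subalgebra (2 * n) L" "L \<subseteq> sp n"
    "derived_series (2 * n) L d = {0\<^sub>m (2 * n) (2 * n)}" "k \<le> n"
  shows "\<exists>f f'. symp_flag n L k f f'"
  using assms(4)
proof (induction k)
  case 0 show ?case by (simp add: symp_flag_def)
next
  case (Suc k)
  then obtain f f' where "symp_flag n L k f f'" by auto
  from symp_flag_step[OF this _ assms(1-3)] Suc.prems show ?case by (metis Suc_le_eq)
qed

subsection \<open>The standard form of a Borel subalgebra\<close>

lemma sum_fun_apply: "(\<Sum>l\<in>A. F l) i = (\<Sum>l\<in>A. F l i)" for F :: "'b \<Rightarrow> nat \<Rightarrow> complex"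
  by (induction A rule: infinite_finite_induct) (simp_all add: vec_ext)

lemma vecs_expand: assumes "u \<in> vecs N" shows "u = (\<Sum>k<N. sc (u k) (unit k))"
proof
  fix i
  have "(\<Sum>k<N. sc (u k) (unit k)) i = (\<Sum>k<N. if k = i then u i else 0)"
    unfolding sum_fun_apply by (intro sum.cong) (auto simp: sc_apply unit_def)
  then show "u i = (\<Sum>k<N. sc (u k) (unit k)) i" using assms by (auto simp: vecs_def)
qed

lemma op_one: "u \<in> vecs N \<Longrightarrow> op N (1\<^sub>m N) u = u"
proof
  fix i assume u: "u \<in> vecs N"
  show "op N (1\<^sub>m N) u i = u i"
  proof (cases "i < N")
    case True
    have "(\<Sum>j<N. 1\<^sub>m N $$ (i, j) * u j) = (\<Sum>j<N. if j = i then u i else 0)"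
      using True by (intro sum.cong) auto
    then show ?thesis using True by (simp add: op_def)
  qed (use u in \<open>simp add: op_def vecs_def\<close>)
qed

lemma index_op: "i < N \<Longrightarrow> j < N \<Longrightarrow> x $$ (i, j) = op N x (unit j) i"
  by (simp add: op_unit)

lemma mat_eq_if_op:
  assumes "x \<in> carrier_mat N N" "y \<in> carrier_mat N N" "\<And>j. j < N \<Longrightarrow> op N x (unit j) = op N y (unit j)"
  shows "x = y"
  using assms by (intro eq_matI) (auto simp: index_op[of _ N])

section \<open>Conjugation and the triangular filtration\<close>

locale conj_mat =
  fixes N :: nat and g gi :: "complex mat"
  assumes g: "g \<in> carrier_mat N N" and gi: "gi \<in> carrier_mat N N"
    and gi_g: "gi * g = 1\<^sub>m N" and g_gi: "g * gi = 1\<^sub>m N"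
begin

abbreviation "C \<equiv> carrier_mat N N :: complex mat set"

text \<open>\<open>w\<close> passes to the coordinates of the adapted basis, and \<open>w'\<close>
  returns to the given ones; both preserve products and therefore brackets.\<close>

definition w :: "complex mat \<Rightarrow> complex mat" where "w x = gi * x * g"
definition w' :: "complex mat \<Rightarrow> complex mat" where "w' y = g * y * gi"

lemma assoc: "a \<in> C \<Longrightarrow> b \<in> C \<Longrightarrow> c \<in> C \<Longrightarrow> a * b * c = a * (b * c)"
  by (rule assoc_mult_mat)

lemma mC [simp]: "a \<in> C \<Longrightarrow> b \<in> C \<Longrightarrow> a * b \<in> C"
  by (rule mult_carrier_mat)

lemma w_C [simp]: "x \<in> C \<Longrightarrow> w x \<in> C" and w'_C [simp]: "x \<in> C \<Longrightarrow> w' x \<in> C"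
  using g gi by (simp_all add: w_def w'_def)

lemma g_gi_cancel: "a \<in> C \<Longrightarrow> g * (gi * a) = a" "a \<in> C \<Longrightarrow> gi * (g * a) = a"
  using assoc[OF g gi, of a] assoc[OF gi g, of a] by (simp_all add: g_gi gi_g)

lemma w_mult: "x \<in> C \<Longrightarrow> y \<in> C \<Longrightarrow> w (x * y) = w x * w y"
  and w'_mult: "x \<in> C \<Longrightarrow> y \<in> C \<Longrightarrow> w' (x * y) = w' x * w' y"
  using g gi by (simp_all add: w_def w'_def assoc g_gi_cancel)

lemma w_w' [simp]: "x \<in> C \<Longrightarrow> w (w' x) = x" and w'_w [simp]: "x \<in> C \<Longrightarrow> w' (w x) = x"
  using g gi by (simp_all add: w_def w'_def assoc g_gi_cancel g_gi gi_g)

lemma w_add: "x \<in> C \<Longrightarrow> y \<in> C \<Longrightarrow> w (x + y) = w x + w y"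
  and w'_add: "x \<in> C \<Longrightarrow> y \<in> C \<Longrightarrow> w' (x + y) = w' x + w' y"
  using g gi by (simp_all add: w_def w'_def mult_add_distrib_mat[of _ N N] add_mult_distrib_mat[of _ N N])

lemma w_minus: "x \<in> C \<Longrightarrow> y \<in> C \<Longrightarrow> w (x - y) = w x - w y"
  and w'_minus: "x \<in> C \<Longrightarrow> y \<in> C \<Longrightarrow> w' (x - y) = w' x - w' y"
  using g gi by (simp_all add: w_def w'_def mult_minus_distrib_mat[of _ N N] minus_mult_distrib_mat[of _ N N])

lemma w_smult: "x \<in> C \<Longrightarrow> w (c \<cdot>\<^sub>m x) = c \<cdot>\<^sub>m w x"
  and w'_smult: "x \<in> C \<Longrightarrow> w' (c \<cdot>\<^sub>m x) = c \<cdot>\<^sub>m w' x"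
  using g gi by (simp_all add: w_def w'_def mult_smult_distrib[of _ N N] mult_smult_assoc_mat[of _ N N])

lemma w_0: "w (0\<^sub>m N N) = 0\<^sub>m N N" and w'_0: "w' (0\<^sub>m N N) = 0\<^sub>m N N"
  using g gi by (simp_all add: w_def w'_def)

lemma w_bracket: "x \<in> C \<Longrightarrow> y \<in> C \<Longrightarrow> w (x * y - y * x) = w x * w y - w y * w x"
  by (simp add: w_minus w_mult)

lemma mat_subspace_w: assumes "mat_subspace N W" shows "mat_subspace N {x \<in> C. w x \<in> W}"
  using mat_subspaceD[OF assms] by (auto simp: mat_subspace_def w_0 w_add w_smult)

lemma mat_subspace_w': assumes "mat_subspace N W" shows "mat_subspace N {y \<in> C. w' y \<in> W}"
  using mat_subspaceD[OF assms] by (auto simp: mat_subspace_def w'_0 w'_add w'_smult)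

end

definition preserves_\<omega> :: "nat \<Rightarrow> complex mat \<Rightarrow> bool" where
  "preserves_\<omega> n h \<longleftrightarrow> (\<forall>u\<in>vecs (2 * n). \<forall>v\<in>vecs (2 * n). \<omega> n (op (2 * n) h u) (op (2 * n) h v) = \<omega> n u v)"

lemma preserves_\<omega>_inverse:
  assumes "conj_mat (2 * n) h hi" "preserves_\<omega> n h" shows "preserves_\<omega> n hi"
proof -
  interpret conj_mat "2 * n" h hi by fact
  have "op (2 * n) h (op (2 * n) hi u) = u" if "u \<in> vecs (2 * n)" for u
    using that g gi by (simp add: op_mult[symmetric] g_gi op_one)
  then show ?thesis using assms(2) unfolding preserves_\<omega>_def by (metis op_vecs)
qed

lemma sp_carrier: "x \<in> sp n \<Longrightarrow> x \<in> carrier_mat (2 * n) (2 * n)"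
  by (simp add: sp_def)

lemma sp_conj:
  assumes "conj_mat (2 * n) h hi" "preserves_\<omega> n h" "x \<in> sp n"
  shows "hi * x * h \<in> sp n"
proof -
  interpret conj_mat "2 * n" h hi by fact
  let ?o = "op (2 * n)"
  have x: "x \<in> C" using sp_carrier[OF assms(3)] .
  have o: "?o (hi * x * h) u = ?o hi (?o x (?o h u))" for u using g gi x by (simp add: op_mult)
  have inv: "?o h (?o hi u) = u" if "u \<in> vecs (2 * n)" for u
    using that g gi by (simp add: op_mult[symmetric] g_gi op_one)
  have p: "\<omega> n (?o hi a) v = \<omega> n a (?o h v)" "\<omega> n v (?o hi a) = \<omega> n (?o h v) a"
    if "a \<in> vecs (2 * n)" "v \<in> vecs (2 * n)" for a v
    using assms(2) inv[OF that(1)] that(2) unfolding preserves_\<omega>_def by (metis op_vecs)+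
  show ?thesis
  proof (rule sp_if_\<omega>)
    show "hi * x * h \<in> C" using g gi x by simp
    fix u v assume "u \<in> vecs (2 * n)" "v \<in> vecs (2 * n)"
    then show "\<omega> n (?o (hi * x * h) u) v + \<omega> n u (?o (hi * x * h) v) = 0"
      unfolding o using \<omega>_op[OF assms(3)] by (simp add: p)
  qed
qed

lemma mat_subspace_sp: "mat_subspace (2 * n) (sp n)"
  unfolding mat_subspace_def by (auto simp: sp_iff)

lemma sp_bracket: assumes x: "x \<in> sp n" and y: "y \<in> sp n" shows "x * y - y * x \<in> sp n"
proof (rule sp_if_\<omega>)
  have C: "x \<in> carrier_mat (2 * n) (2 * n)" "y \<in> carrier_mat (2 * n) (2 * n)"
    using x y sp_carrier by auto
  then show "x * y - y * x \<in> carrier_mat (2 * n) (2 * n)" by auto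
  fix u v
  have sw: "\<omega> n (op (2 * n) z a) b = - \<omega> n a (op (2 * n) z b)" if "z \<in> sp n" for z a b
    using \<omega>_op[OF that, of a b] by (simp add: add_eq_0_iff2)
  show "\<omega> n (op (2 * n) (x * y - y * x) u) v + \<omega> n u (op (2 * n) (x * y - y * x) v) = 0"
    unfolding op_bracket[OF C] \<omega>_linear by (simp add: sw x y)
qed

definition pos :: "nat \<Rightarrow> nat \<Rightarrow> nat" where
  "pos n i = (if i < n then i else 3 * n - 1 - i)"

text \<open>\<open>pos\<close> lists the isotropic basis vectors first and their dual vectors in
  reverse order after them. In this order \<open>filt n d\<close> consists of the matrices supported
  on the \<open>d\<close>-th superdiagonal and above: triangular for 0, strictly triangular for 1,
  only the zero matrix for 2n.\<close>

definition filt :: "nat \<Rightarrow> nat \<Rightarrow> complex mat set" where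
  "filt n d = {y \<in> carrier_mat (2 * n) (2 * n).
     \<forall>i<2 * n. \<forall>j<2 * n. y $$ (i, j) \<noteq> 0 \<longrightarrow> pos n i + d \<le> pos n j}"

lemma pos_less: "i < 2 * n \<Longrightarrow> pos n i < 2 * n"
  by (auto simp: pos_def)

lemma pos_inj: "i < 2 * n \<Longrightarrow> j < 2 * n \<Longrightarrow> pos n i = pos n j \<Longrightarrow> i = j"
  by (auto simp: pos_def split: if_splits)

lemma filtD: "y \<in> filt n d \<Longrightarrow> i < 2 * n \<Longrightarrow> j < 2 * n \<Longrightarrow> \<not> pos n i + d \<le> pos n j \<Longrightarrow> y $$ (i, j) = 0"
  by (auto simp: filt_def)

lemma filtI: "y \<in> carrier_mat (2 * n) (2 * n) \<Longrightarrow>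
    (\<And>i j. i < 2 * n \<Longrightarrow> j < 2 * n \<Longrightarrow> \<not> pos n i + d \<le> pos n j \<Longrightarrow> y $$ (i, j) = 0) \<Longrightarrow> y \<in> filt n d"
  unfolding filt_def by blast

lemma filt_carrier: "y \<in> filt n d \<Longrightarrow> y \<in> carrier_mat (2 * n) (2 * n)"
  by (simp add: filt_def)

lemma filt_mono: "d \<le> e \<Longrightarrow> filt n e \<subseteq> filt n d"
  by (force simp: filt_def)

lemma mat_subspace_filt: "mat_subspace (2 * n) (filt n d)"
  unfolding mat_subspace_def
proof (intro conjI ballI allI)
  show "filt n d \<subseteq> carrier_mat (2 * n) (2 * n)" using filt_carrier by blast
  show "0\<^sub>m (2 * n) (2 * n) \<in> filt n d" by (rule filtI) auto
  fix x assume x: "x \<in> filt n d"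
  note xC = filt_carrier[OF x]
  show "c \<cdot>\<^sub>m x \<in> filt n d" for c
    by (rule filtI) (use xC filtD[OF x] in auto)
  fix y assume y: "y \<in> filt n d"
  show "x + y \<in> filt n d"
    by (rule filtI) (use xC filt_carrier[OF y] filtD[OF x] filtD[OF y] in auto)
qed

lemma mat_subspace_Int: "mat_subspace N A \<Longrightarrow> mat_subspace N B \<Longrightarrow> mat_subspace N (A \<inter> B)"
  unfolding mat_subspace_def by auto

lemma index_mult_sum:
  assumes "x \<in> carrier_mat N N" "y \<in> carrier_mat N N" "i < N" "j < N"
  shows "(x * y) $$ (i, j) = (\<Sum>k<N. x $$ (i, k) * y $$ (k, j))"
  using assms by (auto simp: scalar_prod_def lessThan_atLeast0)

lemma filt_mult:
  assumes x: "x \<in> filt n d" and y: "y \<in> filt n e" shows "x * y \<in> filt n (d + e)"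
proof -
  have C: "x \<in> carrier_mat (2 * n) (2 * n)" "y \<in> carrier_mat (2 * n) (2 * n)"
    using x y filt_carrier by auto
  have "(x * y) $$ (i, j) = 0" if "i < 2 * n" "j < 2 * n" "\<not> pos n i + (d + e) \<le> pos n j" for i j
    unfolding index_mult_sum[OF C that(1,2)]
  proof (intro sum.neutral ballI)
    fix k assume "k \<in> {..<2 * n}"
    then have k: "k < 2 * n" by simp
    have "\<not> pos n i + d \<le> pos n k \<or> \<not> pos n k + e \<le> pos n j" using that(3) by linarith
    then show "x $$ (i, k) * y $$ (k, j) = 0"
      using filtD[OF x that(1) k] filtD[OF y k that(2)] by auto
  qed
  then show ?thesis using mult_carrier_mat[OF C] unfolding filt_def by blast
qed

lemma filt_bracket:
  assumes "x \<in> filt n d" "y \<in> filt n e" shows "x * y - y * x \<in> filt n (d + e)"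
  using mat_subspace_minus[OF mat_subspace_filt filt_mult[OF assms]] filt_mult[OF assms(2,1)]
  by (simp add: add.commute)

lemma filt_zero: "y \<in> filt n (2 * n) \<Longrightarrow> y = 0\<^sub>m (2 * n) (2 * n)"
proof (rule eq_matI)
  fix i j assume y: "y \<in> filt n (2 * n)" and "i < dim_row (0\<^sub>m (2 * n) (2 * n) :: complex mat)"
    "j < dim_col (0\<^sub>m (2 * n) (2 * n) :: complex mat)"
  then have ij: "i < 2 * n" "j < 2 * n" by auto
  have "y $$ (i, j) = 0" by (rule filtD[OF y ij]) (use pos_less[OF ij(2)] in linarith)
  then show "y $$ (i, j) = 0\<^sub>m (2 * n) (2 * n) $$ (i, j)" using ij by simp
qed (auto dest: filt_carrier)

lemma filt_0_diag:
  assumes x: "x \<in> filt n 0" and y: "y \<in> filt n 0" and i: "i < 2 * n"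
  shows "(x * y) $$ (i, i) = x $$ (i, i) * y $$ (i, i)"
proof -
  have "x $$ (i, k) * y $$ (k, i) = (if k = i then x $$ (i, i) * y $$ (i, i) else 0)" if "k < 2 * n" for k
  proof (cases "k = i")
    case False
    then have "pos n i \<noteq> pos n k" using pos_inj[OF i that] by auto
    then consider "\<not> pos n i + 0 \<le> pos n k" | "\<not> pos n k + 0 \<le> pos n i" by linarith
    then show ?thesis
      by cases (use False filtD[OF x i that] filtD[OF y that i] in simp_all)
  qed simp
  then have "(\<Sum>k<2 * n. x $$ (i, k) * y $$ (k, i)) = (\<Sum>k<2 * n. if k = i then x $$ (i, i) * y $$ (i, i) else 0)"
    by (intro sum.cong) auto
  then show ?thesis
    unfolding index_mult_sum[OF filt_carrier[OF x] filt_carrier[OF y] i i] using i by simp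
qed

lemma filt_0_bracket:
  assumes x: "x \<in> filt n 0" and y: "y \<in> filt n 0" shows "x * y - y * x \<in> filt n 1"
proof -
  have b: "x * y - y * x \<in> filt n 0" using filt_bracket[OF assms] by simp
  have C: "x * y \<in> carrier_mat (2 * n) (2 * n)" "y * x \<in> carrier_mat (2 * n) (2 * n)"
    by (rule mult_carrier_mat[OF filt_carrier[OF x] filt_carrier[OF y]],
        rule mult_carrier_mat[OF filt_carrier[OF y] filt_carrier[OF x]])
  have "pos n i + 1 \<le> pos n j" if ij: "i < 2 * n" "j < 2 * n" and ne: "(x * y - y * x) $$ (i, j) \<noteq> 0" for i j
  proof -
    have le: "pos n i \<le> pos n j" using filtD[OF b ij] ne by auto
    have "(x * y - y * x) $$ (i, i) = 0"
      using ij carrier_matD[OF C(2)] filt_0_diag[OF x y ij(1)] filt_0_diag[OF y x ij(1)]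
      by (subst index_minus_mat) (simp_all only: mult.commute diff_self)
    then have "i \<noteq> j" using ne by auto
    then show ?thesis using le pos_inj[OF ij] by linarith
  qed
  then show ?thesis using b unfolding filt_def by blast
qed

text \<open>The adapted symplectic basis conjugates \<bb> into the triangular matrices of
  \<open>sp\<close>. These form a solvable subalgebra themselves, so maximality of \<bb> turns the
  inclusion into an equality.\<close>

theorem borel_standard:
  assumes b: "borel_subalgebra (2 * n) (sp n) \<bb>"
  obtains g gi where "conj_mat (2 * n) g gi"
    "\<bb> = {x \<in> carrier_mat (2 * n) (2 * n). gi * x * g \<in> sp n \<inter> filt n 0}"
proof -
  let ?N = "2 * n" and ?o = "op (2 * n)"
  have bb: "lie_subalgebra ?N \<bb>" "solvable_lie ?N \<bb>" "\<bb> \<subseteq> sp n"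
    and max: "\<And>\<cc>. lie_subalgebra ?N \<cc> \<Longrightarrow> solvable_lie ?N \<cc> \<Longrightarrow> \<bb> \<subseteq> \<cc> \<Longrightarrow> \<cc> \<subseteq> sp n \<Longrightarrow> \<cc> = \<bb>"
    using b by (auto simp: borel_subalgebra_def)
  obtain d where d: "derived_series ?N \<bb> d = {0\<^sub>m ?N ?N}" using bb(2) by (auto simp: solvable_lie_def)
  obtain f f' where fl: "symp_flag n \<bb> n f f'"
    using symp_flag_exists[OF bb(1,3) d, of n] by auto
  have f: "\<And>i. i < n \<Longrightarrow> f i \<in> vecs ?N" "\<And>i. i < n \<Longrightarrow> f' i \<in> vecs ?N"
    and flag: "\<And>i x. i < n \<Longrightarrow> x \<in> \<bb> \<Longrightarrow> ?o x (f i) \<in> lspan f (Suc i)"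
    and \<omega>: "\<And>i j. i < n \<Longrightarrow> j < n \<Longrightarrow> \<omega> n (f i) (f j) = 0"
      "\<And>i j. i < n \<Longrightarrow> j < n \<Longrightarrow> \<omega> n (f' i) (f' j) = 0"
      "\<And>i j. i < n \<Longrightarrow> j < n \<Longrightarrow> \<omega> n (f i) (f' j) = (if i = j then 1 else 0)"
    using fl by (auto simp: symp_flag_def)
  have \<omega>': "\<omega> n (f' i) (f j) = (if i = j then -1 else 0)" if "i < n" "j < n" for i j
    using \<omega>_antisym[of n "f' i" "f j"] \<omega>(3)[OF that(2,1)] by auto
  define F where "F b = (if b < n then f b else f' (b - n))" for b
  \<comment> \<open>Coordinates in the basis \<open>F\<close>, obtained by pairing with the dual
    vectors; they supply the rows of the inverse matrix. The sign comes from antisymmetry of the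
    form.\<close>
  define r where "r a u = (if a < n then \<omega> n u (f' a) else - \<omega> n u (f (a - n)))" for a u
  define g where "g = mat ?N ?N (\<lambda>(i, j). F j i)"
  define gi where "gi = mat ?N ?N (\<lambda>(a, k). r a (unit k))"
  have gC: "g \<in> carrier_mat ?N ?N" "gi \<in> carrier_mat ?N ?N" by (simp_all add: g_def gi_def)
  have FN: "F b \<in> vecs ?N" if "b < ?N" for b using f that by (auto simp: F_def)
  have r_lin: "r a (sc c u) = c * r a u" "r a (\<Sum>k\<in>A. G k) = (\<Sum>k\<in>A. r a (G k))"
    for a c u G and A :: "nat set"
    by (simp_all add: r_def \<omega>_linear \<omega>_sum sum_negf)
  have gi_op: "?o gi u a = r a u" if "u \<in> vecs ?N" "a < ?N" for u a
  proof -
    have "r a u = (\<Sum>k<?N. u k * r a (unit k))"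
      by (subst (1) vecs_expand[OF that(1)]) (simp add: r_lin)
    then show ?thesis using that(2) by (simp add: op_def gi_def mult.commute)
  qed
  have g_unit: "?o g (unit b) = F b" if "b < ?N" for b
  proof
    fix i show "?o g (unit b) i = F b i"
      using that FN[OF that] by (auto simp: op_unit g_def vecs_def)
  qed
  have rF: "r a (F b) = (if a = b then 1 else 0)" if "a < ?N" "b < ?N" for a b
  proof (cases "a < n"; cases "b < n")
    assume "a < n" "\<not> b < n"
    then show ?thesis using that \<omega> by (auto simp: r_def F_def)
  next
    assume a: "\<not> a < n" and b: "\<not> b < n"
    have "b - n < n" "a - n < n" using that a b by auto
    then show ?thesis using that \<omega>'[of "b - n" "a - n"] a b by (auto simp: r_def F_def)
  qed (use that \<omega> in \<open>auto simp: r_def F_def\<close>)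
  have gi_F: "?o gi (F b) = unit b" if "b < ?N" for b
  proof
    fix i show "?o gi (F b) i = unit b i"
    proof (cases "i < ?N")
      case True
      then show ?thesis using gi_op[OF FN[OF that] True] rF[OF True that] by (auto simp: unit_def)
    qed (use that in \<open>auto simp: op_def unit_def\<close>)
  qed
  have gi_g: "gi * g = 1\<^sub>m ?N"
    by (rule mat_eq_if_op[of _ ?N]) (use gC in \<open>auto simp: op_mult g_unit gi_F op_one unit_vecs\<close>)
  then have "g * gi = 1\<^sub>m ?N" using mat_mult_left_right_inverse[OF gC(2,1)] by simp
  with gi_g gC have cj: "conj_mat ?N g gi" by unfold_locales
  then interpret conj_mat ?N g gi .
  have g_op: "?o g u = (\<Sum>b<?N. sc (u b) (F b))" if "u \<in> vecs ?N" for u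
    by (subst (1) vecs_expand[OF that]) (simp add: lin_op_sum[OF lin_op_op] lin_opD[OF lin_op_op] g_unit)
  have pres: "preserves_\<omega> n g"
    unfolding preserves_\<omega>_def
  proof (intro ballI)
    fix u v assume u: "u \<in> vecs ?N" and v: "v \<in> vecs ?N"
    have gv: "r a (?o g v) = v a" if "a < ?N" for a
    proof -
      have "r a (?o g v) = ?o gi (?o g v) a" using that by (simp add: gi_op)
      also have "\<dots> = ?o (1\<^sub>m ?N) v a" using gC by (simp add: op_mult[symmetric] gi_g)
      finally show ?thesis using v by (simp add: op_one)
    qed
    have 1: "\<omega> n (f b) (?o g v) = v (n + b)" "\<omega> n (f' b) (?o g v) = - v b" if "b < n" for b
      using gv[of "n + b"] gv[of b] that \<omega>_antisym[of n _ "?o g v"] by (simp_all add: r_def)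
    have "\<omega> n (?o g u) (?o g v) = (\<Sum>b<?N. u b * \<omega> n (F b) (?o g v))"
      unfolding g_op[OF u] by (simp add: \<omega>_sum \<omega>_linear)
    also have "\<dots> = (\<Sum>b<n. u b * v (n + b)) + (\<Sum>b<n. u (n + b) * - v b)"
      unfolding sum_split2 by (intro arg_cong2[where f = "(+)"] sum.cong) (simp_all add: F_def 1)
    also have "\<dots> = \<omega> n u v" by (simp add: \<omega>_def sum_subtractf sum_negf)
    finally show "\<omega> n (?o g u) (?o g v) = \<omega> n u v" .
  qed
  have cj': "conj_mat ?N gi g" using gC gi_g g_gi by unfold_locales
  define \<cc> where "\<cc> = {x \<in> C. w x \<in> sp n \<inter> filt n 0}"
  have c_sub: "mat_subspace ?N \<cc>"
  proof -
    have "mat_subspace ?N (sp n \<inter> filt n 0)"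
      by (rule mat_subspace_Int[OF mat_subspace_sp mat_subspace_filt])
    then show ?thesis unfolding \<cc>_def by (rule mat_subspace_w)
  qed
  have c_lie: "lie_subalgebra ?N \<cc>"
    unfolding lie_subalgebra_iff
  proof (intro conjI ballI c_sub)
    fix x y assume "x \<in> \<cc>" "y \<in> \<cc>"
    then show "x * y - y * x \<in> \<cc>"
      using sp_bracket filt_bracket[of _ n 0 _ 0] by (auto simp: \<cc>_def w_bracket)
  qed
  have c_der: "derived_series ?N \<cc> k \<subseteq> {x \<in> C. w x \<in> filt n k}" for k
  proof (induction k)
    case (Suc k)
    have "lie_bracket ?N (derived_series ?N \<cc> k) (derived_series ?N \<cc> k) \<subseteq> {x \<in> C. w x \<in> filt n (Suc k)}"
    proof (rule lie_bracket_least[OF mat_subspace_w[OF mat_subspace_filt]])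
      fix x y assume "x \<in> derived_series ?N \<cc> k" "y \<in> derived_series ?N \<cc> k"
      then have xy: "x \<in> C" "y \<in> C" "w x \<in> filt n k" "w y \<in> filt n k" using Suc by auto
      \<comment> \<open>Additivity of the filtration suffices once \<open>k\<close> is positive,
        since then k + k is at least k + 1. The first step instead uses that the diagonals of the
        two products agree.\<close>
      have "w x * w y - w y * w x \<in> filt n (Suc k)"
      proof (cases k)
        case 0 then show ?thesis using filt_0_bracket xy by simp
      next
        case (Suc l)
        then show ?thesis using filt_bracket[OF xy(3,4)] filt_mono[of "Suc k" "k + k" n] by auto
      qed
      then show "x * y - y * x \<in> {x \<in> C. w x \<in> filt n (Suc k)}"
        using xy minus_carrier_mat[OF mC[OF xy(2,1)], of "x * y"] by (simp add: w_bracket)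
    qed
    then show ?case by simp
  qed (auto simp: \<cc>_def)
  have "derived_series ?N \<cc> ?N = {0\<^sub>m ?N ?N}"
  proof
    show "derived_series ?N \<cc> ?N \<subseteq> {0\<^sub>m ?N ?N}"
    proof
      fix x assume "x \<in> derived_series ?N \<cc> ?N"
      then have "x \<in> C" "w x = 0\<^sub>m ?N ?N" using c_der[of ?N] filt_zero by auto
      then have "x = w' (0\<^sub>m ?N ?N)" by (metis w'_w)
      then show "x \<in> {0\<^sub>m ?N ?N}" by (simp add: w'_0)
    qed
    have "mat_subspace ?N (derived_series ?N \<cc> k)" for k
    proof (induction k)
      case (Suc k)
      then show ?case using mat_subspaceD(1)[OF Suc] by (auto intro!: mat_subspace_lie_bracket)
    qed (simp add: c_sub)
    then show "{0\<^sub>m ?N ?N} \<subseteq> derived_series ?N \<cc> ?N" using mat_subspaceD(2) by blast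
  qed
  then have c_solv: "solvable_lie ?N \<cc>" unfolding solvable_lie_def by blast
  have c_sp: "\<cc> \<subseteq> sp n"
  proof
    fix x assume "x \<in> \<cc>"
    then have "w' (w x) \<in> sp n" "x \<in> C"
      using sp_conj[OF cj' preserves_\<omega>_inverse[OF cj pres]] by (auto simp: \<cc>_def w'_def)
    then show "x \<in> sp n" by simp
  qed
  have "\<bb> \<subseteq> \<cc>"
  proof
    fix x assume x: "x \<in> \<bb>"
    then have xs: "x \<in> sp n" using bb by auto
    have xC: "x \<in> C" using sp_carrier[OF xs] .
    have ws: "w x \<in> sp n" unfolding w_def by (rule sp_conj[OF cj pres xs])
    have tri: "w x $$ (i, j) = 0" if ij: "j < n" "i < ?N" "j < i" for i j
    proof -
      obtain c where c: "?o x (f j) = (\<Sum>l<Suc j. sc (c l) (f l))"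
        by (rule lspanE[OF flag[OF ij(1) x]])
      have "w x $$ (i, j) = ?o (w x) (unit j) i" using that by (intro index_op) auto
      also have "\<dots> = ?o gi (?o x (f j)) i"
        using xC gC that g_unit[of j] by (simp add: w_def op_mult F_def)
      also have "\<dots> = (\<Sum>l<Suc j. c l * ?o gi (f l) i)"
        unfolding c lin_op_sum[OF lin_op_op] sum_fun_apply by (simp add: lin_opD[OF lin_op_op] sc_apply)
      also have "\<dots> = 0"
      proof (intro sum.neutral ballI)
        fix l assume "l \<in> {..<Suc j}"
        then have l: "l < n" "l \<noteq> i" using that by auto
        then show "c l * ?o gi (f l) i = 0" using gi_F[of l] by (simp add: F_def unit_def)
      qed
      finally show ?thesis .
    qed
    \<comment> \<open>The flag controls only the first \<open>n\<close> columns. The lower right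
      block is minus the transpose of the upper left one, and \<open>pos\<close> reverses its order,
      so it is triangular as well.\<close>
    have sw: "w x $$ (n + i, n + j) = - w x $$ (j, i)" if "i < n" "j < n" for i j
      using ws that by (auto simp: sp_iff)
    have "w x \<in> filt n 0"
      unfolding filt_def
    proof (intro CollectI conjI allI impI)
      show "w x \<in> C" using xC by simp
      fix i j assume ij: "i < ?N" "j < ?N" and ne: "w x $$ (i, j) \<noteq> 0"
      show "pos n i + 0 \<le> pos n j"
      proof (cases "j < n")
        case True
        then have "i \<le> j" using tri[OF True ij(1)] ne by (meson not_less)
        then show ?thesis using True by (simp add: pos_def)
      next
        case jn: False
        show ?thesis
        proof (cases "i < n")
          case True then show ?thesis using jn ij by (simp add: pos_def)
        next
          case False
          define i' j' where "i' = i - n" and "j' = j - n"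
          have e: "i = n + i'" "j = n + j'" "i' < n" "j' < n"
            using False jn ij by (auto simp: i'_def j'_def)
          have "w x $$ (j', i') \<noteq> 0" using sw[OF e(3,4)] ne e by auto
          then have "j' \<le> i'" using tri[OF e(3), of j'] e by (cases "i' < j'") auto
          then show ?thesis using e by (simp add: pos_def)
        qed
      qed
    qed
    then show "x \<in> \<cc>" using xC ws by (simp add: \<cc>_def)
  qed
  then have "\<cc> = \<bb>" by (rule max[OF c_lie c_solv _ c_sp])
  then show ?thesis using that[OF cj] unfolding \<cc>_def w_def by simp
qed

section \<open>Root vectors and Borel-stable subspaces\<close>

definition dA :: "nat \<Rightarrow> (nat \<Rightarrow> nat \<Rightarrow> complex) \<Rightarrow> complex mat" where
  "dA n A = mat (2 * n) (2 * n) (\<lambda>(p, q). if p < n \<and> q < n then A p q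
     else if n \<le> p \<and> n \<le> q then - A (q - n) (p - n) else 0)"

definition xS :: "nat \<Rightarrow> (nat \<Rightarrow> nat \<Rightarrow> complex) \<Rightarrow> complex mat" where
  "xS n S = mat (2 * n) (2 * n) (\<lambda>(p, q). if p < n \<and> n \<le> q then S p (q - n) else 0)"

definition eA :: "nat \<Rightarrow> nat \<Rightarrow> nat \<Rightarrow> complex mat" where
  "eA n i j = dA n (\<lambda>p q. if p = i \<and> q = j then 1 else 0)"

text \<open>For \<open>i = j\<close> the entry is 2. This keeps the formula additive in the two
  index orders under congruence, and it is the source of the factors 2 and 1/2 below.\<close>

definition sE :: "nat \<Rightarrow> nat \<Rightarrow> nat \<Rightarrow> nat \<Rightarrow> complex" where
  "sE i j p q = (if p = i \<and> q = j then 1 else 0) + (if p = j \<and> q = i then 1 else 0)"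

definition eS :: "nat \<Rightarrow> nat \<Rightarrow> nat \<Rightarrow> complex mat" where
  "eS n i j = xS n (sE i j)"

lemma dA_carrier [simp]: "dA n A \<in> carrier_mat (2 * n) (2 * n)"
  and xS_carrier [simp]: "xS n S \<in> carrier_mat (2 * n) (2 * n)"
  by (simp_all add: dA_def xS_def)

lemma index_dA [simp]:
  "i < n \<Longrightarrow> j < n \<Longrightarrow> dA n A $$ (i, j) = A i j"
  "i < n \<Longrightarrow> j < n \<Longrightarrow> dA n A $$ (n + i, n + j) = - A j i"
  "i < n \<Longrightarrow> j < n \<Longrightarrow> dA n A $$ (i, n + j) = 0"
  "i < n \<Longrightarrow> j < n \<Longrightarrow> dA n A $$ (n + i, j) = 0"
  by (simp_all add: dA_def)

lemma index_xS [simp]: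
  "i < n \<Longrightarrow> j < n \<Longrightarrow> xS n S $$ (i, j) = 0"
  "i < n \<Longrightarrow> j < n \<Longrightarrow> xS n S $$ (n + i, n + j) = 0"
  "i < n \<Longrightarrow> j < n \<Longrightarrow> xS n S $$ (i, n + j) = S i j"
  "i < n \<Longrightarrow> j < n \<Longrightarrow> xS n S $$ (n + i, j) = 0"
  by (simp_all add: xS_def)

lemma block_cases:
  assumes "(p::nat) < 2 * n" obtains "p < n" | i where "i < n" "p = n + i"
  using assms that(1) that(2)[of "p - n"] by (cases "p < n") auto

lemma block_eqI:
  fixes x y :: "complex mat"
  assumes "x \<in> carrier_mat (2 * n) (2 * n)" "y \<in> carrier_mat (2 * n) (2 * n)"
    and "\<And>i j. i < n \<Longrightarrow> j < n \<Longrightarrow> x $$ (i, j) = y $$ (i, j) \<and> x $$ (i, n + j) = y $$ (i, n + j) \<and>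
      x $$ (n + i, j) = y $$ (n + i, j) \<and> x $$ (n + i, n + j) = y $$ (n + i, n + j)"
  shows "x = y"
proof (rule eq_matI)
  fix p q assume "p < dim_row y" "q < dim_col y"
  then have "p < 2 * n" "q < 2 * n" using assms(2) by auto
  then show "x $$ (p, q) = y $$ (p, q)"
    by (elim block_cases) (use assms(3) in simp_all)
qed (use assms(1,2) in auto)

lemma index_mult_block:
  assumes "x \<in> carrier_mat (2 * n) (2 * n)" "y \<in> carrier_mat (2 * n) (2 * n)" "p < 2 * n" "q < 2 * n"
  shows "(x * y) $$ (p, q) = (\<Sum>l<n. x $$ (p, l) * y $$ (l, q)) + (\<Sum>l<n. x $$ (p, n + l) * y $$ (n + l, q))"
  unfolding index_mult_sum[OF assms] sum_split2 ..

lemma dA_mult_xS: "dA n A * xS n S = xS n (\<lambda>p q. \<Sum>l<n. A p l * S l q)"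
  by (rule block_eqI[of _ n]) (auto simp: index_mult_block[of _ n] intro: mult_carrier_mat[OF dA_carrier xS_carrier])

lemma xS_mult_dA: "xS n S * dA n A = xS n (\<lambda>p q. - (\<Sum>l<n. S p l * A q l))"
  by (rule block_eqI[of _ n])
     (auto simp: index_mult_block[of _ n] sum_negf intro: mult_carrier_mat[OF xS_carrier dA_carrier])

lemma xS_mult_xS: "xS n S * xS n T = 0\<^sub>m (2 * n) (2 * n)"
  by (rule block_eqI[of _ n]) (auto simp: index_mult_block[of _ n] intro: mult_carrier_mat[OF xS_carrier xS_carrier])

lemma xS_minus: "xS n S - xS n T = xS n (\<lambda>p q. S p q - T p q)"
  by (rule block_eqI[of _ n]) (auto simp: xS_def)

lemma xS_smult: "c \<cdot>\<^sub>m xS n S = xS n (\<lambda>p q. c * S p q)"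
  by (rule block_eqI[of _ n]) (auto simp: xS_def)

lemma xS_cong: "(\<And>p q. p < n \<Longrightarrow> q < n \<Longrightarrow> S p q = T p q) \<Longrightarrow> xS n S = xS n T"
  by (rule block_eqI[of _ n]) auto

lemma dA_xS_bracket:
  "dA n A * xS n S - xS n S * dA n A = xS n (\<lambda>p q. \<Sum>l<n. A p l * S l q + S p l * A q l)"
  unfolding dA_mult_xS xS_mult_dA xS_minus by (rule xS_cong) (simp add: sum.distrib)

lemma sE_eq: "sE i j p q = (if p = i \<and> q = j \<or> p = j \<and> q = i then if i = j then 2 else 1 else 0)"
  unfolding sE_def by (cases "i = j") auto

lemma sE_sym: "sE i j = sE j i"
  by (auto simp: sE_def fun_eq_iff)

lemma eS_sym: "eS n i j = eS n j i"
  by (simp add: eS_def sE_sym)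

lemma eA_xS_bracket:
  assumes "i < n" "j < n"
  shows "eA n i j * xS n S - xS n S * eA n i j =
    xS n (\<lambda>p q. (if p = i then S j q else 0) + (if q = i then S p j else 0))"
  unfolding eA_def dA_xS_bracket
proof (rule xS_cong)
  fix p q
  have "(\<Sum>l<n. (if p = i \<and> l = j then 1 else 0) * S l q + S p l * (if q = i \<and> l = j then 1 else 0))
      = (\<Sum>l<n. if l = j then (if p = i then S j q else 0) + (if q = i then S p j else 0) else 0)"
    by (intro sum.cong) auto
  then show "(\<Sum>l<n. (if p = i \<and> l = j then 1 else 0) * S l q + S p l * (if q = i \<and> l = j then 1 else 0))
      = (if p = i then S j q else 0) + (if q = i then S p j else 0)"
    using assms by simp
qed

lemma eA_eS_bracket:
  assumes "p < n" "q < n" "k < n" "p \<noteq> q"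
  shows "eA n p q * eS n q k - eS n q k * eA n p q = (if q = k then 2 else 1) \<cdot>\<^sub>m eS n p k"
  unfolding eS_def eA_xS_bracket[OF assms(1,2)] xS_smult
proof (rule xS_cong)
  fix a b
  show "(if a = p then sE q k q b else 0) + (if b = p then sE q k a q else 0)
      = (if q = k then 2 else 1) * sE p k a b"
  proof (cases "q = k")
    case True
    have "sE k k k b = (if b = k then 2 else 0)" "sE k k a k = (if a = k then 2 else 0)" for a b
      by (simp_all add: sE_def)
    then show ?thesis using assms(4) unfolding True by (simp add: sE_def)
  next
    case False
    then have "sE q k q b = (if b = k then 1 else 0)" "sE q k a q = (if a = k then 1 else 0)" for a b
      by (simp_all add: sE_def)
    moreover have "(if a = p then if b = k then 1 else 0 else 0) + (if b = p then if a = k then 1 else 0 else 0) = sE p k a b"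
      unfolding sE_def if_if_eq_conj by (simp only: conj_commute)
    ultimately show ?thesis using False by (simp only: if_False mult_1)
  qed
qed

lemma dA_sp: "dA n A \<in> sp n"
  by (simp add: sp_iff)

lemma xS_sp: "(\<And>p q. p < n \<Longrightarrow> q < n \<Longrightarrow> S p q = S q p) \<Longrightarrow> xS n S \<in> sp n"
  by (simp add: sp_iff)

lemma dA_filt:
  assumes "\<And>p q. p < n \<Longrightarrow> q < n \<Longrightarrow> \<not> p + d \<le> q \<Longrightarrow> A p q = 0"
  shows "dA n A \<in> filt n d"
proof (rule filtI)
  fix p q assume pq: "p < 2 * n" "q < 2 * n" "\<not> pos n p + d \<le> pos n q"
  consider "p < n" "q < n" | "n \<le> p" "n \<le> q" | "p < n" "n \<le> q" | "n \<le> p" "q < n" by linarith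
  then show "dA n A $$ (p, q) = 0"
  proof cases
    case 1
    then have "A p q = 0" using pq by (intro assms) (auto simp: pos_def)
    then show ?thesis using 1 by (simp add: dA_def)
  next
    case 2
    then have "\<not> (q - n) + d \<le> p - n" using pq unfolding pos_def by auto
    then have "A (q - n) (p - n) = 0" using 2 pq by (intro assms) auto
    then show ?thesis using 2 pq by (simp add: dA_def)
  qed (use pq in \<open>simp add: dA_def\<close>)+
qed simp

lemma xS_filt: "xS n S \<in> filt n 1"
proof (rule filtI)
  fix p q assume pq: "p < 2 * n" "q < 2 * n" "\<not> pos n p + 1 \<le> pos n q"
  then have no: "p < n \<Longrightarrow> n \<le> q \<Longrightarrow> False" by (auto simp: pos_def)
  show "xS n S $$ (p, q) = 0"
  proof (cases "p < n \<and> n \<le> q")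
    case False
    then show ?thesis using pq(1,2) by (simp only: xS_def index_mat prod.case if_False)
  qed (use no in blast)
qed simp

lemma eA_sp: "eA n i j \<in> sp n"
  by (simp add: eA_def dA_sp)

lemma eS_sp: "eS n i j \<in> sp n"
proof -
  have "sE i j p q = sE i j q p" for p q by (simp add: sE_def conj_commute add.commute)
  then show ?thesis unfolding eS_def by (intro xS_sp) blast
qed

lemma eA_filt: "i + d \<le> j \<Longrightarrow> eA n i j \<in> filt n d"
  unfolding eA_def by (rule dA_filt) auto

lemma eS_filt: "eS n i j \<in> filt n 1"
  unfolding eS_def by (rule xS_filt)

lemma eS_filt0: "eS n i j \<in> filt n 0"
  by (rule subsetD[OF filt_mono eS_filt]) simp

lemma neg_minus_mat:
  fixes a b :: "complex mat"
  assumes "a \<in> carrier_mat N N" "b \<in> carrier_mat N N" shows "(-1) \<cdot>\<^sub>m (a - b) = b - a"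
  using assms by (intro eq_matI) auto

lemma eA_carrier [simp]: "eA n i j \<in> carrier_mat (2 * n) (2 * n)"
  and eS_carrier [simp]: "eS n i j \<in> carrier_mat (2 * n) (2 * n)"
  by (simp_all add: eA_def eS_def)

lemma sp_filt_1_entries:
  assumes "y \<in> sp n" "y \<in> filt n 1"
  shows "i < n \<Longrightarrow> j < n \<Longrightarrow> y $$ (n + i, j) = 0"
    "i < n \<Longrightarrow> j < n \<Longrightarrow> j \<le> i \<Longrightarrow> y $$ (i, j) = 0"
    "i < n \<Longrightarrow> j < n \<Longrightarrow> y $$ (n + i, n + j) = - y $$ (j, i)"
    "i < n \<Longrightarrow> j < n \<Longrightarrow> y $$ (i, n + j) = y $$ (j, n + i)"
  using assms(1) by (auto simp: sp_iff pos_def intro!: filtD[OF assms(2)])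

lemma sp_filt_0_entries:
  assumes "y \<in> sp n" "y \<in> filt n 0"
  shows "i < n \<Longrightarrow> j < n \<Longrightarrow> y $$ (n + i, j) = 0"
    "i < n \<Longrightarrow> j < n \<Longrightarrow> j < i \<Longrightarrow> y $$ (i, j) = 0"
    "i < n \<Longrightarrow> j < n \<Longrightarrow> y $$ (n + i, n + j) = - y $$ (j, i)"
    "i < n \<Longrightarrow> j < n \<Longrightarrow> y $$ (i, n + j) = y $$ (j, n + i)"
  using assms(1) by (auto simp: sp_iff pos_def intro!: filtD[OF assms(2)])

subsection \<open>Weights of a generic diagonal element\<close>

text \<open>The larger exponent decides: two powers of exponent at most b add up to less than 3^(b +
  1). Sorted exponents can therefore be read off from the sum.\<close>

lemma pow3_sum_less:
  fixes a b c d :: nat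
  assumes "(3::int) ^ a + 3 ^ b = 3 ^ c + 3 ^ d" "a \<le> b" "c \<le> d"
  shows "a = c \<and> b = d"
proof -
  have less: "(3::int) ^ a + 3 ^ b < 3 ^ c + 3 ^ d" if "a \<le> b" "b < d" for a b c d :: nat
  proof -
    have "(3::int) ^ a \<le> 3 ^ b" using that by (intro power_increasing) auto
    moreover have "(3::int) * 3 ^ b \<le> 3 ^ d"
      using power_increasing[of "Suc b" d "3::int"] that by simp
    ultimately show ?thesis using zero_less_power[of "3::int" c] zero_less_power[of "3::int" b] by linarith
  qed
  have "b = d" using less[OF assms(2), of d c] less[OF assms(3), of b a] assms(1) by (metis less_irrefl linorder_neqE_nat)
  then have "(3::int) ^ a = 3 ^ c" using assms(1) by simp
  then show ?thesis using \<open>b = d\<close> by simp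
qed

lemma pow3_sum_eq:
  fixes a b c d :: nat
  assumes "(3::int) ^ a + 3 ^ b = 3 ^ c + 3 ^ d"
  shows "(a = c \<and> b = d) \<or> (a = d \<and> b = c)"
proof -
  have "(3::int) ^ b + 3 ^ a = 3 ^ c + 3 ^ d" "(3::int) ^ a + 3 ^ b = 3 ^ d + 3 ^ c"
    "(3::int) ^ b + 3 ^ a = 3 ^ d + 3 ^ c" using assms by (simp_all only: add.commute)
  note * = pow3_sum_less[OF assms] pow3_sum_less[OF this(1)] pow3_sum_less[OF this(2)] pow3_sum_less[OF this(3)]
  show ?thesis using * nat_le_linear[of a b] nat_le_linear[of c d] by blast
qed

definition rwt :: "nat \<Rightarrow> nat \<Rightarrow> int" where
  "rwt n p = (if p < n then 3 ^ p else - (3 ^ (p - n)))"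

text \<open>A diagonal element generic enough to isolate root vectors: with powers of 3 as
  eigenvalues, \<open>pow3_sum_eq\<close> recovers the indices of a root from its value.\<close>

definition hdiag :: "nat \<Rightarrow> complex mat" where
  "hdiag n = dA n (\<lambda>p q. if p = q then 3 ^ p else 0)"

lemma hdiag_sp_filt: "hdiag n \<in> sp n" "hdiag n \<in> filt n 0"
  unfolding hdiag_def by (rule dA_sp) (rule dA_filt, simp)

lemma index_hdiag:
  "p < 2 * n \<Longrightarrow> q < 2 * n \<Longrightarrow> hdiag n $$ (p, q) = (if p = q then of_int (rwt n p) else 0)"
  unfolding hdiag_def by (elim block_cases) (auto simp: rwt_def)

lemma hdiag_bracket:
  assumes y: "y \<in> carrier_mat (2 * n) (2 * n)" and pq: "p < 2 * n" "q < 2 * n"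
  shows "(hdiag n * y - y * hdiag n) $$ (p, q) = of_int (rwt n p - rwt n q) * y $$ (p, q)"
proof -
  have h: "hdiag n \<in> carrier_mat (2 * n) (2 * n)" by (simp add: hdiag_def)
  have "(hdiag n * y) $$ (p, q) = (\<Sum>k<2 * n. if k = p then of_int (rwt n p) * y $$ (p, q) else 0)"
    unfolding index_mult_sum[OF h y pq] using pq by (intro sum.cong) (auto simp: index_hdiag)
  moreover have "(y * hdiag n) $$ (p, q) = (\<Sum>k<2 * n. if k = q then y $$ (p, q) * of_int (rwt n q) else 0)"
    unfolding index_mult_sum[OF y h pq] using pq by (intro sum.cong) (auto simp: index_hdiag)
  ultimately show ?thesis using pq h y by (simp add: algebra_simps)
qed

text \<open>Products of the operators \<open>ad h - \<lambda>\<close> project a stable subspace onto its weight components.\<close>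

lemma weight_component:
  assumes W: "mat_subspace (2 * n) W" and ad: "\<And>y. y \<in> W \<Longrightarrow> hdiag n * y - y * hdiag n \<in> W"
    and y: "y \<in> W"
  shows "mat (2 * n) (2 * n) (\<lambda>(p, q). if rwt n p - rwt n q = \<mu> then y $$ (p, q) else 0) \<in> W"
proof -
  let ?C = "carrier_mat (2 * n) (2 * n) :: complex mat set"
  have WC: "x \<in> ?C" if "x \<in> W" for x using mat_subspaceD(1)[OF W that] .
  have prod: "\<exists>z\<in>W. \<forall>p<2 * n. \<forall>q<2 * n.
      z $$ (p, q) = (\<Prod>\<nu>\<in>\<Lambda>. of_int (rwt n p - rwt n q - \<nu>)) * y $$ (p, q)" if "finite \<Lambda>" for \<Lambda>
    using that
  proof (induction \<Lambda> rule: finite_induct)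
    case empty show ?case using y by (intro bexI[of _ y]) auto
  next
    case (insert \<nu> \<Lambda>)
    then obtain z where z: "z \<in> W" "\<And>p q. p < 2 * n \<Longrightarrow> q < 2 * n \<Longrightarrow>
      z $$ (p, q) = (\<Prod>\<nu>\<in>\<Lambda>. of_int (rwt n p - rwt n q - \<nu>)) * y $$ (p, q)" by blast
    let ?z = "(hdiag n * z - z * hdiag n) - of_int \<nu> \<cdot>\<^sub>m z"
    have "?z \<in> W" by (intro mat_subspace_minus[OF W] ad mat_subspaceD(4)[OF W] z)
    moreover have "?z $$ (p, q) = (\<Prod>\<nu>\<in>insert \<nu> \<Lambda>. of_int (rwt n p - rwt n q - \<nu>)) * y $$ (p, q)"
      if pq: "p < 2 * n" "q < 2 * n" for p q
    proof -
      have "?z $$ (p, q) = of_int (rwt n p - rwt n q) * z $$ (p, q) - of_int \<nu> * z $$ (p, q)"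
        using hdiag_bracket[OF WC[OF z(1)] pq] WC[OF z(1)] pq by simp
      then show ?thesis using insert.hyps z(2)[OF pq] by (simp add: algebra_simps)
    qed
    ultimately show ?case by blast
  qed
  \<comment> \<open>All weights other than \<mu>. The product over them annihilates their components
    and multiplies the \<mu>-component by the nonzero number \<open>c\<close>.\<close>
  define \<Lambda> where "\<Lambda> = (\<lambda>(p, q). rwt n p - rwt n q) ` ({..<2 * n} \<times> {..<2 * n}) - {\<mu>}"
  have fin: "finite \<Lambda>" by (simp add: \<Lambda>_def)
  define c where "c = (\<Prod>\<nu>\<in>\<Lambda>. of_int (\<mu> - \<nu>) :: complex)"
  have c: "c \<noteq> 0" using fin unfolding c_def by (auto simp: \<Lambda>_def)
  obtain z where z: "z \<in> W" "\<And>p q. p < 2 * n \<Longrightarrow> q < 2 * n \<Longrightarrow>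
      z $$ (p, q) = (\<Prod>\<nu>\<in>\<Lambda>. of_int (rwt n p - rwt n q - \<nu>)) * y $$ (p, q)"
    using prod[OF fin] by blast
  have "(1 / c) \<cdot>\<^sub>m z = mat (2 * n) (2 * n) (\<lambda>(p, q). if rwt n p - rwt n q = \<mu> then y $$ (p, q) else 0)"
  proof (rule eq_matI)
    fix p q assume "p < dim_row (mat (2 * n) (2 * n) (\<lambda>(p, q). if rwt n p - rwt n q = \<mu> then y $$ (p, q) else 0))"
      "q < dim_col (mat (2 * n) (2 * n) (\<lambda>(p, q). if rwt n p - rwt n q = \<mu> then y $$ (p, q) else 0))"
    then have pq: "p < 2 * n" "q < 2 * n" by auto
    show "((1 / c) \<cdot>\<^sub>m z) $$ (p, q) = mat (2 * n) (2 * n) (\<lambda>(p, q). if rwt n p - rwt n q = \<mu> then y $$ (p, q) else 0) $$ (p, q)"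
    proof (cases "rwt n p - rwt n q = \<mu>")
      case True
      have "(\<Prod>\<nu>\<in>\<Lambda>. of_int (rwt n p - rwt n q - \<nu>)) = c" unfolding c_def True ..
      then have "z $$ (p, q) = c * y $$ (p, q)" using z(2)[OF pq] by simp
      then show ?thesis using True pq c WC[OF z(1)] by simp
    next
      case False
      then have "rwt n p - rwt n q \<in> \<Lambda>" using pq by (auto simp: \<Lambda>_def)
      then have "(\<Prod>\<nu>\<in>\<Lambda>. of_int (rwt n p - rwt n q - \<nu>) :: complex) = 0"
        using fin by (intro prod_zero bexI[of _ "rwt n p - rwt n q"]) auto
      then show ?thesis using z(2)[OF pq] pq False WC[OF z(1)] by simp
    qed
  qed (use WC[OF z(1)] in auto)
  then show ?thesis using mat_subspaceD(4)[OF W z(1), of "1 / c"] by simp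
qed

text \<open>All that is used of the nilradical in adapted coordinates. The locale is also
  instantiated with the full strictly triangular part of \<open>sp\<close> in order to compute
  [\<bb>, \<bb>].\<close>

locale borel_stable =
  fixes n :: nat and W :: "complex mat set"
  assumes W: "mat_subspace (2 * n) W" and W_u: "W \<subseteq> sp n \<inter> filt n 1"
    and W_ad: "h \<in> sp n \<Longrightarrow> h \<in> filt n 0 \<Longrightarrow> y \<in> W \<Longrightarrow> h * y - y * h \<in> W"
begin

lemma W_C: "y \<in> W \<Longrightarrow> y \<in> carrier_mat (2 * n) (2 * n)"
  using mat_subspaceD(1)[OF W] .

lemma smult_cancel: "c \<cdot>\<^sub>m x \<in> W \<Longrightarrow> c \<noteq> 0 \<Longrightarrow> x \<in> carrier_mat (2 * n) (2 * n) \<Longrightarrow> x \<in> W"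
proof -
  assume x: "c \<cdot>\<^sub>m x \<in> W" "c \<noteq> 0" "x \<in> carrier_mat (2 * n) (2 * n)"
  then have "(1 / c) \<cdot>\<^sub>m (c \<cdot>\<^sub>m x) = x" by (intro eq_matI) auto
  then show "x \<in> W" using mat_subspaceD(4)[OF W x(1), of "1 / c"] by simp
qed

text \<open>The weight of e_i - e_j occurs in the two diagonal blocks at (i, j) and (n + j, n + i)
  only, and cannot occur in the upper right block for reasons of sign. The weight component of
  \<open>y\<close> is thus a multiple of the root vector.\<close>

lemma eA_mem:
  assumes y: "y \<in> W" and ij: "i < j" "j < n" and ne: "y $$ (i, j) \<noteq> 0"
  shows "eA n i j \<in> W"
proof -
  have yu: "y \<in> sp n" "y \<in> filt n 1" using W_u y by auto
  note ye = sp_filt_1_entries[OF yu]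
  have "mat (2 * n) (2 * n) (\<lambda>(p, q). if rwt n p - rwt n q = rwt n i - rwt n j then y $$ (p, q) else 0) \<in> W"
    by (rule weight_component[OF W W_ad[OF hdiag_sp_filt] y])
  also have "mat (2 * n) (2 * n) (\<lambda>(p, q). if rwt n p - rwt n q = rwt n i - rwt n j then y $$ (p, q) else 0)
      = y $$ (i, j) \<cdot>\<^sub>m eA n i j"
  proof (rule block_eqI[of _ n])
    fix p q assume pq: "p < n" "q < n"
    have neg: "rwt n i - rwt n j < 0" using ij by (simp add: rwt_def)
    have eq: "(rwt n p - rwt n q = rwt n i - rwt n j) \<longleftrightarrow> (p = i \<and> q = j) \<or> (p = q \<and> i = j)"
      using pow3_sum_eq[of p j i q] pq ij by (auto simp: rwt_def)
    have eq2: "(rwt n (n + p) - rwt n (n + q) = rwt n i - rwt n j) \<longleftrightarrow> (p = j \<and> q = i) \<or> (p = q \<and> i = j)"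
      using pow3_sum_eq[of q j i p] pq ij by (auto simp: rwt_def)
    have ne2: "rwt n p - rwt n (n + q) \<noteq> rwt n i - rwt n j"
      using neg pq by (simp add: rwt_def) (smt (verit) zero_less_power)
    let ?M = "mat (2 * n) (2 * n) (\<lambda>(p, q). if rwt n p - rwt n q = rwt n i - rwt n j then y $$ (p, q) else 0)"
    show "?M $$ (p, q) = (y $$ (i, j) \<cdot>\<^sub>m eA n i j) $$ (p, q) \<and>
        ?M $$ (p, n + q) = (y $$ (i, j) \<cdot>\<^sub>m eA n i j) $$ (p, n + q) \<and>
        ?M $$ (n + p, q) = (y $$ (i, j) \<cdot>\<^sub>m eA n i j) $$ (n + p, q) \<and>
        ?M $$ (n + p, n + q) = (y $$ (i, j) \<cdot>\<^sub>m eA n i j) $$ (n + p, n + q)"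
      using pq ij eq eq2 ne2 ye(1)[OF pq] ye(3)[OF pq] by (auto simp: eA_def dA_def)
  qed auto
  finally show ?thesis using smult_cancel ne by auto
qed

lemma eS_mem:
  assumes y: "y \<in> W" and ij: "i < n" "j < n" and ne: "y $$ (i, n + j) \<noteq> 0"
  shows "eS n i j \<in> W"
proof -
  have yu: "y \<in> sp n" "y \<in> filt n 1" using W_u y by auto
  note ye = sp_filt_1_entries[OF yu]
  \<comment> \<open>The factor 1/2 compensates for the entry 2 of \<open>eS n i i\<close>.\<close>
  let ?c = "y $$ (i, n + j) * (if i = j then 1 / 2 else 1)"
  let ?M = "mat (2 * n) (2 * n) (\<lambda>(p, q). if rwt n p - rwt n q = rwt n i - rwt n (n + j) then y $$ (p, q) else 0)"
  have "?M \<in> W"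
    by (rule weight_component[OF W W_ad[OF hdiag_sp_filt] y])
  also have "?M = ?c \<cdot>\<^sub>m eS n i j"
  proof (rule block_eqI[of _ n])
    fix p q assume pq: "p < n" "q < n"
    have gt: "(0::int) < 3 ^ a" for a :: nat by simp
    have eq: "(rwt n p - rwt n (n + q) = rwt n i - rwt n (n + j)) \<longleftrightarrow> (p = i \<and> q = j) \<or> (p = j \<and> q = i)"
      using pow3_sum_eq[of p q i j] pq ij by (auto simp: rwt_def)
    \<comment> \<open>For p > q the two weights may coincide, as in 3 - 1 = 1 + 1; there
      \<open>y\<close> vanishes because it is strictly triangular.\<close>
    have less: "rwt n p - rwt n q \<noteq> rwt n i - rwt n (n + j)" if "p < q"
    proof -
      have "(3::int) ^ p < 3 ^ q" using that by simp
      then have "rwt n p - rwt n q < 0" using pq by (simp add: rwt_def)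
      moreover have "rwt n i - rwt n (n + j) > 0" using ij add_pos_pos[OF gt[of i] gt[of j]] by (simp add: rwt_def)
      ultimately show ?thesis by simp
    qed
    have less2: "rwt n (n + p) - rwt n (n + q) \<noteq> rwt n i - rwt n (n + j)" if "q < p"
    proof -
      have "(3::int) ^ q < 3 ^ p" using that by simp
      then have "rwt n (n + p) - rwt n (n + q) < 0" using pq by (simp add: rwt_def)
      moreover have "rwt n i - rwt n (n + j) > 0" using ij add_pos_pos[OF gt[of i] gt[of j]] by (simp add: rwt_def)
      ultimately show ?thesis by simp
    qed
    have a: "?M $$ (p, q) = 0" using less pq ye(2)[OF pq] by (cases "p < q") auto
    have b: "?M $$ (n + p, n + q) = 0"
      using less2 pq ye(3)[OF pq] ye(2)[OF pq(2,1)] by (cases "q < p") auto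
    have c: "?M $$ (n + p, q) = 0" using pq ye(1)[OF pq] by simp
    have d: "?M $$ (p, n + q) = ?c * sE i j p q"
    proof (cases "p = i \<and> q = j \<or> p = j \<and> q = i")
      case True
      then have "?M $$ (p, n + q) = y $$ (p, n + q)" using eq pq by simp
      also have "\<dots> = y $$ (i, n + j)" using True ye(4)[OF ij] by (elim disjE) (elim conjE, simp)+
      finally show ?thesis using True by (simp only: sE_eq if_True) simp
    next
      case False
      then have "rwt n p - rwt n (n + q) \<noteq> rwt n i - rwt n (n + j)" using eq by blast
      then have "?M $$ (p, n + q) = 0" using pq by simp
      then show ?thesis using False by (simp only: sE_eq if_False mult_zero_right)
    qed
    show "?M $$ (p, q) = (?c \<cdot>\<^sub>m eS n i j) $$ (p, q) \<and>
        ?M $$ (p, n + q) = (?c \<cdot>\<^sub>m eS n i j) $$ (p, n + q) \<and>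
        ?M $$ (n + p, q) = (?c \<cdot>\<^sub>m eS n i j) $$ (n + p, q) \<and>
        ?M $$ (n + p, n + q) = (?c \<cdot>\<^sub>m eS n i j) $$ (n + p, n + q)"
      unfolding a b c d using pq by (simp add: eS_def xS_def)
  qed auto
  finally show ?thesis using smult_cancel[of ?c "eS n i j"] ne by auto
qed

definition roots :: "complex mat set" where
  "roots = {eA n i j | i j. i < j \<and> j < n \<and> eA n i j \<in> W} \<union> {eS n i j | i j. i \<le> j \<and> j < n \<and> eS n i j \<in> W}"

lemma finite_roots: "finite roots"
proof (rule finite_subset)
  show "roots \<subseteq> (\<lambda>(i, j). eA n i j) ` ({..<n} \<times> {..<n}) \<union> (\<lambda>(i, j). eS n i j) ` ({..<n} \<times> {..<n})"
    by (auto simp: roots_def)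
qed auto

lemma roots_W: "roots \<subseteq> W"
  by (auto simp: roots_def)

definition top_support :: "complex mat \<Rightarrow> (nat \<times> nat) set" where
  "top_support y = {(p, q). p < n \<and> q < 2 * n \<and> y $$ (p, q) \<noteq> 0}"

lemma finite_top_support: "finite (top_support y)"
  by (rule finite_subset[of _ "{..<n} \<times> {..<2 * n}"]) (auto simp: top_support_def)

text \<open>Subtracting the component along a root vector that occurs in \<open>y\<close> shrinks
  the support in the upper half, and that root vector is in \<open>W\<close> by the weight argument.
  If nothing is left in the upper half, \<open>y\<close> is zero, since the lower half is determined
  by it.\<close>

lemma W_induct:
  assumes "y \<in> W" and zero: "Q (0\<^sub>m (2 * n) (2 * n))"
    and add: "\<And>v e c. v \<in> W \<Longrightarrow> e \<in> roots \<Longrightarrow> Q v \<Longrightarrow> Q (v + c \<cdot>\<^sub>m e)"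
  shows "Q y"
  using assms(1)
proof (induction "card (top_support y)" arbitrary: y rule: less_induct)
  case less
  have yu: "y \<in> sp n" "y \<in> filt n 1" using W_u less.prems by auto
  note ye = sp_filt_1_entries[OF yu] and yC = W_C[OF less.prems]
  have step: "Q y" if e: "e \<in> roots" and sub: "top_support (y - c \<cdot>\<^sub>m e) \<subset> top_support y" for e c
  proof -
    have eW: "e \<in> W" using roots_W e by auto
    have "y - c \<cdot>\<^sub>m e \<in> W" by (rule mat_subspace_minus[OF W less.prems mat_subspaceD(4)[OF W eW]])
    moreover have "Q (y - c \<cdot>\<^sub>m e)"
      by (rule less.hyps[OF psubset_card_mono[OF finite_top_support sub] \<open>y - c \<cdot>\<^sub>m e \<in> W\<close>])
    ultimately have "Q (y - c \<cdot>\<^sub>m e + c \<cdot>\<^sub>m e)" by (rule add[OF _ e])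
    moreover have "y - c \<cdot>\<^sub>m e + c \<cdot>\<^sub>m e = y"
      using yC W_C[OF eW] by (intro eq_matI) auto
    ultimately show "Q y" by simp
  qed
  show ?case
  proof (cases "\<exists>i j. i < j \<and> j < n \<and> y $$ (i, j) \<noteq> 0")
    case True
    then obtain i j where ij: "i < j" "j < n" "y $$ (i, j) \<noteq> 0" by auto
    show ?thesis
    proof (rule step[of "eA n i j" "y $$ (i, j)"])
      show "eA n i j \<in> roots" using eA_mem[OF less.prems ij] ij by (auto simp: roots_def)
      have "(y - y $$ (i, j) \<cdot>\<^sub>m eA n i j) $$ (p, q) = (if p = i \<and> q = j then 0 else y $$ (p, q))"
        if "p < n" "q < 2 * n" for p q
        using that(2) by (elim block_cases) (use that ij yC in \<open>auto simp: eA_def dA_def\<close>)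
      then have "top_support (y - y $$ (i, j) \<cdot>\<^sub>m eA n i j) = top_support y - {(i, j)}"
        by (auto simp: top_support_def split: if_splits)
      moreover have "(i, j) \<in> top_support y" using ij by (simp add: top_support_def)
      ultimately show "top_support (y - y $$ (i, j) \<cdot>\<^sub>m eA n i j) \<subset> top_support y" by auto
    qed
  next
    case noA: False
    show ?thesis
    proof (cases "\<exists>i j. i < n \<and> j < n \<and> y $$ (i, n + j) \<noteq> 0")
      case True
      then obtain i0 j0 where ij0: "i0 < n" "j0 < n" "y $$ (i0, n + j0) \<noteq> 0" by auto
      define i j where "i = min i0 j0" and "j = max i0 j0"
      have ij: "i \<le> j" "i < n" "j < n" "y $$ (i, n + j) \<noteq> 0" "y $$ (j, n + i) = y $$ (i, n + j)"
        using ij0 ye(4)[OF ij0(1,2)] by (auto simp: i_def j_def min_def max_def)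
      let ?c = "y $$ (i, n + j) * (if i = j then 1 / 2 else 1)"
      show ?thesis
      proof (rule step[of "eS n i j" ?c])
        show "eS n i j \<in> roots" using eS_mem[OF less.prems ij(2-4)] ij by (auto simp: roots_def)
        have "(y - ?c \<cdot>\<^sub>m eS n i j) $$ (p, q)
            = (if (p = i \<and> q = n + j) \<or> (p = j \<and> q = n + i) then 0 else y $$ (p, q))"
          if pq: "p < n" "q < 2 * n" for p q
        proof -
          have "(y - ?c \<cdot>\<^sub>m eS n i j) $$ (p, q) = y $$ (p, q) - ?c * eS n i j $$ (p, q)"
            using pq yC carrier_matD[OF eS_carrier[of n i j]] by (subst index_minus_mat) simp_all
          also have "\<dots> = (if (p = i \<and> q = n + j) \<or> (p = j \<and> q = n + i) then 0 else y $$ (p, q))"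
            using pq(2)
          proof (cases rule: block_cases)
            case (2 b)
            have "eS n i j $$ (p, q) = sE i j p b" using 2 pq by (simp add: eS_def)
            moreover have "?c * sE i j p b = (if (p = i \<and> b = j) \<or> (p = j \<and> b = i) then y $$ (p, n + b) else 0)"
              unfolding sE_eq using ij(5) by (cases "i = j") auto
            ultimately show ?thesis using 2 by simp
          qed (use pq ij in \<open>simp add: eS_def\<close>)
          finally show ?thesis .
        qed
        then have "top_support (y - ?c \<cdot>\<^sub>m eS n i j) = top_support y - {(i, n + j), (j, n + i)}"
          by (auto simp: top_support_def split: if_splits)
        moreover have "(i, n + j) \<in> top_support y" using ij by (simp add: top_support_def)
        ultimately show "top_support (y - ?c \<cdot>\<^sub>m eS n i j) \<subset> top_support y" by auto
      qed
    next
      case False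
      have "y = 0\<^sub>m (2 * n) (2 * n)"
      proof (rule block_eqI[of _ n])
        fix i j assume ij: "i < n" "j < n"
        have a: "y $$ (i, j) = 0" if "i < n" "j < n" for i j
          using noA that ye(2)[OF that] by (meson not_less)
        show "y $$ (i, j) = 0\<^sub>m (2 * n) (2 * n) $$ (i, j) \<and>
            y $$ (i, n + j) = 0\<^sub>m (2 * n) (2 * n) $$ (i, n + j) \<and>
            y $$ (n + i, j) = 0\<^sub>m (2 * n) (2 * n) $$ (n + i, j) \<and>
            y $$ (n + i, n + j) = 0\<^sub>m (2 * n) (2 * n) $$ (n + i, n + j)"
          using ij a[OF ij] a[OF ij(2,1)] ye(1,3)[OF ij] False by simp
      qed (use yC in auto)
      then show ?thesis using zero by simp
    qed
  qed
qed

section \<open>Which root vectors a Borel-stable subspace contains\<close>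

lemma eS_down:
  assumes "eS n q k \<in> W" "p \<le> q" "q < n" "k < n" shows "eS n p k \<in> W"
proof (cases "p = q")
  case False
  then have pq: "p < q" "p < n" using assms by auto
  have "eA n p q * eS n q k - eS n q k * eA n p q \<in> W"
    using pq by (intro W_ad eA_sp eA_filt assms) auto
  then show ?thesis
    using eA_eS_bracket[OF pq(2) assms(3,4)] pq smult_cancel[of _ "eS n p k"] by (auto split: if_splits)
qed (use assms in simp)

lemma eS_down2:
  assumes "eS n i j \<in> W" "p \<le> i" "q \<le> j" "i < n" "j < n" shows "eS n p q \<in> W"
proof -
  have "eS n p j \<in> W" using eS_down[OF assms(1,2,4,5)] .
  then have "eS n j p \<in> W" by (simp add: eS_sym)
  then have "eS n q p \<in> W" using assms by (intro eS_down[of j p q]) auto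
  then show ?thesis by (simp add: eS_sym)
qed

lemma eS_diag: "eS n i j \<in> W \<Longrightarrow> i \<le> j \<Longrightarrow> j < n \<Longrightarrow> eS n i i \<in> W"
  using eS_down2[of i j i i] by auto

text \<open>The root e_i + e_l is the sum of e_i - e_j and e_j + e_l. With \<open>l = i\<close> it
  follows that 2e_i occurs, which later supplies the pivot for removing e_i - e_j.\<close>

lemma eA_eS_mem:
  assumes "eA n i j \<in> W" "i < j" "j < n" "l < n" shows "eS n i l \<in> W"
proof -
  have "eS n j l * eA n i j - eA n i j * eS n j l \<in> W"
    by (intro W_ad eS_sp eS_filt0 assms)
  then have "(-1) \<cdot>\<^sub>m (eS n j l * eA n i j - eA n i j * eS n j l) \<in> W" by (rule mat_subspaceD(4)[OF W])
  also have "(-1) \<cdot>\<^sub>m (eS n j l * eA n i j - eA n i j * eS n j l) = eA n i j * eS n j l - eS n j l * eA n i j"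
    by (rule neg_minus_mat[OF mult_carrier_mat[OF eS_carrier eA_carrier] mult_carrier_mat[OF eA_carrier eS_carrier]])
  also have "\<dots> = (if j = l then 2 else 1) \<cdot>\<^sub>m eS n i l"
    using assms by (intro eA_eS_bracket) auto
  finally show ?thesis using smult_cancel[of _ "eS n i l"] by (auto split: if_splits)
qed

text \<open>The number of long roots in \<open>W\<close>; by \<open>eS_down2\<close> their indices
  form an initial segment.\<close>

definition m :: nat where "m = (LEAST i. n \<le> i \<or> eS n i i \<notin> W)"

lemma m_le: "m \<le> n"
  unfolding m_def by (rule Least_le) simp

lemma less_m: "i < m \<Longrightarrow> i < n \<and> eS n i i \<in> W"
  unfolding m_def using not_less_Least[of i "\<lambda>i. n \<le> i \<or> eS n i i \<notin> W"] by auto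

lemma m_iff: "i < n \<Longrightarrow> eS n i i \<in> W \<longleftrightarrow> i < m"
proof
  assume i: "i < n" "eS n i i \<in> W"
  have "n \<le> m \<or> eS n m m \<notin> W" unfolding m_def by (rule LeastI[of _ n]) simp
  then show "i < m" using eS_down2[OF i(2), of m m] i(1) by (meson le_less_trans not_less)
qed (use less_m in auto)

lemma eS_m: "i < m \<Longrightarrow> j < m \<Longrightarrow> eS n i j \<in> W"
  using eS_down2[of "max i j" "max i j" i j] less_m[of "max i j"] by (auto simp: max_def split: if_splits)

end

section \<open>Nilradicals of standard parabolic subalgebras\<close>

text \<open>The terms are grouped for \<open>a\<close> and \<open>c\<close> in an ideal: the first
  two belong to the ideal, written with its element on the right of the bracket, and the last one is
  a bracket of the other summands.\<close>

lemma bracket_add_add: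
  fixes a b c d :: "complex mat"
  assumes "a \<in> carrier_mat N N" "b \<in> carrier_mat N N" "c \<in> carrier_mat N N" "d \<in> carrier_mat N N"
  shows "(a + b) * (c + d) - (c + d) * (a + b)
    = ((-1) \<cdot>\<^sub>m ((c + d) * a - a * (c + d)) + (b * c - c * b)) + (b * d - d * b)"
proof -
  have C: "x * y \<in> carrier_mat N N" if "x \<in> carrier_mat N N" "y \<in> carrier_mat N N" for x y :: "complex mat"
    using that by (rule mult_carrier_mat)
  note carr = carrier_matD[OF C[OF assms(1,3)]] carrier_matD[OF C[OF assms(1,4)]]
    carrier_matD[OF C[OF assms(2,3)]] carrier_matD[OF C[OF assms(2,4)]]
    carrier_matD[OF C[OF assms(3,1)]] carrier_matD[OF C[OF assms(4,1)]]
    carrier_matD[OF C[OF assms(3,2)]] carrier_matD[OF C[OF assms(4,2)]]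
  have e: "(a + b) * (c + d) = (a * c + a * d) + (b * c + b * d)"
    "(c + d) * (a + b) = (c * a + d * a) + (c * b + d * b)"
    "(c + d) * a = c * a + d * a" "a * (c + d) = a * c + a * d"
    using assms add_carrier_mat[OF assms(4), of c] add_carrier_mat[OF assms(2), of a]
    by (simp_all add: add_mult_distrib_mat[of _ N N] mult_add_distrib_mat[of _ N N] C comm_add_mat[of "c * a" N N]
      assoc_add_mat[of _ N N])
       (intro eq_matI, auto simp: carr simp del: index_mult_mat)
  show ?thesis unfolding e by (rule eq_matI) (auto simp: carr simp del: index_mult_mat)
qed

definition mat_sum :: "complex mat set \<Rightarrow> complex mat set \<Rightarrow> complex mat set" where
  "mat_sum A B = {x + y | x y. x \<in> A \<and> y \<in> B}"

lemma mat_subspace_mat_sum: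
  assumes A: "mat_subspace N A" and B: "mat_subspace N B" shows "mat_subspace N (mat_sum A B)"
  unfolding mat_subspace_def
proof (intro conjI ballI allI)
  have AC: "x \<in> carrier_mat N N" if "x \<in> A" for x using mat_subspaceD(1)[OF A that] .
  have BC: "x \<in> carrier_mat N N" if "x \<in> B" for x using mat_subspaceD(1)[OF B that] .
  show "mat_sum A B \<subseteq> carrier_mat N N" using BC by (auto simp: mat_sum_def)
  have "0\<^sub>m N N + 0\<^sub>m N N \<in> mat_sum A B"
    using mat_subspaceD(2)[OF A] mat_subspaceD(2)[OF B] unfolding mat_sum_def by blast
  then show "0\<^sub>m N N \<in> mat_sum A B" by simp
  fix u assume "u \<in> mat_sum A B"
  then obtain x y where u: "u = x + y" "x \<in> A" "y \<in> B" by (auto simp: mat_sum_def)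
  show "c \<cdot>\<^sub>m u \<in> mat_sum A B" for c
  proof -
    have "c \<cdot>\<^sub>m u = c \<cdot>\<^sub>m x + c \<cdot>\<^sub>m y" unfolding u(1) by (rule add_smult_distrib_left_mat[OF AC[OF u(2)] BC[OF u(3)]])
    then show ?thesis using mat_subspaceD(4)[OF A u(2)] mat_subspaceD(4)[OF B u(3)] unfolding mat_sum_def by blast
  qed
  fix v assume "v \<in> mat_sum A B"
  then obtain x' y' where v: "v = x' + y'" "x' \<in> A" "y' \<in> B" by (auto simp: mat_sum_def)
  have "u + v = (x + x') + (y + y')" unfolding u(1) v(1)
    using AC[OF u(2)] AC[OF v(2)] BC[OF u(3)] BC[OF v(3)] by (intro eq_matI) auto
  then show "u + v \<in> mat_sum A B"
    using mat_subspaceD(3)[OF A u(2) v(2)] mat_subspaceD(3)[OF B u(3) v(3)] unfolding mat_sum_def by blast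
qed

lemma mat_sum_superset:
  assumes "mat_subspace N A" "mat_subspace N B" shows "A \<subseteq> mat_sum A B" "B \<subseteq> mat_sum A B"
proof -
  show "A \<subseteq> mat_sum A B"
  proof
    fix x assume x: "x \<in> A"
    then have "x = x + 0\<^sub>m N N" using mat_subspaceD(1)[OF assms(1)] by simp
    then show "x \<in> mat_sum A B" using x mat_subspaceD(2)[OF assms(2)] unfolding mat_sum_def by blast
  qed
  show "B \<subseteq> mat_sum A B"
  proof
    fix x assume x: "x \<in> B"
    then have "x = 0\<^sub>m N N + x" using mat_subspaceD(1)[OF assms(2)] by simp
    then show "x \<in> mat_sum A B" using x mat_subspaceD(2)[OF assms(1)] unfolding mat_sum_def by blast
  qed
qed

lemma derived_series_subspace:
  assumes "lie_subalgebra N L"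
  shows "lie_subalgebra N (derived_series N L k)" "derived_series N L k \<subseteq> L"
proof (induction k)
  case 0
  show "lie_subalgebra N (derived_series N L 0)" "derived_series N L 0 \<subseteq> L" using assms by simp_all
next
  case (Suc k)
  show "lie_subalgebra N (derived_series N L (Suc k))" "derived_series N L (Suc k) \<subseteq> L"
    using lie_subalgebra_derived[OF Suc(1)] Suc(2) by auto
qed

lemma lower_central_subspace:
  assumes "lie_subalgebra N L"
  shows "mat_subspace N (lower_central_series N L k) \<and> lower_central_series N L k \<subseteq> L"
proof (induction k)
  case (Suc k)
  have L: "mat_subspace N L" "\<And>x y. x \<in> L \<Longrightarrow> y \<in> L \<Longrightarrow> x * y - y * x \<in> L"
    using assms by (auto simp: lie_subalgebra_iff)
  have LC: "L \<subseteq> carrier_mat N N" using mat_subspaceD(1)[OF L(1)] by blast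
  have "mat_subspace N (lie_bracket N L (lower_central_series N L k))"
    using Suc LC by (intro mat_subspace_lie_bracket) auto
  moreover have "lie_bracket N L (lower_central_series N L k) \<subseteq> L"
    using Suc by (intro lie_bracket_least[OF L(1) L(2)]) auto
  ultimately show ?case by simp
qed (use assms in \<open>simp add: lie_subalgebra_iff\<close>)

lemma lie_ideal_subalgebra: "lie_ideal N L I \<Longrightarrow> lie_subalgebra N I"
  unfolding lie_ideal_iff lie_subalgebra_iff by blast

text \<open>The sum of \<open>I\<close> and \<bb> is a solvable subalgebra. Modulo \<open>I\<close>
  its derived series follows that of \<bb>, so after finitely many steps it is inside
  \<open>I\<close>, and from there it descends along the lower central series of \<open>I\<close>.
  By maximality of \<bb> the sum is \<bb>.\<close>

lemma nilpotent_ideal_subset_borel: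
  assumes b: "borel_subalgebra N \<gg> \<bb>" and p: "standard_parabolic N \<gg> \<bb> \<pp>"
    and I: "lie_ideal N \<pp> I" "nilpotent_lie N I"
  shows "I \<subseteq> \<bb>"
proof -
  have bb: "lie_subalgebra N \<bb>" "solvable_lie N \<bb>" "\<bb> \<subseteq> \<gg>"
    and max: "\<And>\<cc>. lie_subalgebra N \<cc> \<Longrightarrow> solvable_lie N \<cc> \<Longrightarrow> \<bb> \<subseteq> \<cc> \<Longrightarrow> \<cc> \<subseteq> \<gg> \<Longrightarrow> \<cc> = \<bb>"
    using b by (auto simp: borel_subalgebra_def)
  have pp: "lie_subalgebra N \<pp>" "\<bb> \<subseteq> \<pp>" "\<pp> \<subseteq> \<gg>" using p by (auto simp: standard_parabolic_def)
  have p_sub: "mat_subspace N \<pp>" using pp(1) by (simp add: lie_subalgebra_iff)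
  have b_sub: "mat_subspace N \<bb>" using bb(1) by (simp add: lie_subalgebra_iff)
  have I_sub: "mat_subspace N I" "I \<subseteq> \<pp>" and I_ad: "\<And>x y. x \<in> \<pp> \<Longrightarrow> y \<in> I \<Longrightarrow> x * y - y * x \<in> I"
    using I(1) by (auto simp: lie_ideal_iff)
  have pC: "x \<in> carrier_mat N N" if "x \<in> \<pp>" for x using mat_subspaceD(1)[OF p_sub that] .
  obtain d where d: "derived_series N \<bb> d = {0\<^sub>m N N}" using bb(2) by (auto simp: solvable_lie_def)
  obtain K where K: "lower_central_series N I K = {0\<^sub>m N N}" using I(2) by (auto simp: nilpotent_lie_def)
  let ?D = "derived_series N \<bb>"
  have D_sub: "mat_subspace N (?D k)" "?D k \<subseteq> \<pp>" for k
    using derived_series_subspace[OF bb(1), of k] pp(2) by (auto simp: lie_subalgebra_iff)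
  have br: "u * v - v * u \<in> mat_sum I (lie_bracket N (?D k) (?D k))"
    if uv: "u \<in> mat_sum I (?D k)" "v \<in> mat_sum I (?D k)" for u v k
  proof -
    obtain x y where u: "u = x + y" "x \<in> I" "y \<in> ?D k" using uv(1) by (auto simp: mat_sum_def)
    obtain x' y' where v: "v = x' + y'" "x' \<in> I" "y' \<in> ?D k" using uv(2) by (auto simp: mat_sum_def)
    have P: "x \<in> \<pp>" "y \<in> \<pp>" "x' \<in> \<pp>" "y' \<in> \<pp>" using u v I_sub D_sub by auto
    have DC: "?D k \<subseteq> carrier_mat N N" using mat_subspaceD(1)[OF D_sub(1)] by blast
    have "u * v - v * u = ((-1) \<cdot>\<^sub>m ((x' + y') * x - x * (x' + y')) + (y * x' - x' * y)) + (y * y' - y' * y)"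
      unfolding u(1) v(1) by (rule bracket_add_add[OF pC[OF P(1)] pC[OF P(2)] pC[OF P(3)] pC[OF P(4)]])
    moreover have "(-1) \<cdot>\<^sub>m ((x' + y') * x - x * (x' + y')) + (y * x' - x' * y) \<in> I"
      using mat_subspaceD(3)[OF p_sub P(3,4)]
      by (intro mat_subspaceD(3)[OF I_sub(1)] mat_subspaceD(4)[OF I_sub(1)] I_ad P u v)
    moreover have "y * y' - y' * y \<in> lie_bracket N (?D k) (?D k)"
      by (rule bracket_in_lie_bracket[OF DC DC u(3) v(3)])
    ultimately show ?thesis unfolding mat_sum_def by blast
  qed
  let ?c = "mat_sum I \<bb>"
  have c_sub: "mat_subspace N ?c" by (rule mat_subspace_mat_sum[OF I_sub(1) b_sub])
  have c_p: "?c \<subseteq> \<pp>" using mat_subspaceD(3)[OF p_sub] I_sub(2) pp(2) by (auto simp: mat_sum_def)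
  have c_lie: "lie_subalgebra N ?c"
    unfolding lie_subalgebra_iff
  proof (intro conjI ballI c_sub)
    fix x y assume "x \<in> ?c" "y \<in> ?c"
    then have "x * y - y * x \<in> mat_sum I (lie_bracket N \<bb> \<bb>)" using br[of x 0 y] by simp
    then show "x * y - y * x \<in> ?c" using lie_subalgebra_derived(1)[OF bb(1)] by (auto simp: mat_sum_def)
  qed
  have c_D: "derived_series N ?c k \<subseteq> mat_sum I (?D k)" for k
  proof (induction k)
    case (Suc k)
    have "lie_bracket N (derived_series N ?c k) (derived_series N ?c k) \<subseteq> mat_sum I (?D (Suc k))"
    proof (rule lie_bracket_least[OF mat_subspace_mat_sum[OF I_sub(1) D_sub(1)]])
      fix x y assume "x \<in> derived_series N ?c k" "y \<in> derived_series N ?c k"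
      then show "x * y - y * x \<in> mat_sum I (?D (Suc k))" using br[of x k y] Suc by auto
    qed
    then show ?case by simp
  qed simp
  note LC = lower_central_subspace[OF lie_ideal_subalgebra[OF I(1)]]
  have IC: "I \<subseteq> carrier_mat N N" using mat_subspaceD(1)[OF I_sub(1)] by blast
  have c_L: "derived_series N ?c (d + k) \<subseteq> lower_central_series N I k" for k
  proof (induction k)
    case 0
    have "mat_sum I {0\<^sub>m N N} \<subseteq> I" using IC by (auto simp: mat_sum_def)
    then show ?case using c_D[of d] d by auto
  next
    case (Suc k)
    have "lie_bracket N (derived_series N ?c (d + k)) (derived_series N ?c (d + k)) \<subseteq> lower_central_series N I (Suc k)"
    proof (rule lie_bracket_least)
      show "mat_subspace N (lower_central_series N I (Suc k))" using LC by blast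
      fix x y assume "x \<in> derived_series N ?c (d + k)" "y \<in> derived_series N ?c (d + k)"
      then have xy: "x \<in> I" "y \<in> lower_central_series N I k" using Suc LC[of k] by auto
      have "lower_central_series N I k \<subseteq> carrier_mat N N" using LC[of k] IC by auto
      then show "x * y - y * x \<in> lower_central_series N I (Suc k)"
        using bracket_in_lie_bracket[OF IC _ xy] by simp
    qed
    then show ?case by simp
  qed
  have "derived_series N ?c (d + K) = {0\<^sub>m N N}"
  proof -
    have "mat_subspace N (derived_series N ?c (d + K))"
      using derived_series_subspace(1)[OF c_lie] by (simp add: lie_subalgebra_iff)
    then show ?thesis using c_L[of K] K mat_subspaceD(2) by auto
  qed
  then have "solvable_lie N ?c" unfolding solvable_lie_def by blast
  then have "?c = \<bb>"
    by (rule max[OF c_lie _ mat_sum_superset(2)[OF I_sub(1) b_sub]]) (use c_p pp(3) in blast)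
  then show ?thesis using mat_sum_superset(1)[OF I_sub(1) b_sub] by simp
qed

lemma sp_filt_0_decomp:
  assumes "y \<in> sp n" "y \<in> filt n 0"
  shows "y = dA n (\<lambda>p q. y $$ (p, q)) + xS n (\<lambda>p q. y $$ (p, n + q))"
proof (rule block_eqI[of _ n])
  fix i j assume ij: "i < n" "j < n"
  note e = sp_filt_0_entries[OF assms]
  show "y $$ (i, j) = (dA n (\<lambda>p q. y $$ (p, q)) + xS n (\<lambda>p q. y $$ (p, n + q))) $$ (i, j) \<and>
      y $$ (i, n + j) = (dA n (\<lambda>p q. y $$ (p, q)) + xS n (\<lambda>p q. y $$ (p, n + q))) $$ (i, n + j) \<and>
      y $$ (n + i, j) = (dA n (\<lambda>p q. y $$ (p, q)) + xS n (\<lambda>p q. y $$ (p, n + q))) $$ (n + i, j) \<and>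
      y $$ (n + i, n + j) = (dA n (\<lambda>p q. y $$ (p, q)) + xS n (\<lambda>p q. y $$ (p, n + q))) $$ (n + i, n + j)"
    using ij e(1)[OF ij] e(3)[OF ij] carrier_matD[OF xS_carrier[of n]] by simp
qed (use sp_carrier[OF assms(1)] in auto)

lemma filt_1_if_diag_0:
  assumes y: "y \<in> sp n" "y \<in> filt n 0" and diag: "\<And>i. i < n \<Longrightarrow> y $$ (i, i) = 0"
  shows "y \<in> filt n 1"
proof -
  have "dA n (\<lambda>p q. y $$ (p, q)) \<in> filt n 1"
  proof (rule dA_filt)
    fix p q assume pq: "p < n" "q < n" "\<not> p + 1 \<le> q"
    show "y $$ (p, q) = 0"
      using sp_filt_0_entries(2)[OF y pq(1,2)] diag[OF pq(1)] pq(3) by (cases "p = q") auto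
  qed
  then show ?thesis
    using mat_subspaceD(3)[OF mat_subspace_filt _ xS_filt] sp_filt_0_decomp[OF y] by metis
qed

lemma sp_filt_0_xS_bracket:
  assumes "y \<in> sp n" "y \<in> filt n 0"
  shows "y * xS n T - xS n T * y = xS n (\<lambda>p q. \<Sum>l<n. y $$ (p, l) * T l q + T p l * y $$ (q, l))"
proof -
  let ?A = "dA n (\<lambda>p q. y $$ (p, q))" and ?S = "xS n (\<lambda>p q. y $$ (p, n + q))"
  note e = sp_filt_0_decomp[OF assms]
  have "y * xS n T = ?A * xS n T"
    by (subst e) (simp add: add_mult_distrib_mat[OF dA_carrier xS_carrier xS_carrier] xS_mult_xS
      right_add_zero_mat[OF mult_carrier_mat[OF dA_carrier xS_carrier]])
  moreover have "xS n T * y = xS n T * ?A"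
    by (subst e) (simp add: mult_add_distrib_mat[OF xS_carrier dA_carrier xS_carrier] xS_mult_xS
      right_add_zero_mat[OF mult_carrier_mat[OF xS_carrier dA_carrier]])
  ultimately show ?thesis using dA_xS_bracket[of n "\<lambda>p q. y $$ (p, q)" T] by simp
qed

section \<open>The nilradical in adapted coordinates\<close>

locale sp_parabolic = conj_mat "2 * n" g gi for n :: nat and g gi :: "complex mat" +
  fixes \<bb> \<pp> :: "complex mat set"
  assumes borel: "borel_subalgebra (2 * n) (sp n) \<bb>"
    and parabolic: "standard_parabolic (2 * n) (sp n) \<bb> \<pp>"
    and b_eq': "\<bb> = {x \<in> carrier_mat (2 * n) (2 * n). gi * x * g \<in> sp n \<inter> filt n 0}"
begin

lemma b_eq: "\<bb> = {x \<in> C. w x \<in> sp n \<inter> filt n 0}"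
  using b_eq' by (simp add: w_def)

lemma b_p: "\<bb> \<subseteq> \<pp>"
  using parabolic by (simp add: standard_parabolic_def)

lemma w'_b: "y \<in> sp n \<Longrightarrow> y \<in> filt n 0 \<Longrightarrow> w' y \<in> \<bb>"
  using sp_carrier[of y] by (simp add: b_eq)

text \<open>A nonzero diagonal entry of \<open>w x\<close> would give repeated brackets with
  \<open>w x\<close> a nonzero eigenvalue on the long root vector \<open>eS n i i\<close>, up to
  lower roots, so they would never vanish. But they run down the lower central series of the
  nilpotent ideal.\<close>

lemma ideal_filt:
  assumes I: "lie_ideal (2 * n) \<pp> I" "nilpotent_lie (2 * n) I" and x: "x \<in> I"
  shows "w x \<in> filt n 1"
proof -
  have xb: "x \<in> \<bb>" using nilpotent_ideal_subset_borel[OF borel parabolic I] x by blast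
  then have xC: "x \<in> C" and y: "w x \<in> sp n" "w x \<in> filt n 0" by (auto simp: b_eq)
  have I_sub: "mat_subspace (2 * n) I" and I_ad: "\<And>x y. x \<in> \<pp> \<Longrightarrow> y \<in> I \<Longrightarrow> x * y - y * x \<in> I"
    using I(1) by (auto simp: lie_ideal_iff)
  have IC: "I \<subseteq> C" using mat_subspaceD(1)[OF I_sub] by blast
  note LC = lower_central_subspace[OF lie_ideal_subalgebra[OF I(1)]]
  obtain K where K: "lower_central_series (2 * n) I K = {0\<^sub>m (2 * n) (2 * n)}"
    using I(2) by (auto simp: nilpotent_lie_def)
  show ?thesis
  proof (rule filt_1_if_diag_0[OF y], rule ccontr)
    fix i assume i: "i < n" and ne: "w x $$ (i, i) \<noteq> 0"
    define Z where "Z k = ((\<lambda>z. w x * z - z * w x) ^^ k) (eS n i i)" for k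
    have Z_Suc: "Z (Suc k) = w x * Z k - Z k * w x" for k by (simp add: Z_def)
    \<comment> \<open>The block stays supported on indices up to \<open>i\<close>, by triangularity,
      and each bracket multiplies its corner entry at (i, i) by twice the diagonal entry of
      \<open>w x\<close>.\<close>
    have Z_xS: "\<exists>T. Z k = xS n T \<and> (\<forall>p<n. \<forall>q<n. (i < p \<or> i < q) \<longrightarrow> T p q = 0) \<and> T i i \<noteq> 0" for k
    proof (induction k)
      case 0
      have "Z 0 = xS n (sE i i)" by (simp add: Z_def eS_def)
      moreover have "\<forall>p<n. \<forall>q<n. (i < p \<or> i < q) \<longrightarrow> sE i i p q = 0" "sE i i i i \<noteq> 0" by (auto simp: sE_eq)
      ultimately show ?case by blast
    next
      case (Suc k)
      then obtain T where T: "Z k = xS n T" "\<And>p q. p < n \<Longrightarrow> q < n \<Longrightarrow> i < p \<or> i < q \<Longrightarrow> T p q = 0" "T i i \<noteq> 0"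
        by blast
      define T' where "T' p q = (\<Sum>l<n. w x $$ (p, l) * T l q + T p l * w x $$ (q, l))" for p q
      have "Z (Suc k) = xS n T'" unfolding Z_Suc T(1) T'_def by (rule sp_filt_0_xS_bracket[OF y])
      moreover have "T' p q = 0" if "p < n" "q < n" "i < p \<or> i < q" for p q
        unfolding T'_def
      proof (intro sum.neutral ballI)
        fix l assume "l \<in> {..<n}"
        then have l: "l < n" by simp
        have "w x $$ (p, l) * T l q = 0"
          using sp_filt_0_entries(2)[OF y that(1) l] T(2)[OF l that(2)] that(3) by (cases "l < p") auto
        moreover have "T p l * w x $$ (q, l) = 0"
          using sp_filt_0_entries(2)[OF y that(2) l] T(2)[OF that(1) l] that(3) by (cases "l < q") auto
        ultimately show "w x $$ (p, l) * T l q + T p l * w x $$ (q, l) = 0" by (simp only: add_0)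
      qed
      moreover have "T' i i = (\<Sum>l<n. if l = i then 2 * (w x $$ (i, i) * T i i) else 0)"
        unfolding T'_def
      proof (intro sum.cong refl)
        fix l assume "l \<in> {..<n}"
        then have l: "l < n" by simp
        show "w x $$ (i, l) * T l i + T i l * w x $$ (i, l) = (if l = i then 2 * (w x $$ (i, i) * T i i) else 0)"
        proof (cases l i rule: linorder_cases)
          case less then show ?thesis using sp_filt_0_entries(2)[OF y i l] by simp
        next
          case greater then show ?thesis using T(2)[OF l i] T(2)[OF i l] by simp
        qed (simp add: mult.commute)
      qed
      then have "T' i i \<noteq> 0" using i ne T(3) by simp
      ultimately show ?case by blast
    qed
    have ZC: "Z k \<in> C" for k using Z_xS[of k] xS_carrier by metis
    \<comment> \<open>The starting vector is known to be in \<bb> only; the first bracket with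
      \<open>x\<close> brings it into the ideal, hence the shift by one.\<close>
    have Z_LC: "w' (Z (Suc k)) \<in> lower_central_series (2 * n) I k" for k
    proof (induction k)
      case 0
      have "w' (Z 0) \<in> \<pp>" using w'_b[OF eS_sp eS_filt0] b_p by (auto simp: Z_def)
      then have "(-1) \<cdot>\<^sub>m (w' (Z 0) * x - x * w' (Z 0)) \<in> I"
        by (intro mat_subspaceD(4)[OF I_sub] I_ad x)
      moreover have "(-1) \<cdot>\<^sub>m (w' (Z 0) * x - x * w' (Z 0)) = w' (Z (Suc 0))"
        unfolding Z_Suc using ZC[of 0] xC by (simp add: w'_minus w'_mult neg_minus_mat[of _ "2 * n"])
      ultimately show ?case by simp
    next
      case (Suc k)
      have "w' (Z (Suc (Suc k))) = x * w' (Z (Suc k)) - w' (Z (Suc k)) * x"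
        unfolding Z_Suc[of "Suc k"] using ZC[of "Suc k"] xC by (simp add: w'_minus w'_mult)
      moreover have "lower_central_series (2 * n) I k \<subseteq> C" using LC[of k] IC by auto
      ultimately show ?case using bracket_in_lie_bracket[OF IC _ x Suc] by simp
    qed
    have "w' (Z (Suc K)) = 0\<^sub>m (2 * n) (2 * n)" using Z_LC[of K] K by simp
    then have "Z (Suc K) = 0\<^sub>m (2 * n) (2 * n)" using w_w'[OF ZC] w_0 by metis
    moreover obtain T where "Z (Suc K) = xS n T" "T i i \<noteq> 0" using Z_xS by blast
    ultimately have "xS n T $$ (i, n + i) = 0" using i by simp
    then show False using \<open>T i i \<noteq> 0\<close> i by simp
  qed
qed

abbreviation "nn \<equiv> nilradical (2 * n) \<pp>"

definition W where "W = {y \<in> C. w' y \<in> nn}"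

lemma nn_gen_C: "\<Union>{I. lie_ideal (2 * n) \<pp> I \<and> nilpotent_lie (2 * n) I} \<subseteq> C"
  using mat_subspaceD(1) by (fastforce simp: lie_ideal_iff)

lemma nn_sub: "mat_subspace (2 * n) nn"
  unfolding nilradical_def by (rule mat_subspace_lin_span[OF nn_gen_C])

lemma nn_C: "v \<in> nn \<Longrightarrow> v \<in> C"
  using mat_subspaceD(1)[OF nn_sub] .

lemma nn_w: "nn \<subseteq> {x \<in> C. w x \<in> sp n \<inter> filt n 1}"
  unfolding nilradical_def
proof (rule lin_span_least)
  show "\<Union>{I. lie_ideal (2 * n) \<pp> I \<and> nilpotent_lie (2 * n) I} \<subseteq> {x \<in> C. w x \<in> sp n \<inter> filt n 1}"
  proof
    fix x assume "x \<in> \<Union>{I. lie_ideal (2 * n) \<pp> I \<and> nilpotent_lie (2 * n) I}"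
    then obtain I where I: "lie_ideal (2 * n) \<pp> I" "nilpotent_lie (2 * n) I" "x \<in> I" by blast
    have "x \<in> \<bb>" using nilpotent_ideal_subset_borel[OF borel parabolic I(1,2)] I(3) by blast
    then show "x \<in> {x \<in> C. w x \<in> sp n \<inter> filt n 1}" using ideal_filt[OF I] by (auto simp: b_eq)
  qed
  show "mat_subspace (2 * n) {x \<in> C. w x \<in> sp n \<inter> filt n 1}"
    by (intro mat_subspace_w mat_subspace_Int mat_subspace_sp mat_subspace_filt)
qed

lemma mat_subspace_ad_preimage:
  assumes x: "x \<in> C" and A: "mat_subspace (2 * n) A"
  shows "mat_subspace (2 * n) {y \<in> C. x * y - y * x \<in> A}"
proof -
  have 1: "x * (y + z) - (y + z) * x = (x * y - y * x) + (x * z - z * x)" if "y \<in> C" "z \<in> C" for y z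
  proof -
    have "x * (y + z) = x * y + x * z" "(y + z) * x = y * x + z * x"
      using x that by (simp_all add: mult_add_distrib_mat[of _ "2 * n" "2 * n"] add_mult_distrib_mat[of _ "2 * n" "2 * n"])
    then show ?thesis
      using carrier_matD[OF mC[OF x that(1)]] carrier_matD[OF mC[OF x that(2)]]
        carrier_matD[OF mC[OF that(1) x]] carrier_matD[OF mC[OF that(2) x]]
      by (intro eq_matI) (auto simp del: index_mult_mat)
  qed
  have 2: "x * (c \<cdot>\<^sub>m y) - (c \<cdot>\<^sub>m y) * x = c \<cdot>\<^sub>m (x * y - y * x)" if "y \<in> C" for y c
  proof -
    have "x * (c \<cdot>\<^sub>m y) = c \<cdot>\<^sub>m (x * y)" "(c \<cdot>\<^sub>m y) * x = c \<cdot>\<^sub>m (y * x)"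
      using x that by (simp_all add: mult_smult_distrib[of _ "2 * n" "2 * n"] mult_smult_assoc_mat[of _ "2 * n" "2 * n"])
    then show ?thesis
      using carrier_matD[OF mC[OF x that(1)]] carrier_matD[OF mC[OF that(1) x]]
      by (intro eq_matI) (auto simp del: index_mult_mat simp: algebra_simps)
  qed
  have 3: "x * 0\<^sub>m (2 * n) (2 * n) - 0\<^sub>m (2 * n) (2 * n) * x = 0\<^sub>m (2 * n) (2 * n)" using x by simp
  show ?thesis unfolding mat_subspace_def
    using mat_subspaceD[OF A] by (auto simp: 1 2 3)
qed

lemma nn_ad: assumes x: "x \<in> \<pp>" and y: "y \<in> nn" shows "x * y - y * x \<in> nn"
proof -
  have xC: "x \<in> C"
    using parabolic x by (auto simp: standard_parabolic_def lie_subalgebra_iff dest: mat_subspaceD(1))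
  have "nn \<subseteq> {y \<in> C. x * y - y * x \<in> nn}"
    unfolding nilradical_def[of "2 * n" \<pp>]
  proof (rule lin_span_least)
    show "mat_subspace (2 * n) {y \<in> C. x * y - y * x \<in> lin_span (2 * n) (\<Union>{I. lie_ideal (2 * n) \<pp> I \<and> nilpotent_lie (2 * n) I})}"
      using mat_subspace_ad_preimage[OF xC nn_sub] by (simp add: nilradical_def)
    show "\<Union>{I. lie_ideal (2 * n) \<pp> I \<and> nilpotent_lie (2 * n) I} \<subseteq>
        {y \<in> C. x * y - y * x \<in> lin_span (2 * n) (\<Union>{I. lie_ideal (2 * n) \<pp> I \<and> nilpotent_lie (2 * n) I})}"
    proof
      fix y assume yy: "y \<in> \<Union>{I. lie_ideal (2 * n) \<pp> I \<and> nilpotent_lie (2 * n) I}"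
      then have "x * y - y * x \<in> \<Union>{I. lie_ideal (2 * n) \<pp> I \<and> nilpotent_lie (2 * n) I}"
        using x by (auto simp: lie_ideal_iff)
      then show "y \<in> {y \<in> C. x * y - y * x \<in> lin_span (2 * n) (\<Union>{I. lie_ideal (2 * n) \<pp> I \<and> nilpotent_lie (2 * n) I})}"
        using lin_span_superset[OF nn_gen_C] yy nn_gen_C by blast
    qed
  qed
  then show ?thesis using y by blast
qed

sublocale borel_stable n W
proof
  show "mat_subspace (2 * n) W" unfolding W_def by (rule mat_subspace_w'[OF nn_sub])
  show "W \<subseteq> sp n \<inter> filt n 1"
  proof
    fix y assume "y \<in> W"
    then have "y \<in> C" "w (w' y) \<in> sp n \<inter> filt n 1" using nn_w by (auto simp: W_def)
    then show "y \<in> sp n \<inter> filt n 1" by simp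
  qed
  fix h y assume h: "h \<in> sp n" "h \<in> filt n 0" and y: "y \<in> W"
  have hC: "h \<in> C" and yC: "y \<in> C" using sp_carrier h y by (auto simp: W_def)
  have "w' h * w' y - w' y * w' h \<in> nn" using w'_b[OF h] b_p y by (intro nn_ad) (auto simp: W_def)
  moreover have "w' h * w' y - w' y * w' h = w' (h * y - y * h)"
    using hC yC by (simp add: w'_minus w'_mult)
  ultimately show "h * y - y * h \<in> W"
    unfolding W_def using minus_carrier_mat[OF mC[OF yC hC], of "h * y"] by simp
qed

end

section \<open>Exponentials of nilpotent matrices\<close>

definition lc :: "nat \<Rightarrow> nat \<Rightarrow> (nat \<Rightarrow> complex) \<Rightarrow> (nat \<Rightarrow> complex mat) \<Rightarrow> complex mat" where
  "lc N m c A = mat N N (\<lambda>(p, q). \<Sum>k<m. c k * A k $$ (p, q))"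

lemma lc_carrier [simp]: "lc N m c A \<in> carrier_mat N N"
  by (simp add: lc_def)

lemma index_lc: "p < N \<Longrightarrow> q < N \<Longrightarrow> lc N m c A $$ (p, q) = (\<Sum>k<m. c k * A k $$ (p, q))"
  by (simp add: lc_def)

lemma lc_0: "lc N 0 c A = 0\<^sub>m N N"
  by (intro eq_matI) (auto simp: lc_def)

lemma lc_Suc: "A m \<in> carrier_mat N N \<Longrightarrow> lc N (Suc m) c A = lc N m c A + c m \<cdot>\<^sub>m A m"
  by (intro eq_matI) (auto simp: lc_def)

lemma lc_in_subspace:
  assumes "mat_subspace N S" "\<And>k. k < m \<Longrightarrow> A k \<in> S" shows "lc N m c A \<in> S"
  using assms(2)
proof (induction m)
  case 0
  then show ?case using mat_subspaceD(2)[OF assms(1)] by (simp add: lc_0)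
next
  case (Suc m)
  have A: "A m \<in> S" using Suc.prems by simp
  show ?case
    unfolding lc_Suc[of A m N c, OF mat_subspaceD(1)[OF assms(1) A]]
    by (intro mat_subspaceD(3)[OF assms(1)] mat_subspaceD(4)[OF assms(1)] A Suc.IH Suc.prems) simp
qed

lemma lc_mult_right:
  assumes A: "\<And>k. k < m \<Longrightarrow> A k \<in> carrier_mat N N" and B: "B \<in> carrier_mat N N"
  shows "lc N m c A * B = lc N m c (\<lambda>k. A k * B)"
proof (rule eq_matI)
  fix p q assume "p < dim_row (lc N m c (\<lambda>k. A k * B))" "q < dim_col (lc N m c (\<lambda>k. A k * B))"
  then have pq: "p < N" "q < N" by (simp_all add: lc_def)
  have "(lc N m c A * B) $$ (p, q) = (\<Sum>l<N. \<Sum>k<m. c k * A k $$ (p, l) * B $$ (l, q))"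
    unfolding index_mult_sum[OF lc_carrier B pq] using pq
    by (intro sum.cong refl) (simp add: index_lc sum_distrib_right)
  also have "\<dots> = (\<Sum>k<m. \<Sum>l<N. c k * A k $$ (p, l) * B $$ (l, q))" by (rule sum.swap)
  also have "\<dots> = (\<Sum>k<m. c k * (A k * B) $$ (p, q))"
  proof (intro sum.cong refl)
    fix k assume "k \<in> {..<m}"
    then show "(\<Sum>l<N. c k * A k $$ (p, l) * B $$ (l, q)) = c k * (A k * B) $$ (p, q)"
      using index_mult_sum[OF A B pq, of k] by (simp only: lessThan_iff sum_distrib_left mult.assoc)
  qed
  finally show "(lc N m c A * B) $$ (p, q) = lc N m c (\<lambda>k. A k * B) $$ (p, q)"
    unfolding index_lc[OF pq] .
qed (use B in \<open>simp_all add: lc_def\<close>)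

lemma lc_mult_left:
  assumes A: "\<And>k. k < m \<Longrightarrow> A k \<in> carrier_mat N N" and B: "B \<in> carrier_mat N N"
  shows "B * lc N m c A = lc N m c (\<lambda>k. B * A k)"
proof (rule eq_matI)
  fix p q assume "p < dim_row (lc N m c (\<lambda>k. B * A k))" "q < dim_col (lc N m c (\<lambda>k. B * A k))"
  then have pq: "p < N" "q < N" by (simp_all add: lc_def)
  have "(B * lc N m c A) $$ (p, q) = (\<Sum>l<N. \<Sum>k<m. c k * (B $$ (p, l) * A k $$ (l, q)))"
    unfolding index_mult_sum[OF B lc_carrier pq] using pq
    by (intro sum.cong refl) (simp add: index_lc sum_distrib_left mult.left_commute)
  also have "\<dots> = (\<Sum>k<m. \<Sum>l<N. c k * (B $$ (p, l) * A k $$ (l, q)))" by (rule sum.swap)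
  also have "\<dots> = (\<Sum>k<m. c k * (B * A k) $$ (p, q))"
  proof (intro sum.cong refl)
    fix k assume "k \<in> {..<m}"
    then show "(\<Sum>l<N. c k * (B $$ (p, l) * A k $$ (l, q))) = c k * (B * A k) $$ (p, q)"
      using index_mult_sum[OF B A pq, of k] by (simp only: lessThan_iff sum_distrib_left)
  qed
  finally show "(B * lc N m c A) $$ (p, q) = lc N m c (\<lambda>k. B * A k) $$ (p, q)"
    unfolding index_lc[OF pq] .
qed (use B in \<open>simp_all add: lc_def\<close>)

section \<open>Powers and exponentials of nilpotent matrices\<close>

lemma pow_mat_Suc_left:
  fixes x :: "complex mat"
  assumes x: "x \<in> carrier_mat N N" shows "x ^\<^sub>m Suc k = x * x ^\<^sub>m k"
proof (induction k)
  case 0 then show ?case using x by simp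
next
  case (Suc k)
  have "x ^\<^sub>m Suc (Suc k) = x * x ^\<^sub>m k * x" using Suc by simp
  also have "\<dots> = x * (x ^\<^sub>m k * x)" by (rule assoc_mult_mat[OF x pow_carrier_mat[OF x] x])
  finally show ?case by simp
qed

lemma pow_mat_zero:
  fixes x :: "complex mat"
  assumes x: "x \<in> carrier_mat N N" and z: "x ^\<^sub>m d = 0\<^sub>m N N" and "d \<le> k"
  shows "x ^\<^sub>m k = 0\<^sub>m N N"
  using \<open>d \<le> k\<close>
proof (induction k rule: dec_induct)
  case (step k)
  then show ?case using x by simp
qed (rule z)

lemma smult_smult_mat: "a \<cdot>\<^sub>m (b \<cdot>\<^sub>m x) = (a * b) \<cdot>\<^sub>m x" for x :: "complex mat"
  by (rule eq_matI) auto

lemma ng_ng: "(-1) \<cdot>\<^sub>m ((-1) \<cdot>\<^sub>m x) = x" for x :: "complex mat"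
  by (rule eq_matI) auto

abbreviation ng :: "complex mat \<Rightarrow> complex mat" where "ng x \<equiv> (-1) \<cdot>\<^sub>m x"

lemma ng_pow:
  fixes x :: "complex mat"
  assumes x: "x \<in> carrier_mat N N" shows "(ng x) ^\<^sub>m k = (-1) ^ k \<cdot>\<^sub>m x ^\<^sub>m k"
proof (induction k)
  case 0 then show ?case using x by (intro eq_matI) auto
next
  case (Suc k)
  have "(ng x) ^\<^sub>m Suc k = ((-1) ^ k \<cdot>\<^sub>m x ^\<^sub>m k) * (ng x)" using Suc by simp
  also have "\<dots> = (-1) ^ k \<cdot>\<^sub>m (x ^\<^sub>m k * ng x)"
    using x by (intro mult_smult_assoc_mat pow_carrier_mat) auto
  also have "x ^\<^sub>m k * ng x = ng (x ^\<^sub>m k * x)" by (rule mult_smult_distrib[OF pow_carrier_mat[OF x] x])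
  finally show ?case by (simp add: smult_smult_mat)
qed

lemma mat_exp_nilpotent:
  assumes x: "x \<in> carrier_mat N N" and z: "x ^\<^sub>m d = 0\<^sub>m N N"
  shows "mat_exp x = lc N d (\<lambda>k. 1 / fact k) (\<lambda>k. x ^\<^sub>m k)"
proof (rule eq_matI)
  fix p q assume "p < dim_row (lc N d (\<lambda>k. 1 / fact k) (\<lambda>k. x ^\<^sub>m k))" "q < dim_col (lc N d (\<lambda>k. 1 / fact k) (\<lambda>k. x ^\<^sub>m k))"
  then have pq: "p < N" "q < N" by (simp_all add: lc_def)
  have "suminf (\<lambda>k. (x ^\<^sub>m k) $$ (p, q) / fact k) = (\<Sum>k<d. (x ^\<^sub>m k) $$ (p, q) / fact k)"
    using pow_mat_zero[OF x z] pq by (intro suminf_finite) auto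
  then show "mat_exp x $$ (p, q) = lc N d (\<lambda>k. 1 / fact k) (\<lambda>k. x ^\<^sub>m k) $$ (p, q)"
    using pq x by (simp add: mat_exp_def index_lc)
qed (use x in \<open>auto simp: mat_exp_def lc_def\<close>)

text \<open>Both sides expand into the terms x^i v (-x)^j / (i! j!). Those with i + j = k add up to
  the k-fold bracket divided by k!, by the same computation as for the binomial theorem.\<close>

lemma exp_conjugation:
  fixes x v :: "complex mat"
  assumes x: "x \<in> carrier_mat N N" and v: "v \<in> carrier_mat N N" and z: "x ^\<^sub>m d = 0\<^sub>m N N"
  shows "mat_exp x * v * mat_exp (ng x) =
    lc N (2 * d) (\<lambda>k. 1 / fact k) (\<lambda>k. ((\<lambda>z. x * z - z * x) ^^ k) v)"
proof -
  let ?C = "carrier_mat N N :: complex mat set"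
  have nx: "ng x \<in> ?C" using x by simp
  have mC: "a * b \<in> ?C" if "a \<in> ?C" "b \<in> ?C" for a b using that by (rule mult_carrier_mat)
  define P where "P i j = x ^\<^sub>m i * v * (ng x) ^\<^sub>m j" for i j
  have PC: "P i j \<in> ?C" for i j unfolding P_def using x nx v by (intro mC pow_carrier_mat)
  define t where "t i j p q = P i j $$ (p, q) / (fact i * fact j)" for i j p q
  define A where "A k = ((\<lambda>z. x * z - z * x) ^^ k) v" for k
  have A_Suc: "A (Suc k) = x * A k - A k * x" for k by (simp add: A_def)
  have AC: "A k \<in> ?C" for k
  proof (induction k)
    case 0 then show ?case using v by (simp add: A_def)
  next
    case (Suc k) then show ?case unfolding A_Suc by (intro minus_carrier_mat mC x)
  qed
  have xP: "x * P i j = P (Suc i) j" for i j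
    unfolding P_def pow_mat_Suc_left[OF x]
    using x v nx assoc_mult_mat[OF x pow_carrier_mat[OF x] v]
      assoc_mult_mat[OF x mC[OF pow_carrier_mat[OF x] v] pow_carrier_mat[OF nx]] by simp
  have Px: "P i j * x = ng (P i (Suc j))" for i j
  proof -
    have "P i (Suc j) = P i j * ng x"
      unfolding P_def pow_mat.simps using assoc_mult_mat[OF mC[OF pow_carrier_mat[OF x] v] pow_carrier_mat[OF nx] nx] by simp
    also have "\<dots> = ng (P i j * x)" by (rule mult_smult_distrib[OF PC x])
    finally show ?thesis by (simp only: ng_ng)
  qed
  \<comment> \<open>Bracketing with \<open>x\<close> raises \<open>i\<close> with the factor i + 1
    and raises \<open>j\<close> with the factor j + 1. For a term of degree k + 1 the two factors
    then add up to k + 1.\<close>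
  have entry: "A k $$ (p, q) = fact k * (\<Sum>i\<le>k. t i (k - i) p q)" if "p < N" "q < N" for k p q
    using that
  proof (induction k arbitrary: p q)
    case 0
    have "P 0 0 = v" unfolding P_def using x v nx by simp
    then show ?case by (simp add: A_def t_def)
  next
    case (Suc k)
    have xt: "(\<Sum>l<N. x $$ (p, l) * t i j l q) = of_nat (Suc i) * t (Suc i) j p q" for i j
    proof -
      have "(\<Sum>l<N. x $$ (p, l) * t i j l q) = (x * P i j) $$ (p, q) / (fact i * fact j)"
        unfolding index_mult_sum[OF x PC Suc.prems] t_def by (simp add: sum_divide_distrib)
      also have "\<dots> = of_nat (Suc i) * t (Suc i) j p q" unfolding xP t_def
        by (simp add: field_simps del: of_nat_Suc)
      finally show ?thesis .
    qed
    have tx: "(\<Sum>l<N. t i j p l * x $$ (l, q)) = - of_nat (Suc j) * t i (Suc j) p q" for i j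
    proof -
      have "(\<Sum>l<N. t i j p l * x $$ (l, q)) = (P i j * x) $$ (p, q) / (fact i * fact j)"
        unfolding index_mult_sum[OF PC x Suc.prems] t_def by (simp add: sum_divide_distrib)
      also have "\<dots> = - of_nat (Suc j) * t i (Suc j) p q"
        unfolding Px t_def using Suc.prems carrier_matD[OF PC] by (simp add: field_simps del: of_nat_Suc)
      finally show ?thesis .
    qed
    have "A (Suc k) $$ (p, q) = (\<Sum>l<N. x $$ (p, l) * A k $$ (l, q)) - (\<Sum>l<N. A k $$ (p, l) * x $$ (l, q))"
      unfolding A_Suc using Suc.prems carrier_matD[OF mC[OF AC x]]
      by (subst index_minus_mat) (simp_all only: index_mult_sum[OF x AC Suc.prems] index_mult_sum[OF AC x Suc.prems])
    also have "(\<Sum>l<N. x $$ (p, l) * A k $$ (l, q)) = (\<Sum>l<N. fact k * (\<Sum>i\<le>k. x $$ (p, l) * t i (k - i) l q))"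
      using Suc by (intro sum.cong refl) (simp add: sum_distrib_left mult.left_commute)
    also have "\<dots> = fact k * (\<Sum>l<N. \<Sum>i\<le>k. x $$ (p, l) * t i (k - i) l q)"
      by (rule sum_distrib_left[symmetric])
    also have "\<dots> = fact k * (\<Sum>i\<le>k. of_nat (Suc i) * t (Suc i) (k - i) p q)"
      by (subst sum.swap) (simp only: xt)
    also have "(\<Sum>l<N. A k $$ (p, l) * x $$ (l, q)) = (\<Sum>l<N. fact k * (\<Sum>i\<le>k. t i (k - i) p l * x $$ (l, q)))"
      using Suc by (intro sum.cong refl) (simp add: sum_distrib_right mult.assoc)
    also have "\<dots> = fact k * (\<Sum>l<N. \<Sum>i\<le>k. t i (k - i) p l * x $$ (l, q))"
      by (rule sum_distrib_left[symmetric])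
    also have "\<dots> = fact k * (\<Sum>i\<le>k. - of_nat (Suc (k - i)) * t i (Suc (k - i)) p q)"
      by (subst sum.swap) (simp only: tx)
    also have "fact k * (\<Sum>i\<le>k. of_nat (Suc i) * t (Suc i) (k - i) p q)
        - fact k * (\<Sum>i\<le>k. - of_nat (Suc (k - i)) * t i (Suc (k - i)) p q)
      = fact k * ((\<Sum>i\<le>Suc k. of_nat i * t i (Suc k - i) p q) + (\<Sum>i\<le>Suc k. of_nat (Suc k - i) * t i (Suc k - i) p q))"
    proof -
      have "(\<Sum>i\<le>Suc k. of_nat i * t i (Suc k - i) p q) = (\<Sum>i\<le>k. of_nat (Suc i) * t (Suc i) (k - i) p q)"
        by (subst sum.atMost_Suc_shift) simp
      moreover have "(\<Sum>i\<le>Suc k. of_nat (Suc k - i) * t i (Suc k - i) p q)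
          = (\<Sum>i\<le>k. of_nat (Suc (k - i)) * t i (Suc (k - i)) p q)"
        by (subst sum.atMost_Suc) (simp add: Suc_diff_le)
      ultimately show ?thesis by (simp only: sum_negf mult_minus_left mult_minus_right diff_minus_eq_add distrib_left)
    qed
    also have "\<dots> = fact k * (\<Sum>i\<le>Suc k. of_nat (Suc k) * t i (Suc k - i) p q)"
      unfolding sum.distrib[symmetric] by (intro arg_cong2[where f = times] sum.cong refl)
        (simp only: distrib_right[symmetric] of_nat_add[symmetric] atMost_iff le_add_diff_inverse)
    also have "\<dots> = fact (Suc k) * (\<Sum>i\<le>Suc k. t i (Suc k - i) p q)"
      by (simp only: sum_distrib_left[symmetric] fact_Suc of_nat_mult mult.assoc mult.left_commute)
    finally show ?case .
  qed
  have nz: "(ng x) ^\<^sub>m d = 0\<^sub>m N N" unfolding ng_pow[OF x] z by simp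
  have t0: "t i j p q = 0" if "d \<le> i \<or> d \<le> j" "p < N" "q < N" for i j p q
  proof -
    have "P i j = 0\<^sub>m N N"
    proof (cases "d \<le> i")
      case True
      show ?thesis unfolding P_def pow_mat_zero[OF x z True] left_mult_zero_mat[OF v]
        by (rule left_mult_zero_mat[OF pow_carrier_mat[OF nx]])
    next
      case False
      then have "d \<le> j" using that(1) by simp
      then show ?thesis unfolding P_def pow_mat_zero[OF nx nz \<open>d \<le> j\<close>]
        by (intro right_mult_zero_mat[OF mC[OF pow_carrier_mat[OF x] v]])
    qed
    then show ?thesis using that by (simp add: t_def)
  qed
  show ?thesis
  proof (rule eq_matI)
    fix p q assume "p < dim_row (lc N (2 * d) (\<lambda>k. 1 / fact k) (\<lambda>k. ((\<lambda>z. x * z - z * x) ^^ k) v))"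
      "q < dim_col (lc N (2 * d) (\<lambda>k. 1 / fact k) (\<lambda>k. ((\<lambda>z. x * z - z * x) ^^ k) v))"
    then have pq: "p < N" "q < N" by (simp_all add: lc_def)
    have "mat_exp x * v = lc N d (\<lambda>i. 1 / fact i) (\<lambda>i. x ^\<^sub>m i * v)"
      unfolding mat_exp_nilpotent[OF x z] using x v by (intro lc_mult_right pow_carrier_mat)
    then have "mat_exp x * v * mat_exp (ng x) = lc N d (\<lambda>i. 1 / fact i) (\<lambda>i. x ^\<^sub>m i * v * mat_exp (ng x))"
      unfolding mat_exp_nilpotent[OF nx nz] using mC[OF pow_carrier_mat[OF x] v] by (simp add: lc_mult_right)
    moreover have "x ^\<^sub>m i * v * mat_exp (ng x) = lc N d (\<lambda>j. 1 / fact j) (\<lambda>j. P i j)" for i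
      unfolding mat_exp_nilpotent[OF nx nz] P_def using mC[OF pow_carrier_mat[OF x] v] nx
      by (intro lc_mult_left pow_carrier_mat)
    ultimately have "(mat_exp x * v * mat_exp (ng x)) $$ (p, q)
        = (\<Sum>i<d. 1 / fact i * (\<Sum>j<d. 1 / fact j * P i j $$ (p, q)))"
      using pq by (simp add: index_lc)
    also have "\<dots> = (\<Sum>i<d. \<Sum>j<d. t i j p q)"
      by (simp add: sum_distrib_left t_def)
    also have "\<dots> = (\<Sum>(i, j)\<in>{..<d} \<times> {..<d}. t i j p q)" by (simp add: sum.cartesian_product)
    \<comment> \<open>Terms with \<open>i\<close> or \<open>j\<close> at least \<open>d\<close>
      vanish, so the square may be enlarged to the triangle that is summed by degree.\<close>
    also have "\<dots> = (\<Sum>(i, j)\<in>{(i, j). i + j < 2 * d}. t i j p q)"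
    proof (rule sum.mono_neutral_left)
      show "finite {(i, j). i + j < 2 * d}"
        by (rule finite_subset[of _ "{..<2 * d} \<times> {..<2 * d}"]) auto
      show "\<forall>i\<in>{(i, j). i + j < 2 * d} - {..<d} \<times> {..<d}. (case i of (i, j) \<Rightarrow> t i j p q) = 0"
        using t0[OF _ pq] by (auto simp: not_less[symmetric])
    qed auto
    also have "\<dots> = (\<Sum>k<2 * d. \<Sum>i\<le>k. t i (k - i) p q)" by (rule sum.triangle_reindex)
    also have "\<dots> = (\<Sum>k<2 * d. 1 / fact k * A k $$ (p, q))" using pq by (simp add: entry)
    finally show "(mat_exp x * v * mat_exp (ng x)) $$ (p, q)
        = lc N (2 * d) (\<lambda>k. 1 / fact k) (\<lambda>k. ((\<lambda>z. x * z - z * x) ^^ k) v) $$ (p, q)"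
      unfolding index_lc[OF pq] A_def .
  qed (use x in \<open>simp_all add: lc_def mat_exp_def\<close>)
qed

text \<open>Conjugation of the identity matrix: all its brackets with \<open>x\<close> vanish, so
  only the term of degree 0 remains.\<close>

lemma exp_inverse:
  fixes x :: "complex mat"
  assumes x: "x \<in> carrier_mat N N" and z: "x ^\<^sub>m d = 0\<^sub>m N N"
  shows "mat_exp x * mat_exp (ng x) = 1\<^sub>m N"
proof -
  have E: "mat_exp x \<in> carrier_mat N N" using x by (simp add: mat_exp_def)
  let ?A = "\<lambda>k. ((\<lambda>z. x * z - z * x) ^^ k) (1\<^sub>m N)"
  have A: "?A k = (if k = 0 then 1\<^sub>m N else 0\<^sub>m N N)" for k
  proof (induction k)
    case (Suc k)
    have "x - x = 0\<^sub>m N N" by (rule eq_matI) (use x in auto)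
    then show ?case using Suc x by (simp split: if_splits)
  qed simp
  show ?thesis
  proof (cases "d = 0")
    \<comment> \<open>With \<open>d = 0\<close> the sum of length 2d is empty and would lose the
      constant term; but then 1 = 0, which forces \<open>N = 0\<close>.\<close>
    case True
    then have "1\<^sub>m N = (0\<^sub>m N N :: complex mat)" using z x by simp
    then have N: "N = 0" by (metis index_one_mat(1) index_zero_mat(1) not_gr_zero one_neq_zero)
    show ?thesis by (rule eq_matI) (use N x in \<open>auto simp: mat_exp_def\<close>)
  next
    case False
    have "mat_exp x * mat_exp (ng x) = mat_exp x * 1\<^sub>m N * mat_exp (ng x)" using E by simp
    also have "\<dots> = lc N (2 * d) (\<lambda>k. 1 / fact k) ?A" using x z by (intro exp_conjugation) auto
    also have "\<dots> = 1\<^sub>m N"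
    proof (rule eq_matI)
      fix p q assume "p < dim_row (1\<^sub>m N :: complex mat)" "q < dim_col (1\<^sub>m N :: complex mat)"
      then have pq: "p < N" "q < N" by auto
      have "(\<Sum>k<2 * d. 1 / fact k * ?A k $$ (p, q)) = (\<Sum>k<2 * d. if k = 0 then 1\<^sub>m N $$ (p, q) else 0)"
        unfolding A using pq by (intro sum.cong refl) auto
      also have "\<dots> = 1\<^sub>m N $$ (p, q)" using False by simp
      finally show "lc N (2 * d) (\<lambda>k. 1 / fact k) ?A $$ (p, q) = 1\<^sub>m N $$ (p, q)"
        unfolding index_lc[OF pq] .
    qed (simp_all add: lc_def)
    finally show ?thesis .
  qed
qed

lemma Ad_mat_exp:
  assumes x: "x \<in> carrier_mat N N" and z: "x ^\<^sub>m d = 0\<^sub>m N N"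
  shows "Ad N (mat_exp x) v = mat_exp x * v * mat_exp (ng x)"
proof -
  have nx: "ng x \<in> carrier_mat N N" and nz: "(ng x) ^\<^sub>m d = 0\<^sub>m N N"
    using x z by (simp_all add: ng_pow[OF x])
  have "ng (ng x) = x" by (rule ng_ng)
  then have inv: "mat_exp x * mat_exp (ng x) = 1\<^sub>m N" "mat_exp (ng x) * mat_exp x = 1\<^sub>m N"
    using exp_inverse[OF x z] exp_inverse[OF nx nz] by simp_all
  interpret R: ring "ring_mat TYPE(complex) N ()" by (rule ring_mat)
  have "inv\<^bsub>ring_mat TYPE(complex) N ()\<^esub> (mat_exp x) = mat_exp (ng x)"
    by (rule R.inv_char) (use x inv in \<open>auto simp: ring_mat_simps mat_exp_def\<close>)
  then show ?thesis by (simp add: Ad_def)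
qed

section \<open>The action of the unipotent group\<close>

lemma filt_pow: assumes y: "y \<in> filt n 1" shows "y ^\<^sub>m k \<in> filt n k"
proof (induction k)
  case 0
  have "1\<^sub>m (2 * n) \<in> filt n 0" by (rule filtI) (auto split: if_splits)
  then show ?case using filt_carrier[OF y] by simp
next
  case (Suc k)
  then show ?case using filt_mult[OF Suc y] by simp
qed

lemma filt_pow_zero: "y \<in> filt n 1 \<Longrightarrow> y ^\<^sub>m (2 * n) = 0\<^sub>m (2 * n) (2 * n)"
  by (rule filt_zero[OF filt_pow])

lemma mat_exp_carrier: "x \<in> carrier_mat N N \<Longrightarrow> mat_exp x \<in> carrier_mat N N"
  by (simp add: mat_exp_def)

lemma index_mat_exp_filt:
  assumes y: "y \<in> filt n 1" and pq: "p < 2 * n" "q < 2 * n"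
  shows "mat_exp y $$ (p, q) = (\<Sum>k<2 * n. (y ^\<^sub>m k) $$ (p, q) / fact k)"
  unfolding mat_exp_nilpotent[OF filt_carrier[OF y] filt_pow_zero[OF y]] index_lc[OF pq] by simp

lemma mat_exp_filt_entries:
  assumes y: "y \<in> filt n 1"
  shows "p < n \<Longrightarrow> q < p \<Longrightarrow> mat_exp y $$ (p, q) = 0" (is "?a \<Longrightarrow> ?b \<Longrightarrow> ?c")
    and "p < n \<Longrightarrow> mat_exp y $$ (p, p) = 1"
    and "p < n \<Longrightarrow> q < n \<Longrightarrow> mat_exp y $$ (n + p, q) = 0"
proof -
  have z: "(y ^\<^sub>m k) $$ (p, q) = 0" if "p < 2 * n" "q < 2 * n" "\<not> pos n p + k \<le> pos n q" for k p q
    using filtD[OF filt_pow[OF y]] that by blast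
  show ?c if pq: "p < n" "q < p"
    using pq z[of p q] by (simp add: index_mat_exp_filt[OF y] pos_def)
  show "mat_exp y $$ (n + p, q) = 0" if pq: "p < n" "q < n"
    using pq z[of "n + p" q] by (simp add: index_mat_exp_filt[OF y] pos_def)
  show "mat_exp y $$ (p, p) = 1" if p: "p < n"
  proof -
    have "(y ^\<^sub>m k) $$ (p, p) / fact k = (if k = 0 then 1 else 0)" for k
      using p filt_carrier[OF y] z[of p p k] by (cases "k = 0") auto
    then have "mat_exp y $$ (p, p) = (\<Sum>k<2 * n. if k = 0 then 1 else 0)"
      using p by (simp only: index_mat_exp_filt[OF y])
    then show ?thesis using p by simp
  qed
qed

lemma ng_filt: "y \<in> filt n d \<Longrightarrow> ng y \<in> filt n d"
  by (rule mat_subspaceD(4)[OF mat_subspace_filt])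

text \<open>On the diagonal blocks \<open>y\<close> is block triangular with lower right block minus
  the transpose of the upper left one. Passing to \<open>-y\<close> removes the sign, and
  transposing powers reverses the order of the factors.\<close>

lemma mat_exp_ng_transpose:
  assumes y: "y \<in> sp n" "y \<in> filt n 1" and pq: "p < n" "q < n"
  shows "mat_exp (ng y) $$ (n + q, n + p) = mat_exp y $$ (p, q)"
proof -
  note yC = filt_carrier[OF y(2)] and e = sp_filt_1_entries[OF y]
  have nC: "ng y \<in> carrier_mat (2 * n) (2 * n)" using yC by simp
  have "((ng y) ^\<^sub>m k) $$ (n + q, n + p) = (y ^\<^sub>m k) $$ (p, q)" if "p < n" "q < n" for k p q
    using that
  proof (induction k arbitrary: p q)
    case 0
    then show ?case using yC by auto
  next
    case (Suc k)
    have i: "n + q < 2 * n" "n + p < 2 * n" "p < 2 * n" "q < 2 * n" using Suc.prems by auto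
    have "((ng y) ^\<^sub>m Suc k) $$ (n + q, n + p) = (ng y * (ng y) ^\<^sub>m k) $$ (n + q, n + p)"
      unfolding pow_mat_Suc_left[OF nC] ..
    also have "\<dots> = (\<Sum>l<n. ng y $$ (n + q, l) * ((ng y) ^\<^sub>m k) $$ (l, n + p))
        + (\<Sum>l<n. ng y $$ (n + q, n + l) * ((ng y) ^\<^sub>m k) $$ (n + l, n + p))"
      by (rule index_mult_block[OF nC pow_carrier_mat[OF nC] i(1,2)])
    also have "(\<Sum>l<n. ng y $$ (n + q, l) * ((ng y) ^\<^sub>m k) $$ (l, n + p)) = 0"
      using yC e(1)[OF Suc.prems(2)] Suc.prems by (intro sum.neutral ballI) simp
    also have "(\<Sum>l<n. ng y $$ (n + q, n + l) * ((ng y) ^\<^sub>m k) $$ (n + l, n + p))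
        = (\<Sum>l<n. (y ^\<^sub>m k) $$ (p, l) * y $$ (l, q))"
      using yC e(3)[OF Suc.prems(2)] Suc by (intro sum.cong refl) simp
    also have "0 + \<dots> = (\<Sum>l<n. (y ^\<^sub>m k) $$ (p, l) * y $$ (l, q)) + (\<Sum>l<n. (y ^\<^sub>m k) $$ (p, n + l) * y $$ (n + l, q))"
      using e(1)[OF _ Suc.prems(2)] by simp
    also have "\<dots> = (y ^\<^sub>m k * y) $$ (p, q)"
      by (rule index_mult_block[OF pow_carrier_mat[OF yC] yC i(3,4), symmetric])
    finally show ?case by simp
  qed
  then show ?thesis
    using pq index_mat_exp_filt[OF ng_filt[OF y(2)], of "n + q" "n + p"] index_mat_exp_filt[OF y(2), of p q] by simp
qed

section \<open>Conjugating root vectors by exponentials\<close>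

lemma mult_xS:
  assumes h: "h \<in> carrier_mat (2 * n) (2 * n)" "\<And>i j. i < n \<Longrightarrow> j < n \<Longrightarrow> h $$ (n + i, j) = 0"
  shows "h * xS n S = xS n (\<lambda>p q. \<Sum>l<n. h $$ (p, l) * S l q)"
  by (rule block_eqI[of _ n]) (auto simp: index_mult_block[OF h(1) xS_carrier] h(2) intro: mult_carrier_mat[OF h(1) xS_carrier])

lemma xS_mult:
  assumes h: "h \<in> carrier_mat (2 * n) (2 * n)" "\<And>i j. i < n \<Longrightarrow> j < n \<Longrightarrow> h $$ (n + i, j) = 0"
  shows "xS n S * h = xS n (\<lambda>p q. \<Sum>l<n. S p l * h $$ (n + l, n + q))"
  by (rule block_eqI[of _ n]) (auto simp: index_mult_block[OF xS_carrier h(1)] h(2) intro: mult_carrier_mat[OF xS_carrier h(1)])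

text \<open>With H the upper left block of the exponential, conjugation acts on the upper right
  block by the congruence H S H^T.\<close>

lemma exp_xS_exp:
  assumes y: "y \<in> sp n" "y \<in> filt n 1"
  shows "mat_exp y * xS n S * mat_exp (ng y)
    = xS n (\<lambda>p q. \<Sum>b<n. (\<Sum>a<n. mat_exp y $$ (p, a) * S a b) * mat_exp y $$ (q, b))"
proof -
  note yC = filt_carrier[OF y(2)] and nf = ng_filt[OF y(2)]
  have "mat_exp y * xS n S = xS n (\<lambda>p q. \<Sum>l<n. mat_exp y $$ (p, l) * S l q)"
    by (rule mult_xS[OF mat_exp_carrier[OF yC]]) (rule mat_exp_filt_entries(3)[OF y(2)])
  moreover have "xS n T * mat_exp (ng y) = xS n (\<lambda>p q. \<Sum>l<n. T p l * mat_exp (ng y) $$ (n + l, n + q))" for T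
    by (rule xS_mult[OF mat_exp_carrier[OF filt_carrier[OF nf]]]) (rule mat_exp_filt_entries(3)[OF nf])
  ultimately have "mat_exp y * xS n S * mat_exp (ng y) = xS n (\<lambda>p q. \<Sum>l<n.
      (\<Sum>a<n. mat_exp y $$ (p, a) * S a l) * mat_exp (ng y) $$ (n + l, n + q))" by simp
  also have "\<dots> = xS n (\<lambda>p q. \<Sum>b<n. (\<Sum>a<n. mat_exp y $$ (p, a) * S a b) * mat_exp y $$ (q, b))"
    by (rule xS_cong) (simp add: mat_exp_ng_transpose[OF y])
  finally show ?thesis .
qed

lemma sE_mult: "sE i j p q = of_bool (p = i) * of_bool (q = j) + of_bool (p = j) * of_bool (q = i)"
  unfolding sE_def by (cases "p = i"; cases "q = j"; cases "p = j"; cases "q = i") simp_all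

lemma sum_of_bool_eq:
  fixes F :: "nat \<Rightarrow> complex"
  shows "(\<Sum>b<M. F b * of_bool (q = b)) = (if q < M then F q else 0)"
    "(\<Sum>b<M. F b * of_bool (b = q)) = (if q < M then F q else 0)"
proof -
  have "F b * of_bool (q = b) = (if b = q then F q else 0)" "F b * of_bool (b = q) = (if b = q then F q else 0)" for b
    by auto
  then show "(\<Sum>b<M. F b * of_bool (q = b)) = (if q < M then F q else 0)"
    "(\<Sum>b<M. F b * of_bool (b = q)) = (if q < M then F q else 0)" by simp_all
qed

text \<open>Since the upper left block of the exponential is triangular, the sums may stop at
  \<open>i\<close> and \<open>j\<close>. Only for such smaller indices does \<open>eS_down2\<close>
  keep the root vectors in the subspace.\<close>

lemma exp_eS_exp:
  assumes y: "y \<in> sp n" "y \<in> filt n 1" and ij: "i < n" "j < n"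
  shows "mat_exp y * eS n i j * mat_exp (ng y)
    = lc (2 * n) (Suc i) (\<lambda>a. mat_exp y $$ (a, i)) (\<lambda>a. lc (2 * n) (Suc j) (\<lambda>b. mat_exp y $$ (b, j)) (\<lambda>b. eS n a b))"
    (is "?L = ?R")
proof (rule block_eqI[of _ n])
  let ?h = "\<lambda>a b. mat_exp y $$ (a, b)"
  have L: "?L = xS n (\<lambda>p q. \<Sum>b<n. (\<Sum>a<n. ?h p a * sE i j a b) * ?h q b)"
    unfolding eS_def by (rule exp_xS_exp[OF y])
  show "?L \<in> carrier_mat (2 * n) (2 * n)" unfolding L by simp
  fix p q assume pq: "p < n" "q < n"
  have h0: "?h p a = 0" if "\<not> p < Suc a" "p < n" for p a
    using mat_exp_filt_entries(1)[OF y(2) that(2), of a] that(1) by simp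
  have inner: "(\<Sum>a<n. ?h p a * sE i j a b) = ?h p i * of_bool (b = j) + ?h p j * of_bool (b = i)" for b
  proof -
    have "(\<Sum>a<n. ?h p a * sE i j a b)
        = (\<Sum>a<n. ?h p a * of_bool (a = i)) * of_bool (b = j) + (\<Sum>a<n. ?h p a * of_bool (a = j)) * of_bool (b = i)"
      unfolding sum_distrib_right sum.distrib[symmetric] by (intro sum.cong refl) (simp only: sE_mult distrib_left mult.assoc)
    then show ?thesis using ij by (simp only: sum_of_bool_eq if_True)
  qed
  have "(\<Sum>b<n. (\<Sum>a<n. ?h p a * sE i j a b) * ?h q b)
      = (\<Sum>b<n. (?h p i * ?h q b) * of_bool (b = j)) + (\<Sum>b<n. (?h p j * ?h q b) * of_bool (b = i))"
    unfolding inner sum.distrib[symmetric] by (intro sum.cong refl) (simp only: distrib_right distrib_left mult.assoc mult.commute mult.left_commute)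
  also have "\<dots> = ?h p i * ?h q j + ?h p j * ?h q i" using ij by (simp only: sum_of_bool_eq if_True)
  finally have L': "?L $$ (p, n + q) = ?h p i * ?h q j + ?h p j * ?h q i" unfolding L using pq by simp
  have inner': "(\<Sum>b<Suc j. ?h b j * sE a b p q) = ?h q j * of_bool (p = a) + ?h p j * of_bool (q = a)" for a
  proof -
    have "(\<Sum>b<Suc j. ?h b j * sE a b p q)
        = (\<Sum>b<Suc j. ?h b j * of_bool (q = b)) * of_bool (p = a) + (\<Sum>b<Suc j. ?h b j * of_bool (p = b)) * of_bool (q = a)"
      unfolding sum_distrib_right sum.distrib[symmetric]
      by (intro sum.cong refl) (simp only: sE_mult distrib_left mult.assoc mult.commute mult.left_commute)
    also have "(\<Sum>b<Suc j. ?h b j * of_bool (q = b)) = ?h q j"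
      unfolding sum_of_bool_eq using h0[OF _ pq(2), of j] by presburger
    also have "(\<Sum>b<Suc j. ?h b j * of_bool (p = b)) = ?h p j"
      unfolding sum_of_bool_eq using h0[OF _ pq(1), of j] by presburger
    finally show ?thesis .
  qed
  have "(\<Sum>a<Suc i. ?h a i * (\<Sum>b<Suc j. ?h b j * sE a b p q))
      = (\<Sum>a<Suc i. (?h a i * ?h q j) * of_bool (p = a)) + (\<Sum>a<Suc i. (?h a i * ?h p j) * of_bool (q = a))"
    unfolding inner' sum.distrib[symmetric] by (intro sum.cong refl) (simp only: distrib_left mult.assoc)
  also have "(\<Sum>a<Suc i. (?h a i * ?h q j) * of_bool (p = a)) = ?h p i * ?h q j"
    unfolding sum_of_bool_eq using h0[OF _ pq(1), of i] by (metis mult_zero_left)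
  also have "(\<Sum>a<Suc i. (?h a i * ?h p j) * of_bool (q = a)) = ?h q i * ?h p j"
    unfolding sum_of_bool_eq using h0[OF _ pq(2), of i] by (metis mult_zero_left)
  finally have R': "?R $$ (p, n + q) = ?h p i * ?h q j + ?h q i * ?h p j"
    using pq by (simp add: index_lc eS_def del: sum.lessThan_Suc)
  show "?L $$ (p, q) = ?R $$ (p, q) \<and> ?L $$ (p, n + q) = ?R $$ (p, n + q) \<and>
      ?L $$ (n + p, q) = ?R $$ (n + p, q) \<and> ?L $$ (n + p, n + q) = ?R $$ (n + p, n + q)"
    unfolding L' R' unfolding L using pq by (simp add: index_lc eS_def del: sum.lessThan_Suc)
qed simp

lemma mat_exp_square_zero:
  assumes x: "x \<in> carrier_mat N N" and z: "x * x = 0\<^sub>m N N"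
  shows "mat_exp x = 1\<^sub>m N + x"
proof -
  have "x ^\<^sub>m 2 = 0\<^sub>m N N" using x z by (simp add: numeral_2_eq_2)
  then have "mat_exp x = lc N 2 (\<lambda>k. 1 / fact k) (\<lambda>k. x ^\<^sub>m k)" by (rule mat_exp_nilpotent[OF x])
  then show ?thesis using x by (intro eq_matI) (auto simp: lc_def numeral_2_eq_2)
qed

lemma dA_bracket:
  "dA n A * dA n B - dA n B * dA n A = dA n (\<lambda>p q. (\<Sum>l<n. A p l * B l q) - (\<Sum>l<n. B p l * A l q))"
proof (rule block_eqI[of _ n])
  have C: "dA n A * dA n B \<in> carrier_mat (2 * n) (2 * n)" for A B by (rule mult_carrier_mat[OF dA_carrier dA_carrier])
  note d = carrier_matD[OF C]
  show "dA n A * dA n B - dA n B * dA n A \<in> carrier_mat (2 * n) (2 * n)" by (rule minus_carrier_mat[OF C])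
  fix i j assume ij: "i < n" "j < n"
  have 1: "(dA n A * dA n B) $$ (i, j) = (\<Sum>l<n. A i l * B l j)" for A B
    using ij by (simp add: index_mult_block[OF dA_carrier dA_carrier] del: index_mult_mat)
  have 2: "(dA n A * dA n B) $$ (n + i, n + j) = (\<Sum>l<n. B j l * A l i)" for A B
    using ij by (simp add: index_mult_block[OF dA_carrier dA_carrier] mult.commute del: index_mult_mat)
  have 3: "(dA n A * dA n B) $$ (i, n + j) = 0" "(dA n A * dA n B) $$ (n + i, j) = 0" for A B
    using ij by (simp_all add: index_mult_block[OF dA_carrier dA_carrier] del: index_mult_mat)
  show "(dA n A * dA n B - dA n B * dA n A) $$ (i, j) = dA n (\<lambda>p q. (\<Sum>l<n. A p l * B l q) - (\<Sum>l<n. B p l * A l q)) $$ (i, j) \<and>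
      (dA n A * dA n B - dA n B * dA n A) $$ (i, n + j) = dA n (\<lambda>p q. (\<Sum>l<n. A p l * B l q) - (\<Sum>l<n. B p l * A l q)) $$ (i, n + j) \<and>
      (dA n A * dA n B - dA n B * dA n A) $$ (n + i, j) = dA n (\<lambda>p q. (\<Sum>l<n. A p l * B l q) - (\<Sum>l<n. B p l * A l q)) $$ (n + i, j) \<and>
      (dA n A * dA n B - dA n B * dA n A) $$ (n + i, n + j) = dA n (\<lambda>p q. (\<Sum>l<n. A p l * B l q) - (\<Sum>l<n. B p l * A l q)) $$ (n + i, n + j)"
    using ij d by (simp add: 1 2 3 del: index_mult_mat(1))
qed simp

lemma dA_cong: "(\<And>p q. p < n \<Longrightarrow> q < n \<Longrightarrow> A p q = B p q) \<Longrightarrow> dA n A = dA n B"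
  by (rule block_eqI[of _ n]) auto

lemma eA_bracket_eA:
  assumes "i < j" "j < n"
  shows "eA n i i * eA n i j - eA n i j * eA n i i = eA n i j"
  unfolding eA_def dA_bracket
proof (rule dA_cong)
  fix p q
  have "(\<Sum>l<n. (if p = i \<and> l = i then 1 else 0) * (if l = i \<and> q = j then 1 else 0))
      = (\<Sum>l<n. if l = i then (if p = i \<and> q = j then 1 else 0) else 0 :: complex)"
    by (intro sum.cong refl) auto
  moreover have "(\<Sum>l<n. (if p = i \<and> l = j then 1 else 0) * (if l = i \<and> q = i then 1 else 0)) = (0 :: complex)"
    using assms by (intro sum.neutral ballI) auto
  ultimately show "(\<Sum>l<n. (if p = i \<and> l = i then 1 else 0) * (if l = i \<and> q = j then 1 else 0))
      - (\<Sum>l<n. (if p = i \<and> l = j then 1 else 0) * (if l = i \<and> q = i then 1 else 0))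
      = (if p = i \<and> q = j then 1 else 0 :: complex)"
    using assms by simp
qed

lemma mat_subspace_u: "mat_subspace (2 * n) (sp n \<inter> filt n 1)"
  by (rule mat_subspace_Int[OF mat_subspace_sp mat_subspace_filt])

section \<open>The derived algebra of the Borel subalgebra and its exponentials\<close>

context sp_parabolic
begin

abbreviation "u \<equiv> sp n \<inter> filt n 1"

lemma u_C: "y \<in> u \<Longrightarrow> y \<in> C"
  using sp_carrier by blast

lemma b_lie: "lie_subalgebra (2 * n) \<bb>"
  using borel by (simp add: borel_subalgebra_def)

lemma b_C: "\<bb> \<subseteq> C"
  by (auto simp: b_eq)

lemma eq_smult_bracket:
  assumes "a \<in> \<bb>" "b \<in> \<bb>" "c \<noteq> 0" "a * b - b * a = c \<cdot>\<^sub>m z"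
  shows "z \<in> lie_bracket (2 * n) \<bb> \<bb>"
proof -
  have "c \<cdot>\<^sub>m z \<in> lie_bracket (2 * n) \<bb> \<bb>"
    using bracket_in_lie_bracket[OF b_C b_C assms(1,2)] assms(4) by simp
  then have "(1 / c) \<cdot>\<^sub>m (c \<cdot>\<^sub>m z) \<in> lie_bracket (2 * n) \<bb> \<bb>"
    by (rule mat_subspaceD(4)[OF mat_subspace_lie_bracket[OF b_C b_C]])
  moreover have "(1 / c) \<cdot>\<^sub>m (c \<cdot>\<^sub>m z) = z" using assms(3) by (intro eq_matI) auto
  ultimately show ?thesis by simp
qed

text \<open>Brackets of triangular matrices are strictly triangular. Conversely each root vector is
  an eigenvector for the bracket with some diagonal \<open>eA n i i\<close>, with eigenvalue 1 or,
  for 2e_i, with 2; dividing by it makes the root vector a bracket.\<close>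

lemma bracket_b: "x \<in> lie_bracket (2 * n) \<bb> \<bb> \<longleftrightarrow> x \<in> C \<and> w x \<in> u"
proof
  have "lie_bracket (2 * n) \<bb> \<bb> \<subseteq> {x \<in> C. w x \<in> u}"
  proof (rule lie_bracket_least[OF mat_subspace_w[OF mat_subspace_u]])
    fix x y assume "x \<in> \<bb>" "y \<in> \<bb>"
    then have xy: "x \<in> C" "y \<in> C" "w x \<in> sp n" "w y \<in> sp n" "w x \<in> filt n 0" "w y \<in> filt n 0" by (auto simp: b_eq)
    show "x * y - y * x \<in> {x \<in> C. w x \<in> u}"
      using minus_carrier_mat[OF mC[OF xy(2,1)], of "x * y"] sp_bracket[OF xy(3,4)] filt_0_bracket[OF xy(5,6)]
      by (simp add: w_bracket[OF xy(1,2)])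
  qed
  then show "x \<in> lie_bracket (2 * n) \<bb> \<bb> \<Longrightarrow> x \<in> C \<and> w x \<in> u" by blast
next
  interpret u: borel_stable n u
  proof
    show "mat_subspace (2 * n) u" by (rule mat_subspace_u)
    fix h y assume "h \<in> sp n" "h \<in> filt n 0" "y \<in> u"
    then show "h * y - y * h \<in> u" using sp_bracket filt_bracket[of h n 0 y 1] by simp
  qed simp
  have L: "mat_subspace (2 * n) (lie_bracket (2 * n) \<bb> \<bb>)" by (rule mat_subspace_lie_bracket[OF b_C b_C])
  have H: "w' (eA n i i) \<in> \<bb>" if "i < n" for i by (rule w'_b[OF eA_sp eA_filt]) simp
  have root: "w' e \<in> lie_bracket (2 * n) \<bb> \<bb>" if "e \<in> u.roots" for e
  proof -
    have "e \<in> u" using that u.roots_W by blast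
    then have eb: "w' e \<in> \<bb>" "e \<in> C" using filt_mono[of 0 1 n] u_C by (auto intro!: w'_b)
    from that consider i j where "i < j" "j < n" "e = eA n i j" | i j where "i \<le> j" "j < n" "e = eS n i j"
      unfolding u.roots_def by blast
    then show ?thesis
    proof cases
      case 1
      have "1 \<cdot>\<^sub>m z = z" for z :: "complex mat" by (rule eq_matI) auto
      then have "w' (eA n i i) * w' e - w' e * w' (eA n i i) = 1 \<cdot>\<^sub>m w' e"
        using eA_bracket_eA[OF 1(1,2)] 1(3) w'_minus[OF mC[OF eA_carrier eA_carrier] mC[OF eA_carrier eA_carrier], of i i i j i j i i]
        by (simp add: w'_mult)
      then show ?thesis using H[of i] 1 eb by (intro eq_smult_bracket[of "w' (eA n i i)" "w' e" 1]) auto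
    next
      case 2
      have i: "i < n" using 2 by simp
      have "eA n i i * e - e * eA n i i = (if i = j then 2 else 1) \<cdot>\<^sub>m e"
        unfolding 2(3) eS_def eA_xS_bracket[OF i i] xS_smult
        by (rule xS_cong) (auto simp: sE_eq)
      then have "w' (eA n i i) * w' e - w' e * w' (eA n i i) = (if i = j then 2 else 1) \<cdot>\<^sub>m w' e"
        using w'_minus[OF mC[OF eA_carrier eb(2)] mC[OF eb(2) eA_carrier], of i i i i] eb(2)
        by (simp add: w'_mult w'_smult split: if_splits)
      then show ?thesis using H[OF i] eb by (intro eq_smult_bracket[of "w' (eA n i i)" "w' e"]) auto
    qed
  qed
  assume x: "x \<in> C \<and> w x \<in> u"
  then have "w x \<in> u" by simp
  then have "w' (w x) \<in> lie_bracket (2 * n) \<bb> \<bb>"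
  proof (rule u.W_induct)
    show "w' (0\<^sub>m (2 * n) (2 * n)) \<in> lie_bracket (2 * n) \<bb> \<bb>" unfolding w'_0 by (rule mat_subspaceD(2)[OF L])
    fix v e c assume v: "v \<in> u" "w' v \<in> lie_bracket (2 * n) \<bb> \<bb>" and e: "e \<in> u.roots"
    have "e \<in> u" using e u.roots_W by blast
    then show "w' (v + c \<cdot>\<^sub>m e) \<in> lie_bracket (2 * n) \<bb> \<bb>"
      using u_C v mat_subspaceD(3)[OF L v(2) mat_subspaceD(4)[OF L root[OF e]]] by (simp add: w'_add w'_smult)
  qed
  then show "x \<in> lie_bracket (2 * n) \<bb> \<bb>" using x by simp
qed

abbreviation "G \<equiv> max_unipotent (2 * n) \<bb>"

lemma w'_lc: "(\<And>k. k < d \<Longrightarrow> A k \<in> C) \<Longrightarrow> w' (lc (2 * n) d c A) = lc (2 * n) d c (\<lambda>k. w' (A k))"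
  unfolding w'_def using g gi by (simp add: lc_mult_left lc_mult_right)

lemma w'_pow: "y \<in> C \<Longrightarrow> w' (y ^\<^sub>m k) = (w' y) ^\<^sub>m k"
proof (induction k)
  case 0
  then show ?case using g gi g_gi by (simp add: w'_def)
next
  case (Suc k)
  then show ?case by (simp add: w'_mult pow_carrier_mat)
qed

lemma w'_pow_zero: "y \<in> u \<Longrightarrow> (w' y) ^\<^sub>m (2 * n) = 0\<^sub>m (2 * n) (2 * n)"
  using w'_pow[OF u_C, symmetric] filt_pow_zero w'_0 by simp

lemma mat_exp_w': assumes y: "y \<in> u" shows "mat_exp (w' y) = w' (mat_exp y)"
proof -
  have yC: "y \<in> C" using u_C[OF y] .
  have "y ^\<^sub>m (2 * n) = 0\<^sub>m (2 * n) (2 * n)" using filt_pow_zero y by simp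
  then show ?thesis
    using mat_exp_nilpotent[OF w'_C[OF yC] w'_pow_zero[OF y]] mat_exp_nilpotent[OF yC]
    by (simp add: w'_lc pow_carrier_mat[OF yC] w'_pow[OF yC])
qed

lemma G_iff: "h \<in> G \<longleftrightarrow> (\<exists>y\<in>u. h = mat_exp (w' y))"
proof
  assume "h \<in> G"
  then obtain x where x: "x \<in> lie_bracket (2 * n) \<bb> \<bb>" "h = mat_exp x" by (auto simp: max_unipotent_def)
  then have "x \<in> C" "w x \<in> u" by (simp_all add: bracket_b)
  then show "\<exists>y\<in>u. h = mat_exp (w' y)" using x(2) by (intro bexI[of _ "w x"]) simp_all
next
  assume "\<exists>y\<in>u. h = mat_exp (w' y)"
  then obtain y where y: "y \<in> u" "h = mat_exp (w' y)" by blast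
  then have "w' y \<in> lie_bracket (2 * n) \<bb> \<bb>" using u_C[OF y(1)] by (simp add: bracket_b)
  then show "h \<in> G" using y(2) by (simp add: max_unipotent_def)
qed

lemma Ad_w':
  assumes y: "y \<in> u" and z: "z \<in> C"
  shows "Ad (2 * n) (mat_exp (w' y)) (w' z) = w' (mat_exp y * z * mat_exp (ng y))"
proof -
  have yC: "y \<in> C" using u_C[OF y] .
  have ny: "ng y \<in> u" by (rule mat_subspaceD(4)[OF mat_subspace_u y])
  have "Ad (2 * n) (mat_exp (w' y)) (w' z) = mat_exp (w' y) * w' z * mat_exp (ng (w' y))"
    by (rule Ad_mat_exp[OF w'_C[OF yC] w'_pow_zero[OF y]])
  also have "\<dots> = w' (mat_exp y) * w' z * w' (mat_exp (ng y))"
    using mat_exp_w'[OF y] mat_exp_w'[OF ny] w'_smult[OF yC, of "-1"] by simp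
  also have "\<dots> = w' (mat_exp y * z * mat_exp (ng y))"
    unfolding w'_mult[OF mC[OF mat_exp_carrier[OF yC] z] mat_exp_carrier[OF u_C[OF ny]]]
      w'_mult[OF mat_exp_carrier[OF yC] z] ..
  finally show ?thesis .
qed

lemma Ad_nn: assumes "h \<in> G" "v \<in> nn" shows "Ad (2 * n) h v \<in> nn"
proof -
  obtain x where x: "x \<in> lie_bracket (2 * n) \<bb> \<bb>" "h = mat_exp x" using assms(1) by (auto simp: max_unipotent_def)
  then have xC: "x \<in> C" "w x \<in> u" by (simp_all add: bracket_b)
  have xp: "x \<in> \<pp>" using x(1) lie_subalgebra_derived(1)[OF b_lie] b_p by blast
  have z: "x ^\<^sub>m (2 * n) = 0\<^sub>m (2 * n) (2 * n)" using w'_pow_zero[OF xC(2)] xC(1) by simp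
  have "((\<lambda>z. x * z - z * x) ^^ k) v \<in> nn" for k
    by (induction k) (use assms(2) nn_ad[OF xp] in auto)
  then show ?thesis
    unfolding x(2) Ad_mat_exp[OF xC(1) z] exp_conjugation[OF xC(1) nn_C[OF assms(2)] z]
    by (intro lc_in_subspace[OF nn_sub])
qed

lemma Ad_linear:
  assumes "h \<in> G" "v \<in> C"
  shows "v' \<in> C \<Longrightarrow> Ad (2 * n) h (v + v') = Ad (2 * n) h v + Ad (2 * n) h v'"
    "Ad (2 * n) h (c \<cdot>\<^sub>m v) = c \<cdot>\<^sub>m Ad (2 * n) h v"
proof -
  obtain y where y: "y \<in> u" "h = mat_exp (w' y)" using assms(1) G_iff by blast
  have yC: "w' y \<in> C" "ng (w' y) \<in> C" using u_C[OF y(1)] by simp_all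
  note E = mat_exp_carrier[OF yC(1)] mat_exp_carrier[OF yC(2)]
  show "Ad (2 * n) h (v + v') = Ad (2 * n) h v + Ad (2 * n) h v'" if "v' \<in> C"
    unfolding y(2) Ad_mat_exp[OF yC(1) w'_pow_zero[OF y(1)]]
    using E assms(2) that by (simp add: mult_add_distrib_mat[of _ "2 * n" "2 * n"] add_mult_distrib_mat[of _ "2 * n" "2 * n"])
  show "Ad (2 * n) h (c \<cdot>\<^sub>m v) = c \<cdot>\<^sub>m Ad (2 * n) h v"
    unfolding y(2) Ad_mat_exp[OF yC(1) w'_pow_zero[OF y(1)]]
    using E assms(2) by (simp add: mult_smult_distrib[of _ "2 * n" "2 * n"] mult_smult_assoc_mat[of _ "2 * n" "2 * n"])
qed

end

lemma sum_mult_cong: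
  fixes c :: "nat \<Rightarrow> complex"
  shows "(\<And>k. k < d \<Longrightarrow> F k = F' k) \<Longrightarrow> (\<Sum>k<d. c k * F k) = (\<Sum>k<d. c k * F' k)"
  by (rule sum.cong) simp_all

lemma index_lmat: "i < k \<Longrightarrow> j < k \<Longrightarrow> lmat k r $$ (i, j) = r i j"
  by (simp add: lmat_def)

section \<open>Moving linear forms on the nilradical\<close>

context sp_parabolic
begin

abbreviation "V \<equiv> nilradical_space (2 * n) \<pp>"
abbreviation "Adj \<equiv> Ad (2 * n)"

lemma V_simps: "carrier V = nn" "zero V = 0\<^sub>m (2 * n) (2 * n)" "add V = (+)" "module.smult V = (\<cdot>\<^sub>m)"
  by (simp_all add: module_mat_def)

lemma linear_formD:
  assumes "linear_form V \<xi>"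
  shows "v \<in> nn \<Longrightarrow> v' \<in> nn \<Longrightarrow> \<xi> (v + v') = \<xi> v + \<xi> v'" "v \<in> nn \<Longrightarrow> \<xi> (c \<cdot>\<^sub>m v) = c * \<xi> v"
  using assms unfolding linear_form_def V_simps by blast+

lemma linear_form_Ad: "linear_form V \<xi> \<Longrightarrow> h \<in> G \<Longrightarrow> linear_form V (\<lambda>v. \<xi> (Adj h v))"
  unfolding linear_form_def V_simps
  using Ad_linear[OF _ nn_C] nn_C Ad_nn by simp

lemma linear_form_lc:
  assumes \<xi>: "linear_form V \<xi>" and A: "\<And>k. k < d \<Longrightarrow> A k \<in> W"
  shows "\<xi> (w' (lc (2 * n) d c A)) = (\<Sum>k<d. c k * \<xi> (w' (A k)))"
  using A
proof (induction d)
  case 0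
  have "\<xi> (0 \<cdot>\<^sub>m 0\<^sub>m (2 * n) (2 * n)) = 0" using linear_formD(2)[OF \<xi> mat_subspaceD(2)[OF nn_sub], of 0] by simp
  moreover have "0 \<cdot>\<^sub>m 0\<^sub>m (2 * n) (2 * n) = (0\<^sub>m (2 * n) (2 * n) :: complex mat)" by (rule eq_matI) auto
  ultimately show ?case by (simp add: lc_0 w'_0)
next
  case (Suc d)
  have A: "A d \<in> W" "A d \<in> C" "w' (A d) \<in> nn" using Suc.prems by (auto simp: W_def)
  have "lc (2 * n) d c A \<in> W" by (rule lc_in_subspace[OF borel_stable.W[OF borel_stable_axioms]]) (simp add: Suc.prems)
  then have L: "w' (lc (2 * n) d c A) \<in> nn" by (simp add: W_def)
  have "w' (lc (2 * n) (Suc d) c A) = w' (lc (2 * n) d c A) + c d \<cdot>\<^sub>m w' (A d)"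
    unfolding lc_Suc[of A d "2 * n" c, OF A(2)] using A(2) by (simp add: w'_add w'_smult)
  then show ?case
    using linear_formD(1)[OF \<xi> L mat_subspaceD(4)[OF nn_sub A(3)]] linear_formD(2)[OF \<xi> A(3)] Suc by simp
qed

lemma form_Ad_eS:
  assumes \<xi>: "linear_form V \<xi>" and y: "y \<in> u" and ij: "i < n" "j < n" "eS n i j \<in> W"
  shows "\<xi> (Adj (mat_exp (w' y)) (w' (eS n i j)))
    = (\<Sum>a<Suc i. mat_exp y $$ (a, i) * (\<Sum>b<Suc j. mat_exp y $$ (b, j) * \<xi> (w' (eS n a b))))"
proof -
  have S: "eS n a b \<in> W" if "a < Suc i" "b < Suc j" for a b
    using eS_down2[OF ij(3) _ _ ij(1,2), of a b] that by simp
  have L: "lc (2 * n) (Suc j) (\<lambda>b. mat_exp y $$ (b, j)) (\<lambda>b. eS n a b) \<in> W" if "a < Suc i" for a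
    using S[OF that] by (intro lc_in_subspace[OF borel_stable.W[OF borel_stable_axioms]])
  have "\<xi> (w' (lc (2 * n) (Suc i) (\<lambda>a. mat_exp y $$ (a, i)) (\<lambda>a. lc (2 * n) (Suc j) (\<lambda>b. mat_exp y $$ (b, j)) (\<lambda>b. eS n a b))))
      = (\<Sum>a<Suc i. mat_exp y $$ (a, i) * \<xi> (w' (lc (2 * n) (Suc j) (\<lambda>b. mat_exp y $$ (b, j)) (\<lambda>b. eS n a b))))"
    by (rule linear_form_lc[OF \<xi>]) (rule L)
  also have "\<dots> = (\<Sum>a<Suc i. mat_exp y $$ (a, i) * (\<Sum>b<Suc j. mat_exp y $$ (b, j) * \<xi> (w' (eS n a b))))"
    by (rule sum_mult_cong, rule linear_form_lc[OF \<xi>], rule S)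
  finally show ?thesis
    unfolding Ad_w'[OF y eS_carrier] exp_eS_exp[OF IntD1[OF y] IntD2[OF y] ij(1,2)] .
qed

text \<open>The matrix of values changes to H^T M H. As H is upper unitriangular, each leading block
  of the result involves the leading blocks of H and M alone, and those of H have determinant
  1.\<close>

lemma minors_Ad:
  assumes \<xi>: "linear_form V \<xi>" and h: "h \<in> G" and k: "k < m"
  shows "det (lmat (Suc k) (\<lambda>i j. \<xi> (Adj h (w' (eS n i j))))) = det (lmat (Suc k) (\<lambda>i j. \<xi> (w' (eS n i j))))"
proof -
  obtain y where y: "y \<in> u" "h = mat_exp (w' y)" using h G_iff by blast
  note e = mat_exp_filt_entries[OF IntD2[OF y(1)]]
  let ?h = "\<lambda>a b. mat_exp y $$ (a, b)" and ?r = "\<lambda>a b. \<xi> (w' (eS n a b))"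
  let ?H = "lmat (Suc k) ?h" and ?M = "lmat (Suc k) ?r"
  have HC: "?H \<in> carrier_mat (Suc k) (Suc k)" "transpose_mat ?H \<in> carrier_mat (Suc k) (Suc k)"
    "?M \<in> carrier_mat (Suc k) (Suc k)" by (simp_all add: lmat_def)
  have kn: "i < n" if "i < Suc k" for i using that k m_le by simp
  have "\<xi> (Adj h (w' (eS n i j))) = (transpose_mat ?H * (?M * ?H)) $$ (i, j)" if ij: "i < Suc k" "j < Suc k" for i j
  proof -
    have "\<xi> (Adj h (w' (eS n i j))) = (\<Sum>a<Suc i. ?h a i * (\<Sum>b<Suc j. ?h b j * ?r a b))"
      unfolding y(2) using k ij by (intro form_Ad_eS[OF \<xi> y(1)] kn eS_m) auto
    also have "\<dots> = (\<Sum>a<Suc k. ?h a i * (\<Sum>b<Suc j. ?h b j * ?r a b))"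
      using ij(1) kn by (intro sum.mono_neutral_left) (auto simp: e(1) simp del: sum.lessThan_Suc)
    also have "\<dots> = (\<Sum>a<Suc k. ?h a i * (\<Sum>b<Suc k. ?h b j * ?r a b))"
    proof (rule sum_mult_cong)
      fix a
      show "(\<Sum>b<Suc j. ?h b j * ?r a b) = (\<Sum>b<Suc k. ?h b j * ?r a b)"
        using ij(2) kn by (intro sum.mono_neutral_left) (auto simp: e(1))
    qed
    also have "\<dots> = (\<Sum>a<Suc k. transpose_mat ?H $$ (i, a) * (?M * ?H) $$ (a, j))"
    proof (rule sum.cong[OF refl])
      fix a assume "a \<in> {..<Suc k}"
      then have a: "a < Suc k" by simp
      have "?h a i = transpose_mat ?H $$ (i, a)" using a ij by (subst index_transpose_mat) (simp_all only: index_lmat carrier_matD[OF lmat_carrier])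
      moreover have "(\<Sum>b<Suc k. ?h b j * ?r a b) = (?M * ?H) $$ (a, j)"
        unfolding index_mult_sum[OF HC(3,1) a ij(2)] using a ij by (intro sum.cong refl) (simp add: index_lmat mult.commute)
      ultimately show "?h a i * (\<Sum>b<Suc k. ?h b j * ?r a b) = transpose_mat ?H $$ (i, a) * (?M * ?H) $$ (a, j)"
        by (simp only:)
    qed
    also have "\<dots> = (transpose_mat ?H * (?M * ?H)) $$ (i, j)"
      by (rule index_mult_sum[OF HC(2) mult_carrier_mat[OF HC(3,1)] ij, symmetric])
    finally show ?thesis .
  qed
  note entry = this
  have TC: "transpose_mat ?H * (?M * ?H) \<in> carrier_mat (Suc k) (Suc k)"
    by (rule mult_carrier_mat[OF HC(2) mult_carrier_mat[OF HC(3,1)]])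
  have "lmat (Suc k) (\<lambda>i j. \<xi> (Adj h (w' (eS n i j)))) = transpose_mat ?H * (?M * ?H)"
  proof (rule eq_matI)
    fix i j assume "i < dim_row (transpose_mat ?H * (?M * ?H))" "j < dim_col (transpose_mat ?H * (?M * ?H))"
    then have "i < Suc k" "j < Suc k" unfolding carrier_matD[OF TC] .
    then show "lmat (Suc k) (\<lambda>i j. \<xi> (Adj h (w' (eS n i j)))) $$ (i, j) = (transpose_mat ?H * (?M * ?H)) $$ (i, j)"
      by (simp only: index_lmat entry)
  qed (simp_all only: carrier_matD[OF TC] carrier_matD[OF lmat_carrier])
  moreover have "det ?H = 1"
  proof -
    have "upper_triangular ?H" using e(1) kn by (auto simp: lmat_def upper_triangular_def)
    then have "det ?H = prod_list (diag_mat ?H)" by (rule det_upper_triangular[OF _ HC(1)])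
    also have "\<dots> = (\<Prod>i = 0..<Suc k. ?H $$ (i, i))" by (simp only: prod_list_diag_prod) (simp add: lmat_def)
    also have "\<dots> = 1" using e(2) kn by (intro prod.neutral) (auto simp: lmat_def)
    finally show ?thesis .
  qed
  ultimately show ?thesis
    by (simp only: det_mult[OF HC(2) mult_carrier_mat[OF HC(3,1)]] det_mult[OF HC(3,1)] det_transpose[OF HC(1)] mult_1 mult_1_right)
qed

definition reach :: "(complex mat \<Rightarrow> complex) \<Rightarrow> (complex mat \<Rightarrow> complex) \<Rightarrow> bool" where
  "reach \<xi> \<xi>' \<longleftrightarrow> (\<exists>gs. set gs \<subseteq> G \<and> (\<forall>v. \<xi>' v = \<xi> (foldr Adj gs v)))"

lemma reach_refl: "reach \<xi> \<xi>"
  unfolding reach_def by (rule exI[of _ "[]"]) simp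

text \<open>The new element acts first on the vector, so it is appended at the end of the
  list.\<close>

lemma reach_step: assumes "reach \<xi> \<xi>'" "h \<in> G" shows "reach \<xi> (\<lambda>v. \<xi>' (Adj h v))"
proof -
  obtain gs where "set gs \<subseteq> G" "\<And>v. \<xi>' v = \<xi> (foldr Adj gs v)" using assms(1) by (auto simp: reach_def)
  then show ?thesis unfolding reach_def using assms(2) by (intro exI[of _ "gs @ [h]"]) simp
qed

definition regular_form :: "(complex mat \<Rightarrow> complex) \<Rightarrow> bool" where
  "regular_form \<xi> \<longleftrightarrow> linear_form V \<xi> \<and> (\<forall>k<m. det (lmat (Suc k) (\<lambda>i j. \<xi> (w' (eS n i j)))) \<noteq> 0)"

lemma regular_form_Ad: "regular_form \<xi> \<Longrightarrow> h \<in> G \<Longrightarrow> regular_form (\<lambda>v. \<xi> (Adj h v))"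
  unfolding regular_form_def using minors_Ad linear_form_Ad by simp

text \<open>The column index may go beyond \<open>m\<close>: roots e_i + e_j with i < m \<le> j can
  occur in \<open>W\<close> and have to be cleared as well.\<close>

definition diagonal_upto :: "nat \<Rightarrow> (complex mat \<Rightarrow> complex) \<Rightarrow> bool" where
  "diagonal_upto k \<xi> \<longleftrightarrow> (\<forall>j<k. \<forall>i<j. eS n i j \<in> W \<longrightarrow> \<xi> (w' (eS n i j)) = 0)"

lemma diagonal_uptoD:
  "diagonal_upto k \<xi> \<Longrightarrow> i < k \<Longrightarrow> j < k \<Longrightarrow> i \<noteq> j \<Longrightarrow> eS n i j \<in> W \<Longrightarrow> \<xi> (w' (eS n i j)) = 0"
  using eS_sym[of n i j] unfolding diagonal_upto_def by (metis linorder_neqE_nat)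

text \<open>For a diagonal matrix the leading minor of size i + 1 is the product of the first
  diagonal entries, and regularity makes it nonzero.\<close>

lemma diagonal_nonzero:
  assumes \<xi>: "regular_form \<xi>" and d: "diagonal_upto k \<xi>" and i: "i < m" "i < k"
  shows "\<xi> (w' (eS n i i)) \<noteq> 0"
proof
  assume 0: "\<xi> (w' (eS n i i)) = 0"
  let ?M = "lmat (Suc i) (\<lambda>i j. \<xi> (w' (eS n i j)))"
  have "upper_triangular ?M"
    using i d by (auto simp: lmat_def upper_triangular_def intro!: diagonal_uptoD[of k] eS_m)
  then have "det ?M = prod_list (diag_mat ?M)" by (rule det_upper_triangular[OF _ lmat_carrier])
  also have "\<dots> = (\<Prod>j = 0..<Suc i. ?M $$ (j, j))" by (simp only: prod_list_diag_prod) (simp add: lmat_def)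
  also have "\<dots> = 0" using 0 by (intro prod_zero bexI[of _ i]) (auto simp: lmat_def)
  finally show False using \<xi> i by (auto simp: regular_form_def)
qed

text \<open>Symmetric Gaussian elimination of column \<open>k\<close>, with the nonzero diagonal
  values of the earlier indices as pivots.\<close>

lemma diagonalize_step:
  assumes \<xi>: "regular_form \<xi>" and d: "diagonal_upto k \<xi>" and k: "k < n"
  shows "\<exists>h\<in>G. diagonal_upto (Suc k) (\<lambda>v. \<xi> (Adj h v))"
proof -
  define r where "r i j = \<xi> (w' (eS n i j))" for i j
  \<comment> \<open>Only column \<open>k\<close> is nonzero, above the diagonal, so \<open>y\<close>
    has square zero and its exponential is 1 + y. If \<open>eS n p k\<close> is in \<open>W\<close>,
    then so is \<open>eS n p p\<close>, and the denominator is nonzero.\<close>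
  define a where "a p q = (if q = k \<and> p < k \<and> eS n p k \<in> W then - r p k / r p p else 0)" for p q
  define y where "y = dA n a"
  have yu: "y \<in> u" unfolding y_def by (intro IntI dA_sp dA_filt) (auto simp: a_def)
  have yy: "y * y = 0\<^sub>m (2 * n) (2 * n)"
  proof (rule block_eqI[of _ n])
    have z: "a p l * a l q = 0" "a l p * a q l = 0" for p l q by (auto simp: a_def)
    show "y * y \<in> carrier_mat (2 * n) (2 * n)" unfolding y_def by (rule mult_carrier_mat[OF dA_carrier dA_carrier])
    fix i j assume ij: "i < n" "j < n"
    show "(y * y) $$ (i, j) = 0\<^sub>m (2 * n) (2 * n) $$ (i, j) \<and> (y * y) $$ (i, n + j) = 0\<^sub>m (2 * n) (2 * n) $$ (i, n + j) \<and>
        (y * y) $$ (n + i, j) = 0\<^sub>m (2 * n) (2 * n) $$ (n + i, j) \<and>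
        (y * y) $$ (n + i, n + j) = 0\<^sub>m (2 * n) (2 * n) $$ (n + i, n + j)"
      unfolding y_def using ij
      by (simp add: index_mult_block[OF dA_carrier dA_carrier] z del: index_mult_mat mult_eq_0_iff)
  qed simp
  have h: "mat_exp y $$ (p, q) = (if p = q then 1 else 0) + a p q" if "p < n" "q < n" for p q
    unfolding mat_exp_square_zero[OF u_C[OF yu] yy] using that carrier_matD[OF dA_carrier[of n a]] by (simp add: y_def)
  let ?h = "mat_exp (w' y)"
  have G: "?h \<in> G" using yu G_iff by blast
  have "\<xi> (Adj ?h (w' (eS n i j))) = 0" if ij: "i < j" "j < Suc k" "eS n i j \<in> W" for i j
  proof -
    have n: "i < n" "j < n" "i < k" using ij k by auto
    \<comment> \<open>Before column \<open>k\<close> the form is already diagonal; the bound by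
      \<open>j\<close> guarantees that \<open>eS n i b\<close> is in \<open>W\<close>.\<close>
    have rz: "r i b = 0" if "b \<noteq> i" "b < k" "b \<le> j" for b
      unfolding r_def using that n eS_down2[OF ij(3) order_refl \<open>b \<le> j\<close> n(1,2)] by (intro diagonal_uptoD[OF d]) auto
    have "\<xi> (Adj ?h (w' (eS n i j))) = (\<Sum>p<Suc i. mat_exp y $$ (p, i) * (\<Sum>b<Suc j. mat_exp y $$ (b, j) * r p b))"
      unfolding r_def using \<xi> by (intro form_Ad_eS[OF _ yu n(1,2) ij(3)]) (simp add: regular_form_def)
    also have "\<dots> = (\<Sum>p<Suc i. (\<Sum>b<Suc j. mat_exp y $$ (b, j) * r p b) * of_bool (p = i))"
      using n by (intro sum.cong refl) (auto simp: h a_def simp del: sum.lessThan_Suc)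
    also have "\<dots> = (\<Sum>b<Suc j. mat_exp y $$ (b, j) * r i b)"
      unfolding sum_of_bool_eq by simp
    also have "\<dots> = (\<Sum>b<Suc j. r i b * of_bool (b = j)) + (\<Sum>b<Suc j. a b j * r i b)"
      unfolding sum.distrib[symmetric] using n by (intro sum.cong refl) (auto simp: h algebra_simps)
    also have "(\<Sum>b<Suc j. r i b * of_bool (b = j)) = r i j" unfolding sum_of_bool_eq by simp
    also have "(\<Sum>b<Suc j. a b j * r i b) = (\<Sum>b<Suc j. (a i j * r i i) * of_bool (b = i))"
      using n ij rz by (intro sum.cong refl) (auto simp: a_def)
    also have "\<dots> = a i j * r i i" unfolding sum_of_bool_eq using ij by simp
    also have "r i j + a i j * r i i = 0"
    proof (cases "j = k")
      case True
      have "i < m" using eS_diag[OF ij(3)] m_iff n ij by auto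
      then have "r i i \<noteq> 0" unfolding r_def using diagonal_nonzero[OF \<xi> d _ n(3)] by simp
      then show ?thesis using True n ij by (simp add: a_def)
    next
      case False
      then show ?thesis using rz[of j] ij by (simp add: a_def)
    qed
    finally show ?thesis .
  qed
  then have "diagonal_upto (Suc k) (\<lambda>v. \<xi> (Adj ?h v))" unfolding diagonal_upto_def by blast
  then show ?thesis using G by blast
qed

lemma diagonalize:
  assumes "regular_form \<xi>" "k \<le> n"
  shows "\<exists>\<xi>'. reach \<xi> \<xi>' \<and> regular_form \<xi>' \<and> diagonal_upto k \<xi>'"
  using assms(2)
proof (induction k)
  case 0
  then show ?case using assms(1) reach_refl by (auto simp: diagonal_upto_def)
next
  case (Suc k)
  then obtain \<xi>' where 1: "reach \<xi> \<xi>'" "regular_form \<xi>'" "diagonal_upto k \<xi>'" by auto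
  obtain h where "h \<in> G" "diagonal_upto (Suc k) (\<lambda>v. \<xi>' (Adj h v))"
    using diagonalize_step[OF 1(2,3)] Suc.prems by auto
  then show ?case using reach_step[OF 1(1)] regular_form_Ad[OF 1(2)] by blast
qed

text \<open>An exponential of a symmetric block T fixes every \<open>eS\<close> and subtracts from
  \<open>eA n i j\<close> the sum of the \<open>T j l\<close> times \<open>eS n i l\<close>. On a
  diagonal form only \<open>l = i\<close> counts, so the single entry \<open>T j i\<close> can be
  chosen to cancel the value.\<close>

lemma kill_eA:
  assumes \<xi>: "regular_form \<xi>" and d: "diagonal_upto n \<xi>"
  shows "\<exists>h\<in>G. (\<forall>i j. i < j \<longrightarrow> j < n \<longrightarrow> eA n i j \<in> W \<longrightarrow> \<xi> (Adj h (w' (eA n i j))) = 0) \<and>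
    (\<forall>i j. Adj h (w' (eS n i j)) = w' (eS n i j))"
proof -
  let ?N = "2 * n"
  have lin: "linear_form V \<xi>" using \<xi> by (simp add: regular_form_def)
  define r where "r i j = \<xi> (w' (eS n i j))" for i j
  \<comment> \<open>T has to be symmetric, while a value is prescribed for each pair i < j; sorting
    the indices defines both entries at once. The pivot is nonzero because \<open>eS n i i\<close>
    is in \<open>W\<close> whenever \<open>eA n i j\<close> is.\<close>
  define T where "T p q = (if min p q < max p q \<and> eA n (min p q) (max p q) \<in> W
    then \<xi> (w' (eA n (min p q) (max p q))) / r (min p q) (min p q) else 0)" for p q
  define y where "y = xS n T"
  have T_sym: "T p q = T q p" for p q unfolding T_def by (simp add: min.commute max.commute)
  have yu: "y \<in> u" unfolding y_def using xS_filt xS_sp[of n T] T_sym by blast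
  have yC: "y \<in> C" "ng y \<in> C" using u_C[OF yu] by simp_all
  have ng_xS: "ng y = xS n (\<lambda>p q. - T p q)" unfolding y_def xS_smult by simp
  have E: "mat_exp y = 1\<^sub>m ?N + y" "mat_exp (ng y) = 1\<^sub>m ?N + ng y"
  proof -
    show "mat_exp y = 1\<^sub>m ?N + y" by (rule mat_exp_square_zero[OF yC(1)]) (simp add: y_def xS_mult_xS)
    show "mat_exp (ng y) = 1\<^sub>m ?N + ng y" by (rule mat_exp_square_zero[OF yC(2)]) (unfold ng_xS xS_mult_xS, rule refl)
  qed
  have conj: "mat_exp y * z * mat_exp (ng y) = z - (z * y - y * z)"
    if z: "z \<in> C" and zz: "y * z * ng y = 0\<^sub>m ?N ?N" for z
  proof -
    have zyz: "z + y * z \<in> C" using yC z by simp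
    have "mat_exp y * z = z + y * z"
      unfolding E using add_mult_distrib_mat[OF one_carrier_mat yC(1) z] z by simp
    then have "mat_exp y * z * mat_exp (ng y) = (z + y * z) + (z + y * z) * ng y"
      unfolding E using mult_add_distrib_mat[OF zyz one_carrier_mat yC(2)] right_mult_one_mat[OF zyz] by simp
    also have "(z + y * z) * ng y = z * ng y + y * z * ng y"
      using yC z by (intro add_mult_distrib_mat[of _ ?N ?N]) auto
    also have "z * ng y = ng (z * y)" by (rule mult_smult_distrib[OF z yC(1)])
    finally show ?thesis
      unfolding zz using carrier_matD[OF z] carrier_matD[OF mC[OF z yC(1)]] carrier_matD[OF mC[OF yC(1) z]]
      by (intro eq_matI) (auto simp del: index_mult_mat(1))
  qed
  let ?h = "mat_exp (w' y)"
  have G: "?h \<in> G" using yu G_iff by blast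
  have "Adj ?h (w' (eS n i j)) = w' (eS n i j)" for i j
  proof -
    have "y * eS n i j * ng y = 0\<^sub>m ?N ?N"
      unfolding ng_xS unfolding y_def eS_def xS_mult_xS by (rule left_mult_zero_mat[OF xS_carrier])
    then have "mat_exp y * eS n i j * mat_exp (ng y) = eS n i j - (eS n i j * y - y * eS n i j)" by (rule conj[OF eS_carrier])
    also have "\<dots> = eS n i j" unfolding y_def eS_def xS_mult_xS by (intro eq_matI) (auto simp: xS_def)
    finally show ?thesis using Ad_w'[OF yu eS_carrier] by simp
  qed
  moreover have "\<xi> (Adj ?h (w' (eA n i j))) = 0" if ij: "i < j" "j < n" "eA n i j \<in> W" for i j
  proof -
    have i: "i < n" using ij by simp
    have S: "eS n i l \<in> W" if "l < n" for l using eA_eS_mem[OF ij(3,1,2) that] .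
    have im: "i < m" using S[OF i] m_iff[OF i] by simp
    have r0: "r i i \<noteq> 0" unfolding r_def by (rule diagonal_nonzero[OF \<xi> d im i])
    have "y * eA n i j * ng y = 0\<^sub>m ?N ?N"
      unfolding ng_xS unfolding y_def eA_def xS_mult_dA xS_mult_xS ..
    then have "mat_exp y * eA n i j * mat_exp (ng y) = eA n i j - (eA n i j * y - y * eA n i j)"
      by (rule conj[OF eA_carrier])
    also have "eA n i j * y - y * eA n i j = lc ?N n (\<lambda>l. T j l) (\<lambda>l. eS n i l)"
      unfolding y_def eA_xS_bracket[OF i ij(2)]
    proof (rule block_eqI[of _ n])
      fix p q assume pq: "p < n" "q < n"
      have "(\<Sum>l<n. T j l * sE i l p q) = (\<Sum>l<n. (T j l * of_bool (p = i)) * of_bool (q = l)) + (\<Sum>l<n. (T j l * of_bool (q = i)) * of_bool (p = l))"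
        unfolding sum.distrib[symmetric] by (intro sum.cong refl) (simp only: sE_mult distrib_left mult.assoc mult.commute mult.left_commute)
      also have "\<dots> = T j q * of_bool (p = i) + T j p * of_bool (q = i)"
        using pq by (simp only: sum_of_bool_eq if_True)
      finally have s: "(\<Sum>l<n. T j l * sE i l p q) = (if p = i then T j q else 0) + (if q = i then T p j else 0)"
        by (simp add: T_sym[of p j])
      let ?x = "xS n (\<lambda>p q. (if p = i then T j q else 0) + (if q = i then T p j else 0))" and ?l = "lc ?N n (\<lambda>l. T j l) (\<lambda>l. eS n i l)"
      show "?x $$ (p, q) = ?l $$ (p, q) \<and> ?x $$ (p, n + q) = ?l $$ (p, n + q) \<and>
          ?x $$ (n + p, q) = ?l $$ (n + p, q) \<and> ?x $$ (n + p, n + q) = ?l $$ (n + p, n + q)"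
        using pq s by (simp add: index_lc eS_def)
    qed simp_all
    finally have "Adj ?h (w' (eA n i j)) = w' (eA n i j) + (-1) \<cdot>\<^sub>m w' (lc ?N n (\<lambda>l. T j l) (\<lambda>l. eS n i l))"
      unfolding Ad_w'[OF yu eA_carrier]
      using w'_minus[OF eA_carrier lc_carrier] w'_C[OF eA_carrier[of n i j]] w'_C[OF lc_carrier[of "2 * n" n "T j" "eS n i"]]
      by (auto intro!: eq_matI)
    moreover have "w' (eA n i j) \<in> nn" using ij(3) by (simp add: W_def)
    moreover have "lc ?N n (\<lambda>l. T j l) (\<lambda>l. eS n i l) \<in> W"
      by (rule lc_in_subspace[OF borel_stable.W[OF borel_stable_axioms]]) (rule S)
    then have "w' (lc ?N n (\<lambda>l. T j l) (\<lambda>l. eS n i l)) \<in> nn" by (simp add: W_def)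
    moreover have LC: "\<xi> (w' (lc ?N n (\<lambda>l. T j l) (\<lambda>l. eS n i l))) = (\<Sum>l<n. T j l * r i l)"
      unfolding r_def by (rule linear_form_lc[OF lin]) (rule S)
    ultimately have "\<xi> (Adj ?h (w' (eA n i j))) = \<xi> (w' (eA n i j)) - (\<Sum>l<n. T j l * r i l)"
      using linear_formD[OF lin] mat_subspaceD(4)[OF nn_sub] LC by (simp add: r_def)
    also have "(\<Sum>l<n. T j l * r i l) = (\<Sum>l<n. (T j i * r i i) * of_bool (l = i))"
    proof (intro sum.cong refl)
      fix l assume "l \<in> {..<n}"
      then have l: "l < n" by simp
      show "T j l * r i l = (T j i * r i i) * of_bool (l = i)"
        using diagonal_uptoD[OF d i l _ S[OF l]] by (cases "l = i") (auto simp: r_def)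
    qed
    also have "\<dots> = T j i * r i i" unfolding sum_of_bool_eq using i by simp
    also have "T j i * r i i = \<xi> (w' (eA n i j))" using ij r0 by (simp add: T_def min_def max_def)
    finally show ?thesis by simp
  qed
  ultimately show ?thesis using G by blast
qed

definition "E = w' ` roots"

text \<open>The roots e_i - e_j are treated last: their removal needs a diagonal form, and it does
  not disturb that form because it fixes all \<open>eS\<close>.\<close>

lemma forms_diagonalizable:
  assumes \<xi>: "linear_form V \<xi>" "\<And>k. k < m \<Longrightarrow> det (lmat (Suc k) (\<lambda>i j. \<xi> (w' (eS n i j)))) \<noteq> 0"
  shows "\<exists>gs. set gs \<subseteq> G \<and> (\<forall>e\<in>E - {w' (eS n i i) | i. i < m}. \<xi> (foldr Adj gs e) = 0)"
proof -
  have "regular_form \<xi>" using \<xi> by (simp add: regular_form_def)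
  then obtain \<xi>' where 1: "reach \<xi> \<xi>'" "regular_form \<xi>'" "diagonal_upto n \<xi>'" using diagonalize by blast
  obtain h where h: "h \<in> G" "\<And>i j. i < j \<Longrightarrow> j < n \<Longrightarrow> eA n i j \<in> W \<Longrightarrow> \<xi>' (Adj h (w' (eA n i j))) = 0"
    "\<And>i j. Adj h (w' (eS n i j)) = w' (eS n i j)" using kill_eA[OF 1(2,3)] by blast
  obtain gs where gs: "set gs \<subseteq> G" "\<And>v. \<xi>' (Adj h v) = \<xi> (foldr Adj gs v)"
    using reach_step[OF 1(1) h(1)] by (auto simp: reach_def)
  have "\<xi> (foldr Adj gs e) = 0" if e: "e \<in> E - {w' (eS n i i) | i. i < m}" for e
  proof -
    from e consider i j where "i < j" "j < n" "eA n i j \<in> W" "e = w' (eA n i j)"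
      | i j where "i \<le> j" "j < n" "eS n i j \<in> W" "e = w' (eS n i j)"
      unfolding E_def roots_def by blast
    then show ?thesis
    proof cases
      case 1
      then show ?thesis using h(2) gs(2) by simp
    next
      case 2
      have "i \<noteq> j" using e 2 m_iff[of i] by auto
      then show ?thesis using 2 h(3)[of i j] gs(2)[of e] diagonal_uptoD[OF 1(3), of i j] by simp
    qed
  qed
  then show ?thesis using gs(1) by blast
qed

section \<open>Supports of root vectors and dual coordinates\<close>

lemma top_support_eA: "i < j \<Longrightarrow> j < n \<Longrightarrow> top_support (eA n i j) = {(i, j)}"
  by (auto simp: top_support_def eA_def dA_def split: if_splits)

lemma top_support_eS:
  assumes "i \<le> j" "j < n" shows "top_support (eS n i j) = {(i, n + j), (j, n + i)}"
proof -
  have "eS n i j $$ (p, q) = (if n \<le> q then sE i j p (q - n) else 0)" if "p < n" "q < 2 * n" for p q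
    using that by (simp add: eS_def xS_def)
  moreover have "sE i j p q \<noteq> 0 \<longleftrightarrow> (p = i \<and> q = j \<or> p = j \<and> q = i)" for p q by (simp add: sE_eq)
  ultimately have "eS n i j $$ (p, q) \<noteq> 0 \<longleftrightarrow> n \<le> q \<and> (p = i \<and> q - n = j \<or> p = j \<and> q - n = i)"
    if "p < n" "q < 2 * n" for p q
    using that by (cases "n \<le> q") (simp_all only: if_True if_False simp_thms)
  then have *: "(p, q) \<in> top_support (eS n i j) \<longleftrightarrow>
      p < n \<and> q < 2 * n \<and> n \<le> q \<and> (p = i \<and> q - n = j \<or> p = j \<and> q - n = i)" for p q
    unfolding top_support_def mem_Collect_eq prod.case by blast
  show ?thesis using assms by (auto simp: *)
qed

lemma roots_support:
  assumes "e \<in> roots" "e' \<in> roots" shows "top_support e \<noteq> {}" "e \<noteq> e' \<Longrightarrow> top_support e \<inter> top_support e' = {}"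
proof -
  have r: "(\<exists>i j. i < j \<and> j < n \<and> e = eA n i j \<and> top_support e = {(i, j)}) \<or>
      (\<exists>i j. i \<le> j \<and> j < n \<and> e = eS n i j \<and> top_support e = {(i, n + j), (j, n + i)})" if "e \<in> roots" for e
  proof -
    from that consider i j where "i < j" "j < n" "e = eA n i j" | i j where "i \<le> j" "j < n" "e = eS n i j"
      unfolding roots_def by blast
    then show ?thesis
    proof cases
      case 1
      then show ?thesis using top_support_eA[OF 1(1,2)] by (intro disjI1 exI[of _ i] exI[of _ j]) simp
    next
      case 2
      then show ?thesis using top_support_eS[OF 2(1,2)] by (intro disjI2 exI[of _ i] exI[of _ j]) simp
    qed
  qed
  show "top_support e \<noteq> {}" using r[OF assms(1)] by auto
  show "top_support e \<inter> top_support e' = {}" if ne: "e \<noteq> e'"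
    using r[OF assms(1)] r[OF assms(2)]
  proof (elim disjE exE conjE)
    fix i j k l
    assume "i \<le> j" "j < n" "e = eS n i j" "top_support e = {(i, n + j), (j, n + i)}"
      "k \<le> l" "l < n" "e' = eS n k l" "top_support e' = {(k, n + l), (l, n + k)}"
    moreover from this have "i \<noteq> k \<or> j \<noteq> l" using ne by auto
    ultimately show ?thesis by auto
  qed (use ne in auto)
qed

definition piv :: "complex mat \<Rightarrow> nat \<times> nat" where
  "piv e = (SOME pq. pq \<in> top_support e)"

text \<open>A coordinate is read off at one position of the support of the root vector. Supports of
  different root vectors are disjoint, so other roots do not contribute. The value 0 outside
  \<open>E\<close> makes linearity hold for every index.\<close>

definition co :: "complex mat \<Rightarrow> complex mat \<Rightarrow> complex" where
  "co v e = (if e \<in> E then w v $$ piv (w e) / w e $$ piv (w e) else 0)"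

lemma piv: "e \<in> roots \<Longrightarrow> piv e \<in> top_support e"
  unfolding piv_def using roots_support(1)[of e e] some_in_eq by blast

lemma roots_C: "e \<in> roots \<Longrightarrow> e \<in> C"
  using roots_W W_C by blast

lemma piv_E: "e \<in> E \<Longrightarrow> w e \<in> roots \<and> (\<exists>p q. piv (w e) = (p, q) \<and> p < 2 * n \<and> q < 2 * n \<and> w e $$ (p, q) \<noteq> 0)"
  using piv roots_C by (fastforce simp: E_def top_support_def)

theorem free_nilradical: "free_over_subring (sym_alg V) (sym_invariants V Adj G)"
proof -
  have "minors_action V E co m (\<lambda>i j. w' (eS n i j)) Adj G"
  proof unfold_locales
    show "finite E" unfolding E_def using finite_roots by simp
    show "E \<subseteq> carrier V" unfolding E_def V_simps using roots_W by (auto simp: W_def)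
    show "\<zero>\<^bsub>V\<^esub> \<in> carrier V" unfolding V_simps by (rule mat_subspaceD(2)[OF nn_sub])
    show "v \<oplus>\<^bsub>V\<^esub> v' \<in> carrier V" if "v \<in> carrier V" "v' \<in> carrier V" for v v'
      using that mat_subspaceD(3)[OF nn_sub] unfolding V_simps by blast
    show "c \<odot>\<^bsub>V\<^esub> v \<in> carrier V" if "v \<in> carrier V" for v c
      using that mat_subspaceD(4)[OF nn_sub] unfolding V_simps by blast
    show "0 \<odot>\<^bsub>V\<^esub> v = \<zero>\<^bsub>V\<^esub>" if "v \<in> carrier V" for v
      using that unfolding V_simps by (intro eq_matI) (auto simp: carrier_matD[OF nn_C])
    show "co (v \<oplus>\<^bsub>V\<^esub> v') e = co v e + co v' e" if "v \<in> carrier V" "v' \<in> carrier V" for v v' e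
      using that piv_E[of e] nn_C by (auto simp: co_def V_simps w_add add_divide_distrib carrier_matD[OF w_C[OF nn_C]])
    show "co (c \<odot>\<^bsub>V\<^esub> v) e = c * co v e" if "v \<in> carrier V" for v c e
      using that piv_E[of e] nn_C by (auto simp: co_def V_simps w_smult carrier_matD[OF w_C[OF nn_C]])
    show "co e e' = (if e = e' then 1 else 0)" if ee: "e \<in> E" "e' \<in> E" for e e'
    proof (cases "e = e'")
      case True
      then show ?thesis using piv_E[OF ee(2)] ee by (auto simp: co_def)
    next
      case False
      have "w e \<in> roots" "w e' \<in> roots" using piv_E ee by blast+
      moreover have "w e \<noteq> w e'" using False ee by (metis E_def imageE roots_C w_w')
      ultimately have "piv (w e') \<notin> top_support (w e)" "piv (w e') \<in> top_support (w e')"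
        using roots_support(2)[of "w e" "w e'"] piv by blast+
      then have "w e $$ piv (w e') = 0" by (auto simp: top_support_def)
      then show ?thesis using False by (simp add: co_def)
    qed
    show "Q v" if v: "v \<in> carrier V" "Q \<zero>\<^bsub>V\<^esub>"
      "\<And>v e c. v \<in> carrier V \<Longrightarrow> e \<in> E \<Longrightarrow> Q v \<Longrightarrow> Q (v \<oplus>\<^bsub>V\<^esub> c \<odot>\<^bsub>V\<^esub> e)" for v Q
    proof -
      have vn: "v \<in> nn" using v(1) by (simp add: V_simps)
      then have "w v \<in> W" using nn_C by (simp add: W_def)
      then have "Q (w' (w v))"
      proof (rule W_induct)
        show "Q (w' (0\<^sub>m (2 * n) (2 * n)))" using v(2) by (simp add: V_simps w'_0)
        fix y e c assume y: "y \<in> W" "Q (w' y)" and e: "e \<in> roots"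
        have "Q (w' y \<oplus>\<^bsub>V\<^esub> c \<odot>\<^bsub>V\<^esub> w' e)"
          using y e by (intro v(3)) (auto simp: V_simps W_def E_def)
        then show "Q (w' (y + c \<cdot>\<^sub>m e))"
          using W_C[OF y(1)] roots_C[OF e] by (simp add: V_simps w'_add w'_smult)
      qed
      then show ?thesis using nn_C[OF vn] by simp
    qed
    show "w' (eS n i j) \<in> E" if ij: "i < m" "j < m" for i j
    proof -
      have "eS n i j \<in> W" by (rule eS_m[OF ij])
      moreover have "i < n" "j < n" using ij m_le by auto
      moreover have "eS n i j \<in> roots" if "i \<le> j" "j < n" "eS n i j \<in> W" for i j
        unfolding roots_def using that by blast
      ultimately have "eS n i j \<in> roots" using eS_sym[of n i j] nat_le_linear[of i j] by metis
      then show ?thesis by (simp add: E_def)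
    qed
    show "w' (eS n i j) = w' (eS n j i)" for i j by (simp add: eS_sym)
    show "i = k \<and> j = l" if ij: "i \<le> j" "k \<le> l" "j < m" "l < m" "w' (eS n i j) = w' (eS n k l)" for i j k l
    proof -
      have "eS n i j = eS n k l" using ij(5) w_w'[OF eS_carrier] by metis
      then have "{(i, n + j), (j, n + i)} = {(k, n + l), (l, n + k)}"
        using top_support_eS[of i j] top_support_eS[of k l] ij m_le by simp
      then show ?thesis using ij(1,2) by (auto simp: doubleton_eq_iff)
    qed
    show "Adj h v \<in> carrier V" if "h \<in> G" "v \<in> carrier V" for h v
      using Ad_nn that by (simp add: V_simps)
    show "Adj h (v \<oplus>\<^bsub>V\<^esub> v') = Adj h v \<oplus>\<^bsub>V\<^esub> Adj h v'" if "h \<in> G" "v \<in> carrier V" "v' \<in> carrier V" for h v v'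
      using Ad_linear(1)[OF that(1)] that nn_C by (simp add: V_simps)
    show "Adj h (c \<odot>\<^bsub>V\<^esub> v) = c \<odot>\<^bsub>V\<^esub> Adj h v" if "h \<in> G" "v \<in> carrier V" for h v c
      using Ad_linear(2)[OF that(1)] that nn_C by (simp add: V_simps)
    show "det (lmat (Suc k) (\<lambda>i j. \<xi> (Adj h (w' (eS n i j))))) = det (lmat (Suc k) (\<lambda>i j. \<xi> (w' (eS n i j))))"
      if "h \<in> G" "linear_form V \<xi>" "k < m" for h \<xi> k
      using minors_Ad that by blast
    show "\<exists>gs. set gs \<subseteq> G \<and> (\<forall>e\<in>E - {w' (eS n i i) | i. i < m}. \<xi> (foldr Adj gs e) = 0)"
      if "linear_form V \<xi>" "\<And>k. k < m \<Longrightarrow> det (lmat (Suc k) (\<lambda>i j. \<xi> (w' (eS n i j)))) \<noteq> 0" for \<xi>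
      using forms_diagonalizable that by blast
  qed
  then show ?thesis by (rule minors_action.free_over_invariants)
qed

end

theorem proposition8p5:
  fixes n :: nat and \<bb> \<pp> :: "complex mat set"
  assumes "borel_subalgebra (2 * n) (sp n) \<bb>"
    and "standard_parabolic (2 * n) (sp n) \<bb> \<pp>"
  shows "free_over_subring (sym_alg (nilradical_space (2 * n) \<pp>))
           (sym_invariants (nilradical_space (2 * n) \<pp>) (Ad (2 * n))
              (max_unipotent (2 * n) \<bb>))"
proof -
  obtain g gi where g: "conj_mat (2 * n) g gi"
    "\<bb> = {x \<in> carrier_mat (2 * n) (2 * n). gi * x * g \<in> sp n \<inter> filt n 0}"
    using borel_standard[OF assms(1)] .
  interpret sp_parabolic n g gi \<bb> \<pp>
    using g assms by (simp add: sp_parabolic_def sp_parabolic_axioms_def)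
  show ?thesis by (rule free_nilradical)
qed

end
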